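(* Let $w=(w_1,\dots,w_d)$ be a $d$-dimensional Brownian motion on $[0,1]$, let $z$ be a one-dimensional Brownian motion independent of $w$, let $r\in(0,1)$, and set $\beta(t)=r\,w_1(t)+\sqrt{1-r^2}\,z(t)$. Let $u\in\mathbb{R}^d\setminus\{0\}$, let $f:\mathbb{R}\to[0,\infty)$ be a Borel function with $\int_{\mathbb{R}}f^2(x)e^{-x^2/2}dx<\infty$, and let $$\eta=\int_{\Delta_2}\delta_u\big(w(t_2)-w(t_1)\big)f\big(\beta(t_2)-\beta(t_1)\big)\,dt_1dt_2=\lim_{\varepsilon\to0}\int_{\Delta_2}p^d_\varepsilon\big(w(t_2)-w(t_1)-u\big)f\big(\beta(t_2)-\beta(t_1)\big)\,dt_1dt_2.$$ Fix $(s_1,s_2)\in\Delta_2$ and consider a test function of the form $F=F_1(w(s_2)-w(s_1))\,F_2(z)$, where $F_1\in\mathcal{C}_b^\infty(\mathbb{R}^d)$ and $F_2\in\mathcal{FC}_b^\infty(W_0^1)$. Then $$(\eta,F)=\int_{\Delta_2}p^d_{t_2-t_1}(u)\,\mathbb{E}\Big[F_1(w(s_2)-w(s_1))\,\Big|\,w(t_2)-w(t_1)=u\Big]\,\mathbb{E}\Big[F_2(z)f\big(\beta(t_2)-\beta(t_1)\big)\,\Big|\,w(t_2)-w(t_1)=u\Big]\,dt_1dt_2.$$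
   Context: $p^d_\varepsilon(x)=(2\pi\varepsilon)^{-d/2}e^{-\|x\|^2/(2\varepsilon)}$; $\Delta_2=\{(t_1,t_2)\in[0,1]^2:t_1<t_2\}$. $W_0^1=\{\omega:[0,1]\to\mathbb{R}\text{ continuous},\ \omega(0)=0\}$ with the supremum norm. $\mathcal{C}_b^\infty(\mathbb{R}^m)$ is the set of infinitely differentiable functions $\mathbb{R}^m\to\mathbb{R}$ bounded together with all derivatives; $\mathcal{FC}_b^\infty(W_0^1)$ is the set of functions $F(\omega)=g(\ell_1(\omega),\dots,\ell_n(\omega))$ with $n\ge1$, $\ell_i\in(W_0^1)^*$, $g\in\mathcal{C}_b^\infty(\mathbb{R}^n)$. Sobolev spaces over the $(d+1)$-dimensional Brownian motion $(w,z)$: write $L^2(\Omega,\sigma(w,z),\mathbb{P})=\bigoplus_{n\ge0}\mathcal{H}_n$ for the Wiener chaos decomposition. For $\gamma\in\mathbb{R}$, $\mathbb{D}^{2,\gamma}$ is the completion of the finite sums $\sum_{n=0}^N X_n$, $X_n\in\mathcal{H}_n$, under the norm $\|\sum_n X_n\|_{2,\gamma}^2=\sum_n (n+1)^\gamma\,\mathbb{E}[X_n^2]$; $\mathbb{D}^{2,\gamma}$ is the dual of $\mathbb{D}^{2,-\gamma}$, with pairing $(\cdot,\cdot)$ extending $(X,Y)\mapsto\mathbb{E}[XY]$. The limit defining $\eta$ is understood in $\mathbb{D}^{2,\gamma}$ for suitable $\gamma<0$, so that $(\eta,F)$ is the limit as $\varepsilon\to0$ of $\mathbb{E}\big[F\int_{\Delta_2}p^d_\varepsilon(w(t_2)-w(t_1)-u)f(\beta(t_2)-\beta(t_1))dt_1dt_2\big]$.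 Conditional expectations given $w(t_2)-w(t_1)=u$ denote the values at $u$ of the versions continuous in $u$; in particular $\mathbb{E}[F_2(z)f(\beta(t_2)-\beta(t_1))\,|\,w(t_2)-w(t_1)=u]=\mathbb{E}[F_2(z)f(ru_1+\sqrt{1-r^2}(z(t_2)-z(t_1)))]$, where $u_1$ is the first coordinate of $u$. *)

theory Defs
  imports "HOL-Probability.Probability"
begin

section \<open>Brownian motion\<close>

definition heat_kernel :: "real \<Rightarrow> 'v::euclidean_space \<Rightarrow> real" where
  "heat_kernel \<epsilon> x =
     (2 * pi * \<epsilon>) powr (- real DIM('v) / 2) * exp (- (norm x)\<^sup>2 / (2 * \<epsilon>))"

definition Delta2 :: "(real \<times> real) set" where
  "Delta2 = {(t1, t2). 0 \<le> t1 \<and> t1 < t2 \<and> t2 \<le> 1}"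

text \<open>
  Standard Brownian motion on \<open>[0, 1]\<close>, with values in a Euclidean space and with every path
  continuous, so that paths of a real Brownian motion are elements of \<open>W01\<close> below.
  Processes are functions on all of \<open>real\<close>; their values outside \<open>{0..1}\<close> are irrelevant.
\<close>
definition brownian_motion :: "'a measure \<Rightarrow> (real \<Rightarrow> 'a \<Rightarrow> 'v::euclidean_space) \<Rightarrow> bool" where
  "brownian_motion M B \<longleftrightarrow>
     prob_space M \<and>
     (\<forall>t\<in>{0..1}. B t \<in> borel_measurable M) \<and>
     (\<forall>\<omega>\<in>space M. B 0 \<omega> = 0 \<and> continuous_on {0..1} (\<lambda>t. B t \<omega>)) \<and>
     (\<forall>s t. 0 \<le> s \<and> s < t \<and> t \<le> 1 \<longrightarrow>
        distributed M lborel (\<lambda>\<omega>. B t \<omega> - B s \<omega>) (\<lambda>x. ennreal (heat_kernel (t - s) x))) \<and>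
     (\<forall>(n::nat) \<tau>. 0 \<le> \<tau> 0 \<and> (\<forall>i<n. \<tau> i \<le> \<tau> (Suc i)) \<and> \<tau> n \<le> 1 \<longrightarrow>
        prob_space.indep_vars M (\<lambda>_. borel) (\<lambda>i \<omega>. B (\<tau> (Suc i)) \<omega> - B (\<tau> i) \<omega>) {..<n})"

definition path_events :: "'a measure \<Rightarrow> (real \<Rightarrow> 'a \<Rightarrow> 'v::euclidean_space) \<Rightarrow> 'a set set" where
  "path_events M X =
     sets (vimage_algebra (space M) (\<lambda>\<omega>. \<lambda>t\<in>{0..1}. X t \<omega>) (Pi\<^sub>M {0..1} (\<lambda>_. borel)))"

definition independent_processes ::
    "'a measure \<Rightarrow> (real \<Rightarrow> 'a \<Rightarrow> 'v::euclidean_space) \<Rightarrow> (real \<Rightarrow> 'a \<Rightarrow> 'w::euclidean_space) \<Rightarrow> bool"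
  where
  "independent_processes M X Y \<longleftrightarrow>
     prob_space.indep_set M (path_events M X) (path_events M Y)"


section \<open>Test functions\<close>

fun iter_deriv :: "'v list \<Rightarrow> ('v::euclidean_space \<Rightarrow> real) \<Rightarrow> 'v \<Rightarrow> real" where
  "iter_deriv [] f = f"
| "iter_deriv (v # vs) f = (\<lambda>x. frechet_derivative (iter_deriv vs f) (at x) v)"

definition Cb_infty :: "('v::euclidean_space \<Rightarrow> real) set" where
  "Cb_infty = {f. \<forall>vs\<in>lists Basis.
     iter_deriv vs f differentiable_on UNIV \<and> bounded (range (iter_deriv vs f))}"

definition W01 :: "(real \<Rightarrow> real) set" where
  "W01 = {x. continuous_on {0..1} x \<and> x 0 = 0}"

text \<open>
  Elements of \<open>W01\<close> carry arbitrary values outside \<open>{0..1}\<close>; the norm bound forces a functional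
  in \<open>W01_dual\<close> to ignore them.
\<close>
definition W01_dual :: "((real \<Rightarrow> real) \<Rightarrow> real) set" where
  "W01_dual = {l.
     (\<forall>x\<in>W01. \<forall>y\<in>W01. \<forall>a b. l (\<lambda>t. a * x t + b * y t) = a * l x + b * l y) \<and>
     (\<exists>C. \<forall>x\<in>W01. \<bar>l x\<bar> \<le> C * (SUP t\<in>{0..1}. \<bar>x t\<bar>))}"

text \<open>
  The type argument fixes the number \<open>CARD('n) \<ge> 1\<close> of linear functionals; the space of all
  smooth cylindrical functions is the union over \<open>'n\<close>.
\<close>
definition FCb_infty :: "'n::finite itself \<Rightarrow> ((real \<Rightarrow> real) \<Rightarrow> real) set" where
  "FCb_infty _ = {F. \<exists>g::real^'n \<Rightarrow> real. \<exists>l. g \<in> Cb_infty \<and> (\<forall>i. l i \<in> W01_dual) \<and>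
     (\<forall>x\<in>W01. F x = g (\<chi> i. l i x))}"


section \<open>Conditional expectation at a point\<close>

text \<open>
  The value at \<open>y\<close> of the continuous function \<open>\<phi>\<close> with \<open>\<phi>(Y) = E[X | Y]\<close> almost surely. If the
  law of \<open>Y\<close> has full support, there is at most one such \<open>\<phi>\<close>.
\<close>
definition cond_exp_at ::
    "'a measure \<Rightarrow> ('a \<Rightarrow> real) \<Rightarrow> ('a \<Rightarrow> 'v::euclidean_space) \<Rightarrow> 'v \<Rightarrow> real" where
  "cond_exp_at M X Y y =
     (THE \<phi>. continuous_on UNIV \<phi> \<and>
        (AE \<omega> in M. real_cond_exp M (vimage_algebra (space M) Y borel) X \<omega> = \<phi> (Y \<omega>))) y"


section \<open>Wiener chaos and Sobolev spaces\<close>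

definition L2 :: "'a measure \<Rightarrow> ('a \<Rightarrow> real) set" where
  "L2 M = {X. X \<in> borel_measurable M \<and> integrable M (\<lambda>\<omega>. (X \<omega>)\<^sup>2)}"

definition lin_span :: "('a \<Rightarrow> real) set \<Rightarrow> ('a \<Rightarrow> real) set" where
  "lin_span S = {(\<lambda>\<omega>. \<Sum>X\<in>A. c X * X \<omega>) | A c. finite A \<and> A \<subseteq> S}"

fun hermite :: "nat \<Rightarrow> real \<Rightarrow> real" where
  "hermite 0 x = 1"
| "hermite (Suc 0) x = x"
| "hermite (Suc (Suc n)) x = x * hermite (Suc n) x - real (Suc n) * hermite n x"

text \<open>
  The \<open>n\<close>-th chaos of a centred Gaussian family \<open>S\<close>: the closed linear span in \<open>L2\<close> of the
  variables \<open>hermite n G\<close>, where \<open>G\<close> has unit variance and lies in the Gaussian space of \<open>S\<close>.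
  Taking \<open>G\<close> in the linear span of \<open>S\<close> rather than in its \<open>L2\<close>-closure gives the same closed
  span. As everywhere in this section, random variables are not identified almost everywhere.
\<close>
definition wiener_chaos :: "'a measure \<Rightarrow> ('a \<Rightarrow> real) set \<Rightarrow> nat \<Rightarrow> ('a \<Rightarrow> real) set" where
  "wiener_chaos M S n = {X \<in> L2 M. \<forall>e>0.
     \<exists>Y\<in>lin_span {(\<lambda>\<omega>. hermite n (G \<omega>)) | G. G \<in> lin_span S \<and> (\<integral>\<omega>. (G \<omega>)\<^sup>2 \<partial>M) = 1}.
       (\<integral>\<omega>. (X \<omega> - Y \<omega>)\<^sup>2 \<partial>M) < e}"

text \<open>\<open>X = (\<Sum>n. \<xi> n)\<close> in \<open>L2\<close> with \<open>\<xi> n\<close> in the \<open>n\<close>-th chaos.\<close>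
definition chaos_expansion ::
    "'a measure \<Rightarrow> ('a \<Rightarrow> real) set \<Rightarrow> ('a \<Rightarrow> real) \<Rightarrow> (nat \<Rightarrow> 'a \<Rightarrow> real) \<Rightarrow> bool" where
  "chaos_expansion M S X \<xi> \<longleftrightarrow>
     X \<in> L2 M \<and> (\<forall>n. \<xi> n \<in> wiener_chaos M S n) \<and>
     (\<lambda>N. \<integral>\<omega>. (X \<omega> - (\<Sum>n<N. \<xi> n \<omega>))\<^sup>2 \<partial>M) \<longlonglongrightarrow> 0"

text \<open>
  The completion of the finite sums of chaos elements under the weighted norm is the weighted
  square-summable direct sum of the chaoses: an element is the sequence of its chaos components.
\<close>
definition D2 :: "'a measure \<Rightarrow> ('a \<Rightarrow> real) set \<Rightarrow> real \<Rightarrow> (nat \<Rightarrow> 'a \<Rightarrow> real) set" where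
  "D2 M S \<gamma> = {\<xi>. (\<forall>n. \<xi> n \<in> wiener_chaos M S n) \<and>
     summable (\<lambda>n. real (n + 1) powr \<gamma> * (\<integral>\<omega>. (\<xi> n \<omega>)\<^sup>2 \<partial>M))}"

definition D2_norm :: "'a measure \<Rightarrow> real \<Rightarrow> (nat \<Rightarrow> 'a \<Rightarrow> real) \<Rightarrow> real" where
  "D2_norm M \<gamma> \<xi> = sqrt (\<Sum>n. real (n + 1) powr \<gamma> * (\<integral>\<omega>. (\<xi> n \<omega>)\<^sup>2 \<partial>M))"

text \<open>The random variables \<open>X \<epsilon>\<close> converge to \<open>\<eta>\<close> in \<open>D2 M S \<gamma>\<close> as \<open>\<epsilon>\<close> decreases to \<open>0\<close>.\<close>
definition D2_limit ::
    "'a measure \<Rightarrow> ('a \<Rightarrow> real) set \<Rightarrow> real \<Rightarrow> (real \<Rightarrow> 'a \<Rightarrow> real) \<Rightarrow> (nat \<Rightarrow> 'a \<Rightarrow> real) \<Rightarrow> bool" where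
  "D2_limit M S \<gamma> X \<eta> \<longleftrightarrow>
     \<eta> \<in> D2 M S \<gamma> \<and>
     (\<exists>\<Xi>. (\<forall>\<epsilon>>0. chaos_expansion M S (X \<epsilon>) (\<Xi> \<epsilon>) \<and> \<Xi> \<epsilon> \<in> D2 M S \<gamma>) \<and>
       ((\<lambda>\<epsilon>. D2_norm M \<gamma> (\<lambda>n \<omega>. \<Xi> \<epsilon> n \<omega> - \<eta> n \<omega>)) \<longlongrightarrow> 0) (at_right 0))"

text \<open>
  \<open>(\<xi>, F) = c\<close> for \<open>\<xi>\<close> in \<open>D2 M S \<gamma>\<close> and a test variable \<open>F\<close> in \<open>L2\<close>: the limit of \<open>E[X F]\<close> along
  the finite sums \<open>X = (\<Sum>n<N. \<xi> n)\<close>, which converge to \<open>\<xi>\<close>. Since the chaoses are orthogonal,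
  \<open>E[\<xi> n * F]\<close> only involves the \<open>n\<close>-th chaos component of \<open>F\<close>.
\<close>
definition has_D2_pairing ::
    "'a measure \<Rightarrow> (nat \<Rightarrow> 'a \<Rightarrow> real) \<Rightarrow> ('a \<Rightarrow> real) \<Rightarrow> real \<Rightarrow> bool" where
  "has_D2_pairing M \<xi> F c \<longleftrightarrow> (\<lambda>n. \<integral>\<omega>. \<xi> n \<omega> * F \<omega> \<partial>M) sums c"

definition brownian_generators ::
    "(real \<Rightarrow> 'a \<Rightarrow> real^'d) \<Rightarrow> (real \<Rightarrow> 'a \<Rightarrow> real) \<Rightarrow> ('a \<Rightarrow> real) set" where
  "brownian_generators w z =
     {(\<lambda>\<omega>. w t \<omega> $ i) | t i. t \<in> {0..1}} \<union> {z t | t. t \<in> {0..1}}"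


section \<open>The approximations of \<open>\<eta>\<close>\<close>

definition eta_approx ::
    "(real \<Rightarrow> 'a \<Rightarrow> real^'d) \<Rightarrow> (real \<Rightarrow> 'a \<Rightarrow> real) \<Rightarrow> real^'d \<Rightarrow> (real \<Rightarrow> real) \<Rightarrow> real \<Rightarrow> 'a \<Rightarrow> real"
  where
  "eta_approx w \<beta> u f \<epsilon> \<omega> =
     (LINT (t1, t2):Delta2|lborel.
        heat_kernel \<epsilon> (w t2 \<omega> - w t1 \<omega> - u) * f (\<beta> t2 \<omega> - \<beta> t1 \<omega>))"

end

theory Submission
  imports Defs
begin

text \<open>
  The limit of \<open>E[F \<eta>\<^sub>\<epsilon>]\<close>. By Fubini, \<open>E[F \<eta>\<^sub>\<epsilon>]\<close> is an integral over the pairs of times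
  \<open>(t1, t2)\<close>, so the times may first be fixed. Put \<open>X = w s2 - w s1\<close>, \<open>Y = w t2 - w t1\<close> and
  \<open>\<tau> = t2 - t1\<close>. Since \<open>z\<close> is independent of \<open>w\<close>, freezing the increments of \<open>w\<close> integrates \<open>z\<close>
  out and leaves a function \<open>Q(Y)\<close>; since \<open>X - a Y\<close> is independent of \<open>Y\<close> for a suitable number \<open>a\<close>,
  freezing \<open>Y\<close> integrates out the rest of \<open>X\<close> and leaves \<open>\<phi>(Y)\<close>. Here \<open>\<phi>\<close> and \<open>Q\<close> are the
  continuous versions of the two conditional expectations, and the expectation at fixed times is
  \<open>\<integral> p\<^sub>\<epsilon>(y - u) p\<^sub>\<tau>(y) \<phi>(y) Q(y) dy\<close> (\<open>fixed_time_factorisation\<close>). The kernels \<open>p\<^sub>\<epsilon>\<close> are an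
  approximate identity, so this tends to \<open>p\<^sub>\<tau>(u) \<phi>(u) Q(u)\<close>, which is the integrand on the right.

  Two estimates allow dominated convergence over the times. The hypothesis on \<open>f\<close> gives
  \<open>\<bar>Q(y)\<bar> \<le> C \<tau>\<^sup>-\<^sup>1\<^sup>/\<^sup>2 exp (\<bar>y\<bar>\<^sup>2 / 4)\<close> (\<open>gaussian_average\<close>), and the exponential is absorbed by
  passing from \<open>p\<^sub>\<tau>\<close> to \<open>p\<^sub>2\<^sub>\<tau>\<close>. Because \<open>u \<noteq> 0\<close>, the integrals of \<open>p\<^sub>\<epsilon>(y - u) p\<^sub>2\<^sub>\<tau>(y)\<close> are
  bounded uniformly in \<open>\<epsilon>\<close> and \<open>\<tau>\<close> (\<open>heat_kernel_product_bound\<close>). The resulting bound, a multiple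
  of \<open>\<tau>\<^sup>-\<^sup>1\<^sup>/\<^sup>2\<close>, is integrable over \<open>Delta2\<close> (\<open>expectation_limit\<close>).

  The pairing. Convergence of \<open>\<eta>\<^sub>\<epsilon>\<close> in a space \<open>D2\<close> of arbitrarily negative order controls
  \<open>E[F \<eta>\<^sub>\<epsilon>]\<close> provided that the chaos components of \<open>F\<close> decrease faster than every power. Integration by parts moves the number
  operator, which multiplies the \<open>n\<close>-th chaos by \<open>n\<close>, from Hermite polynomials to smooth functions
  of a Gaussian vector, where it is a second order differential operator; thus every power of \<open>n\<close>
  costs two derivatives of the test function (\<open>number_operator_power\<close>). The factor \<open>F2(z)\<close> depends
  on the whole path. It is the limit of the functions of finitely many values of \<open>z\<close> obtained by
  interpolating the path linearly; the Gaussian vectors that occur have a fixed dimension and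
  uniformly bounded covariances, so the decay estimates survive the limit (\<open>chaos_decay\<close>). The
  same estimates make \<open>F\<close> a continuous functional on \<open>D2\<close> (\<open>has_D2_pairing_limit\<close>).
\<close>

section \<open>The heat kernel and Gaussian measures\<close>

lemma heat_kernel_nonneg [simp]: "0 \<le> heat_kernel t x"
  by (simp add: heat_kernel_def)

lemma borel_measurable_heat_kernel [measurable]:
  "heat_kernel t \<in> borel_measurable borel"
  unfolding heat_kernel_def [abs_def] by measurable

lemma heat_kernel_eq_prod_normal_density:
  fixes x :: "'v::euclidean_space"
  assumes "0 < t"
  shows "heat_kernel t x = (\<Prod>b\<in>Basis. normal_density 0 (sqrt t) (x \<bullet> b))"
proof -
  have "(\<Prod>b\<in>Basis. normal_density 0 (sqrt t) (x \<bullet> b)) =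
      (1 / sqrt (2 * pi * t)) ^ DIM('v) * exp (\<Sum>b\<in>Basis. - (x \<bullet> b)\<^sup>2 / (2 * t))"
    using assms by (simp add: normal_density_def exp_sum prod_dividef power_divide)
  also have "(\<Sum>b\<in>Basis. - (x \<bullet> b)\<^sup>2 / (2 * t)) = - (norm x)\<^sup>2 / (2 * t)"
    unfolding power2_norm_eq_inner euclidean_inner[of x x]
    by (simp add: sum_negf sum_divide_distrib power2_eq_square)
  also have "(1 / sqrt (2 * pi * t)) ^ DIM('v) = (2 * pi * t) powr (- real DIM('v) / 2)"
    using assms
    by (simp add: powr_half_sqrt[symmetric] powr_minus_divide powr_powr power_divide
        flip: powr_realpow)
  finally show ?thesis by (simp add: heat_kernel_def)
qed

lemma nn_integral_heat_kernel:
  assumes "0 < t"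
  shows "(\<integral>\<^sup>+x. heat_kernel t (x::'v::euclidean_space) \<partial>lborel) = 1"
proof -
  interpret prob_space "density lborel (normal_density 0 (sqrt t))"
    using assms by (intro prob_space_normal_density) auto
  have 1: "(\<integral>\<^sup>+x. ennreal (normal_density 0 (sqrt t) x) \<partial>lborel) = 1"
    using emeasure_space_1 by (simp add: emeasure_density)
  have "(\<integral>\<^sup>+x. heat_kernel t (x::'v) \<partial>lborel) =
      (\<integral>\<^sup>+x. (\<Prod>b\<in>Basis. ennreal (normal_density 0 (sqrt t) ((x::'v) \<bullet> b))) \<partial>lborel)"
    using assms by (simp add: heat_kernel_eq_prod_normal_density prod_ennreal)
  also have "\<dots> = (\<Prod>b\<in>(Basis::'v set). \<integral>\<^sup>+x. ennreal (normal_density 0 (sqrt t) x) \<partial>lborel)"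
    by (rule nn_integral_lborel_prod) auto
  finally show ?thesis by (simp add: 1)
qed

lemma integrable_heat_kernel: "0 < t \<Longrightarrow> integrable lborel (heat_kernel t :: 'v::euclidean_space \<Rightarrow> real)"
  by (intro integrableI_nonneg) (auto simp: nn_integral_heat_kernel)

lemma integral_heat_kernel: "0 < t \<Longrightarrow> (\<integral>x. heat_kernel t (x::'v::euclidean_space) \<partial>lborel) = 1"
  using nn_integral_heat_kernel[of t, where 'v='v] by (intro integral_eq_nn_integral[THEN trans]) auto

lemma nn_integral_lborel_affine:
  fixes f :: "'v::euclidean_space \<Rightarrow> ennreal"
  assumes [measurable]: "f \<in> borel_measurable borel" and "c \<noteq> 0"
  shows "(\<integral>\<^sup>+x. f x \<partial>lborel) = ennreal (\<bar>c\<bar> ^ DIM('v)) * (\<integral>\<^sup>+x. f (t + c *\<^sub>R x) \<partial>lborel)"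
  by (subst lborel_affine[OF \<open>c \<noteq> 0\<close>, of t])
    (simp add: nn_integral_density nn_integral_distr nn_integral_cmult)

lemma heat_kernel_scale:
  fixes x :: "'v::euclidean_space"
  assumes "0 < v" "0 < t"
  shows "heat_kernel (v * t) (sqrt v *\<^sub>R x) * sqrt v ^ DIM('v) = heat_kernel t x"
proof -
  have "sqrt v ^ DIM('v) = v powr (real DIM('v) / 2)"
    using assms by (simp add: powr_half_sqrt[symmetric] powr_powr flip: powr_realpow)
  then have "(2 * pi * (v * t)) powr (- real DIM('v) / 2) * sqrt v ^ DIM('v)
      = (2 * pi * t) powr (- real DIM('v) / 2)"
    using assms by (simp add: powr_mult powr_minus field_simps)
  then show ?thesis
    using assms by (simp add: heat_kernel_def power_mult_distrib mult.commute mult.left_commute)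
qed

text \<open>
  The centred Gaussian measure with covariance \<open>v\<close> times the identity. Defining it as an image of the
  standard one includes the degenerate case \<open>v = 0\<close>, which occurs when grid points coincide.
\<close>
definition gauss :: "real \<Rightarrow> 'v::euclidean_space measure" where
  "gauss v = distr (density lborel (\<lambda>x. ennreal (heat_kernel 1 x))) borel (\<lambda>x. sqrt v *\<^sub>R x)"

lemma sets_gauss [measurable_cong, simp]: "sets (gauss v) = sets borel"
  by (simp add: gauss_def)

lemma space_gauss [simp]: "space (gauss v) = UNIV"
  by (simp add: gauss_def)

lemma prob_space_gauss: "prob_space (gauss v)"
  unfolding gauss_def
  by (intro prob_space.prob_space_distr prob_spaceI)
    (auto simp: emeasure_density nn_integral_heat_kernel)

lemma gauss_eq_density:
  assumes "0 < v"
  shows "(gauss v :: 'v::euclidean_space measure) = density lborel (\<lambda>x. ennreal (heat_kernel v x))"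
proof (rule measure_eqI)
  fix A :: "'v set" assume "A \<in> sets (gauss v)"
  then have [measurable]: "A \<in> sets borel" by simp
  have "emeasure (density lborel (\<lambda>x. ennreal (heat_kernel v x))) A =
      ennreal (\<bar>sqrt v\<bar> ^ DIM('v)) *
        (\<integral>\<^sup>+x. ennreal (heat_kernel v (0 + sqrt v *\<^sub>R x)) * indicator A (0 + sqrt v *\<^sub>R x) \<partial>lborel)"
    using assms
    by (subst emeasure_density, simp, simp, subst nn_integral_lborel_affine[of _ "sqrt v" 0]) auto
  also have "\<dots> = (\<integral>\<^sup>+x. ennreal (heat_kernel 1 x) * indicator A (sqrt v *\<^sub>R x) \<partial>lborel)"
    using assms
    by (subst nn_integral_cmult[symmetric])
       (auto intro!: nn_integral_cong
         simp: heat_kernel_scale[of v 1, simplified, symmetric] ennreal_mult' mult_ac)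
  also have "\<dots> = emeasure (gauss v) A"
    unfolding gauss_def
    by (subst nn_integral_indicator[symmetric], simp, subst nn_integral_distr)
      (auto simp: nn_integral_density)
  finally show "emeasure (gauss v) A = emeasure (density lborel (\<lambda>x. ennreal (heat_kernel v x))) A" ..
qed simp

lemma gauss_0: "(gauss 0 :: 'v::euclidean_space measure) = return borel 0"
proof -
  interpret prob_space "gauss 0 :: 'v measure" by (rule prob_space_gauss)
  show ?thesis
  proof (rule measure_eqI)
    fix A :: "'v set" assume "A \<in> sets (gauss 0)"
    then have [measurable]: "A \<in> sets borel" by simp
    interpret D: prob_space "density lborel (\<lambda>x::'v. ennreal (heat_kernel 1 x))"
      by (intro prob_spaceI) (auto simp: emeasure_density nn_integral_heat_kernel)
    show "emeasure (gauss 0) A = emeasure (return borel 0) A"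
      unfolding gauss_def using D.emeasure_space_1
      by (subst emeasure_distr) (auto simp: indicator_def vimage_def)
  qed simp
qed

text \<open>Completing the square: a translate of a Gaussian measure is an exponential tilt of it.\<close>
lemma gauss_shift:
  fixes a :: "'v::euclidean_space"
  assumes "0 \<le> v"
  shows "distr (gauss v) borel (\<lambda>x. x + v *\<^sub>R a)
    = density (gauss v) (\<lambda>x. ennreal (exp (a \<bullet> x - v * (a \<bullet> a) / 2)))"
proof (rule measure_eqI)
  fix A :: "'v set" assume "A \<in> sets (distr (gauss v) borel (\<lambda>x. x + v *\<^sub>R a))"
  then have [measurable]: "A \<in> sets borel" by simp
  define b where "b = sqrt v *\<^sub>R a"
  have bb: "b \<bullet> b = v * (a \<bullet> a)" "sqrt v *\<^sub>R b = v *\<^sub>R a" "sqrt v * (a \<bullet> x) = b \<bullet> x" for x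
    using assms by (auto simp: b_def)
  have key: "heat_kernel 1 (x - b) = heat_kernel 1 x * exp (b \<bullet> x - b \<bullet> b / 2)" for x
    by (simp add: heat_kernel_def exp_add[symmetric] power2_norm_eq_inner inner_diff_left
        inner_diff_right inner_commute[of x b] field_simps)
  have "emeasure (distr (gauss v) borel (\<lambda>x. x + v *\<^sub>R a)) A
      = (\<integral>\<^sup>+x. ennreal (heat_kernel 1 x) * indicator A (sqrt v *\<^sub>R (x + b)) \<partial>lborel)"
  proof -
    have "emeasure (distr (gauss v) borel (\<lambda>x. x + v *\<^sub>R a)) A
      = (\<integral>\<^sup>+x. indicator A x \<partial>distr (gauss v) borel (\<lambda>x. x + v *\<^sub>R a))"
      by simp
    also have "\<dots> = (\<integral>\<^sup>+x. ennreal (heat_kernel 1 x) * indicator A (sqrt v *\<^sub>R (x + b)) \<partial>lborel)"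
      unfolding gauss_def
      by (simp add: nn_integral_distr nn_integral_density bb scaleR_add_right del: nn_integral_indicator)
    finally show ?thesis .
  qed
  also have "\<dots> = (\<integral>\<^sup>+x. ennreal (heat_kernel 1 (x - b)) * indicator A (sqrt v *\<^sub>R x) \<partial>lborel)"
    by (subst nn_integral_lborel_affine[where c=1 and t="-b"]) auto
  also have "\<dots> = (\<integral>\<^sup>+x. ennreal (heat_kernel 1 x) *
      (ennreal (exp (b \<bullet> x - b \<bullet> b / 2)) * indicator A (sqrt v *\<^sub>R x)) \<partial>lborel)"
    by (simp add: key ennreal_mult' mult_ac)
  also have "\<dots> = emeasure (density (gauss v) (\<lambda>x. ennreal (exp (a \<bullet> x - v * (a \<bullet> a) / 2)))) A"
    unfolding gauss_def
    by (subst emeasure_density) (simp_all add: nn_integral_distr nn_integral_density bb)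
  finally show "emeasure (distr (gauss v) borel (\<lambda>x. x + v *\<^sub>R a)) A = \<dots>" .
qed simp

section \<open>The Cameron--Martin formula for Brownian motion\<close>

text \<open>
  Repeated grid points are allowed, as in the definition of Brownian motion.
\<close>
definition grid :: "(nat \<Rightarrow> real) \<Rightarrow> nat \<Rightarrow> bool" where
  "grid \<tau> n \<longleftrightarrow> 0 < n \<and> 0 \<le> \<tau> 0 \<and> (\<forall>i<n. \<tau> i \<le> \<tau> (Suc i)) \<and> \<tau> n \<le> 1"

text \<open>
  The covariance of the linear combinations of increments with coefficients \<open>a\<close> and \<open>b\<close>, see
  \<open>covariance_lincomb\<close> below.
\<close>
definition grid_cov :: "(nat \<Rightarrow> real) \<Rightarrow> nat \<Rightarrow> (nat \<Rightarrow> 'v::euclidean_space) \<Rightarrow> (nat \<Rightarrow> 'v) \<Rightarrow> real" where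
  "grid_cov \<tau> n a b = (\<Sum>k<n. (\<tau> (Suc k) - \<tau> k) * (a k \<bullet> b k))"

lemma grid_mono:
  assumes "grid \<tau> n" "i \<le> j" "j \<le> n"
  shows "\<tau> i \<le> \<tau> j"
  using assms(2,3)
proof (induction j rule: dec_induct)
  case (step j)
  then show ?case using assms(1) by (auto simp: grid_def intro: order_trans[of _ "\<tau> j"])
qed simp

lemma grid_bounds:
  assumes "grid \<tau> n" "i \<le> n"
  shows "0 \<le> \<tau> i" "\<tau> i \<le> 1"
  using grid_mono[OF assms(1), of 0 i] grid_mono[OF assms(1), of i n] assms by (auto simp: grid_def)

lemma grid_cov_commute: "grid_cov \<tau> n a b = grid_cov \<tau> n b a"
  by (simp add: grid_cov_def inner_commute)

lemma grid_cov_scaleR [simp]: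
  "grid_cov \<tau> n (\<lambda>k. c *\<^sub>R a k) b = c * grid_cov \<tau> n a b" "grid_cov \<tau> n a (\<lambda>k. c *\<^sub>R b k) = c * grid_cov \<tau> n a b"
  by (simp_all add: grid_cov_def sum_distrib_left mult_ac)

lemma grid_cov_minus [simp]:
  "grid_cov \<tau> n (\<lambda>k. - a k) b = - grid_cov \<tau> n a b" "grid_cov \<tau> n a (\<lambda>k. - b k) = - grid_cov \<tau> n a b"
  by (simp_all add: grid_cov_def sum_negf)

lemma grid_cov_nonneg: "grid \<tau> n \<Longrightarrow> 0 \<le> grid_cov \<tau> n a a"
  by (auto simp: grid_cov_def grid_def intro!: sum_nonneg)

text \<open>
  The translation formula of \<open>gauss_shift\<close> in every coordinate.
\<close>
lemma PiM_gauss_shift: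
  fixes a :: "nat \<Rightarrow> 'v::euclidean_space"
  assumes v: "\<And>k. k < n \<Longrightarrow> 0 \<le> v k"
  defines "P \<equiv> PiM {..<n} (\<lambda>k. gauss (v k))"
  shows "distr P (PiM {..<n} (\<lambda>_. borel)) (\<lambda>x. \<lambda>k\<in>{..<n}. x k + v k *\<^sub>R a k)
    = density P (\<lambda>x. \<Prod>k<n. ennreal (exp (a k \<bullet> x k - v k * (a k \<bullet> a k) / 2)))"
proof -
  define w where "w k = (if k < n then v k else 0)" for k
  have w: "0 \<le> w k" for k using v by (simp add: w_def)
  define g where "g k x = ennreal (exp (a k \<bullet> x - w k * (a k \<bullet> a k) / 2))" for k and x :: 'v
  have [measurable]: "g k \<in> borel_measurable borel" for k
    unfolding g_def by measurable
  define \<nu> where "\<nu> k = density (gauss (w k)) (g k)" for k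
  have \<nu>: "\<nu> k = distr (gauss (w k)) borel (\<lambda>x. x + w k *\<^sub>R a k)" for k
    unfolding \<nu>_def g_def by (rule gauss_shift[OF w, symmetric])
  have [simp, measurable_cong]: "sets (\<nu> k) = sets borel" for k
    by (simp add: \<nu>_def)
  interpret G: product_prob_space "\<lambda>k. gauss (w k) :: 'v measure" "{..<n}"
    by (intro product_prob_spaceI prob_space_gauss)
  interpret N: product_prob_space \<nu> "{..<n}"
    unfolding \<nu> by (intro product_prob_spaceI prob_space.prob_space_distr prob_space_gauss) simp
  have P: "P = PiM {..<n} (\<lambda>k. gauss (w k))"
    unfolding P_def by (intro PiM_cong) (auto simp: w_def)
  have sets_P [measurable_cong, simp]: "sets P = sets (PiM {..<n} (\<lambda>_. borel))"
    unfolding P by (intro sets_PiM_cong) auto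
  have sets_N: "sets (PiM {..<n} \<nu>) = sets (PiM {..<n} (\<lambda>_. borel))"
    by (intro sets_PiM_cong) auto
  have space_P: "space P = PiE {..<n} (\<lambda>_. UNIV)"
    unfolding P by (simp add: space_PiM)
  have 1: "density P (\<lambda>x. \<Prod>k<n. g k (x k)) = PiM {..<n} \<nu>"
  proof (rule N.PiM_eqI)
    fix A :: "nat \<Rightarrow> 'v set" assume A: "\<And>i. i \<in> {..<n} \<Longrightarrow> A i \<in> sets (\<nu> i)"
    then have [measurable]: "i < n \<Longrightarrow> A i \<in> sets borel" for i by auto
    have "emeasure (density P (\<lambda>x. \<Prod>k<n. g k (x k))) (Pi\<^sub>E {..<n} A)
      = (\<integral>\<^sup>+x. (\<Prod>k<n. g k (x k)) * indicator (Pi\<^sub>E {..<n} A) x \<partial>P)"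
      by (intro emeasure_density) (auto simp: A intro!: sets_PiM_I_finite)
    also have "\<dots> = (\<integral>\<^sup>+x. (\<Prod>k<n. g k (x k) * indicator (A k) (x k)) \<partial>P)"
    proof (rule nn_integral_cong)
      fix x assume "x \<in> space P"
      then have "indicator (Pi\<^sub>E {..<n} A) x = (\<Prod>k<n. indicator (A k) (x k) :: ennreal)"
        unfolding space_P by (auto simp: indicator_def prod_eq_1_iff PiE_iff Pi_iff split: if_splits)
      then show "(\<Prod>k<n. g k (x k)) * indicator (Pi\<^sub>E {..<n} A) x = (\<Prod>k<n. g k (x k) * indicator (A k) (x k))"
        by (simp add: prod.distrib)
    qed
    also have "\<dots> = (\<Prod>k<n. \<integral>\<^sup>+x. g k x * indicator (A k) x \<partial>gauss (w k))"
      unfolding P by (rule G.product_nn_integral_prod) auto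
    also have "\<dots> = (\<Prod>k<n. emeasure (\<nu> k) (A k))"
      by (intro prod.cong) (auto simp: \<nu>_def emeasure_density)
    finally show "emeasure (density P (\<lambda>x. \<Prod>k<n. g k (x k))) (Pi\<^sub>E {..<n} A)
      = (\<Prod>i<n. emeasure (\<nu> i) (A i))" .
  qed (simp_all add: sets_N)
  have 2: "distr P (PiM {..<n} (\<lambda>_. borel)) (\<lambda>x. \<lambda>k\<in>{..<n}. x k + w k *\<^sub>R a k) = PiM {..<n} \<nu>"
  proof (rule N.PiM_eqI)
    fix A :: "nat \<Rightarrow> 'v set" assume A: "\<And>i. i \<in> {..<n} \<Longrightarrow> A i \<in> sets (\<nu> i)"
    then have A' [measurable]: "i < n \<Longrightarrow> A i \<in> sets borel" for i by auto
    define A' where "A' i = (\<lambda>x. x + w i *\<^sub>R a i) -` A i" for i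
    have A'_sets: "i < n \<Longrightarrow> A' i \<in> sets borel" for i
      unfolding A'_def by (rule measurable_sets_borel[OF _ A']) auto
    have "(\<lambda>x. \<lambda>k\<in>{..<n}. x k + w k *\<^sub>R a k) -` (Pi\<^sub>E {..<n} A) \<inter> space P = Pi\<^sub>E {..<n} A'"
      unfolding space_P A'_def by (auto simp: PiE_iff)
    then have "emeasure (distr P (PiM {..<n} (\<lambda>_. borel)) (\<lambda>x. \<lambda>k\<in>{..<n}. x k + w k *\<^sub>R a k)) (Pi\<^sub>E {..<n} A)
      = emeasure P (Pi\<^sub>E {..<n} A')"
      by (subst emeasure_distr) (auto simp: A intro!: sets_PiM_I_finite)
    also have "\<dots> = (\<Prod>i<n. emeasure (gauss (w i)) (A' i))"
      unfolding P by (intro G.emeasure_PiM) (auto simp: A'_sets)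
    also have "\<dots> = (\<Prod>i<n. emeasure (\<nu> i) (A i))"
      unfolding \<nu> by (intro prod.cong) (auto simp: emeasure_distr A'_def)
    finally show "emeasure (distr P (PiM {..<n} (\<lambda>_. borel)) (\<lambda>x. \<lambda>k\<in>{..<n}. x k + w k *\<^sub>R a k)) (Pi\<^sub>E {..<n} A)
      = (\<Prod>i<n. emeasure (\<nu> i) (A i))" .
  qed (simp_all add: sets_N)
  have "(\<lambda>x::nat \<Rightarrow> 'v. \<lambda>k\<in>{..<n}. x k + v k *\<^sub>R a k) = (\<lambda>x. \<lambda>k\<in>{..<n}. x k + w k *\<^sub>R a k)"
    by (auto simp: w_def restrict_def fun_eq_iff)
  moreover have "(\<lambda>x. \<Prod>k<n. ennreal (exp (a k \<bullet> x k - v k * (a k \<bullet> a k) / 2))) = (\<lambda>x. \<Prod>k<n. g k (x k))"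
    by (auto simp: w_def g_def fun_eq_iff intro!: prod.cong)
  ultimately show ?thesis using 1 2 by simp
qed

locale brownian = prob_space M for M :: "'a measure" +
  fixes B :: "real \<Rightarrow> 'a \<Rightarrow> 'v::euclidean_space"
  assumes brownian: "brownian_motion M B"
begin

lemma B_measurable: "t \<in> {0..1} \<Longrightarrow> B t \<in> borel_measurable M"
  using brownian by (auto simp: brownian_motion_def)

lemma B_0: "\<omega> \<in> space M \<Longrightarrow> B 0 \<omega> = 0"
  using brownian by (auto simp: brownian_motion_def)

lemma B_continuous: "\<omega> \<in> space M \<Longrightarrow> continuous_on {0..1} (\<lambda>t. B t \<omega>)"
  using brownian by (auto simp: brownian_motion_def)

definition incr :: "(nat \<Rightarrow> real) \<Rightarrow> nat \<Rightarrow> 'a \<Rightarrow> 'v" where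
  "incr \<tau> k \<omega> = B (\<tau> (Suc k)) \<omega> - B (\<tau> k) \<omega>"

definition lincomb :: "(nat \<Rightarrow> real) \<Rightarrow> nat \<Rightarrow> (nat \<Rightarrow> 'v) \<Rightarrow> 'a \<Rightarrow> real" where
  "lincomb \<tau> n a \<omega> = (\<Sum>k<n. a k \<bullet> incr \<tau> k \<omega>)"

text \<open>
  The Gaussian vector whose component along the basis vector \<open>b\<close> is the linear combination with
  coefficients \<open>\<beta> b\<close>.
\<close>
definition grid_vec :: "(nat \<Rightarrow> real) \<Rightarrow> nat \<Rightarrow> ('y::euclidean_space \<Rightarrow> nat \<Rightarrow> 'v) \<Rightarrow> 'a \<Rightarrow> 'y" where
  "grid_vec \<tau> n \<beta> \<omega> = (\<Sum>b\<in>Basis. lincomb \<tau> n (\<beta> b) \<omega> *\<^sub>R b)"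

lemma incr_measurable: "grid \<tau> n \<Longrightarrow> k < n \<Longrightarrow> incr \<tau> k \<in> borel_measurable M"
  unfolding incr_def using B_measurable grid_bounds[of \<tau> n] by (auto intro!: borel_measurable_diff)

lemma lincomb_measurable: "grid \<tau> n \<Longrightarrow> lincomb \<tau> n a \<in> borel_measurable M"
  unfolding lincomb_def [abs_def]
  by (intro borel_measurable_sum borel_measurable_inner borel_measurable_const incr_measurable) auto

lemma grid_vec_measurable: "grid \<tau> n \<Longrightarrow> grid_vec \<tau> n \<beta> \<in> borel_measurable M"
  unfolding grid_vec_def [abs_def]
  by (intro borel_measurable_sum borel_measurable_scaleR borel_measurable_const lincomb_measurable) auto

lemma lincomb_scaleR: "lincomb \<tau> n (\<lambda>k. c *\<^sub>R a k) \<omega> = c * lincomb \<tau> n a \<omega>"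
  by (simp add: lincomb_def sum_distrib_left)

lemma grid_vec_inner: "b \<in> Basis \<Longrightarrow> grid_vec \<tau> n \<beta> \<omega> \<bullet> b = lincomb \<tau> n (\<beta> b) \<omega>"
  by (simp add: grid_vec_def inner_sum_left inner_Basis if_distrib sum.If_cases)

lemma distr_incr:
  assumes "0 \<le> s" "s \<le> t" "t \<le> 1"
  shows "distr M borel (\<lambda>\<omega>. B t \<omega> - B s \<omega>) = gauss (t - s)"
proof (cases "s = t")
  case True
  then have "distr M borel (\<lambda>\<omega>. B t \<omega> - B s \<omega>) = distr M borel (\<lambda>\<omega>. 0::'v)" by simp
  then show ?thesis using True by (simp add: gauss_0 distr_const)
next
  case False
  then have "distributed M lborel (\<lambda>\<omega>. B t \<omega> - B s \<omega>) (\<lambda>x. ennreal (heat_kernel (t - s) x))"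
    using brownian assms unfolding brownian_motion_def by auto
  then have "distr M lborel (\<lambda>\<omega>. B t \<omega> - B s \<omega>) = gauss (t - s)"
    using False assms by (simp add: distributed_def gauss_eq_density)
  then show ?thesis
    by (metis distr_cong sets_lborel)
qed

lemma indep_incr:
  assumes "grid \<tau> n"
  shows "indep_vars (\<lambda>_. borel) (incr \<tau>) {..<n}"
  using brownian assms unfolding brownian_motion_def grid_def incr_def[abs_def] by auto

lemma distr_incrs:
  assumes "grid \<tau> n"
  shows "distr M (PiM {..<n} (\<lambda>_. borel)) (\<lambda>\<omega>. \<lambda>k\<in>{..<n}. incr \<tau> k \<omega>)
    = PiM {..<n} (\<lambda>k. gauss (\<tau> (Suc k) - \<tau> k))"
proof -
  have "distr M (PiM {..<n} (\<lambda>_. borel)) (\<lambda>\<omega>. \<lambda>k\<in>{..<n}. incr \<tau> k \<omega>)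
    = PiM {..<n} (\<lambda>k. distr M borel (incr \<tau> k))"
    using indep_incr[OF assms] assms
    by (subst indep_vars_iff_distr_eq_PiM'[symmetric]) (auto simp: grid_def intro: incr_measurable[OF assms])
  also have "\<dots> = PiM {..<n} (\<lambda>k. gauss (\<tau> (Suc k) - \<tau> k))"
  proof (intro PiM_cong refl)
    fix k assume "k \<in> {..<n}"
    then show "distr M borel (incr \<tau> k) = gauss (\<tau> (Suc k) - \<tau> k)"
      unfolding incr_def[abs_def] using grid_bounds[OF assms, of k] grid_bounds[OF assms, of "Suc k"] assms
      by (intro distr_incr) (auto simp: grid_def)
  qed
  finally show ?thesis .
qed

text \<open>
  Adding drifts to the increments is a change of measure, by the translation formula for each of the
  independent increments.
\<close>
lemma cameron_martin_incrs:
  fixes H :: "(nat \<Rightarrow> 'v) \<Rightarrow> real"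
  assumes g: "grid \<tau> n" and [measurable]: "H \<in> borel_measurable (PiM {..<n} (\<lambda>_. borel))"
  shows "(\<integral>\<omega>. H (\<lambda>k\<in>{..<n}. incr \<tau> k \<omega> + (\<tau> (Suc k) - \<tau> k) *\<^sub>R a k) \<partial>M)
    = (\<integral>\<omega>. H (\<lambda>k\<in>{..<n}. incr \<tau> k \<omega>) * exp (lincomb \<tau> n a \<omega> - grid_cov \<tau> n a a / 2) \<partial>M)"
proof -
  define v where "v k = \<tau> (Suc k) - \<tau> k" for k
  define D where "D \<omega> = (\<lambda>k\<in>{..<n}. incr \<tau> k \<omega>)" for \<omega>
  define N :: "(nat \<Rightarrow> 'v) measure" where "N = PiM {..<n} (\<lambda>_. borel)"
  define P :: "(nat \<Rightarrow> 'v) measure" where "P = PiM {..<n} (\<lambda>k. gauss (v k))"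
  have [measurable_cong]: "sets P = sets N" unfolding P_def N_def by (intro sets_PiM_cong) auto
  have [measurable]: "H \<in> borel_measurable N" by (simp add: N_def)
  have D [measurable]: "D \<in> measurable M N"
    unfolding D_def[abs_def] N_def by (intro measurable_restrict incr_measurable[OF g]) auto
  have DP: "distr M N D = P"
    using distr_incrs[OF g] by (simp add: D_def[abs_def] N_def P_def v_def)
  define S where "S x = (\<lambda>k\<in>{..<n}. x k + v k *\<^sub>R a k)" for x
  have [measurable]: "S \<in> measurable N N"
    unfolding S_def[abs_def] N_def by measurable
  define W where "W x = exp (\<Sum>k<n. a k \<bullet> x k - v k * (a k \<bullet> a k) / 2)" for x
  have W [measurable]: "W \<in> borel_measurable N"
    unfolding W_def[abs_def] N_def by measurable
  have SP: "distr P N S = density P (\<lambda>x. ennreal (W x))"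
    using PiM_gauss_shift[of n v a] g
    by (simp add: P_def N_def S_def[abs_def] W_def v_def grid_def exp_sum prod_ennreal)
  have "(\<integral>\<omega>. H (S (D \<omega>)) \<partial>M) = (\<integral>x. H (S x) \<partial>P)"
    unfolding DP[symmetric] by (rule integral_distr[symmetric]) auto
  also have "\<dots> = (\<integral>x. H x \<partial>distr P N S)"
    by (rule integral_distr[symmetric]) auto
  also have "\<dots> = (\<integral>x. W x * H x \<partial>P)"
    unfolding SP by (subst integral_density) (auto simp: W_def)
  also have "\<dots> = (\<integral>\<omega>. W (D \<omega>) * H (D \<omega>) \<partial>M)"
    unfolding DP[symmetric] by (rule integral_distr) auto
  finally have "(\<integral>\<omega>. H (S (D \<omega>)) \<partial>M) = (\<integral>\<omega>. W (D \<omega>) * H (D \<omega>) \<partial>M)" .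
  moreover have "S (D \<omega>) = (\<lambda>k\<in>{..<n}. incr \<tau> k \<omega> + (\<tau> (Suc k) - \<tau> k) *\<^sub>R a k)" for \<omega>
    by (auto simp: S_def D_def v_def restrict_def)
  moreover have "W (D \<omega>) = exp (lincomb \<tau> n a \<omega> - grid_cov \<tau> n a a / 2)" for \<omega>
    by (simp add: W_def D_def v_def lincomb_def grid_cov_def sum_subtractf sum_divide_distrib)
  ultimately show ?thesis by (simp add: D_def mult.commute)
qed

text \<open>
  The drift \<open>a\<close> enters a Gaussian vector only through its covariances with
  that vector.
\<close>
lemma cameron_martin:
  fixes H :: "'y::euclidean_space \<Rightarrow> real"
  assumes g: "grid \<tau> n" and [measurable]: "H \<in> borel_measurable borel"
  shows "(\<integral>\<omega>. H (grid_vec \<tau> n \<beta> \<omega> + (\<Sum>b\<in>Basis. grid_cov \<tau> n a (\<beta> b) *\<^sub>R b)) \<partial>M)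
    = (\<integral>\<omega>. H (grid_vec \<tau> n \<beta> \<omega>) * exp (lincomb \<tau> n a \<omega> - grid_cov \<tau> n a a / 2) \<partial>M)"
proof -
  define Y where "Y x = (\<Sum>b\<in>Basis. (\<Sum>k<n. \<beta> b k \<bullet> x k) *\<^sub>R b)" for x
  have [measurable]: "Y \<in> borel_measurable (PiM {..<n} (\<lambda>_. borel))"
    unfolding Y_def[abs_def] by measurable
  have "Y (\<lambda>k\<in>{..<n}. incr \<tau> k \<omega> + (\<tau> (Suc k) - \<tau> k) *\<^sub>R a k)
      = grid_vec \<tau> n \<beta> \<omega> + (\<Sum>b\<in>Basis. grid_cov \<tau> n a (\<beta> b) *\<^sub>R b)" for \<omega>
    by (simp add: Y_def grid_vec_def lincomb_def grid_cov_def inner_add_right sum.distrib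
        scaleR_add_left inner_commute)
  moreover have "Y (\<lambda>k\<in>{..<n}. incr \<tau> k \<omega>) = grid_vec \<tau> n \<beta> \<omega>" for \<omega>
    by (simp add: Y_def grid_vec_def lincomb_def)
  ultimately show ?thesis
    using cameron_martin_incrs[OF g, of "\<lambda>x. H (Y x)" a] by simp
qed

lemma exp_lincomb:
  assumes g: "grid \<tau> n"
  shows "integrable M (\<lambda>\<omega>. exp (lincomb \<tau> n a \<omega>))"
    and "(\<integral>\<omega>. exp (lincomb \<tau> n a \<omega>) \<partial>M) = exp (grid_cov \<tau> n a a / 2)"
proof -
  have "(\<integral>\<omega>. exp (lincomb \<tau> n a \<omega>) \<partial>M) * exp (- grid_cov \<tau> n a a / 2)
      = (\<integral>\<omega>. exp (lincomb \<tau> n a \<omega>) * exp (- grid_cov \<tau> n a a / 2) \<partial>M)"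
    by (rule integral_mult_left_zero[symmetric])
  also have "\<dots> = (\<integral>\<omega>. exp (lincomb \<tau> n a \<omega> - grid_cov \<tau> n a a / 2) \<partial>M)"
    by (simp add: mult_exp_exp)
  also have "\<dots> = 1"
    using cameron_martin[OF g, of "\<lambda>_::real. 1" _ a] by (simp add: prob_space)
  finally have *: "(\<integral>\<omega>. exp (lincomb \<tau> n a \<omega>) \<partial>M) * exp (- grid_cov \<tau> n a a / 2) = 1" .
  then show "(\<integral>\<omega>. exp (lincomb \<tau> n a \<omega>) \<partial>M) = exp (grid_cov \<tau> n a a / 2)"
    by (simp add: exp_minus field_simps)
  show "integrable M (\<lambda>\<omega>. exp (lincomb \<tau> n a \<omega>))"
    using * not_integrable_integral_eq by fastforce
qed

lemma exp_abs_lincomb: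
  assumes g: "grid \<tau> n"
  shows "integrable M (\<lambda>\<omega>. exp (c * \<bar>lincomb \<tau> n a \<omega>\<bar>))"
    and "(\<integral>\<omega>. exp (c * \<bar>lincomb \<tau> n a \<omega>\<bar>) \<partial>M) \<le> 2 * exp (c\<^sup>2 * grid_cov \<tau> n a a / 2)"
proof -
  note [measurable] = lincomb_measurable[OF g]
  have b: "exp (c * \<bar>x\<bar>) \<le> exp (c * x) + exp (- c * x)" for x :: real
    by (cases "0 \<le> x") auto
  have e: "exp (c * lincomb \<tau> n a \<omega>) = exp (lincomb \<tau> n (\<lambda>k. c *\<^sub>R a k) \<omega>)"
    "exp (- c * lincomb \<tau> n a \<omega>) = exp (lincomb \<tau> n (\<lambda>k. (-c) *\<^sub>R a k) \<omega>)" for c \<omega>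
    unfolding lincomb_scaleR by auto
  have i: "integrable M (\<lambda>\<omega>. exp (c * lincomb \<tau> n a \<omega>) + exp (- c * lincomb \<tau> n a \<omega>))"
    unfolding e by (intro Bochner_Integration.integrable_add exp_lincomb g)
  show 1: "integrable M (\<lambda>\<omega>. exp (c * \<bar>lincomb \<tau> n a \<omega>\<bar>))"
    by (rule Bochner_Integration.integrable_bound[OF i]) (use b in \<open>auto simp del: mult_minus_left\<close>)
  have "(\<integral>\<omega>. exp (c * \<bar>lincomb \<tau> n a \<omega>\<bar>) \<partial>M)
    \<le> (\<integral>\<omega>. exp (c * lincomb \<tau> n a \<omega>) + exp (- c * lincomb \<tau> n a \<omega>) \<partial>M)"
    by (intro integral_mono 1 i b)
  also have "\<dots> = 2 * exp (c\<^sup>2 * grid_cov \<tau> n a a / 2)"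
    unfolding e by (subst Bochner_Integration.integral_add)
      (auto intro!: exp_lincomb g simp: exp_lincomb[OF g] power2_eq_square mult_ac)
  finally show "(\<integral>\<omega>. exp (c * \<bar>lincomb \<tau> n a \<omega>\<bar>) \<partial>M) \<le> 2 * exp (c\<^sup>2 * grid_cov \<tau> n a a / 2)" .
qed

lemma exp_norm_grid_vec:
  fixes \<beta> :: "'y::euclidean_space \<Rightarrow> nat \<Rightarrow> 'v"
  assumes g: "grid \<tau> n" and L: "0 \<le> L"
  shows "integrable M (\<lambda>\<omega>. exp (L * norm (grid_vec \<tau> n \<beta> \<omega>)))"
    and "(\<integral>\<omega>. exp (L * norm (grid_vec \<tau> n \<beta> \<omega>)) \<partial>M)
      \<le> (\<Sum>b\<in>Basis. 2 * exp ((L * real DIM('y))\<^sup>2 * grid_cov \<tau> n (\<beta> b) (\<beta> b) / 2))"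
proof -
  note [measurable] = grid_vec_measurable[OF g]
  have b: "exp (L * norm y) \<le> (\<Sum>b\<in>Basis. exp ((L * real DIM('y)) * \<bar>y \<bullet> b\<bar>))" for y :: 'y
  proof -
    obtain b where b: "b \<in> Basis" "Max ((\<lambda>b. \<bar>y \<bullet> b\<bar>) ` Basis) = \<bar>y \<bullet> b\<bar>"
    proof -
      have "Max ((\<lambda>b. \<bar>y \<bullet> b\<bar>) ` Basis) \<in> (\<lambda>b. \<bar>y \<bullet> b\<bar>) ` Basis" by (rule Max_in) auto
      then show ?thesis by (elim imageE) (rule that)
    qed
    have "norm y \<le> (\<Sum>b\<in>Basis. \<bar>y \<bullet> b\<bar>)" by (rule norm_le_l1)
    also have "\<dots> \<le> (\<Sum>b'\<in>(Basis::'y set). \<bar>y \<bullet> b\<bar>)"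
      by (intro sum_mono) (auto simp flip: b(2))
    finally have "L * norm y \<le> (L * real DIM('y)) * \<bar>y \<bullet> b\<bar>"
      using L by (simp add: mult_left_mono mult.assoc)
    then have "exp (L * norm y) \<le> exp ((L * real DIM('y)) * \<bar>y \<bullet> b\<bar>)" by simp
    also have "\<dots> \<le> (\<Sum>b\<in>Basis. exp ((L * real DIM('y)) * \<bar>y \<bullet> b\<bar>))"
      by (rule member_le_sum) (use b in auto)
    finally show ?thesis .
  qed
  have i: "integrable M (\<lambda>\<omega>. \<Sum>b\<in>Basis. exp ((L * real DIM('y)) * \<bar>grid_vec \<tau> n \<beta> \<omega> \<bullet> b\<bar>))"
    by (intro Bochner_Integration.integrable_sum) (simp add: grid_vec_inner exp_abs_lincomb[OF g])
  show 1: "integrable M (\<lambda>\<omega>. exp (L * norm (grid_vec \<tau> n \<beta> \<omega>)))"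
    by (rule Bochner_Integration.integrable_bound[OF i]) (auto intro!: AE_I2 intro: order_trans[OF b abs_ge_self])
  have "(\<integral>\<omega>. exp (L * norm (grid_vec \<tau> n \<beta> \<omega>)) \<partial>M)
    \<le> (\<integral>\<omega>. (\<Sum>b\<in>Basis. exp ((L * real DIM('y)) * \<bar>grid_vec \<tau> n \<beta> \<omega> \<bullet> b\<bar>)) \<partial>M)"
    by (intro integral_mono 1 i b)
  also have "\<dots> = (\<Sum>b\<in>Basis. \<integral>\<omega>. exp ((L * real DIM('y)) * \<bar>grid_vec \<tau> n \<beta> \<omega> \<bullet> b\<bar>) \<partial>M)"
    by (intro Bochner_Integration.integral_sum) (simp add: grid_vec_inner exp_abs_lincomb[OF g])
  also have "\<dots> \<le> (\<Sum>b\<in>Basis. 2 * exp ((L * real DIM('y))\<^sup>2 * grid_cov \<tau> n (\<beta> b) (\<beta> b) / 2))"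
    by (intro sum_mono) (simp add: grid_vec_inner exp_abs_lincomb[OF g])
  finally show "(\<integral>\<omega>. exp (L * norm (grid_vec \<tau> n \<beta> \<omega>)) \<partial>M) \<le> \<dots>" .
qed

end

section \<open>Gaussian integration by parts\<close>

lemma abs_exp_minus_1_le: "\<bar>exp q - 1\<bar> \<le> \<bar>q\<bar> * exp \<bar>q\<bar>" for q :: real
proof (cases "0 \<le> q")
  case True
  have "1 - q \<le> exp (- q)" using exp_ge_add_one_self[of "-q"] by simp
  then have "(1 - q) * exp q \<le> 1" by (simp add: exp_minus field_simps)
  then show ?thesis using True by (simp add: algebra_simps)
next
  case False
  have "1 + q \<le> exp q" by (rule exp_ge_add_one_self)
  moreover have "-q * 1 \<le> -q * exp (-q)" using False by (intro mult_left_mono) auto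
  moreover have "\<bar>q\<bar> = - q" "\<bar>exp q - 1\<bar> = 1 - exp q" using False by auto
  ultimately show ?thesis by (simp only:)
qed

lemma exp_add_le: "exp (a + b) \<le> exp (2 * a) + exp (2 * b)" for a b :: real
proof -
  have "exp (a + b) \<le> exp (2 * max a b)" by simp
  also have "\<dots> \<le> exp (2 * a) + exp (2 * b)" by (simp add: max_def)
  finally show ?thesis .
qed

context brownian
begin

lemma integrable_grid_vec:
  assumes "grid \<tau> n" "0 \<le> L" "H \<in> borel_measurable borel" "\<And>y. \<bar>H y\<bar> \<le> K * exp (L * norm y)"
  shows "integrable M (\<lambda>\<omega>. H (grid_vec \<tau> n \<beta> \<omega>) :: real)"
proof (rule Bochner_Integration.integrable_bound)
  show "integrable M (\<lambda>\<omega>. K * exp (L * norm (grid_vec \<tau> n \<beta> \<omega>)))"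
    by (intro integrable_mult_right exp_norm_grid_vec assms)
  show "(\<lambda>\<omega>. H (grid_vec \<tau> n \<beta> \<omega>)) \<in> borel_measurable M"
    by (rule measurable_compose[OF grid_vec_measurable assms(3)]) fact
qed (use assms(4) in \<open>auto intro!: AE_I2 intro: order_trans[OF _ abs_ge_self]\<close>)

text \<open>
  Differentiate the Cameron--Martin formula with \<open>h a\<close> in place of \<open>a\<close> at \<open>h = 0\<close>: the left side gives the
  derivative of \<open>H\<close>, the density on the right gives the factor \<open>lincomb \<tau> n a\<close>. The growth bounds dominate both
  difference quotients.
\<close>
lemma stein:
  fixes H :: "'y::euclidean_space \<Rightarrow> real"
  assumes g: "grid \<tau> n"
    and H': "\<And>y. (H has_derivative H' y) (at y)"
    and K: "0 \<le> K" and L: "0 \<le> L"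
    and bd: "\<And>y. \<bar>H y\<bar> \<le> K * exp (L * norm y)"
    and bd': "\<And>y v. \<bar>H' y v\<bar> \<le> K * exp (L * norm y) * norm v"
  shows "(\<integral>\<omega>. lincomb \<tau> n a \<omega> * H (grid_vec \<tau> n \<beta> \<omega>) \<partial>M)
    = (\<integral>\<omega>. H' (grid_vec \<tau> n \<beta> \<omega>) (\<Sum>b\<in>Basis. grid_cov \<tau> n a (\<beta> b) *\<^sub>R b) \<partial>M)"
proof -
  define c where "c = (\<Sum>b\<in>Basis. grid_cov \<tau> n a (\<beta> b) *\<^sub>R b)"
  define Y where "Y = grid_vec \<tau> n \<beta>"
  define G where "G = lincomb \<tau> n a"
  define V where "V = grid_cov \<tau> n a a"
  define h where "h m = 1 / (real m + 1)" for m :: nat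
  have V: "0 \<le> V" unfolding V_def by (rule grid_cov_nonneg[OF g])
  have h: "0 < h m" "h m \<le> 1" for m by (auto simp: h_def)
  have h0: "h \<longlonglongrightarrow> 0"
    unfolding h_def [abs_def] using LIMSEQ_inverse_real_of_nat by (simp add: divide_inverse add.commute)
  then have h_at: "filterlim h (at 0) sequentially"
    using h by (auto simp: filterlim_at intro!: always_eventually) (metis less_irrefl)
  have [measurable]: "Y \<in> borel_measurable M" "G \<in> borel_measurable M"
    unfolding Y_def G_def by (intro grid_vec_measurable lincomb_measurable g)+
  have contH: "continuous_on UNIV H"
    using H' by (meson continuous_at_imp_continuous_on has_derivative_continuous)
  then have H_meas [measurable]: "H \<in> borel_measurable borel"
    by (rule borel_measurable_continuous_onI)
  have iY: "integrable M (\<lambda>\<omega>. exp (L' * norm (Y \<omega>)))" if "0 \<le> L'" for L'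
    unfolding Y_def by (rule exp_norm_grid_vec[OF g that])
  have iG: "integrable M (\<lambda>\<omega>. exp (L' * \<bar>G \<omega>\<bar>))" for L'
    unfolding G_def by (rule exp_abs_lincomb[OF g])
  have iH: "integrable M (\<lambda>\<omega>. H (Y \<omega>))"
    by (rule Bochner_Integration.integrable_bound[where f="\<lambda>\<omega>. K * exp (L * norm (Y \<omega>))"])
      (use bd iY[OF L] in \<open>auto intro!: AE_I2 intro: order_trans[OF _ abs_ge_self]\<close>)
  define q where "q m \<omega> = h m * G \<omega> - (h m)\<^sup>2 * V / 2" for m \<omega>
  define A where "A m \<omega> = (H (Y \<omega> + h m *\<^sub>R c) - H (Y \<omega>)) / h m" for m \<omega>
  define E where "E m \<omega> = H (Y \<omega>) * ((exp (q m \<omega>) - 1) / h m)" for m \<omega>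
  \<comment> \<open>\<open>A\<close> and \<open>E\<close> are the difference quotients of the two sides, \<open>wA\<close> and \<open>wE\<close> their majorants.\<close>
  define wA where "wA \<omega> = K * exp (L * norm c) * norm c * exp (L * norm (Y \<omega>))" for \<omega>
  define wE where "wE \<omega> = K * exp (2 * V) * (exp ((2 * L) * norm (Y \<omega>)) + exp (4 * \<bar>G \<omega>\<bar>))" for \<omega>
  have iwA: "integrable M wA"
    unfolding wA_def[abs_def] by (intro integrable_mult_right iY L)
  have iwE: "integrable M wE"
    unfolding wE_def[abs_def] by (intro integrable_mult_right Bochner_Integration.integrable_add iY iG) (use L in simp)
  have q_meas[measurable]: "q m \<in> borel_measurable M" for m
    unfolding q_def[abs_def] by measurable
  have A_meas[measurable]: "A m \<in> borel_measurable M" and E_meas[measurable]: "E m \<in> borel_measurable M" for m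
    unfolding A_def[abs_def] E_def[abs_def] by measurable
  have A_le: "\<bar>A m \<omega>\<bar> \<le> wA \<omega>" for m \<omega>
  proof -
    have "norm (H (Y \<omega> + h m *\<^sub>R c) - H (Y \<omega>))
        \<le> K * exp (L * (norm (Y \<omega>) + norm c)) * norm (Y \<omega> + h m *\<^sub>R c - Y \<omega>)"
    proof (rule differentiable_bound)
      show "convex (cball (Y \<omega>) (norm c))" by simp
      show "(H has_derivative H' x) (at x within cball (Y \<omega>) (norm c))" for x
        using H' by (rule has_derivative_at_withinI)
      show "onorm (H' x) \<le> K * exp (L * (norm (Y \<omega>) + norm c))" if "x \<in> cball (Y \<omega>) (norm c)" for x
      proof (rule onorm_bound)
        fix v :: 'y
        have "norm x \<le> norm (Y \<omega>) + norm c"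
          using that norm_triangle_sub[of x "Y \<omega>"] by (auto simp: dist_norm norm_minus_commute)
        then have "K * exp (L * norm x) * norm v \<le> K * exp (L * (norm (Y \<omega>) + norm c)) * norm v"
          using K L by (intro mult_right_mono mult_left_mono) (auto intro: mult_left_mono)
        then show "norm (H' x v) \<le> K * exp (L * (norm (Y \<omega>) + norm c)) * norm v"
          using bd'[of x v] by simp
      qed (use K in simp)
      show "Y \<omega> + h m *\<^sub>R c \<in> cball (Y \<omega>) (norm c)"
        using h[of m] by (simp add: dist_norm mult_left_le_one_le)
    qed simp
    then show ?thesis
      using h[of m] by (simp add: A_def wA_def field_simps exp_add)
  qed
  have E_le: "\<bar>E m \<omega>\<bar> \<le> wE \<omega>" and HE_le: "\<bar>H (Y \<omega>) * exp (q m \<omega>)\<bar> \<le> wE \<omega>" for m \<omega>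
  proof -
    define S where "S = \<bar>G \<omega>\<bar> + V"
    have S: "0 \<le> S" using V by (simp add: S_def)
    have "\<bar>q m \<omega>\<bar> \<le> h m * \<bar>G \<omega>\<bar> + (h m)\<^sup>2 * V / 2"
      unfolding q_def using h[of m] V by (intro order_trans[OF abs_triangle_ineq4]) (simp add: abs_mult)
    also have "(h m)\<^sup>2 * V / 2 \<le> h m * V"
    proof -
      have "(h m)\<^sup>2 \<le> h m" using h[of m] by (simp add: power2_eq_square mult_left_le)
      then have "(h m)\<^sup>2 * V \<le> h m * V" using V by (rule mult_right_mono)
      moreover have "0 \<le> h m * V" using V h[of m] by simp
      ultimately show ?thesis by simp
    qed
    finally have qh: "\<bar>q m \<omega>\<bar> \<le> h m * S" by (simp add: S_def algebra_simps)
    have qS: "\<bar>q m \<omega>\<bar> \<le> S" using qh h[of m] S by (meson mult_left_le_one_le order_less_imp_le order_trans)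
    have "\<bar>exp (q m \<omega>) - 1\<bar> \<le> (h m * S) * exp S"
      using abs_exp_minus_1_le[of "q m \<omega>"] qh qS S h[of m]
      by (intro order_trans[OF abs_exp_minus_1_le] mult_mono) auto
    then have "\<bar>(exp (q m \<omega>) - 1) / h m\<bar> \<le> S * exp S"
      using h[of m] by (simp add: field_simps)
    also have "S \<le> exp S" using exp_ge_add_one_self[of S] by linarith
    then have "S * exp S \<le> exp S * exp S" by (rule mult_right_mono) simp
    also have "exp S * exp S = exp (2 * S)" by (simp add: mult_exp_exp)
    finally have 1: "\<bar>(exp (q m \<omega>) - 1) / h m\<bar> \<le> exp (2 * S)" .
    have w: "K * exp (L * norm (Y \<omega>)) * exp (2 * S) \<le> wE \<omega>"
    proof -
      have "K * exp (L * norm (Y \<omega>)) * exp (2 * S) = K * exp (2 * V) * exp (L * norm (Y \<omega>) + 2 * \<bar>G \<omega>\<bar>)"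
        by (simp add: S_def mult_exp_exp algebra_simps)
      also have "\<dots> \<le> wE \<omega>"
        unfolding wE_def using exp_add_le[of "L * norm (Y \<omega>)" "2 * \<bar>G \<omega>\<bar>"] K
        by (intro mult_left_mono) (auto simp: mult.assoc)
      finally show ?thesis .
    qed
    show "\<bar>E m \<omega>\<bar> \<le> wE \<omega>"
      unfolding E_def abs_mult using bd[of "Y \<omega>"] 1 K
      by (intro order_trans[OF _ w] mult_mono) auto
    have "exp (q m \<omega>) \<le> exp (2 * S)" using qS S by auto
    then show "\<bar>H (Y \<omega>) * exp (q m \<omega>)\<bar> \<le> wE \<omega>"
      unfolding abs_mult using bd[of "Y \<omega>"] K
      by (intro order_trans[OF _ w] mult_mono) auto
  qed
  have AE: "integral\<^sup>L M (A m) = integral\<^sup>L M (E m)" for m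
  proof -
    have "(\<integral>\<omega>. H (Y \<omega> + h m *\<^sub>R c) \<partial>M) = (\<integral>\<omega>. H (Y \<omega>) * exp (q m \<omega>) \<partial>M)"
      using cameron_martin[OF g H_meas, where \<beta>=\<beta> and a="\<lambda>k. h m *\<^sub>R a k"]
      by (simp add: Y_def c_def q_def G_def V_def lincomb_scaleR scaleR_sum_right power2_eq_square mult.assoc)
    moreover have iA: "integrable M (\<lambda>\<omega>. H (Y \<omega> + h m *\<^sub>R c))"
    proof -
      have "integrable M (\<lambda>\<omega>. A m \<omega> * h m + H (Y \<omega>))"
        using A_le by (intro Bochner_Integration.integrable_add iH integrable_mult_left Bochner_Integration.integrable_bound[OF iwA])
          (auto intro!: AE_I2 intro: order_trans[OF _ abs_ge_self])
      then show ?thesis using h[of m] by (simp add: A_def)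
    qed
    moreover have iE: "integrable M (\<lambda>\<omega>. H (Y \<omega>) * exp (q m \<omega>))"
      using HE_le by (intro Bochner_Integration.integrable_bound[OF iwE])
        (auto intro!: AE_I2 intro: order_trans[OF _ abs_ge_self])
    moreover have "E m = (\<lambda>\<omega>. (H (Y \<omega>) * exp (q m \<omega>) - H (Y \<omega>)) / h m)"
      by (simp add: E_def fun_eq_iff algebra_simps)
    ultimately show ?thesis
      using iH by (simp add: A_def[abs_def])
  qed
  have "(\<lambda>m. integral\<^sup>L M (A m)) \<longlonglongrightarrow> (\<integral>\<omega>. H' (Y \<omega>) c \<partial>M)"
  proof (rule integral_dominated_convergence[OF _ _ iwA])
    have lim: "(\<lambda>m. A m \<omega>) \<longlonglongrightarrow> H' (Y \<omega>) c" for \<omega>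
    proof -
      have "((\<lambda>t. H (Y \<omega> + t *\<^sub>R c)) has_derivative (\<lambda>t. H' (Y \<omega>) (t *\<^sub>R c))) (at 0)"
        using H'[of "Y \<omega>"] by (intro has_derivative_compose[of "\<lambda>t. Y \<omega> + t *\<^sub>R c" _ _ _ H])
          (auto intro!: derivative_eq_intros)
      moreover have "(\<lambda>t. H' (Y \<omega>) (t *\<^sub>R c)) = (*) (H' (Y \<omega>) c)"
        using H'[of "Y \<omega>"] by (auto simp: linear_cmul has_derivative_linear fun_eq_iff)
      ultimately have "((\<lambda>t. H (Y \<omega> + t *\<^sub>R c)) has_real_derivative H' (Y \<omega>) c) (at 0)"
        by (simp add: has_field_derivative_def)
      then have "((\<lambda>t. (H (Y \<omega> + t *\<^sub>R c) - H (Y \<omega>)) / t) \<longlongrightarrow> H' (Y \<omega>) c) (at 0)"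
        by (simp add: has_field_derivative_iff)
      from filterlim_compose[OF this h_at] show ?thesis by (simp add: A_def)
    qed
    then show "AE \<omega> in M. (\<lambda>m. A m \<omega>) \<longlonglongrightarrow> H' (Y \<omega>) c" by simp
    show "(\<lambda>\<omega>. H' (Y \<omega>) c) \<in> borel_measurable M"
      by (rule borel_measurable_LIMSEQ_real[OF lim A_meas])
  qed (use A_le in auto)
  moreover have "(\<lambda>m. integral\<^sup>L M (E m)) \<longlonglongrightarrow> (\<integral>\<omega>. H (Y \<omega>) * G \<omega> \<partial>M)"
  proof (rule integral_dominated_convergence[OF _ _ iwE])
    have lim: "(\<lambda>m. E m \<omega>) \<longlonglongrightarrow> H (Y \<omega>) * G \<omega>" for \<omega>
    proof -
      have "((\<lambda>t. exp (t * G \<omega> - t\<^sup>2 * V / 2)) has_real_derivative G \<omega>) (at 0)"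
        by (auto intro!: derivative_eq_intros)
      then have "((\<lambda>t. (exp (t * G \<omega> - t\<^sup>2 * V / 2) - 1) / t) \<longlongrightarrow> G \<omega>) (at 0)"
        by (simp add: has_field_derivative_iff)
      from filterlim_compose[OF this h_at] show ?thesis
        unfolding E_def q_def by (intro tendsto_mult tendsto_const)
    qed
    then show "AE \<omega> in M. (\<lambda>m. E m \<omega>) \<longlonglongrightarrow> H (Y \<omega>) * G \<omega>" by simp
  qed (use E_le in auto)
  ultimately have "(\<integral>\<omega>. H' (Y \<omega>) c \<partial>M) = (\<integral>\<omega>. H (Y \<omega>) * G \<omega> \<partial>M)"
    unfolding AE by (rule LIMSEQ_unique)
  then show ?thesis by (simp add: c_def Y_def G_def mult.commute)
qed

end

section \<open>Smooth functions of exponential growth\<close>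

definition dir_deriv :: "'y \<Rightarrow> ('y::euclidean_space \<Rightarrow> real) \<Rightarrow> 'y \<Rightarrow> real" where
  "dir_deriv b H y = frechet_derivative H (at y) b"

text \<open>
  A bound for a whole family of functions. The uniformity in the index \<open>i\<close> is what allows passing
  to the limit along approximations of a functional by functions of Gaussian vectors.
\<close>
definition expbound :: "('i \<Rightarrow> 'y::euclidean_space \<Rightarrow> real) \<Rightarrow> bool" where
  "expbound h \<longleftrightarrow> (\<exists>K L. 0 \<le> K \<and> 0 \<le> L \<and> (\<forall>i y. \<bar>h i y\<bar> \<le> K * exp (L * norm y)))"

text \<open>
  Families whose derivatives up to order \<open>k\<close> exist and have exponential growth, uniformly in \<open>i\<close>. This
  class is stable under multiplication by polynomials, hence under the number operator, and
  integrable against every Gaussian measure.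
\<close>
primrec expsmooth :: "nat \<Rightarrow> ('i \<Rightarrow> 'y::euclidean_space \<Rightarrow> real) \<Rightarrow> bool" where
  "expsmooth 0 h \<longleftrightarrow> expbound h \<and> (\<forall>i. h i \<in> borel_measurable borel)"
| "expsmooth (Suc k) h \<longleftrightarrow> expbound h \<and> (\<forall>i y. h i differentiable (at y)) \<and>
     (\<forall>b\<in>Basis. expsmooth k (\<lambda>i. dir_deriv b (h i)))"

lemma expboundI: "0 \<le> K \<Longrightarrow> 0 \<le> L \<Longrightarrow> (\<And>i y. \<bar>h i y\<bar> \<le> K * exp (L * norm y)) \<Longrightarrow> expbound h"
  unfolding expbound_def by blast

lemma expbound_common:
  fixes f :: "'i \<Rightarrow> 'y::euclidean_space \<Rightarrow> real" and g :: "'j \<Rightarrow> 'z::euclidean_space \<Rightarrow> real"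
  assumes "expbound f" "expbound g"
  obtains K L where "0 \<le> K" "0 \<le> L" "\<And>i y. \<bar>f i y\<bar> \<le> K * exp (L * norm y)"
    "\<And>i y. \<bar>g i y\<bar> \<le> K * exp (L * norm y)"
proof -
  obtain K1 L1 K2 L2 where *: "0 \<le> K1" "0 \<le> L1" "0 \<le> K2" "0 \<le> L2"
    "\<And>i y. \<bar>f i y\<bar> \<le> K1 * exp (L1 * norm y)" "\<And>i y. \<bar>g i y\<bar> \<le> K2 * exp (L2 * norm y)"
    using assms unfolding expbound_def by blast
  show thesis
  proof (rule that[of "K1 + K2" "L1 + L2"])
    show "\<bar>f i y\<bar> \<le> (K1 + K2) * exp ((L1 + L2) * norm y)" for i y
      by (rule order_trans[OF *(5)], rule mult_mono) (use * in \<open>auto intro!: mult_right_mono\<close>)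
    show "\<bar>g i y\<bar> \<le> (K1 + K2) * exp ((L1 + L2) * norm y)" for i y
      by (rule order_trans[OF *(6)], rule mult_mono) (use * in \<open>auto intro!: mult_right_mono\<close>)
  qed (use * in auto)
qed

lemma expbound_add: "expbound f \<Longrightarrow> expbound g \<Longrightarrow> expbound (\<lambda>i y. f i y + g i y)"
proof (erule (1) expbound_common)
  fix K L assume *: "0 \<le> K" "0 \<le> L" "\<And>i y. \<bar>f i y\<bar> \<le> K * exp (L * norm y)"
    "\<And>i y. \<bar>g i y\<bar> \<le> K * exp (L * norm y)"
  show "expbound (\<lambda>i y. f i y + g i y)"
  proof (rule expboundI[of "2 * K" L])
    fix i y
    show "\<bar>f i y + g i y\<bar> \<le> 2 * K * exp (L * norm y)"
      using *(3)[of i y] *(4)[of i y] by (simp add: mult.assoc)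
  qed (use * in auto)
qed

lemma expbound_mult: "expbound f \<Longrightarrow> expbound g \<Longrightarrow> expbound (\<lambda>i y. f i y * g i y)"
proof (erule (1) expbound_common)
  fix K L assume *: "0 \<le> K" "0 \<le> L" "\<And>i y. \<bar>f i y\<bar> \<le> K * exp (L * norm y)"
    "\<And>i y. \<bar>g i y\<bar> \<le> K * exp (L * norm y)"
  show "expbound (\<lambda>i y. f i y * g i y)"
  proof (rule expboundI[of "K * K" "2 * L"])
    fix i y
    have "\<bar>f i y * g i y\<bar> \<le> (K * exp (L * norm y)) * (K * exp (L * norm y))"
      unfolding abs_mult using * by (intro mult_mono) auto
    then show "\<bar>f i y * g i y\<bar> \<le> K * K * exp (2 * L * norm y)"
      by (simp add: mult_exp_exp mult_ac)
  qed (use * in auto)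
qed

lemma expbound_const: "(\<And>i. \<bar>c i\<bar> \<le> C) \<Longrightarrow> expbound (\<lambda>i y. c i)"
  by (rule expboundI[of "\<bar>C\<bar>" 0]) (auto intro: order_trans[OF _ abs_ge_self])

lemma expsmooth_imp_expbound: "expsmooth k h \<Longrightarrow> expbound h"
  by (cases k) auto

lemma differentiable_imp_borel:
  fixes f :: "'y::euclidean_space \<Rightarrow> real"
  assumes "\<And>y. f differentiable (at y)" shows "f \<in> borel_measurable borel"
  using assms
  by (intro borel_measurable_continuous_onI)
    (auto simp: continuous_on_eq_continuous_at differentiable_imp_continuous_within)

lemma expsmooth_measurable: "expsmooth k h \<Longrightarrow> h i \<in> borel_measurable borel"
  by (cases k) (auto intro: differentiable_imp_borel)

lemma expsmooth_SucD: "expsmooth (Suc k) h \<Longrightarrow> expsmooth k h"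
proof (induction k arbitrary: h)
  case 0
  then show ?case using expsmooth_measurable[OF 0] by simp
next
  case (Suc k)
  then show ?case using expsmooth.simps(2) by blast
qed

lemma dir_deriv_eqI: "(f has_derivative f') (at y) \<Longrightarrow> dir_deriv b f y = f' b"
  by (simp add: dir_deriv_def frechet_derivative_at[symmetric])

lemma dir_deriv_const [simp]: "dir_deriv b (\<lambda>y. c) = (\<lambda>y. 0)"
  by (simp add: dir_deriv_def fun_eq_iff frechet_derivative_const)

lemma expsmooth_const:
  fixes c :: "'i \<Rightarrow> real"
  shows "(\<And>i. \<bar>c i\<bar> \<le> C) \<Longrightarrow> expsmooth k (\<lambda>i (y::'y::euclidean_space). c i)"
proof (induction k arbitrary: c C)
  case 0
  then show ?case by (auto intro: expbound_const)
next
  case (Suc k)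
  have "expsmooth k (\<lambda>(i::'i) (y::'y). 0)" using Suc.IH[of "\<lambda>_. 0" 0] by simp
  then show ?case using Suc.prems by (auto intro: expbound_const)
qed

lemma dir_deriv_add:
  assumes "f differentiable (at y)" "g differentiable (at y)"
  shows "dir_deriv b (\<lambda>y. f y + g y) y = dir_deriv b f y + dir_deriv b g y"
  unfolding dir_deriv_eqI[OF has_derivative_add[OF assms[unfolded frechet_derivative_works]]]
  by (simp add: dir_deriv_def)

lemma dir_deriv_mult:
  assumes "f differentiable (at y)" "g differentiable (at y)"
  shows "dir_deriv b (\<lambda>y. f y * g y) y = f y * dir_deriv b g y + dir_deriv b f y * g y"
  unfolding dir_deriv_eqI[OF has_derivative_mult[OF assms[unfolded frechet_derivative_works]]]
  by (simp add: dir_deriv_def)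

lemma expsmooth_add: "expsmooth k f \<Longrightarrow> expsmooth k g \<Longrightarrow> expsmooth k (\<lambda>i y. f i y + g i y)"
proof (induction k arbitrary: f g)
  case 0
  then show ?case by (auto intro: expbound_add borel_measurable_add)
next
  case (Suc k)
  have "dir_deriv b (\<lambda>y. f i y + g i y) = (\<lambda>y. dir_deriv b (f i) y + dir_deriv b (g i) y)" for b i
    using Suc.prems by (auto simp: dir_deriv_add)
  then show ?case using Suc by (auto intro: expbound_add)
qed

lemma expsmooth_mult: "expsmooth k f \<Longrightarrow> expsmooth k g \<Longrightarrow> expsmooth k (\<lambda>i y. f i y * g i y)"
proof (induction k arbitrary: f g)
  case 0
  then show ?case by (auto intro: expbound_mult borel_measurable_times)
next
  case (Suc k)
  have "dir_deriv b (\<lambda>y. f i y * g i y) = (\<lambda>y. f i y * dir_deriv b (g i) y + dir_deriv b (f i) y * g i y)" for b i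
    using Suc.prems by (auto simp: dir_deriv_mult)
  then show ?case
    using Suc.prems expsmooth_SucD[OF Suc.prems(1)] expsmooth_SucD[OF Suc.prems(2)]
    by (auto intro!: expbound_mult expsmooth_add Suc.IH)
qed

lemma expsmooth_sum:
  "finite A \<Longrightarrow> (\<And>a. a \<in> A \<Longrightarrow> expsmooth k (f a)) \<Longrightarrow> expsmooth k (\<lambda>i y. \<Sum>a\<in>A. f a i y)"
  by (induction A rule: finite_induct) (auto intro: expsmooth_const[of _ 0] expsmooth_add)

lemma expsmooth_inner:
  assumes b: "b \<in> Basis"
  shows "expsmooth k (\<lambda>(i::'i) y. y \<bullet> b)"
proof -
  have e: "expbound (\<lambda>(i::'i) y. y \<bullet> b)"
  proof (rule expboundI[of 1 1])
    fix y
    have "\<bar>y \<bullet> b\<bar> \<le> norm y" using b by (rule Basis_le_norm)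
    also have "\<dots> \<le> exp (norm y)" using exp_ge_add_one_self[of "norm y"] by linarith
    finally show "\<bar>y \<bullet> b\<bar> \<le> 1 * exp (1 * norm y)" by simp
  qed auto
  have d: "dir_deriv b' (\<lambda>y. y \<bullet> b) = (\<lambda>y. b' \<bullet> b)" for b'
    by (rule ext, rule dir_deriv_eqI[OF has_derivative_inner_left[OF has_derivative_ident]])
  show ?thesis
  proof (cases k)
    case (Suc k')
    have "(\<lambda>y. y \<bullet> b) differentiable (at y)" for y
      by (auto intro!: derivative_intros)
    then show ?thesis using e by (auto simp: Suc d intro!: expsmooth_const[of _ "\<bar>_ \<bullet> b\<bar>"])
  qed (use e in auto)
qed

lemma frechet_eq_sum_dir_deriv:
  fixes H :: "'y::euclidean_space \<Rightarrow> real"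
  assumes "H differentiable (at y)"
  shows "frechet_derivative H (at y) v = (\<Sum>b\<in>Basis. (v \<bullet> b) * dir_deriv b H y)"
proof -
  interpret linear "frechet_derivative H (at y)"
    by (rule linear_frechet_derivative[OF assms])
  have "frechet_derivative H (at y) v = frechet_derivative H (at y) (\<Sum>b\<in>Basis. (v \<bullet> b) *\<^sub>R b)"
    by (simp add: euclidean_representation)
  also have "\<dots> = (\<Sum>b\<in>Basis. (v \<bullet> b) * dir_deriv b H y)"
    by (simp add: sum scaleR dir_deriv_def)
  finally show ?thesis .
qed

lemma frechet_expbound:
  fixes h :: "'i \<Rightarrow> 'y::euclidean_space \<Rightarrow> real"
  assumes h: "expsmooth (Suc k) h"
  obtains K L where "0 \<le> K" "0 \<le> L"
    "\<And>i y v. \<bar>frechet_derivative (h i) (at y) v\<bar> \<le> K * exp (L * norm y) * norm v"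
proof -
  have "\<forall>b\<in>Basis. \<exists>K L. 0 \<le> K \<and> 0 \<le> L \<and> (\<forall>i y. \<bar>dir_deriv b (h i) y\<bar> \<le> K * exp (L * norm y))"
    using h expsmooth_imp_expbound unfolding expbound_def by fastforce
  then obtain K L where KL: "\<And>b. b \<in> Basis \<Longrightarrow> 0 \<le> K b" "\<And>b. b \<in> Basis \<Longrightarrow> 0 \<le> L b"
    "\<And>b i y. b \<in> Basis \<Longrightarrow> \<bar>dir_deriv b (h i) y\<bar> \<le> K b * exp (L b * norm y)"
    by metis
  show thesis
  proof (rule that[of "\<Sum>b\<in>Basis. K b" "\<Sum>b\<in>Basis. L b"])
    fix i and y v :: 'y
    have "\<bar>frechet_derivative (h i) (at y) v\<bar> \<le> (\<Sum>b\<in>Basis. \<bar>(v \<bullet> b) * dir_deriv b (h i) y\<bar>)"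
      using h by (subst frechet_eq_sum_dir_deriv) (auto intro: sum_abs)
    also have "\<dots> \<le> (\<Sum>b\<in>Basis. norm v * (K b * exp ((\<Sum>b\<in>Basis. L b) * norm y)))"
    proof (intro sum_mono)
      fix b :: 'y assume b: "b \<in> Basis"
      have "L b \<le> (\<Sum>b\<in>Basis. L b)" using b KL(2) by (intro member_le_sum) auto
      then have "K b * exp (L b * norm y) \<le> K b * exp ((\<Sum>b\<in>Basis. L b) * norm y)"
        using KL(1)[OF b] by (intro mult_left_mono) (auto intro: mult_right_mono)
      then show "\<bar>(v \<bullet> b) * dir_deriv b (h i) y\<bar> \<le> norm v * (K b * exp ((\<Sum>b\<in>Basis. L b) * norm y))"
        unfolding abs_mult using KL(3)[OF b, of i y] Basis_le_norm[OF b, of v]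
        by (intro mult_mono) auto
    qed
    also have "\<dots> = (\<Sum>b\<in>Basis. K b) * exp ((\<Sum>b\<in>Basis. L b) * norm y) * norm v"
      by (simp add: sum_distrib_left sum_distrib_right mult_ac)
    finally show "\<bar>frechet_derivative (h i) (at y) v\<bar>
      \<le> (\<Sum>b\<in>Basis. K b) * exp ((\<Sum>b\<in>Basis. L b) * norm y) * norm v" .
  qed (auto intro!: sum_nonneg KL)
qed

lemma norm_fst: "norm (fst p) \<le> norm p" and norm_snd: "norm (snd p) \<le> norm p"
  by (cases p, simp add: norm_fst_le) (cases p, simp add: norm_snd_le)

lemma sum_Basis_prod:
  fixes f :: "'a::euclidean_space \<times> 'b::euclidean_space \<Rightarrow> 'c::comm_monoid_add"
  shows "sum f Basis = (\<Sum>u\<in>Basis. f (u, 0)) + (\<Sum>v\<in>Basis. f (0, v))"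
proof -
  have "inj_on (\<lambda>u. (u::'a, 0::'b)) Basis" "inj_on (\<lambda>u. (0::'a, u::'b)) Basis"
    by (auto intro!: inj_onI Pair_inject)
  then show ?thesis
    unfolding Basis_prod_def by (subst sum.union_disjoint) (auto simp: sum.reindex)
qed

lemma DERIV_hermite: "(hermite n has_real_derivative real n * hermite (n - 1) x) (at x)"
proof (induction n rule: induct_nat_012)
  case (ge2 n)
  have *: "hermite (Suc (Suc n)) = (\<lambda>x. x * hermite (Suc n) x - real (Suc n) * hermite n x)" by auto
  have "((\<lambda>x. x * hermite (Suc n) x - real (Suc n) * hermite n x) has_real_derivative
     (1 * hermite (Suc n) x + (real (Suc n) * hermite (Suc n - 1) x) * x
        - real (Suc n) * (real n * hermite (n - 1) x))) (at x)"
    by (intro DERIV_diff DERIV_mult DERIV_ident DERIV_cmult ge2.IH)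
  moreover have "1 * hermite (Suc n) x + (real (Suc n) * hermite (Suc n - 1) x) * x
        - real (Suc n) * (real n * hermite (n - 1) x) = real (Suc (Suc n)) * hermite (Suc (Suc n) - 1) x"
    by (cases n) (auto simp: algebra_simps)
  ultimately show ?case unfolding * by simp
qed (auto intro!: derivative_eq_intros simp: fun_eq_iff)

lemma expbound_hermite: "expbound (\<lambda>i::unit. hermite n)"
proof (induction n rule: induct_nat_012)
  case 0
  show ?case using expbound_const[of "\<lambda>_. 1" 1] by (simp add: fun_eq_iff)
next
  case 1
  show ?case using expsmooth_imp_expbound[OF expsmooth_inner[of "1::real"]] by simp
next
  case (ge2 n)
  have x: "expbound (\<lambda>(i::unit) x::real. x)"
    using expsmooth_imp_expbound[OF expsmooth_inner[of "1::real"]] by simp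
  have "expbound (\<lambda>(i::unit) x. x * hermite (Suc n) x + (- real (Suc n)) * hermite n x)"
    by (intro expbound_add expbound_mult x ge2.IH expbound_const[of _ "real (Suc n)"]) simp
  moreover have "hermite (Suc (Suc n)) = (\<lambda>x. x * hermite (Suc n) x + (- real (Suc n)) * hermite n x)"
    by (auto simp: fun_eq_iff algebra_simps)
  ultimately show ?case by simp
qed

context brownian
begin

lemma grid_vec_pair:
  fixes \<beta> :: "'y::euclidean_space \<Rightarrow> nat \<Rightarrow> 'v"
  shows  "grid_vec \<tau> n (\<lambda>(s, y). if y = 0 then a else \<beta> y) \<omega> = (lincomb \<tau> n a \<omega>, grid_vec \<tau> n \<beta> \<omega>)"
proof -
  have "(\<Sum>v\<in>Basis. lincomb \<tau> n (if v = 0 then a else \<beta> v) \<omega> *\<^sub>R ((0::real), v))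
    = (\<Sum>v\<in>Basis. (0, lincomb \<tau> n (\<beta> v) \<omega> *\<^sub>R v))"
    by (intro sum.cong) auto
  then show ?thesis
    unfolding grid_vec_def by (simp add: sum_Basis_prod sum_prod)
qed

lemma integrable_product_grid_vec:
  fixes h :: "'y::euclidean_space \<Rightarrow> real"
  assumes g: "grid \<tau> n" and P: "expbound (\<lambda>i::unit. P)" "P \<in> borel_measurable borel"
    and h: "expbound (\<lambda>i::unit. h)" "h \<in> borel_measurable borel"
  shows "integrable M (\<lambda>\<omega>. P (lincomb \<tau> n a \<omega>) * h (grid_vec \<tau> n \<beta> \<omega>))"
proof -
  obtain K L where KL: "0 \<le> K" "0 \<le> L" "\<And>x. \<bar>P x\<bar> \<le> K * exp (L * norm x)" "\<And>y. \<bar>h y\<bar> \<le> K * exp (L * norm y)"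
    using expbound_common[OF P(1) h(1)] by metis
  note P(2)[measurable] h(2)[measurable]
  have "integrable M (\<lambda>\<omega>. (\<lambda>p. P (fst p) * h (snd p))
    (grid_vec \<tau> n (\<lambda>(s::real, y). if y = 0 then a else \<beta> y) \<omega>))"
  proof (rule integrable_grid_vec[OF g, where L="2 * L" and K="K * K"])
    fix p :: "real \<times> 'y"
    have "\<bar>P (fst p)\<bar> \<le> K * exp (L * norm p)"
      by (rule order_trans[OF KL(3)]) (use KL norm_fst[of p] in \<open>auto intro!: mult_left_mono\<close>)
    moreover have "\<bar>h (snd p)\<bar> \<le> K * exp (L * norm p)"
      by (rule order_trans[OF KL(4)]) (use KL norm_snd[of p] in \<open>auto intro!: mult_left_mono\<close>)
    ultimately have "\<bar>P (fst p) * h (snd p)\<bar> \<le> (K * exp (L * norm p)) * (K * exp (L * norm p))"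
      unfolding abs_mult using KL by (intro mult_mono) auto
    then show "\<bar>P (fst p) * h (snd p)\<bar> \<le> K * K * exp (2 * L * norm p)"
      by (simp add: mult_exp_exp mult_ac)
  qed (use KL in \<open>auto simp: borel_prod[symmetric]\<close>)
  then show ?thesis by (simp add: grid_vec_pair)
qed

text \<open>
  Integration by parts against a product of a function of one Gaussian variable and a function of a
  Gaussian vector: both are functions of the joint vector, to which \<open>stein\<close> applies.
\<close>
lemma stein_product:
  fixes \<beta> :: "'y::euclidean_space \<Rightarrow> nat \<Rightarrow> 'v" and H :: "'y \<Rightarrow> real"
  assumes g: "grid \<tau> n"
    and P: "expbound (\<lambda>i::unit. P)" "expbound (\<lambda>i::unit. P')" "P' \<in> borel_measurable borel"
      "\<And>x. (P has_real_derivative P' x) (at x)"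
    and H: "expsmooth (Suc 0) (\<lambda>i::unit. H)"
  shows "(\<integral>\<omega>. lincomb \<tau> n a' \<omega> * (P (lincomb \<tau> n a \<omega>) * H (grid_vec \<tau> n \<beta> \<omega>)) \<partial>M)
    = grid_cov \<tau> n a' a * (\<integral>\<omega>. P' (lincomb \<tau> n a \<omega>) * H (grid_vec \<tau> n \<beta> \<omega>) \<partial>M)
    + (\<Sum>b\<in>Basis. grid_cov \<tau> n a' (\<beta> b) * (\<integral>\<omega>. P (lincomb \<tau> n a \<omega>) * dir_deriv b H (grid_vec \<tau> n \<beta> \<omega>) \<partial>M))"
proof -
  \<comment> \<open>coefficients of the joint vector: \<open>a\<close> for the first component, \<open>\<beta>\<close> for the others\<close>
  define \<beta>' where "\<beta>' = (\<lambda>(s::real, y). if y = 0 then a else \<beta> y)"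
  define \<Phi> where "\<Phi> p = P (fst p) * H (snd p)" for p :: "real \<times> 'y"
  define \<Phi>' where "\<Phi>' p q = P (fst p) * frechet_derivative H (at (snd p)) (snd q) + P' (fst p) * fst q * H (snd p)"
    for p q :: "real \<times> 'y"
  have diffH: "H differentiable (at y)" for y using H by auto
  obtain K1 L1 where 1: "0 \<le> K1" "0 \<le> L1" "\<And>x. \<bar>P x\<bar> \<le> K1 * exp (L1 * norm x)" "\<And>x. \<bar>P' x\<bar> \<le> K1 * exp (L1 * norm x)"
    using expbound_common[OF P(1,2)] by metis
  obtain K2 L2 where 2: "0 \<le> K2" "0 \<le> L2" "\<And>y. \<bar>H y\<bar> \<le> K2 * exp (L2 * norm y)"
    using expsmooth_imp_expbound[OF H] unfolding expbound_def by auto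
  obtain K3 L3 where 3: "0 \<le> K3" "0 \<le> L3"
    "\<And>y v. \<bar>frechet_derivative H (at y) v\<bar> \<le> K3 * exp (L3 * norm y) * norm v"
    using frechet_expbound[OF H] by metis
  define K where "K = K1 * K2 + K1 * K3"
  define L where "L = L1 + (L2 + L3)"
  have KL: "0 \<le> K" "0 \<le> L" using 1 2 3 by (auto simp: K_def L_def)
  have mm: "x * y \<le> (K1 * c) * exp (L * norm p)"
    if "0 \<le> x" "0 \<le> y" "x \<le> K1 * exp (L1 * norm (fst p))" "y \<le> c * exp (l * norm (snd p))" "0 \<le> c" "0 \<le> l" "l \<le> L2 + L3"
    for x y c l and p :: "real \<times> 'y"
  proof -
    have "x * y \<le> (K1 * exp (L1 * norm (fst p))) * (c * exp (l * norm (snd p)))"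
      using that 1 by (intro mult_mono) auto
    also have "\<dots> = (K1 * c) * exp (L1 * norm (fst p) + l * norm (snd p))"
      by (simp add: exp_add mult_ac)
    also have "L1 * norm (fst p) + l * norm (snd p) \<le> L1 * norm p + (L2 + L3) * norm p"
      using that 1 2 3 norm_fst[of p] norm_snd[of p] by (intro add_mono mult_mono) auto
    then have "(K1 * c) * exp (L1 * norm (fst p) + l * norm (snd p)) \<le> (K1 * c) * exp (L * norm p)"
      using that 1 by (intro mult_left_mono) (auto simp: L_def algebra_simps)
    finally show ?thesis .
  qed
  have "(\<integral>\<omega>. lincomb \<tau> n a' \<omega> * \<Phi> (grid_vec \<tau> n \<beta>' \<omega>) \<partial>M)
    = (\<integral>\<omega>. \<Phi>' (grid_vec \<tau> n \<beta>' \<omega>) (\<Sum>b\<in>Basis. grid_cov \<tau> n a' (\<beta>' b) *\<^sub>R b) \<partial>M)"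
  proof (rule stein[OF g _ KL])
    fix p :: "real \<times> 'y"
    have "((\<lambda>p. P (fst p)) has_derivative (\<lambda>q. P' (fst p) * fst q)) (at p)"
      by (rule has_derivative_compose[where g=P, OF has_derivative_fst[OF has_derivative_ident]])
        (use P(4) in \<open>simp add: has_field_derivative_def\<close>)
    moreover have "((\<lambda>p. H (snd p)) has_derivative (\<lambda>q. frechet_derivative H (at (snd p)) (snd q))) (at p)"
      by (rule has_derivative_compose[where g=H, OF has_derivative_snd[OF has_derivative_ident]])
        (use diffH in \<open>simp add: frechet_derivative_works\<close>)
    ultimately show "(\<Phi> has_derivative \<Phi>' p) (at p)"
      unfolding \<Phi>_def[abs_def] \<Phi>'_def[abs_def] by (rule has_derivative_mult)
    have "\<bar>\<Phi> p\<bar> \<le> (K1 * K2) * exp (L * norm p)"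
      unfolding \<Phi>_def abs_mult by (rule mm[of _ _ p K2 L2]) (use 1 2 3 in auto)
    also have "\<dots> \<le> K * exp (L * norm p)"
      using 1 3 by (intro mult_right_mono) (auto simp: K_def)
    finally show "\<bar>\<Phi> p\<bar> \<le> K * exp (L * norm p)" .
    fix q :: "real \<times> 'y"
    have "\<bar>P (fst p)\<bar> * (K3 * exp (L3 * norm (snd p))) \<le> K1 * K3 * exp (L * norm p)"
      by (rule mm[of _ _ p K3 L3]) (use 1 2 3 in auto)
    then have "\<bar>P (fst p)\<bar> * (K3 * exp (L3 * norm (snd p))) * norm q \<le> K1 * K3 * exp (L * norm p) * norm q"
      by (rule mult_right_mono) simp
    moreover have "\<bar>P (fst p) * frechet_derivative H (at (snd p)) (snd q)\<bar>
        \<le> \<bar>P (fst p)\<bar> * (K3 * exp (L3 * norm (snd p))) * norm q"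
    proof -
      have "\<bar>frechet_derivative H (at (snd p)) (snd q)\<bar> \<le> K3 * exp (L3 * norm (snd p)) * norm q"
        using 3(1) norm_snd[of q] by (intro order_trans[OF 3(3)] mult_left_mono) auto
      then show ?thesis by (simp add: abs_mult mult.assoc mult_left_mono)
    qed
    moreover have "\<bar>P' (fst p) * fst q * H (snd p)\<bar> \<le> K1 * K2 * exp (L * norm p) * norm q"
    proof -
      have "\<bar>P' (fst p)\<bar> * \<bar>H (snd p)\<bar> \<le> K1 * K2 * exp (L * norm p)"
        by (rule mm[of _ _ p K2 L2]) (use 1 2 3 in auto)
      then have "(\<bar>P' (fst p)\<bar> * \<bar>H (snd p)\<bar>) * \<bar>fst q\<bar> \<le> K1 * K2 * exp (L * norm p) * norm q"
        by (rule mult_mono) (use norm_fst[of q] 1 2 in auto)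
      then show ?thesis by (simp add: abs_mult mult_ac)
    qed
    ultimately show "\<bar>\<Phi>' p q\<bar> \<le> K * exp (L * norm p) * norm q"
      unfolding \<Phi>'_def K_def by (simp add: distrib_right)
  qed
  moreover have "(\<Sum>b\<in>Basis. grid_cov \<tau> n a' (\<beta>' b) *\<^sub>R b)
      = (grid_cov \<tau> n a' a, \<Sum>b\<in>Basis. grid_cov \<tau> n a' (\<beta> b) *\<^sub>R b)"
  proof -
    have "(\<Sum>v\<in>Basis. grid_cov \<tau> n a' (if v = 0 then a else \<beta> v) *\<^sub>R ((0::real), v))
      = (\<Sum>v\<in>Basis. (0, grid_cov \<tau> n a' (\<beta> v) *\<^sub>R v))"
      by (intro sum.cong) auto
    then show ?thesis by (simp add: sum_Basis_prod sum_prod \<beta>'_def)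
  qed
  moreover have "frechet_derivative H (at y) (\<Sum>b\<in>Basis. grid_cov \<tau> n a' (\<beta> b) *\<^sub>R b)
    = (\<Sum>b\<in>Basis. grid_cov \<tau> n a' (\<beta> b) * dir_deriv b H y)" for y
  proof -
    interpret linear "frechet_derivative H (at y)"
      by (rule linear_frechet_derivative[OF diffH])
    show ?thesis by (simp add: sum scaleR dir_deriv_def)
  qed
  ultimately have "(\<integral>\<omega>. lincomb \<tau> n a' \<omega> * (P (lincomb \<tau> n a \<omega>) * H (grid_vec \<tau> n \<beta> \<omega>)) \<partial>M)
    = (\<integral>\<omega>. (\<Sum>b\<in>Basis. grid_cov \<tau> n a' (\<beta> b) * (P (lincomb \<tau> n a \<omega>) * dir_deriv b H (grid_vec \<tau> n \<beta> \<omega>)))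
        + grid_cov \<tau> n a' a * (P' (lincomb \<tau> n a \<omega>) * H (grid_vec \<tau> n \<beta> \<omega>)) \<partial>M)"
    by (simp add: \<beta>'_def grid_vec_pair \<Phi>_def \<Phi>'_def sum_distrib_left mult_ac)
  also have "\<dots> = (\<Sum>b\<in>Basis. grid_cov \<tau> n a' (\<beta> b) * (\<integral>\<omega>. P (lincomb \<tau> n a \<omega>) * dir_deriv b H (grid_vec \<tau> n \<beta> \<omega>) \<partial>M))
    + grid_cov \<tau> n a' a * (\<integral>\<omega>. P' (lincomb \<tau> n a \<omega>) * H (grid_vec \<tau> n \<beta> \<omega>) \<partial>M)"
  proof -
    have Pm: "P \<in> borel_measurable borel"
      using P(4) by (intro borel_measurable_continuous_onI)
        (meson DERIV_isCont continuous_at_imp_continuous_on)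
    have "integrable M (\<lambda>\<omega>. P (lincomb \<tau> n a \<omega>) * dir_deriv b H (grid_vec \<tau> n \<beta> \<omega>))" if "b \<in> Basis" for b
      using H that by (intro integrable_product_grid_vec g P Pm) auto
    moreover have "integrable M (\<lambda>\<omega>. P' (lincomb \<tau> n a \<omega>) * H (grid_vec \<tau> n \<beta> \<omega>))"
      using expsmooth_imp_expbound[OF H] expsmooth_measurable[OF H] by (intro integrable_product_grid_vec g P)
    ultimately show ?thesis
      by (subst Bochner_Integration.integral_add)
        (auto intro!: Bochner_Integration.integrable_sum integrable_mult_right)
  qed
  finally show ?thesis by simp
qed

end

section \<open>The number operator on functions of Gaussian vectors\<close>

text \<open>
  The generator of the Ornstein--Uhlenbeck semigroup, with the opposite sign, acting on functions of a
  centred Gaussian vector with covariance \<open>C\<close>.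
\<close>
definition number_op :: "('y \<Rightarrow> 'y \<Rightarrow> real) \<Rightarrow> ('y::euclidean_space \<Rightarrow> real) \<Rightarrow> 'y \<Rightarrow> real" where
  "number_op C H y = (\<Sum>b\<in>Basis. (y \<bullet> b) * dir_deriv b H y) - (\<Sum>b\<in>Basis. \<Sum>b'\<in>Basis. C b b' * dir_deriv b' (dir_deriv b H) y)"

lemma expsmooth_number_op:
  fixes h :: "'i \<Rightarrow> 'y::euclidean_space \<Rightarrow> real"
  assumes h: "expsmooth (Suc (Suc k)) h" and C: "\<And>i b b'. b \<in> Basis \<Longrightarrow> b' \<in> Basis \<Longrightarrow> \<bar>C i b b'\<bar> \<le> \<kappa>"
  shows "expsmooth k (\<lambda>i. number_op (C i) (h i))"
proof -
  have 1: "expsmooth k (\<lambda>i y. (y \<bullet> b) * dir_deriv b (h i) y)" if "b \<in> Basis" for b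
  proof (rule expsmooth_mult[OF expsmooth_inner[OF that]])
    show "expsmooth k (\<lambda>i. dir_deriv b (h i))" by (rule expsmooth_SucD) (use h that in simp)
  qed
  have 2: "expsmooth k (\<lambda>i y. - C i b b' * dir_deriv b' (dir_deriv b (h i)) y)" if "b \<in> Basis" "b' \<in> Basis" for b b'
  proof (rule expsmooth_mult)
    show "expsmooth k (\<lambda>i y. - C i b b')"
      by (rule expsmooth_const[of _ \<kappa>]) (use C that in simp)
    show "expsmooth k (\<lambda>i. dir_deriv b' (dir_deriv b (h i)))"
      using h that by simp
  qed
  have "expsmooth k (\<lambda>i y. (\<Sum>b\<in>Basis. (y \<bullet> b) * dir_deriv b (h i) y)
    + (\<Sum>b\<in>Basis. \<Sum>b'\<in>Basis. - C i b b' * dir_deriv b' (dir_deriv b (h i)) y))"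
    by (rule expsmooth_add[OF expsmooth_sum[OF finite_Basis 1]
        expsmooth_sum[OF finite_Basis expsmooth_sum[OF finite_Basis 2]]])
  then show ?thesis unfolding number_op_def[abs_def] by (simp add: sum_negf)
qed

lemma expbound_unit: "expbound h \<Longrightarrow> expbound (\<lambda>_::'j. h i)"
  unfolding expbound_def by blast

lemma expsmooth_unit: "expsmooth k h \<Longrightarrow> expsmooth k (\<lambda>_::'j. h i)"
proof (induction k arbitrary: h)
  case 0
  then show ?case using expbound_unit[of h i] by simp
next
  case (Suc k)
  then have "expsmooth k (\<lambda>_::'j. dir_deriv b (h i))" if "b \<in> Basis" for b
    using that by (intro Suc.IH[of "\<lambda>i. dir_deriv b (h i)"]) simp
  then show ?case using expbound_unit[of h i] Suc.prems by simp
qed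

lemma hermite_Suc: "hermite (Suc j) x = x * hermite j x - real j * hermite (j - 1) x"
  by (cases j) auto

lemma hermite_measurable [measurable]: "hermite n \<in> borel_measurable borel"
  by (intro borel_measurable_continuous_onI continuous_at_imp_continuous_on ballI
      DERIV_isCont[OF DERIV_hermite])

lemma expbound_hermite': "expbound (\<lambda>i::unit. \<lambda>x. real n * hermite (n - 1) x)"
  by (rule expbound_mult[OF expbound_const[of _ "real n"] expbound_hermite]) simp

lemma expbound_real_ident: "expbound (\<lambda>(i::unit) x::real. x)"
  using expsmooth_imp_expbound[OF expsmooth_inner[of "1::real"]] by simp

context brownian
begin

text \<open>
  Hermite polynomials are eigenfunctions of the number operator, which is symmetric. Both sides are
  equal to the sum over \<open>b\<close> of the covariances of the two Gaussian arguments times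
  \<open>m E[hermite (m - 1) dir_deriv b H]\<close>: integrate by parts in the factors \<open>y \<bullet> b\<close> on the right and, by the recursion of
  the Hermite polynomials, in one factor \<open>lincomb \<tau> n a\<close> on the left.
\<close>
lemma hermite_number_operator:
  fixes \<beta> :: "'y::euclidean_space \<Rightarrow> nat \<Rightarrow> 'v" and H :: "'y \<Rightarrow> real"
  assumes g: "grid \<tau> n" and a: "grid_cov \<tau> n a a = 1" and H: "expsmooth (Suc (Suc 0)) (\<lambda>i::unit. H)"
  shows "real m * (\<integral>\<omega>. hermite m (lincomb \<tau> n a \<omega>) * H (grid_vec \<tau> n \<beta> \<omega>) \<partial>M)
    = (\<integral>\<omega>. hermite m (lincomb \<tau> n a \<omega>) * number_op (\<lambda>b b'. grid_cov \<tau> n (\<beta> b) (\<beta> b')) H (grid_vec \<tau> n \<beta> \<omega>) \<partial>M)"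
proof -
  define G where "G = lincomb \<tau> n a"
  define Y where "Y = grid_vec \<tau> n \<beta>"
  define C where "C b b' = grid_cov \<tau> n (\<beta> b) (\<beta> b')" for b b'
  have int: "integrable M (\<lambda>\<omega>. P (G \<omega>) * h (Y \<omega>))"
    if "expbound (\<lambda>i::unit. P)" "P \<in> borel_measurable borel" "expsmooth k (\<lambda>i::unit. h)" for P h k
    unfolding G_def Y_def using that
    by (intro integrable_product_grid_vec g expsmooth_imp_expbound[OF that(3)] expsmooth_measurable[OF that(3)]) auto
  have H1: "expsmooth (Suc 0) (\<lambda>i::unit. H)" by (rule expsmooth_SucD[OF H])
  have dH: "expsmooth (Suc 0) (\<lambda>i::unit. dir_deriv b H)" if "b \<in> Basis" for b
    using H that by simp
  have ddH: "expsmooth 0 (\<lambda>i::unit. dir_deriv b' (dir_deriv b H))" if "b \<in> Basis" "b' \<in> Basis" for b b'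
    using H that by simp
  have A: "(\<integral>\<omega>. hermite m (G \<omega>) * ((Y \<omega> \<bullet> b) * dir_deriv b H (Y \<omega>)) \<partial>M)
     = grid_cov \<tau> n (\<beta> b) a * (\<integral>\<omega>. real m * hermite (m - 1) (G \<omega>) * dir_deriv b H (Y \<omega>) \<partial>M)
     + (\<Sum>b'\<in>Basis. C b b' * (\<integral>\<omega>. hermite m (G \<omega>) * dir_deriv b' (dir_deriv b H) (Y \<omega>) \<partial>M))" if b: "b \<in> Basis" for b
    using stein_product[OF g expbound_hermite expbound_hermite' _ DERIV_hermite dH[OF b], where a'="\<beta> b" and a=a and \<beta>=\<beta>]
    by (simp add: G_def Y_def C_def grid_vec_inner[OF b] mult_ac)
  have i1: "integrable M (\<lambda>\<omega>. hermite m (G \<omega>) * ((Y \<omega> \<bullet> b) * dir_deriv b H (Y \<omega>)))" if "b \<in> Basis" for b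
    using that by (intro int[of "hermite m" "Suc 0" "\<lambda>y. (y \<bullet> b) * dir_deriv b H y"] expbound_hermite hermite_measurable
      expsmooth_mult expsmooth_inner dH)
  have i2: "integrable M (\<lambda>\<omega>. hermite m (G \<omega>) * dir_deriv b' (dir_deriv b H) (Y \<omega>))" if "b \<in> Basis" "b' \<in> Basis" for b b'
    using that by (intro int[of "hermite m" 0 "dir_deriv b' (dir_deriv b H)"] expbound_hermite hermite_measurable ddH)
  have "(\<integral>\<omega>. hermite m (G \<omega>) * number_op C H (Y \<omega>) \<partial>M)
    = (\<integral>\<omega>. (\<Sum>b\<in>Basis. hermite m (G \<omega>) * ((Y \<omega> \<bullet> b) * dir_deriv b H (Y \<omega>)))
        - (\<Sum>b\<in>Basis. \<Sum>b'\<in>Basis. C b b' * (hermite m (G \<omega>) * dir_deriv b' (dir_deriv b H) (Y \<omega>))) \<partial>M)"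
    by (simp add: number_op_def right_diff_distrib sum_distrib_left mult_ac)
  also have "\<dots> = (\<Sum>b\<in>Basis. \<integral>\<omega>. hermite m (G \<omega>) * ((Y \<omega> \<bullet> b) * dir_deriv b H (Y \<omega>)) \<partial>M)
        - (\<Sum>b\<in>Basis. \<Sum>b'\<in>Basis. C b b' * (\<integral>\<omega>. hermite m (G \<omega>) * dir_deriv b' (dir_deriv b H) (Y \<omega>) \<partial>M))"
    using i1 i2 by (subst Bochner_Integration.integral_diff)
      (auto intro!: Bochner_Integration.integrable_sum simp: Bochner_Integration.integral_sum)
  also have "\<dots> = (\<Sum>b\<in>Basis. grid_cov \<tau> n a (\<beta> b) * (\<integral>\<omega>. real m * hermite (m - 1) (G \<omega>) * dir_deriv b H (Y \<omega>) \<partial>M))"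
    by (simp add: A sum.distrib grid_cov_commute[of _ _ a])
  finally have N: "(\<integral>\<omega>. hermite m (G \<omega>) * number_op C H (Y \<omega>) \<partial>M)
    = (\<Sum>b\<in>Basis. grid_cov \<tau> n a (\<beta> b) * (\<integral>\<omega>. real m * hermite (m - 1) (G \<omega>) * dir_deriv b H (Y \<omega>) \<partial>M))" .
  have "real m * (\<integral>\<omega>. hermite m (G \<omega>) * H (Y \<omega>) \<partial>M)
    = (\<Sum>b\<in>Basis. grid_cov \<tau> n a (\<beta> b) * (\<integral>\<omega>. real m * hermite (m - 1) (G \<omega>) * dir_deriv b H (Y \<omega>) \<partial>M))"
  proof (cases m)
    case (Suc j)
    have j1: "integrable M (\<lambda>\<omega>. G \<omega> * (hermite j (G \<omega>) * H (Y \<omega>)))"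
      using int[OF expbound_mult[OF expbound_real_ident expbound_hermite] _ H, of j] by (simp add: mult.assoc)
    have j2: "integrable M (\<lambda>\<omega>. real j * hermite (j - 1) (G \<omega>) * H (Y \<omega>))"
      by (intro int[OF expbound_hermite' _ H]) simp
    have "(\<integral>\<omega>. hermite (Suc j) (G \<omega>) * H (Y \<omega>) \<partial>M)
      = (\<integral>\<omega>. G \<omega> * (hermite j (G \<omega>) * H (Y \<omega>)) - real j * hermite (j - 1) (G \<omega>) * H (Y \<omega>) \<partial>M)"
      by (simp add: hermite_Suc left_diff_distrib mult.assoc del: hermite.simps)
    also have "\<dots> = (\<integral>\<omega>. G \<omega> * (hermite j (G \<omega>) * H (Y \<omega>)) \<partial>M) - (\<integral>\<omega>. real j * hermite (j - 1) (G \<omega>) * H (Y \<omega>) \<partial>M)"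
      by (rule Bochner_Integration.integral_diff[OF j1 j2])
    also have "\<dots> = (\<Sum>b\<in>Basis. grid_cov \<tau> n a (\<beta> b) * (\<integral>\<omega>. hermite j (G \<omega>) * dir_deriv b H (Y \<omega>) \<partial>M))"
      using stein_product[OF g expbound_hermite expbound_hermite' _ DERIV_hermite H1, where a'=a and a=a and \<beta>=\<beta>]
      by (simp add: G_def Y_def a)
    finally have e: "(\<integral>\<omega>. hermite (Suc j) (G \<omega>) * H (Y \<omega>) \<partial>M)
      = (\<Sum>b\<in>Basis. grid_cov \<tau> n a (\<beta> b) * (\<integral>\<omega>. hermite j (G \<omega>) * dir_deriv b H (Y \<omega>) \<partial>M))" .
    have c: "(\<integral>\<omega>. real (Suc j) * hermite j (G \<omega>) * dir_deriv b H (Y \<omega>) \<partial>M)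
      = real (Suc j) * (\<integral>\<omega>. hermite j (G \<omega>) * dir_deriv b H (Y \<omega>) \<partial>M)" for b
      unfolding mult.assoc by simp
    show ?thesis
      unfolding Suc diff_Suc_1 c e sum_distrib_left by (rule sum.cong) (auto simp: mult_ac)
  qed simp
  with N show ?thesis by (simp add: G_def Y_def C_def[abs_def])
qed

lemma covariance_lincomb:
  assumes g: "grid \<tau> n"
  shows "(\<integral>\<omega>. lincomb \<tau> n a \<omega> * lincomb \<tau> n b \<omega> \<partial>M) = grid_cov \<tau> n a b"
proof -
  have "expbound (\<lambda>(i::unit) x::real. 1)" by (rule expbound_const[of _ 1]) simp
  moreover have "expsmooth (Suc 0) (\<lambda>(i::unit) x::real. 1)" by (rule expsmooth_const[of _ 1]) simp
  ultimately show ?thesis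
    using stein_product[OF g expbound_real_ident, where P'="\<lambda>_. 1" and H="\<lambda>_::real. 1" and a'=a and a=b and \<beta>="\<lambda>_. b"]
    by (simp add: prob_space)
qed

lemma integrable_lincomb_mult:
  assumes g: "grid \<tau> n"
  shows "integrable M (\<lambda>\<omega>. lincomb \<tau> n a \<omega> * lincomb \<tau> n b \<omega>)"
proof -
  have "(\<lambda>x::real. x) \<in> borel_measurable borel" by simp
  from integrable_product_grid_vec[OF g expbound_real_ident this expbound_real_ident this, of a "\<lambda>_. b"]
  show ?thesis by (simp add: grid_vec_def)
qed

text \<open>
  The Gaussian space of the process: finite linear combinations of its values. Equality is only required
  on \<open>space M\<close>, where the process is known to start at \<open>0\<close>.
\<close>
definition gaussian_space :: "('a \<Rightarrow> real) set" where
  "gaussian_space = {X. \<exists>T c. finite T \<and> T \<subseteq> {0..1} \<and> (\<forall>\<omega>\<in>space M. X \<omega> = (\<Sum>t\<in>T. c t \<bullet> B t \<omega>))}"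

text \<open>
  Every value \<open>B t\<close> is the sum of the increments before \<open>t\<close> on a grid that contains \<open>0\<close> and \<open>t\<close>.
\<close>
lemma common_grid:
  assumes T: "finite T" "T \<subseteq> {0..1}"
  obtains \<tau> n where "grid \<tau> n"
    "\<forall>c. \<exists>a. \<forall>\<omega>\<in>space M. (\<Sum>t\<in>T. c t \<bullet> B t \<omega>) = lincomb \<tau> n a \<omega>"
proof -
  define xs where "xs = sorted_list_of_set (insert 0 (insert 1 T))"
  have set_xs: "set xs = insert 0 (insert 1 T)"
    unfolding xs_def using T by (intro set_sorted_list_of_set) auto
  have sorted: "sorted xs"
    by (simp only: xs_def sorted_sorted_list_of_set)
  define n where "n = length xs - 1"
  define \<tau> where "\<tau> i = xs ! i" for i
  have "card (set xs) \<ge> card {0, 1::real}"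
    unfolding set_xs using T by (intro card_mono) auto
  then have len: "2 \<le> length xs" using card_length[of xs] by simp
  have in01: "\<tau> i \<in> {0..1}" if "i \<le> n" for i
  proof -
    have "\<tau> i \<in> set xs" unfolding \<tau>_def using that len by (intro nth_mem) (auto simp: n_def)
    then show ?thesis using T(2) unfolding set_xs by auto
  qed
  have mono: "\<tau> i \<le> \<tau> j" if "i \<le> j" "j \<le> n" for i j
    using sorted that len by (auto simp: \<tau>_def n_def intro!: sorted_nth_mono)
  have grid: "grid \<tau> n"
    unfolding grid_def using in01[of 0] in01[of n] mono len by (auto simp: n_def)
  have ex: "\<exists>j\<le>n. t = \<tau> j" if "t \<in> insert 0 T" for t
    using that set_xs len in_set_conv_nth[of t xs] unfolding \<tau>_def n_def
    by (metis One_nat_def insert_iff Suc_pred' less_Suc_eq_le less_le_trans pos2)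
  have \<tau>0: "\<tau> 0 = 0"
    using ex[of 0] mono[of 0] in01[of 0] by fastforce
  from ex obtain j where j: "\<And>t. t \<in> T \<Longrightarrow> j t \<le> n \<and> t = \<tau> (j t)" by (metis insertCI)
  have tele: "B (\<tau> i) \<omega> = (\<Sum>k<i. incr \<tau> k \<omega>)" if "\<omega> \<in> space M" for i \<omega>
    using sum_lessThan_telescope[of "\<lambda>k. B (\<tau> k) \<omega>" i] that by (simp add: incr_def \<tau>0 B_0)
  show thesis
  proof (rule that[OF grid], intro allI exI ballI)
    fix c \<omega> assume \<omega>: "\<omega> \<in> space M"
    have "c t \<bullet> B t \<omega> = (\<Sum>k<n. (if k < j t then c t else 0) \<bullet> incr \<tau> k \<omega>)" if "t \<in> T" for t
    proof -
      have "c t \<bullet> B t \<omega> = (\<Sum>k<j t. c t \<bullet> incr \<tau> k \<omega>)"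
        using j[OF that] tele[OF \<omega>, of "j t"] by (metis inner_sum_right)
      also have "\<dots> = (\<Sum>k<n. (if k < j t then c t else 0) \<bullet> incr \<tau> k \<omega>)"
        using j[OF that] by (intro sum.mono_neutral_cong_left) auto
      finally show ?thesis .
    qed
    then have "(\<Sum>t\<in>T. c t \<bullet> B t \<omega>) = (\<Sum>t\<in>T. \<Sum>k<n. (if k < j t then c t else 0) \<bullet> incr \<tau> k \<omega>)"
      by (intro sum.cong) auto
    also have "\<dots> = (\<Sum>k<n. \<Sum>t\<in>T. (if k < j t then c t else 0) \<bullet> incr \<tau> k \<omega>)"
      by (rule sum.swap)
    finally show "(\<Sum>t\<in>T. c t \<bullet> B t \<omega>) = lincomb \<tau> n (\<lambda>k. \<Sum>t\<in>T. if k < j t then c t else 0) \<omega>"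
      by (simp add: lincomb_def inner_sum_left)
  qed
qed

lemma gaussian_space_grid:
  assumes G: "G \<in> gaussian_space" and Y: "\<And>b. b \<in> Basis \<Longrightarrow> (\<lambda>\<omega>. Y \<omega> \<bullet> b) \<in> gaussian_space"
  obtains \<tau> n a \<beta> where "grid \<tau> n" "\<And>\<omega>. \<omega> \<in> space M \<Longrightarrow> G \<omega> = lincomb \<tau> n a \<omega>"
    "\<And>\<omega>. \<omega> \<in> space M \<Longrightarrow> (Y \<omega> :: 'y::euclidean_space) = grid_vec \<tau> n \<beta> \<omega>"
proof -
  obtain T0 c0 where 0: "finite T0" "T0 \<subseteq> {0..1}" "\<And>\<omega>. \<omega> \<in> space M \<Longrightarrow> G \<omega> = (\<Sum>t\<in>T0. c0 t \<bullet> B t \<omega>)"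
    using G unfolding gaussian_space_def by auto
  have "\<forall>b\<in>Basis. \<exists>T c. finite T \<and> T \<subseteq> {0..1} \<and> (\<forall>\<omega>\<in>space M. Y \<omega> \<bullet> b = (\<Sum>t\<in>T. c t \<bullet> B t \<omega>))"
    using Y unfolding gaussian_space_def by auto
  then obtain T c where 1: "\<And>b. b \<in> Basis \<Longrightarrow> finite (T b)" "\<And>b. b \<in> Basis \<Longrightarrow> T b \<subseteq> {0..1}"
    "\<And>b \<omega>. b \<in> Basis \<Longrightarrow> \<omega> \<in> space M \<Longrightarrow> Y \<omega> \<bullet> b = (\<Sum>t\<in>T b. c b t \<bullet> B t \<omega>)"
    by metis
  define U where "U = T0 \<union> (\<Union>b\<in>Basis. T b)"
  have U: "finite U" using 0(1) 1(1) by (auto simp: U_def)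
  have U01: "U \<subseteq> {0..1}" unfolding U_def using 0(2) 1(2) by blast
  obtain \<tau> n where g: "grid \<tau> n" and ex: "\<forall>c. \<exists>a. \<forall>\<omega>\<in>space M. (\<Sum>t\<in>U. c t \<bullet> B t \<omega>) = lincomb \<tau> n a \<omega>"
    by (rule common_grid[OF U U01])
  have ext: "(\<Sum>t\<in>T'. c t \<bullet> B t \<omega>) = (\<Sum>t\<in>U. (if t \<in> T' then c t else 0) \<bullet> B t \<omega>)" if "T' \<subseteq> U" for T' c \<omega>
    using that U by (intro sum.mono_neutral_cong_left) auto
  obtain a where a: "\<And>\<omega>. \<omega> \<in> space M \<Longrightarrow> (\<Sum>t\<in>U. (if t \<in> T0 then c0 t else 0) \<bullet> B t \<omega>) = lincomb \<tau> n a \<omega>"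
    using ex[rule_format, of "\<lambda>t. if t \<in> T0 then c0 t else 0"] by auto
  have "\<forall>b. \<exists>a. \<forall>\<omega>\<in>space M. (\<Sum>t\<in>U. (if t \<in> T b then c b t else 0) \<bullet> B t \<omega>) = lincomb \<tau> n a \<omega>"
    by (intro allI ex[rule_format])
  then obtain \<beta> where \<beta>: "\<And>b \<omega>. \<omega> \<in> space M \<Longrightarrow> (\<Sum>t\<in>U. (if t \<in> T b then c b t else 0) \<bullet> B t \<omega>) = lincomb \<tau> n (\<beta> b) \<omega>"
    by metis
  show thesis
  proof (rule that[OF g, of a \<beta>])
    fix \<omega> assume \<omega>: "\<omega> \<in> space M"
    show "G \<omega> = lincomb \<tau> n a \<omega>"
      using 0(3)[OF \<omega>] a[OF \<omega>] ext[of T0 c0 \<omega>] by (simp add: U_def)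
    have "Y \<omega> \<bullet> b = lincomb \<tau> n (\<beta> b) \<omega>" if b: "b \<in> Basis" for b
    proof -
      have "T b \<subseteq> U" using b by (auto simp: U_def)
      then show ?thesis using 1(3)[OF b \<omega>] \<beta>[OF \<omega>, of b] ext[of "T b" "c b" \<omega>] by simp
    qed
    then show "Y \<omega> = grid_vec \<tau> n \<beta> \<omega>"
      by (intro euclidean_eqI[where 'a='y]) (simp add: grid_vec_inner)
  qed
qed

end

section \<open>Rapid decay implies continuity on Sobolev spaces\<close>

lemma abs_mult_le_squares: "\<bar>x * y\<bar> \<le> x\<^sup>2 + y\<^sup>2" for x y :: real
proof -
  have "2 * \<bar>x\<bar> * \<bar>y\<bar> \<le> \<bar>x\<bar>\<^sup>2 + \<bar>y\<bar>\<^sup>2" by (rule sum_squares_bound)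
  moreover have "0 \<le> \<bar>x\<bar> * \<bar>y\<bar>" by simp
  ultimately show ?thesis unfolding abs_mult power2_abs by linarith
qed

lemma L2_integrable_mult:
  assumes "X \<in> L2 M" "Y \<in> L2 M"
  shows "integrable M (\<lambda>\<omega>. X \<omega> * Y \<omega>)"
proof (rule Bochner_Integration.integrable_bound)
  show "integrable M (\<lambda>\<omega>. (X \<omega>)\<^sup>2 + (Y \<omega>)\<^sup>2)"
    using assms by (auto simp: L2_def)
  show "(\<lambda>\<omega>. X \<omega> * Y \<omega>) \<in> borel_measurable M"
    using assms by (auto simp: L2_def intro: borel_measurable_times)
qed (use abs_mult_le_squares in \<open>auto intro!: AE_I2 intro: order_trans[OF _ abs_ge_self]\<close>)

lemma L2_add:
  assumes "X \<in> L2 M" "Y \<in> L2 M"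
  shows "(\<lambda>\<omega>. X \<omega> + Y \<omega>) \<in> L2 M"
proof -
  have "integrable M (\<lambda>\<omega>. (X \<omega>)\<^sup>2 + (Y \<omega>)\<^sup>2 + 2 * (X \<omega> * Y \<omega>))"
    using L2_integrable_mult[OF assms] assms by (auto simp: L2_def)
  then have "integrable M (\<lambda>\<omega>. (X \<omega> + Y \<omega>)\<^sup>2)"
    by (simp add: power2_sum mult.assoc)
  then show ?thesis using assms by (auto simp: L2_def intro: borel_measurable_add)
qed

lemma L2_cmult: "X \<in> L2 M \<Longrightarrow> (\<lambda>\<omega>. c * X \<omega>) \<in> L2 M"
  by (auto simp: L2_def power_mult_distrib intro: borel_measurable_times)

lemma L2_diff:
  assumes "X \<in> L2 M" "Y \<in> L2 M"
  shows "(\<lambda>\<omega>. X \<omega> - Y \<omega>) \<in> L2 M"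
  using L2_add[OF assms(1) L2_cmult[OF assms(2), of "-1"]] by simp

lemma L2_zero: "(\<lambda>\<omega>. 0) \<in> L2 M"
  by (simp add: L2_def)

lemma L2_sum: "finite A \<Longrightarrow> (\<And>a. a \<in> A \<Longrightarrow> X a \<in> L2 M) \<Longrightarrow> (\<lambda>\<omega>. \<Sum>a\<in>A. X a \<omega>) \<in> L2 M"
  by (induction A rule: finite_induct) (auto intro: L2_zero L2_add)

lemma L2_lin_span: "S \<subseteq> L2 M \<Longrightarrow> X \<in> lin_span S \<Longrightarrow> X \<in> L2 M"
  unfolding lin_span_def by (auto intro!: L2_sum L2_cmult)

lemma lin_span_diff:
  assumes "X \<in> lin_span S" "Y \<in> lin_span S"
  shows "(\<lambda>\<omega>. X \<omega> - Y \<omega>) \<in> lin_span S"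
proof -
  obtain A c where A: "finite A" "A \<subseteq> S" "X = (\<lambda>\<omega>. \<Sum>U\<in>A. c U * U \<omega>)"
    using assms(1) unfolding lin_span_def by auto
  obtain A' c' where A': "finite A'" "A' \<subseteq> S" "Y = (\<lambda>\<omega>. \<Sum>U\<in>A'. c' U * U \<omega>)"
    using assms(2) unfolding lin_span_def by auto
  have "X \<omega> - Y \<omega> = (\<Sum>U\<in>A \<union> A'. ((if U \<in> A then c U else 0) - (if U \<in> A' then c' U else 0)) * U \<omega>)" for \<omega>
  proof -
    have "X \<omega> = (\<Sum>U\<in>A \<union> A'. (if U \<in> A then c U else 0) * U \<omega>)"
      unfolding A(3) using A(1) A'(1) by (intro sum.mono_neutral_cong_left) auto
    moreover have "Y \<omega> = (\<Sum>U\<in>A \<union> A'. (if U \<in> A' then c' U else 0) * U \<omega>)"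
      unfolding A'(3) using A(1) A'(1) by (intro sum.mono_neutral_cong_left) auto
    ultimately show ?thesis by (simp add: left_diff_distrib sum_subtractf)
  qed
  then show ?thesis
    unfolding lin_span_def using A(1,2) A'(1,2)
    by (intro CollectI exI[of _ "A \<union> A'"] exI[of _ "\<lambda>U. (if U \<in> A then c U else 0) - (if U \<in> A' then c' U else 0)"])
      auto
qed

lemma L2_Cauchy_Schwarz:
  assumes X: "X \<in> L2 M" and Y: "Y \<in> L2 M"
  shows "\<bar>\<integral>\<omega>. X \<omega> * Y \<omega> \<partial>M\<bar> \<le> sqrt (\<integral>\<omega>. (X \<omega>)\<^sup>2 \<partial>M) * sqrt (\<integral>\<omega>. (Y \<omega>)\<^sup>2 \<partial>M)"
proof -
  define A where "A = (\<integral>\<omega>. (X \<omega>)\<^sup>2 \<partial>M)"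
  define Bq where "Bq = (\<integral>\<omega>. X \<omega> * Y \<omega> \<partial>M)"
  define C where "C = (\<integral>\<omega>. (Y \<omega>)\<^sup>2 \<partial>M)"
  have C0: "0 \<le> C" and A0: "0 \<le> A" by (simp_all add: A_def C_def)
  have q: "0 \<le> A + 2 * t * Bq + t\<^sup>2 * C" for t
  proof -
    have "0 \<le> (\<integral>\<omega>. (X \<omega> + t * Y \<omega>)\<^sup>2 \<partial>M)" by simp
    also have "\<dots> = (\<integral>\<omega>. (X \<omega>)\<^sup>2 + (2 * t) * (X \<omega> * Y \<omega>) + t\<^sup>2 * (Y \<omega>)\<^sup>2 \<partial>M)"
      by (rule Bochner_Integration.integral_cong) (auto simp: power2_eq_square algebra_simps)
    also have "\<dots> = A + 2 * t * Bq + t\<^sup>2 * C"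
      unfolding A_def Bq_def C_def using X Y L2_integrable_mult[OF X Y] by (simp add: L2_def)
    finally show ?thesis .
  qed
  have "Bq\<^sup>2 \<le> A * C"
  proof (cases "C = 0")
    case True
    have "Bq = 0"
    proof (rule ccontr)
      assume "Bq \<noteq> 0"
      then have "A + 2 * (- (A + 1) / (2 * Bq)) * Bq = -1" by (simp add: field_simps)
      with q[of "- (A + 1) / (2 * Bq)"] show False unfolding True by simp
    qed
    then show ?thesis using True by simp
  next
    case False
    then have "A + 2 * (- Bq / C) * Bq + (- Bq / C)\<^sup>2 * C = A - Bq\<^sup>2 / C"
      by (simp add: power2_eq_square field_simps)
    then have "Bq\<^sup>2 / C \<le> A" using q[of "- Bq / C"] by linarith
    then show ?thesis using False C0 by (simp add: pos_divide_le_eq)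
  qed
  then have "sqrt (Bq\<^sup>2) \<le> sqrt (A * C)" by (rule real_sqrt_le_mono)
  then show ?thesis by (simp add: A_def Bq_def C_def real_sqrt_mult)
qed

lemma wiener_chaos_L2: "X \<in> wiener_chaos M S n \<Longrightarrow> X \<in> L2 M"
  by (simp add: wiener_chaos_def)

lemma square_diff_le: "(a - b)\<^sup>2 \<le> 2 * a\<^sup>2 + 2 * b\<^sup>2" for a b :: real
  using zero_le_power2[of "a + b"] by (simp add: power2_eq_square algebra_simps)

lemma wiener_chaos_diff:
  assumes X: "X \<in> wiener_chaos M S n" and X': "X' \<in> wiener_chaos M S n"
    and sub: "{(\<lambda>\<omega>. hermite n (G \<omega>)) | G. G \<in> lin_span S \<and> (\<integral>\<omega>. (G \<omega>)\<^sup>2 \<partial>M) = 1} \<subseteq> L2 M"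
  shows "(\<lambda>\<omega>. X \<omega> - X' \<omega>) \<in> wiener_chaos M S n"
proof -
  let ?H = "{(\<lambda>\<omega>. hermite n (G \<omega>)) | G. G \<in> lin_span S \<and> (\<integral>\<omega>. (G \<omega>)\<^sup>2 \<partial>M) = 1}"
  have L: "X \<in> L2 M" "X' \<in> L2 M" using X X' by (auto intro: wiener_chaos_L2)
  have "\<exists>Y\<in>lin_span ?H. (\<integral>\<omega>. (X \<omega> - X' \<omega> - Y \<omega>)\<^sup>2 \<partial>M) < e" if "0 < e" for e
  proof -
    have "0 < e / 4" using that by simp
    then obtain Y Y' where Y: "Y \<in> lin_span ?H" "(\<integral>\<omega>. (X \<omega> - Y \<omega>)\<^sup>2 \<partial>M) < e / 4"
      and Y': "Y' \<in> lin_span ?H" "(\<integral>\<omega>. (X' \<omega> - Y' \<omega>)\<^sup>2 \<partial>M) < e / 4"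
      using X X' unfolding wiener_chaos_def by blast
    have YL: "Y \<in> L2 M" "Y' \<in> L2 M" using Y(1) Y'(1) L2_lin_span[OF sub] by auto
    have i: "integrable M (\<lambda>\<omega>. (X \<omega> - Y \<omega>)\<^sup>2)" "integrable M (\<lambda>\<omega>. (X' \<omega> - Y' \<omega>)\<^sup>2)"
      "integrable M (\<lambda>\<omega>. (X \<omega> - X' \<omega> - (Y \<omega> - Y' \<omega>))\<^sup>2)"
      using L2_diff[OF L(1) YL(1)] L2_diff[OF L(2) YL(2)] L2_diff[OF L2_diff[OF L] L2_diff[OF YL]]
      by (auto simp: L2_def)
    have "(\<integral>\<omega>. (X \<omega> - X' \<omega> - (Y \<omega> - Y' \<omega>))\<^sup>2 \<partial>M)
      \<le> (\<integral>\<omega>. 2 * (X \<omega> - Y \<omega>)\<^sup>2 + 2 * (X' \<omega> - Y' \<omega>)\<^sup>2 \<partial>M)"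
    proof (rule integral_mono)
      show "(X \<omega> - X' \<omega> - (Y \<omega> - Y' \<omega>))\<^sup>2 \<le> 2 * (X \<omega> - Y \<omega>)\<^sup>2 + 2 * (X' \<omega> - Y' \<omega>)\<^sup>2" for \<omega>
        using square_diff_le[of "X \<omega> - Y \<omega>" "X' \<omega> - Y' \<omega>"] by (simp add: algebra_simps)
    qed (use i in auto)
    also have "\<dots> = 2 * (\<integral>\<omega>. (X \<omega> - Y \<omega>)\<^sup>2 \<partial>M) + 2 * (\<integral>\<omega>. (X' \<omega> - Y' \<omega>)\<^sup>2 \<partial>M)"
      using i by simp
    also have "\<dots> < e" using Y(2) Y'(2) by simp
    finally show ?thesis using lin_span_diff[OF Y(1) Y'(1)] by (rule bexI)
  qed
  then show ?thesis using L2_diff[OF L] by (simp add: wiener_chaos_def)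
qed

text \<open>
  The pairing with \<open>F\<close> satisfies a weighted Cauchy--Schwarz inequality on \<open>D2 M S \<gamma>\<close>, because the decay of
  the chaos components of \<open>F\<close> compensates any negative weight. Hence it is continuous there, and the
  pairings of the approximations converge to the pairing of their limit.
\<close>
lemma has_D2_pairing_limit:
  fixes M :: "'a measure"
  assumes F: "F \<in> L2 M"
    and H: "\<And>n. {(\<lambda>\<omega>. hermite n (G \<omega>)) | G. G \<in> lin_span S \<and> (\<integral>\<omega>. (G \<omega>)\<^sup>2 \<partial>M) = 1} \<subseteq> L2 M"
    and decay: "\<And>k. \<exists>K\<ge>0. \<forall>n. \<forall>X\<in>wiener_chaos M S n.
      real (n + 1) ^ k * \<bar>\<integral>\<omega>. X \<omega> * F \<omega> \<partial>M\<bar> \<le> K * sqrt (\<integral>\<omega>. (X \<omega>)\<^sup>2 \<partial>M)"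
    and lim: "((\<lambda>\<epsilon>. \<integral>\<omega>. F \<omega> * X \<epsilon> \<omega> \<partial>M) \<longlongrightarrow> c) (at_right 0)"
    and \<eta>: "D2_limit M S \<gamma> X \<eta>"
  shows "has_D2_pairing M \<eta> F c"
proof -
  define q where "q \<xi> n = real (n + 1) powr \<gamma> * (\<integral>\<omega>. (\<xi> n \<omega>)\<^sup>2 \<partial>M)" for \<xi> :: "nat \<Rightarrow> 'a \<Rightarrow> real" and n
  have q0: "0 \<le> q \<xi> n" for \<xi> n by (simp add: q_def)
  define a where "a \<xi> n = (\<integral>\<omega>. \<xi> n \<omega> * F \<omega> \<partial>M)" for \<xi> :: "nat \<Rightarrow> 'a \<Rightarrow> real" and n
  define k where "k = nat \<lceil>1 + \<bar>\<gamma>\<bar>\<rceil>"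
  have k: "1 + \<bar>\<gamma>\<bar> \<le> real k" unfolding k_def by linarith
  obtain K where K: "0 \<le> K" "\<And>n Z. Z \<in> wiener_chaos M S n \<Longrightarrow>
      real (n + 1) ^ k * \<bar>\<integral>\<omega>. Z \<omega> * F \<omega> \<partial>M\<bar> \<le> K * sqrt (\<integral>\<omega>. (Z \<omega>)\<^sup>2 \<partial>M)"
    using decay[of k] by metis
  define p where "p n = 1 / (real (n + 1))\<^sup>2" for n
  have p: "summable p"
    using inverse_power_summable[of 2, where 'a=real] summable_Suc_iff[of "\<lambda>n. inverse (real n ^ 2)"]
    by (simp add: p_def[abs_def] inverse_eq_divide)
  define P where "P = suminf p"
  \<comment> \<open>The choice of \<open>k\<close> makes the weights \<open>(n + 1) powr (- k - \<gamma> / 2)\<close> at most \<open>1 / (n + 1)\<close>. The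
    free parameter \<open>\<theta>\<close> replaces the Cauchy--Schwarz inequality for series.\<close>
  have a_le: "\<bar>a \<xi> n\<bar> \<le> K / 2 * (q \<xi> n / \<theta> + \<theta> * p n)"
    if \<xi>: "\<xi> n \<in> wiener_chaos M S n" and \<theta>: "0 < \<theta>" for \<xi> n \<theta>
  proof -
    define v where "v = (\<integral>\<omega>. (\<xi> n \<omega>)\<^sup>2 \<partial>M)"
    define N where "N = real (n + 1)"
    have N: "1 \<le> N" by (simp add: N_def)
    have v0: "0 \<le> v" by (simp add: v_def)
    have "\<bar>a \<xi> n\<bar> \<le> K * sqrt v / N ^ k"
      using K(2)[OF \<xi>] N by (simp add: a_def v_def N_def field_simps)
    also have "\<dots> = K * (sqrt (N powr \<gamma> * v) * (N powr (- real k - \<gamma> / 2)))"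
    proof -
      have "sqrt (N powr \<gamma> * v) = N powr (\<gamma> / 2) * sqrt v"
        using N by (simp add: real_sqrt_mult powr_half_sqrt[symmetric] powr_powr)
      moreover have "N powr (\<gamma> / 2) * N powr (- real k - \<gamma> / 2) = 1 / N ^ k"
        using N by (simp add: powr_add[symmetric] powr_minus powr_realpow field_simps)
      ultimately show ?thesis by (simp add: field_simps)
    qed
    also have "\<dots> \<le> K * (sqrt (q \<xi> n) * (1 / N))"
    proof -
      have "N powr (- real k - \<gamma> / 2) \<le> N powr (- 1)"
        using N k by (intro powr_mono) auto
      then have "N powr (- real k - \<gamma> / 2) \<le> 1 / N"
        using N by (simp add: powr_minus field_simps)
      moreover have "q \<xi> n = N powr \<gamma> * v" by (simp add: q_def v_def N_def)
      ultimately show ?thesis using K(1) v0 by (simp only:) (intro mult_left_mono, auto)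
    qed
    finally have f: "\<bar>a \<xi> n\<bar> \<le> K * (sqrt (q \<xi> n) * (1 / N))" .
    have "sqrt (q \<xi> n) * (1 / N) \<le> (q \<xi> n / \<theta> + \<theta> * p n) / 2"
    proof -
      have "2 * (sqrt (q \<xi> n) / sqrt \<theta>) * (sqrt \<theta> / N) \<le> (sqrt (q \<xi> n) / sqrt \<theta>)\<^sup>2 + (sqrt \<theta> / N)\<^sup>2"
        by (rule sum_squares_bound)
      then show ?thesis
        using \<theta> q0[of \<xi> n] by (simp add: power_divide p_def N_def mult.commute)
    qed
    then have "K * (sqrt (q \<xi> n) * (1 / N)) \<le> K * ((q \<xi> n / \<theta> + \<theta> * p n) / 2)"
      using K(1) by (rule mult_left_mono)
    from order_trans[OF f this] show ?thesis by (simp add: mult.commute)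
  qed
  have sum_abs: "summable (\<lambda>n. \<bar>a \<xi> n\<bar>)" and a_sum_le: "\<bar>\<Sum>n. a \<xi> n\<bar> \<le> K / 2 * (suminf (q \<xi>) / \<theta> + \<theta> * P)"
    if \<xi>: "\<And>n. \<xi> n \<in> wiener_chaos M S n" and s: "summable (q \<xi>)" and \<theta>: "0 < \<theta>" for \<xi> \<theta>
  proof -
    have al: "\<bar>a \<xi> n\<bar> \<le> K / 2 * (q \<xi> n / \<theta> + \<theta> * p n)" for n
      by (rule a_le[of \<xi> n, OF \<xi> \<theta>])
    have s2: "summable (\<lambda>n. K / 2 * (q \<xi> n / \<theta> + \<theta> * p n))"
      by (intro summable_mult summable_add summable_divide s p)
    show 1: "summable (\<lambda>n. \<bar>a \<xi> n\<bar>)"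
      by (rule summable_comparison_test_ev[OF _ s2]) (use al in auto)
    have "\<bar>\<Sum>n. a \<xi> n\<bar> \<le> (\<Sum>n. \<bar>a \<xi> n\<bar>)" by (rule summable_rabs[OF 1])
    also have "\<dots> \<le> (\<Sum>n. K / 2 * (q \<xi> n / \<theta> + \<theta> * p n))"
      by (intro suminf_le 1 s2 al)
    also have "\<dots> = K / 2 * (suminf (q \<xi>) / \<theta> + \<theta> * P)"
      unfolding P_def
      by (subst suminf_mult, intro summable_add summable_mult summable_divide s p,
          subst suminf_add[symmetric], intro summable_divide s, intro summable_mult p)
        (simp add: suminf_divide s suminf_mult p)
    finally show "\<bar>\<Sum>n. a \<xi> n\<bar> \<le> K / 2 * (suminf (q \<xi>) / \<theta> + \<theta> * P)" .
  qed
  obtain \<Xi> where \<eta>D: "\<eta> \<in> D2 M S \<gamma>" and \<Xi>: "\<And>\<epsilon>. 0 < \<epsilon> \<Longrightarrow> chaos_expansion M S (X \<epsilon>) (\<Xi> \<epsilon>)"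
    "\<And>\<epsilon>. 0 < \<epsilon> \<Longrightarrow> \<Xi> \<epsilon> \<in> D2 M S \<gamma>"
    and conv: "((\<lambda>\<epsilon>. D2_norm M \<gamma> (\<lambda>n \<omega>. \<Xi> \<epsilon> n \<omega> - \<eta> n \<omega>)) \<longlongrightarrow> 0) (at_right 0)"
    using \<eta> unfolding D2_limit_def by blast
  have \<eta>1: "\<eta> n \<in> wiener_chaos M S n" "summable (q \<eta>)" for n
    using \<eta>D by (auto simp: D2_def q_def[abs_def])
  define \<sigma> where "\<sigma> = (\<Sum>n. a \<eta> n)"
  have a\<eta>: "summable (a \<eta>)" by (rule summable_rabs_cancel[OF sum_abs[OF \<eta>1, of 1]]) simp
  have key: "\<bar>(\<integral>\<omega>. F \<omega> * X \<epsilon> \<omega> \<partial>M) - \<sigma>\<bar>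
      \<le> K / 2 * ((D2_norm M \<gamma> (\<lambda>n \<omega>. \<Xi> \<epsilon> n \<omega> - \<eta> n \<omega>))\<^sup>2 / \<theta> + \<theta> * P)" if \<epsilon>: "0 < \<epsilon>" and \<theta>: "0 < \<theta>" for \<epsilon> \<theta>
  proof -
    define \<zeta> where "\<zeta> = (\<lambda>n \<omega>. \<Xi> \<epsilon> n \<omega> - \<eta> n \<omega>)"
    have \<Xi>1: "\<Xi> \<epsilon> n \<in> wiener_chaos M S n" "summable (q (\<Xi> \<epsilon>))" for n
      using \<Xi>(2)[OF \<epsilon>] by (auto simp: D2_def q_def[abs_def])
    have \<zeta>1: "\<zeta> n \<in> wiener_chaos M S n" for n
      unfolding \<zeta>_def by (intro wiener_chaos_diff \<Xi>1 \<eta>1 H)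
    have \<zeta>2: "summable (q \<zeta>)"
    proof (rule summable_comparison_test_ev)
      show "summable (\<lambda>n. 2 * q (\<Xi> \<epsilon>) n + 2 * q \<eta> n)"
        by (intro summable_add summable_mult \<Xi>1 \<eta>1)
      have "q \<zeta> n \<le> 2 * q (\<Xi> \<epsilon>) n + 2 * q \<eta> n" for n
      proof -
        have i: "integrable M (\<lambda>\<omega>. (\<Xi> \<epsilon> n \<omega>)\<^sup>2)" "integrable M (\<lambda>\<omega>. (\<eta> n \<omega>)\<^sup>2)" "integrable M (\<lambda>\<omega>. (\<zeta> n \<omega>)\<^sup>2)"
          using wiener_chaos_L2[OF \<Xi>1(1)] wiener_chaos_L2[OF \<eta>1(1)] wiener_chaos_L2[OF \<zeta>1] by (auto simp: L2_def)
        have "(\<integral>\<omega>. (\<zeta> n \<omega>)\<^sup>2 \<partial>M) \<le> (\<integral>\<omega>. 2 * (\<Xi> \<epsilon> n \<omega>)\<^sup>2 + 2 * (\<eta> n \<omega>)\<^sup>2 \<partial>M)"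
          using i by (intro integral_mono) (auto simp: \<zeta>_def square_diff_le)
        also have "\<dots> = 2 * (\<integral>\<omega>. (\<Xi> \<epsilon> n \<omega>)\<^sup>2 \<partial>M) + 2 * (\<integral>\<omega>. (\<eta> n \<omega>)\<^sup>2 \<partial>M)"
          using i by simp
        finally have "q \<zeta> n \<le> real (n + 1) powr \<gamma> * (2 * (\<integral>\<omega>. (\<Xi> \<epsilon> n \<omega>)\<^sup>2 \<partial>M) + 2 * (\<integral>\<omega>. (\<eta> n \<omega>)\<^sup>2 \<partial>M))"
          unfolding q_def by (intro mult_left_mono) auto
        then show ?thesis by (simp add: q_def algebra_simps)
      qed
      then show "\<forall>\<^sub>F n in sequentially. norm (q \<zeta> n) \<le> 2 * q (\<Xi> \<epsilon>) n + 2 * q \<eta> n"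
        using q0 by (intro always_eventually) auto
    qed
    have "a (\<Xi> \<epsilon>) sums (\<integral>\<omega>. F \<omega> * X \<epsilon> \<omega> \<partial>M)"
      unfolding sums_def
    proof (rule Lim_null[THEN iffD2], rule Lim_null_comparison)
      have ce: "X \<epsilon> \<in> L2 M" "(\<lambda>N. \<integral>\<omega>. (X \<epsilon> \<omega> - (\<Sum>n<N. \<Xi> \<epsilon> n \<omega>))\<^sup>2 \<partial>M) \<longlonglongrightarrow> 0"
        using \<Xi>(1)[OF \<epsilon>] by (auto simp: chaos_expansion_def)
      have "(\<lambda>N. sqrt (\<integral>\<omega>. (X \<epsilon> \<omega> - (\<Sum>n<N. \<Xi> \<epsilon> n \<omega>))\<^sup>2 \<partial>M) * sqrt (\<integral>\<omega>. (F \<omega>)\<^sup>2 \<partial>M))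
        \<longlonglongrightarrow> sqrt 0 * sqrt (\<integral>\<omega>. (F \<omega>)\<^sup>2 \<partial>M)"
        by (intro tendsto_intros ce(2))
      then show "(\<lambda>N. sqrt (\<integral>\<omega>. (X \<epsilon> \<omega> - (\<Sum>n<N. \<Xi> \<epsilon> n \<omega>))\<^sup>2 \<partial>M) * sqrt (\<integral>\<omega>. (F \<omega>)\<^sup>2 \<partial>M)) \<longlonglongrightarrow> 0"
        by simp
      have "norm ((\<Sum>n<N. a (\<Xi> \<epsilon>) n) - (\<integral>\<omega>. F \<omega> * X \<epsilon> \<omega> \<partial>M))
        \<le> sqrt (\<integral>\<omega>. (X \<epsilon> \<omega> - (\<Sum>n<N. \<Xi> \<epsilon> n \<omega>))\<^sup>2 \<partial>M) * sqrt (\<integral>\<omega>. (F \<omega>)\<^sup>2 \<partial>M)" for N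
      proof -
        have L: "(\<lambda>\<omega>. \<Sum>n<N. \<Xi> \<epsilon> n \<omega>) \<in> L2 M"
          by (intro L2_sum wiener_chaos_L2[OF \<Xi>1(1)]) simp
        have "(\<Sum>n<N. a (\<Xi> \<epsilon>) n) = (\<integral>\<omega>. (\<Sum>n<N. \<Xi> \<epsilon> n \<omega>) * F \<omega> \<partial>M)"
          unfolding a_def sum_distrib_right
          by (rule Bochner_Integration.integral_sum[symmetric])
            (intro L2_integrable_mult wiener_chaos_L2[OF \<Xi>1(1)] F)
        then have "(\<integral>\<omega>. F \<omega> * X \<epsilon> \<omega> \<partial>M) - (\<Sum>n<N. a (\<Xi> \<epsilon>) n) = (\<integral>\<omega>. X \<epsilon> \<omega> * F \<omega> - (\<Sum>n<N. \<Xi> \<epsilon> n \<omega>) * F \<omega> \<partial>M)"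
          using L2_integrable_mult[OF ce(1) F] L2_integrable_mult[OF L F]
          by (simp add: mult.commute)
        also have "\<dots> = (\<integral>\<omega>. (X \<epsilon> \<omega> - (\<Sum>n<N. \<Xi> \<epsilon> n \<omega>)) * F \<omega> \<partial>M)"
          by (simp add: left_diff_distrib)
        finally show ?thesis
          using L2_Cauchy_Schwarz[OF L2_diff[OF ce(1) L] F] by (simp add: abs_minus_commute)
      qed
      then show "\<forall>\<^sub>F N in sequentially. norm ((\<Sum>n<N. a (\<Xi> \<epsilon>) n) - (\<integral>\<omega>. F \<omega> * X \<epsilon> \<omega> \<partial>M))
        \<le> sqrt (\<integral>\<omega>. (X \<epsilon> \<omega> - (\<Sum>n<N. \<Xi> \<epsilon> n \<omega>))\<^sup>2 \<partial>M) * sqrt (\<integral>\<omega>. (F \<omega>)\<^sup>2 \<partial>M)"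
        by (intro always_eventually) auto
    qed
    moreover have "a \<eta> sums \<sigma>" unfolding \<sigma>_def using a\<eta> by (rule summable_sums)
    ultimately have "(\<lambda>n. a (\<Xi> \<epsilon>) n - a \<eta> n) sums ((\<integral>\<omega>. F \<omega> * X \<epsilon> \<omega> \<partial>M) - \<sigma>)"
      by (rule sums_diff)
    moreover have "a (\<Xi> \<epsilon>) n - a \<eta> n = a \<zeta> n" for n
      unfolding a_def \<zeta>_def
      using L2_integrable_mult[OF wiener_chaos_L2[OF \<Xi>1(1)] F, of n] L2_integrable_mult[OF wiener_chaos_L2[OF \<eta>1(1)] F, of n]
      by (simp add: left_diff_distrib)
    ultimately have "(\<integral>\<omega>. F \<omega> * X \<epsilon> \<omega> \<partial>M) - \<sigma> = (\<Sum>n. a \<zeta> n)"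
      by (simp add: sums_iff)
    moreover have "(D2_norm M \<gamma> \<zeta>)\<^sup>2 = suminf (q \<zeta>)"
      using suminf_nonneg[OF \<zeta>2 q0] by (simp add: D2_norm_def q_def[abs_def])
    ultimately show ?thesis
      using a_sum_le[OF \<zeta>1 \<zeta>2 \<theta>] by (simp add: \<zeta>_def)
  qed
  have "\<bar>c - \<sigma>\<bar> \<le> K / 2 * (\<theta> * P)" if \<theta>: "0 < \<theta>" for \<theta>
  proof (rule tendsto_le)
    show "((\<lambda>\<epsilon>. \<bar>(\<integral>\<omega>. F \<omega> * X \<epsilon> \<omega> \<partial>M) - \<sigma>\<bar>) \<longlongrightarrow> \<bar>c - \<sigma>\<bar>) (at_right 0)"
      by (intro tendsto_intros lim)
    have "((\<lambda>\<epsilon>. K / 2 * ((D2_norm M \<gamma> (\<lambda>n \<omega>. \<Xi> \<epsilon> n \<omega> - \<eta> n \<omega>))\<^sup>2 / \<theta> + \<theta> * P))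
      \<longlongrightarrow> K / 2 * (0\<^sup>2 / \<theta> + \<theta> * P)) (at_right 0)"
      using \<theta> by (intro tendsto_intros conv) auto
    then show "((\<lambda>\<epsilon>. K / 2 * ((D2_norm M \<gamma> (\<lambda>n \<omega>. \<Xi> \<epsilon> n \<omega> - \<eta> n \<omega>))\<^sup>2 / \<theta> + \<theta> * P))
      \<longlongrightarrow> K / 2 * (\<theta> * P)) (at_right 0)" by simp
    show "\<forall>\<^sub>F \<epsilon> in at_right 0. \<bar>(\<integral>\<omega>. F \<omega> * X \<epsilon> \<omega> \<partial>M) - \<sigma>\<bar>
      \<le> K / 2 * ((D2_norm M \<gamma> (\<lambda>n \<omega>. \<Xi> \<epsilon> n \<omega> - \<eta> n \<omega>))\<^sup>2 / \<theta> + \<theta> * P)"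
      using key[OF _ \<theta>] by (auto simp: eventually_at_right_less intro!: eventually_at_rightI[of 0 1])
  qed simp
  moreover have "((\<lambda>\<theta>. K / 2 * (\<theta> * P)) \<longlongrightarrow> K / 2 * (0 * P)) (at_right 0)"
    by (intro tendsto_intros)
  ultimately have "\<bar>c - \<sigma>\<bar> \<le> K / 2 * (0 * P)"
    by (intro tendsto_lowerbound[where F="at_right (0::real)"]) (auto intro!: eventually_at_rightI[of 0 1])
  then have "c = \<sigma>" by simp
  then show ?thesis
    using summable_sums[OF a\<eta>] by (simp add: has_D2_pairing_def \<sigma>_def a_def[abs_def])
qed

section \<open>Rapid decay of the chaos components of smooth functions\<close>

lemma number_op_cong: "(\<And>b b'. b \<in> Basis \<Longrightarrow> b' \<in> Basis \<Longrightarrow> C b b' = C' b b') \<Longrightarrow> number_op C H y = number_op C' H y"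
  by (simp add: number_op_def)

context brownian
begin

lemma gaussian_space_zero: "(\<lambda>\<omega>. 0) \<in> gaussian_space"
  unfolding gaussian_space_def by (intro CollectI exI[of _ "{}"]) auto

lemma gaussian_space_add_scale:
  assumes "X \<in> gaussian_space" "Y \<in> gaussian_space"
  shows "(\<lambda>\<omega>. r * X \<omega> + Y \<omega>) \<in> gaussian_space"
proof -
  obtain T c where 1: "finite T" "T \<subseteq> {0..1}" "\<And>\<omega>. \<omega> \<in> space M \<Longrightarrow> X \<omega> = (\<Sum>t\<in>T. c t \<bullet> B t \<omega>)"
    using assms(1) unfolding gaussian_space_def by auto
  obtain T' c' where 2: "finite T'" "T' \<subseteq> {0..1}" "\<And>\<omega>. \<omega> \<in> space M \<Longrightarrow> Y \<omega> = (\<Sum>t\<in>T'. c' t \<bullet> B t \<omega>)"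
    using assms(2) unfolding gaussian_space_def by auto
  have "r * X \<omega> + Y \<omega> = (\<Sum>t\<in>T \<union> T'. (r *\<^sub>R (if t \<in> T then c t else 0) + (if t \<in> T' then c' t else 0)) \<bullet> B t \<omega>)"
    if \<omega>: "\<omega> \<in> space M" for \<omega>
  proof -
    have "X \<omega> = (\<Sum>t\<in>T \<union> T'. (if t \<in> T then c t else 0) \<bullet> B t \<omega>)"
      unfolding 1(3)[OF \<omega>] using 1(1) 2(1) by (intro sum.mono_neutral_cong_left) auto
    moreover have "Y \<omega> = (\<Sum>t\<in>T \<union> T'. (if t \<in> T' then c' t else 0) \<bullet> B t \<omega>)"
      unfolding 2(3)[OF \<omega>] using 1(1) 2(1) by (intro sum.mono_neutral_cong_left) auto
    ultimately show ?thesis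
      by (simp add: inner_add_left sum.distrib sum_distrib_left)
  qed
  then show ?thesis
    unfolding gaussian_space_def using 1(1,2) 2(1,2)
    by (intro CollectI exI[of _ "T \<union> T'"]
        exI[of _ "\<lambda>t. r *\<^sub>R (if t \<in> T then c t else 0) + (if t \<in> T' then c' t else 0)"]) auto
qed

lemma gaussian_space_sum:
  "finite A \<Longrightarrow> (\<And>x. x \<in> A \<Longrightarrow> X x \<in> gaussian_space) \<Longrightarrow> (\<lambda>\<omega>. \<Sum>x\<in>A. c x * X x \<omega>) \<in> gaussian_space"
  by (induction A rule: finite_induct) (auto intro: gaussian_space_zero gaussian_space_add_scale)

lemma gaussian_space_lin_span: "S \<subseteq> gaussian_space \<Longrightarrow> X \<in> lin_span S \<Longrightarrow> X \<in> gaussian_space"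
  unfolding lin_span_def by (auto intro!: gaussian_space_sum)

lemma gaussian_space_inner: "t \<in> {0..1} \<Longrightarrow> (\<lambda>\<omega>. c \<bullet> B t \<omega>) \<in> gaussian_space"
  unfolding gaussian_space_def by (intro CollectI exI[of _ "{t}"] exI[of _ "\<lambda>_. c"]) auto

lemma gaussian_space_measurable: "X \<in> gaussian_space \<Longrightarrow> X \<in> borel_measurable M"
proof -
  assume "X \<in> gaussian_space"
  then obtain T c where 1: "finite T" "T \<subseteq> {0..1}" "\<And>\<omega>. \<omega> \<in> space M \<Longrightarrow> X \<omega> = (\<Sum>t\<in>T. c t \<bullet> B t \<omega>)"
    unfolding gaussian_space_def by auto
  have "(\<lambda>\<omega>. \<Sum>t\<in>T. c t \<bullet> B t \<omega>) \<in> borel_measurable M"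
    using 1(2) by (intro borel_measurable_sum borel_measurable_inner borel_measurable_const B_measurable) auto
  then show ?thesis
    by (rule measurable_cong[THEN iffD1, rotated]) (simp add: 1(3))
qed

lemma number_operator_gaussian_space:
  fixes Y :: "'a \<Rightarrow> 'y::euclidean_space"
  assumes G: "G \<in> gaussian_space" "(\<integral>\<omega>. (G \<omega>)\<^sup>2 \<partial>M) = 1"
    and Y: "\<And>b. b \<in> Basis \<Longrightarrow> (\<lambda>\<omega>. Y \<omega> \<bullet> b) \<in> gaussian_space"
    and H: "expsmooth (Suc (Suc 0)) (\<lambda>i::unit. H)"
  shows "real m * (\<integral>\<omega>. hermite m (G \<omega>) * H (Y \<omega>) \<partial>M)
    = (\<integral>\<omega>. hermite m (G \<omega>) * number_op (\<lambda>b b'. \<integral>\<omega>. (Y \<omega> \<bullet> b) * (Y \<omega> \<bullet> b') \<partial>M) H (Y \<omega>) \<partial>M)"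
proof -
  obtain \<tau> n a \<beta> where g: "grid \<tau> n" and a: "\<And>\<omega>. \<omega> \<in> space M \<Longrightarrow> G \<omega> = lincomb \<tau> n a \<omega>"
    and \<beta>: "\<And>\<omega>. \<omega> \<in> space M \<Longrightarrow> Y \<omega> = grid_vec \<tau> n \<beta> \<omega>"
    using gaussian_space_grid[OF G(1) Y] by metis
  have "(\<integral>\<omega>. (G \<omega>)\<^sup>2 \<partial>M) = (\<integral>\<omega>. lincomb \<tau> n a \<omega> * lincomb \<tau> n a \<omega> \<partial>M)"
    by (rule Bochner_Integration.integral_cong) (auto simp: a power2_eq_square)
  then have aa: "grid_cov \<tau> n a a = 1" using G(2) covariance_lincomb[OF g] by simp
  have "(\<integral>\<omega>. (Y \<omega> \<bullet> b) * (Y \<omega> \<bullet> b') \<partial>M) = grid_cov \<tau> n (\<beta> b) (\<beta> b')"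
    if "b \<in> Basis" "b' \<in> Basis" for b b'
    unfolding covariance_lincomb[OF g, symmetric]
    by (rule Bochner_Integration.integral_cong) (auto simp: \<beta> grid_vec_inner that)
  then have C: "number_op (\<lambda>b b'. \<integral>\<omega>. (Y \<omega> \<bullet> b) * (Y \<omega> \<bullet> b') \<partial>M) H y = number_op (\<lambda>b b'. grid_cov \<tau> n (\<beta> b) (\<beta> b')) H y" for y
    by (rule number_op_cong)
  have "(\<integral>\<omega>. hermite m (G \<omega>) * H (Y \<omega>) \<partial>M) = (\<integral>\<omega>. hermite m (lincomb \<tau> n a \<omega>) * H (grid_vec \<tau> n \<beta> \<omega>) \<partial>M)"
    by (rule Bochner_Integration.integral_cong) (auto simp: a \<beta>)
  moreover have "(\<integral>\<omega>. hermite m (G \<omega>) * number_op (\<lambda>b b'. grid_cov \<tau> n (\<beta> b) (\<beta> b')) H (Y \<omega>) \<partial>M)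
    = (\<integral>\<omega>. hermite m (lincomb \<tau> n a \<omega>) * number_op (\<lambda>b b'. grid_cov \<tau> n (\<beta> b) (\<beta> b')) H (grid_vec \<tau> n \<beta> \<omega>) \<partial>M)"
    by (rule Bochner_Integration.integral_cong) (auto simp: a \<beta>)
  ultimately show ?thesis
    unfolding C using hermite_number_operator[OF g aa H] by simp
qed

text \<open>
  A bound on the variances suffices, by the Cauchy--Schwarz inequality.
\<close>
lemma gaussian_space_covariance_le:
  fixes Y :: "'a \<Rightarrow> 'y::euclidean_space"
  assumes Y: "\<And>b. b \<in> Basis \<Longrightarrow> (\<lambda>\<omega>. Y \<omega> \<bullet> b) \<in> gaussian_space" "\<And>b. b \<in> Basis \<Longrightarrow> (\<integral>\<omega>. (Y \<omega> \<bullet> b)\<^sup>2 \<partial>M) \<le> \<kappa>"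
    and b: "b \<in> Basis" "b' \<in> Basis"
  shows "\<bar>\<integral>\<omega>. (Y \<omega> \<bullet> b) * (Y \<omega> \<bullet> b') \<partial>M\<bar> \<le> \<kappa>"
proof -
  have L: "(\<lambda>\<omega>. Y \<omega> \<bullet> b) \<in> L2 M" if b: "b \<in> Basis" for b
  proof -
    obtain \<tau> n a \<beta> where g: "grid \<tau> n" and \<beta>: "\<And>\<omega>. \<omega> \<in> space M \<Longrightarrow> Y \<omega> = grid_vec \<tau> n \<beta> \<omega>"
      using gaussian_space_grid[OF Y(1)[OF b] Y(1)] by metis
    have "integrable M (\<lambda>\<omega>. (Y \<omega> \<bullet> b)\<^sup>2) \<longleftrightarrow> integrable M (\<lambda>\<omega>. lincomb \<tau> n (\<beta> b) \<omega> * lincomb \<tau> n (\<beta> b) \<omega>)"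
      by (intro Bochner_Integration.integrable_cong) (auto simp: \<beta> grid_vec_inner b power2_eq_square)
    then show ?thesis
      using integrable_lincomb_mult[OF g] gaussian_space_measurable[OF Y(1)[OF b]] by (simp add: L2_def)
  qed
  have "0 \<le> (\<integral>\<omega>. (Y \<omega> \<bullet> b)\<^sup>2 \<partial>M)" by simp
  then have \<kappa>0: "0 \<le> \<kappa>" using Y(2)[OF b(1)] by linarith
  have "\<bar>\<integral>\<omega>. (Y \<omega> \<bullet> b) * (Y \<omega> \<bullet> b') \<partial>M\<bar> \<le> sqrt (\<integral>\<omega>. (Y \<omega> \<bullet> b)\<^sup>2 \<partial>M) * sqrt (\<integral>\<omega>. (Y \<omega> \<bullet> b')\<^sup>2 \<partial>M)"
    by (rule L2_Cauchy_Schwarz[OF L[OF b(1)] L[OF b(2)]])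
  also have "\<dots> \<le> sqrt \<kappa> * sqrt \<kappa>"
    by (intro mult_mono real_sqrt_le_mono Y(2) b) (use \<kappa>0 in auto)
  also have "\<dots> = \<kappa>"
    using \<kappa>0 by simp
  finally show ?thesis .
qed

text \<open>
  The covariances of \<open>Y i\<close>, which are the coefficients of the number operator, are bounded uniformly in \<open>i\<close>.
  Therefore \<open>k\<close> applications of the operator use up \<open>2 k\<close> derivatives and leave a family of uniform
  exponential growth.
\<close>
lemma number_operator_power:
  fixes Y :: "nat \<Rightarrow> 'a \<Rightarrow> 'y::euclidean_space"
  assumes Y: "\<And>i b. b \<in> Basis \<Longrightarrow> (\<lambda>\<omega>. Y i \<omega> \<bullet> b) \<in> gaussian_space"
    and \<kappa>: "\<And>i b. b \<in> Basis \<Longrightarrow> (\<integral>\<omega>. (Y i \<omega> \<bullet> b)\<^sup>2 \<partial>M) \<le> \<kappa>"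
    and h: "expsmooth (2 * k) h"
  shows "\<exists>h'. expsmooth 0 h' \<and> (\<forall>i m G. G \<in> gaussian_space \<longrightarrow> (\<integral>\<omega>. (G \<omega>)\<^sup>2 \<partial>M) = 1 \<longrightarrow>
    real m ^ k * (\<integral>\<omega>. hermite m (G \<omega>) * h i (Y i \<omega>) \<partial>M) = (\<integral>\<omega>. hermite m (G \<omega>) * h' i (Y i \<omega>) \<partial>M))"
  using h
proof (induction k arbitrary: h)
  case 0
  then show ?case by (intro exI[of _ h]) auto
next
  case (Suc k)
  define C where "C i b b' = (\<integral>\<omega>. (Y i \<omega> \<bullet> b) * (Y i \<omega> \<bullet> b') \<partial>M)" for i b b'
  have h2: "expsmooth (Suc (Suc (2 * k))) h" using Suc.prems by simp
  have "expsmooth (2 * k) (\<lambda>i. number_op (C i) (h i))"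
    by (rule expsmooth_number_op[OF h2, of C \<kappa>]) (unfold C_def, rule gaussian_space_covariance_le[OF Y \<kappa>], auto)
  from Suc.IH[OF this] obtain h' where h': "expsmooth 0 h'"
    "\<And>i m G. G \<in> gaussian_space \<Longrightarrow> (\<integral>\<omega>. (G \<omega>)\<^sup>2 \<partial>M) = 1 \<Longrightarrow>
    real m ^ k * (\<integral>\<omega>. hermite m (G \<omega>) * number_op (C i) (h i) (Y i \<omega>) \<partial>M) = (\<integral>\<omega>. hermite m (G \<omega>) * h' i (Y i \<omega>) \<partial>M)"
    by blast
  have dec: "expsmooth (Suc (Suc j)) h \<Longrightarrow> expsmooth (Suc (Suc 0)) h" for j
  proof (induction j)
    case (Suc j)
    then show ?case using expsmooth_SucD by blast
  qed
  have "real m * (\<integral>\<omega>. hermite m (G \<omega>) * h i (Y i \<omega>) \<partial>M) = (\<integral>\<omega>. hermite m (G \<omega>) * number_op (C i) (h i) (Y i \<omega>) \<partial>M)"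
    if "G \<in> gaussian_space" "(\<integral>\<omega>. (G \<omega>)\<^sup>2 \<partial>M) = 1" for i m G
    unfolding C_def by (rule number_operator_gaussian_space[OF that Y expsmooth_unit[OF dec[OF h2]]])
  then show ?case
    using h' by (intro exI[of _ h']) (auto simp: mult.assoc power_Suc2 simp del: power_Suc)
qed

abbreviation chaos_gens :: "('a \<Rightarrow> real) set \<Rightarrow> nat \<Rightarrow> ('a \<Rightarrow> real) set" where
  "chaos_gens S n \<equiv> {(\<lambda>\<omega>. hermite n (G \<omega>)) | G. G \<in> lin_span S \<and> (\<integral>\<omega>. (G \<omega>)\<^sup>2 \<partial>M) = 1}"

lemma expbound_L2:
  fixes Y :: "'a \<Rightarrow> 'y::euclidean_space"
  assumes Y: "\<And>b. b \<in> Basis \<Longrightarrow> (\<lambda>\<omega>. Y \<omega> \<bullet> b) \<in> gaussian_space"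
    and KL: "0 \<le> K" "0 \<le> L" "\<And>y. \<bar>H y\<bar> \<le> K * exp (L * norm y)" and H: "H \<in> borel_measurable borel"
  shows "(\<lambda>\<omega>. H (Y \<omega>)) \<in> L2 M"
    and "(\<And>b. b \<in> Basis \<Longrightarrow> (\<integral>\<omega>. (Y \<omega> \<bullet> b)\<^sup>2 \<partial>M) \<le> \<kappa>) \<Longrightarrow>
      (\<integral>\<omega>. (H (Y \<omega>))\<^sup>2 \<partial>M) \<le> K\<^sup>2 * (real DIM('y) * (2 * exp ((2 * L * real DIM('y))\<^sup>2 * \<kappa> / 2)))"
proof -
  obtain \<tau> n \<beta> where g: "grid \<tau> n" and \<beta>: "\<And>\<omega>. \<omega> \<in> space M \<Longrightarrow> Y \<omega> = grid_vec \<tau> n \<beta> \<omega>"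
    using gaussian_space_grid[OF gaussian_space_zero Y] by metis
  have KL2: "(H y)\<^sup>2 \<le> K\<^sup>2 * exp ((2 * L) * norm y)" for y
  proof -
    have "(H y)\<^sup>2 = \<bar>H y\<bar>\<^sup>2" by simp
    also have "\<dots> \<le> (K * exp (L * norm y))\<^sup>2" by (rule power_mono[OF KL(3)]) simp
    also have "\<dots> = K\<^sup>2 * exp ((2 * L) * norm y)"
      by (simp add: power_mult_distrib exp_double[symmetric] mult.assoc)
    finally show ?thesis .
  qed
  have Ym: "Y \<in> borel_measurable M"
    using grid_vec_measurable[OF g] by (rule measurable_cong[THEN iffD1, rotated]) (simp add: \<beta>)
  have i: "integrable M (\<lambda>\<omega>. (H (Y \<omega>))\<^sup>2) \<longleftrightarrow> integrable M (\<lambda>\<omega>. (H (grid_vec \<tau> n \<beta> \<omega>))\<^sup>2)"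
    by (intro Bochner_Integration.integrable_cong) (auto simp: \<beta>)
  have i2: "integrable M (\<lambda>\<omega>. (H (grid_vec \<tau> n \<beta> \<omega>))\<^sup>2)"
    by (rule integrable_grid_vec[OF g, where L="2 * L" and K="K\<^sup>2"]) (use KL KL2 H in auto)
  then show "(\<lambda>\<omega>. H (Y \<omega>)) \<in> L2 M"
    using i Ym H by (auto simp: L2_def intro: measurable_compose)
  assume \<kappa>: "\<And>b. b \<in> Basis \<Longrightarrow> (\<integral>\<omega>. (Y \<omega> \<bullet> b)\<^sup>2 \<partial>M) \<le> \<kappa>"
  have cov: "grid_cov \<tau> n (\<beta> b) (\<beta> b) \<le> \<kappa>" if b: "b \<in> Basis" for b
  proof -
    have "grid_cov \<tau> n (\<beta> b) (\<beta> b) = (\<integral>\<omega>. (Y \<omega> \<bullet> b)\<^sup>2 \<partial>M)"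
      unfolding covariance_lincomb[OF g, symmetric]
      by (rule Bochner_Integration.integral_cong) (auto simp: \<beta> grid_vec_inner b power2_eq_square)
    then show ?thesis using \<kappa>[OF b] by simp
  qed
  have "(\<integral>\<omega>. (H (Y \<omega>))\<^sup>2 \<partial>M) = (\<integral>\<omega>. (H (grid_vec \<tau> n \<beta> \<omega>))\<^sup>2 \<partial>M)"
    by (rule Bochner_Integration.integral_cong) (auto simp: \<beta>)
  also have "\<dots> \<le> (\<integral>\<omega>. K\<^sup>2 * exp ((2 * L) * norm (grid_vec \<tau> n \<beta> \<omega>)) \<partial>M)"
    using KL by (intro integral_mono i2 integrable_mult_right exp_norm_grid_vec g KL2) auto
  also have "\<dots> = K\<^sup>2 * (\<integral>\<omega>. exp ((2 * L) * norm (grid_vec \<tau> n \<beta> \<omega>)) \<partial>M)" by simp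
  also have "\<dots> \<le> K\<^sup>2 * (\<Sum>b\<in>(Basis::'y set). 2 * exp ((2 * L * real DIM('y))\<^sup>2 * grid_cov \<tau> n (\<beta> b) (\<beta> b) / 2))"
    using KL by (intro mult_left_mono exp_norm_grid_vec g) auto
  also have "\<dots> \<le> K\<^sup>2 * (\<Sum>b\<in>(Basis::'y set). 2 * exp ((2 * L * real DIM('y))\<^sup>2 * \<kappa> / 2))"
    by (intro mult_left_mono sum_mono) (auto intro!: mult_left_mono cov)
  finally show "(\<integral>\<omega>. (H (Y \<omega>))\<^sup>2 \<partial>M) \<le> K\<^sup>2 * (real DIM('y) * (2 * exp ((2 * L * real DIM('y))\<^sup>2 * \<kappa> / 2)))"
    by simp
qed

lemma chaos_gens_L2:
  assumes S: "S \<subseteq> gaussian_space" shows "chaos_gens S n \<subseteq> L2 M"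
proof clarify
  fix G assume G: "G \<in> lin_span S"
  obtain K L where KL: "0 \<le> K" "0 \<le> L" "\<And>x. \<bar>hermite n x\<bar> \<le> K * exp (L * norm x)"
    using expbound_hermite[of n] unfolding expbound_def by auto
  have "(\<lambda>\<omega>. G \<omega> \<bullet> b) \<in> gaussian_space" if "b \<in> Basis" for b :: real
    using gaussian_space_lin_span[OF S G] that by simp
  from expbound_L2(1)[where Y=G, OF this KL hermite_measurable]
  show "(\<lambda>\<omega>. hermite n (G \<omega>)) \<in> L2 M" .
qed

text \<open>
  On the span of the Hermite polynomials of degree \<open>m\<close>, the factor \<open>m ^ k\<close> moves to the other side as
  the \<open>k\<close>-th power of the number operator; what it produces is bounded in \<open>L2\<close> uniformly in \<open>i\<close>.
\<close>
lemma chaos_decay_span: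
  fixes Y :: "nat \<Rightarrow> 'a \<Rightarrow> 'y::euclidean_space"
  assumes S: "S \<subseteq> gaussian_space"
    and Y: "\<And>i b. b \<in> Basis \<Longrightarrow> (\<lambda>\<omega>. Y i \<omega> \<bullet> b) \<in> gaussian_space"
    and \<kappa>: "\<And>i b. b \<in> Basis \<Longrightarrow> (\<integral>\<omega>. (Y i \<omega> \<bullet> b)\<^sup>2 \<partial>M) \<le> \<kappa>"
    and h: "expsmooth (2 * k) h"
  shows "\<exists>K\<ge>0. \<forall>i m. \<forall>X\<in>lin_span (chaos_gens S m).
     real m ^ k * \<bar>\<integral>\<omega>. X \<omega> * h i (Y i \<omega>) \<partial>M\<bar> \<le> K * sqrt (\<integral>\<omega>. (X \<omega>)\<^sup>2 \<partial>M)"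
proof -
  obtain h' where h': "expsmooth 0 h'"
    and eq: "\<And>i m G. G \<in> gaussian_space \<Longrightarrow> (\<integral>\<omega>. (G \<omega>)\<^sup>2 \<partial>M) = 1 \<Longrightarrow>
    real m ^ k * (\<integral>\<omega>. hermite m (G \<omega>) * h i (Y i \<omega>) \<partial>M) = (\<integral>\<omega>. hermite m (G \<omega>) * h' i (Y i \<omega>) \<partial>M)"
    using number_operator_power[of Y \<kappa> k h, OF Y \<kappa> h] by blast
  obtain K L where KL: "0 \<le> K" "0 \<le> L" "\<And>i y. \<bar>h i y\<bar> \<le> K * exp (L * norm y)" "\<And>i y. \<bar>h' i y\<bar> \<le> K * exp (L * norm y)"
    using expbound_common[OF expsmooth_imp_expbound[OF h] expsmooth_imp_expbound[OF h']] by metis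
  have hL: "(\<lambda>\<omega>. h i (Y i \<omega>)) \<in> L2 M" for i
    by (rule expbound_L2[OF Y KL(1-3) expsmooth_measurable[OF h]])
  have h'L: "(\<lambda>\<omega>. h' i (Y i \<omega>)) \<in> L2 M" for i
    by (rule expbound_L2[OF Y KL(1,2,4) expsmooth_measurable[OF h']])
  define Q where "Q = K\<^sup>2 * (real DIM('y) * (2 * exp ((2 * L * real DIM('y))\<^sup>2 * \<kappa> / 2)))"
  have Q: "(\<integral>\<omega>. (h' i (Y i \<omega>))\<^sup>2 \<partial>M) \<le> Q" for i
    unfolding Q_def by (rule expbound_L2(2)[OF Y KL(1,2,4) expsmooth_measurable[OF h'] \<kappa>])
  show ?thesis
  proof (intro exI[of _ "sqrt Q"] conjI allI ballI)
    show "0 \<le> sqrt Q" by (simp add: Q_def)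
    fix i m X assume X: "X \<in> lin_span (chaos_gens S m)"
    then have XL: "X \<in> L2 M" using L2_lin_span[OF chaos_gens_L2[OF S]] by auto
    obtain A c where A: "finite A" "A \<subseteq> chaos_gens S m" "X = (\<lambda>\<omega>. \<Sum>U\<in>A. c U * U \<omega>)"
      using X unfolding lin_span_def by auto
    have AL: "U \<in> L2 M" if "U \<in> A" for U using that A(2) chaos_gens_L2[OF S] by blast
    have XI: "(\<integral>\<omega>. X \<omega> * g \<omega> \<partial>M) = (\<Sum>U\<in>A. c U * (\<integral>\<omega>. U \<omega> * g \<omega> \<partial>M))" if g: "g \<in> L2 M" for g
      unfolding A(3) sum_distrib_right
      using AL L2_integrable_mult[OF AL g]
      by (subst Bochner_Integration.integral_sum) (auto simp: mult.assoc)
    have "real m ^ k * (\<integral>\<omega>. U \<omega> * h i (Y i \<omega>) \<partial>M) = (\<integral>\<omega>. U \<omega> * h' i (Y i \<omega>) \<partial>M)" if "U \<in> A" for U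
      using that A(2) eq gaussian_space_lin_span[OF S] by blast
    then have "real m ^ k * (\<integral>\<omega>. X \<omega> * h i (Y i \<omega>) \<partial>M) = (\<integral>\<omega>. X \<omega> * h' i (Y i \<omega>) \<partial>M)"
      unfolding XI[OF hL] XI[OF h'L] sum_distrib_left by (intro sum.cong) (auto simp: mult.left_commute)
    then have "real m ^ k * \<bar>\<integral>\<omega>. X \<omega> * h i (Y i \<omega>) \<partial>M\<bar> = \<bar>\<integral>\<omega>. X \<omega> * h' i (Y i \<omega>) \<partial>M\<bar>"
      by (metis abs_mult abs_of_nat of_nat_power)
    also have "\<dots> \<le> sqrt (\<integral>\<omega>. (X \<omega>)\<^sup>2 \<partial>M) * sqrt (\<integral>\<omega>. (h' i (Y i \<omega>))\<^sup>2 \<partial>M)"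
      by (rule L2_Cauchy_Schwarz[OF XL h'L])
    also have "\<dots> \<le> sqrt (\<integral>\<omega>. (X \<omega>)\<^sup>2 \<partial>M) * sqrt Q"
      by (intro mult_left_mono real_sqrt_le_mono Q) simp
    finally show "real m ^ k * \<bar>\<integral>\<omega>. X \<omega> * h i (Y i \<omega>) \<partial>M\<bar> \<le> sqrt Q * sqrt (\<integral>\<omega>. (X \<omega>)\<^sup>2 \<partial>M)"
      by (simp add: mult.commute)
  qed
qed

text \<open>
  The bounds of \<open>chaos_decay_span\<close> do not depend on \<open>i\<close> and pass to the limit \<open>F\<close>; they extend to the closed
  span because \<open>F\<close> is bounded. The chaos of order \<open>0\<close> is treated separately, since \<open>m ^ k\<close> says nothing there.
\<close>
lemma chaos_decay:
  fixes Y :: "nat \<Rightarrow> 'a \<Rightarrow> 'y::euclidean_space"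
  assumes S: "S \<subseteq> gaussian_space"
    and Y: "\<And>i b. b \<in> Basis \<Longrightarrow> (\<lambda>\<omega>. Y i \<omega> \<bullet> b) \<in> gaussian_space"
    and \<kappa>: "\<And>i b. b \<in> Basis \<Longrightarrow> (\<integral>\<omega>. (Y i \<omega> \<bullet> b)\<^sup>2 \<partial>M) \<le> \<kappa>"
    and h: "\<And>k. expsmooth k h"
    and F: "F \<in> borel_measurable M" and lim: "\<And>\<omega>. \<omega> \<in> space M \<Longrightarrow> (\<lambda>i. h i (Y i \<omega>)) \<longlonglongrightarrow> F \<omega>"
    and bd: "\<And>i y. \<bar>h i y\<bar> \<le> C"
  shows "\<exists>K\<ge>0. \<forall>m. \<forall>X\<in>wiener_chaos M S m.
      real (m + 1) ^ k * \<bar>\<integral>\<omega>. X \<omega> * F \<omega> \<partial>M\<bar> \<le> K * sqrt (\<integral>\<omega>. (X \<omega>)\<^sup>2 \<partial>M)"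
proof -
  have C: "0 \<le> C" using bd[of 0 0] by linarith
  have Fb: "\<bar>F \<omega>\<bar> \<le> C" if "\<omega> \<in> space M" for \<omega>
    by (rule LIMSEQ_le_const2[OF tendsto_rabs[OF lim[OF that]]]) (use bd in auto)
  have FL: "F \<in> L2 M"
  proof -
    have "integrable M (\<lambda>\<omega>. (F \<omega>)\<^sup>2)"
      by (rule integrable_const_bound[where B="C\<^sup>2"])
        (use Fb F C in \<open>auto intro!: AE_I2 simp: abs_le_square_iff[symmetric]\<close>)
    then show ?thesis using F by (simp add: L2_def)
  qed
  have Fn: "sqrt (\<integral>\<omega>. (F \<omega>)\<^sup>2 \<partial>M) \<le> C"
  proof -
    have "(\<integral>\<omega>. (F \<omega>)\<^sup>2 \<partial>M) \<le> (\<integral>\<omega>. C\<^sup>2 \<partial>M)"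
      using FL Fb C by (intro integral_mono) (auto simp: L2_def abs_le_square_iff[symmetric])
    then show ?thesis using C by (simp add: prob_space real_le_lsqrt)
  qed
  have main: "\<exists>K\<ge>0. \<forall>m. \<forall>X\<in>wiener_chaos M S m.
      real m ^ k * \<bar>\<integral>\<omega>. X \<omega> * F \<omega> \<partial>M\<bar> \<le> K * sqrt (2 * (\<integral>\<omega>. (X \<omega>)\<^sup>2 \<partial>M))"
  proof -
    obtain K where K: "0 \<le> K" "\<And>i m X. X \<in> lin_span (chaos_gens S m) \<Longrightarrow>
     real m ^ k * \<bar>\<integral>\<omega>. X \<omega> * h i (Y i \<omega>) \<partial>M\<bar> \<le> K * sqrt (\<integral>\<omega>. (X \<omega>)\<^sup>2 \<partial>M)"
      using chaos_decay_span[of S Y \<kappa> k h, OF S Y \<kappa> h] by blast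
    have span: "real m ^ k * \<bar>\<integral>\<omega>. X \<omega> * F \<omega> \<partial>M\<bar> \<le> K * sqrt (\<integral>\<omega>. (X \<omega>)\<^sup>2 \<partial>M)"
      if X: "X \<in> lin_span (chaos_gens S m)" for m X
    proof -
      have XL: "X \<in> L2 M" using L2_lin_span[OF chaos_gens_L2[OF S] X] .
      have Xi: "integrable M X"
        using L2_integrable_mult[OF XL, of "\<lambda>_. 1"] by (simp add: L2_def)
      have "(\<lambda>i. \<integral>\<omega>. X \<omega> * h i (Y i \<omega>) \<partial>M) \<longlonglongrightarrow> (\<integral>\<omega>. X \<omega> * F \<omega> \<partial>M)"
      proof (rule integral_dominated_convergence[where w="\<lambda>\<omega>. \<bar>X \<omega>\<bar> * C"])
        show "(\<lambda>\<omega>. X \<omega> * h i (Y i \<omega>)) \<in> borel_measurable M" for i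
        proof -
          obtain K' L' where "0 \<le> K'" "0 \<le> L'" "\<And>i y. \<bar>h i y\<bar> \<le> K' * exp (L' * norm y)"
            using expsmooth_imp_expbound[OF h[of 0]] unfolding expbound_def by blast
          then have "(\<lambda>\<omega>. h i (Y i \<omega>)) \<in> L2 M"
            by (intro expbound_L2[OF Y] expsmooth_measurable[OF h[of 0]])
          then show ?thesis using XL by (auto simp: L2_def)
        qed
        show "AE \<omega> in M. (\<lambda>i. X \<omega> * h i (Y i \<omega>)) \<longlonglongrightarrow> X \<omega> * F \<omega>"
          by (intro AE_I2 tendsto_mult tendsto_const lim)
        show "AE \<omega> in M. norm (X \<omega> * h i (Y i \<omega>)) \<le> \<bar>X \<omega>\<bar> * C" for i
          by (intro AE_I2) (auto simp: abs_mult intro!: mult_left_mono bd)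
      qed (use XL F Xi in \<open>auto simp: L2_def\<close>)
      then have "(\<lambda>i. real m ^ k * \<bar>\<integral>\<omega>. X \<omega> * h i (Y i \<omega>) \<partial>M\<bar>) \<longlonglongrightarrow> real m ^ k * \<bar>\<integral>\<omega>. X \<omega> * F \<omega> \<partial>M\<bar>"
        by (intro tendsto_intros)
      then show ?thesis by (rule LIMSEQ_le_const2) (use K(2)[OF X] in auto)
    qed
    have "real m ^ k * \<bar>\<integral>\<omega>. X \<omega> * F \<omega> \<partial>M\<bar> \<le> K * sqrt (2 * (\<integral>\<omega>. (X \<omega>)\<^sup>2 \<partial>M))"
      if X: "X \<in> wiener_chaos M S m" for m X
    proof -
      have XL: "X \<in> L2 M" using wiener_chaos_L2[OF X] .
      define v where "v = (\<integral>\<omega>. (X \<omega>)\<^sup>2 \<partial>M)"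
      define \<phi> where "\<phi> e = K * sqrt (2 * v + 2 * e) + real m ^ k * (sqrt e * C)" for e
      have "real m ^ k * \<bar>\<integral>\<omega>. X \<omega> * F \<omega> \<partial>M\<bar> \<le> \<phi> e" if e: "0 < e" for e
      proof -
        obtain Z where Z: "Z \<in> lin_span (chaos_gens S m)" "(\<integral>\<omega>. (X \<omega> - Z \<omega>)\<^sup>2 \<partial>M) < e"
          using X e unfolding wiener_chaos_def by blast
        have ZL: "Z \<in> L2 M" using L2_lin_span[OF chaos_gens_L2[OF S] Z(1)] .
        note DL = L2_diff[OF XL ZL]
        have "(\<integral>\<omega>. (Z \<omega>)\<^sup>2 \<partial>M) \<le> (\<integral>\<omega>. 2 * (X \<omega>)\<^sup>2 + 2 * (X \<omega> - Z \<omega>)\<^sup>2 \<partial>M)"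
        proof (rule integral_mono)
          show "(Z \<omega>)\<^sup>2 \<le> 2 * (X \<omega>)\<^sup>2 + 2 * (X \<omega> - Z \<omega>)\<^sup>2" for \<omega>
            using square_diff_le[of "X \<omega>" "X \<omega> - Z \<omega>"] by simp
        qed (use XL ZL DL in \<open>auto simp: L2_def\<close>)
        also have "\<dots> = 2 * v + 2 * (\<integral>\<omega>. (X \<omega> - Z \<omega>)\<^sup>2 \<partial>M)"
          unfolding v_def using XL DL by (simp add: L2_def)
        finally have Zv: "(\<integral>\<omega>. (Z \<omega>)\<^sup>2 \<partial>M) \<le> 2 * v + 2 * e" using Z(2) by linarith
        have "(\<integral>\<omega>. X \<omega> * F \<omega> \<partial>M) = (\<integral>\<omega>. Z \<omega> * F \<omega> + (X \<omega> - Z \<omega>) * F \<omega> \<partial>M)"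
          by (simp add: algebra_simps)
        also have "\<dots> = (\<integral>\<omega>. Z \<omega> * F \<omega> \<partial>M) + (\<integral>\<omega>. (X \<omega> - Z \<omega>) * F \<omega> \<partial>M)"
          by (rule Bochner_Integration.integral_add[OF L2_integrable_mult[OF ZL FL] L2_integrable_mult[OF DL FL]])
        finally have "\<bar>\<integral>\<omega>. X \<omega> * F \<omega> \<partial>M\<bar> \<le> \<bar>\<integral>\<omega>. Z \<omega> * F \<omega> \<partial>M\<bar> + \<bar>\<integral>\<omega>. (X \<omega> - Z \<omega>) * F \<omega> \<partial>M\<bar>"
          by simp
        also have "\<bar>\<integral>\<omega>. (X \<omega> - Z \<omega>) * F \<omega> \<partial>M\<bar> \<le> sqrt (\<integral>\<omega>. (X \<omega> - Z \<omega>)\<^sup>2 \<partial>M) * sqrt (\<integral>\<omega>. (F \<omega>)\<^sup>2 \<partial>M)"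
          by (rule L2_Cauchy_Schwarz[OF DL FL])
        also have "\<dots> \<le> sqrt e * C"
          using Z(2) Fn e by (intro mult_mono real_sqrt_le_mono) auto
        finally have "real m ^ k * \<bar>\<integral>\<omega>. X \<omega> * F \<omega> \<partial>M\<bar> \<le> real m ^ k * (\<bar>\<integral>\<omega>. Z \<omega> * F \<omega> \<partial>M\<bar> + sqrt e * C)"
          by (intro mult_left_mono) auto
        also have "\<dots> = real m ^ k * \<bar>\<integral>\<omega>. Z \<omega> * F \<omega> \<partial>M\<bar> + real m ^ k * (sqrt e * C)"
          by (simp add: algebra_simps)
        also have "real m ^ k * \<bar>\<integral>\<omega>. Z \<omega> * F \<omega> \<partial>M\<bar> \<le> K * sqrt (\<integral>\<omega>. (Z \<omega>)\<^sup>2 \<partial>M)"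
          by (rule span[OF Z(1)])
        also have "\<dots> \<le> K * sqrt (2 * v + 2 * e)"
          by (intro mult_left_mono real_sqrt_le_mono Zv K)
        finally show ?thesis by (simp add: \<phi>_def)
      qed
      moreover have "(\<phi> \<longlongrightarrow> K * sqrt (2 * v + 2 * 0) + real m ^ k * (sqrt 0 * C)) (at_right 0)"
        unfolding \<phi>_def[abs_def] by (intro tendsto_intros)
      ultimately show ?thesis
        by (intro tendsto_lowerbound[where F="at_right (0::real)"]) (auto simp: v_def intro!: eventually_at_rightI[of 0 1])
    qed
    then show ?thesis using K(1) by blast
  qed
  then obtain K where K: "0 \<le> K" "\<And>m X. X \<in> wiener_chaos M S m \<Longrightarrow>
      real m ^ k * \<bar>\<integral>\<omega>. X \<omega> * F \<omega> \<partial>M\<bar> \<le> K * sqrt (2 * (\<integral>\<omega>. (X \<omega>)\<^sup>2 \<partial>M))"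
    by blast
  show ?thesis
  proof (intro exI[of _ "2 ^ k * (K * sqrt 2) + C"] conjI allI ballI)
    show "0 \<le> 2 ^ k * (K * sqrt 2) + C" using K C by simp
    fix m X assume X: "X \<in> wiener_chaos M S m"
    define v where "v = sqrt (\<integral>\<omega>. (X \<omega>)\<^sup>2 \<partial>M)"
    have v: "0 \<le> v" by (simp add: v_def)
    show "real (m + 1) ^ k * \<bar>\<integral>\<omega>. X \<omega> * F \<omega> \<partial>M\<bar> \<le> (2 ^ k * (K * sqrt 2) + C) * sqrt (\<integral>\<omega>. (X \<omega>)\<^sup>2 \<partial>M)"
    proof (cases "m = 0")
      case True
      have "\<bar>\<integral>\<omega>. X \<omega> * F \<omega> \<partial>M\<bar> \<le> v * sqrt (\<integral>\<omega>. (F \<omega>)\<^sup>2 \<partial>M)"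
        unfolding v_def by (rule L2_Cauchy_Schwarz[OF wiener_chaos_L2[OF X] FL])
      also have "\<dots> \<le> C * v" using mult_left_mono[OF Fn v] by (simp add: mult.commute)
      also have "\<dots> \<le> (2 ^ k * (K * sqrt 2) + C) * v"
        using K v by (intro mult_right_mono) auto
      finally show ?thesis using True by (simp add: v_def)
    next
      case False
      then have "real (m + 1) ^ k \<le> (2 * real m) ^ k" by (intro power_mono) auto
      then have "real (m + 1) ^ k * \<bar>\<integral>\<omega>. X \<omega> * F \<omega> \<partial>M\<bar> \<le> (2 * real m) ^ k * \<bar>\<integral>\<omega>. X \<omega> * F \<omega> \<partial>M\<bar>"
        by (rule mult_right_mono) simp
      also have "\<dots> = 2 ^ k * (real m ^ k * \<bar>\<integral>\<omega>. X \<omega> * F \<omega> \<partial>M\<bar>)"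
        by (simp add: power_mult_distrib)
      also have "\<dots> \<le> 2 ^ k * (K * sqrt (2 * (\<integral>\<omega>. (X \<omega>)\<^sup>2 \<partial>M)))"
        by (intro mult_left_mono K(2)[OF X]) simp
      also have "\<dots> = 2 ^ k * (K * sqrt 2) * v"
        by (simp add: v_def real_sqrt_mult)
      also have "\<dots> \<le> (2 ^ k * (K * sqrt 2) + C) * v"
        using C v by (intro mult_right_mono) auto
      finally show ?thesis by (simp add: v_def)
    qed
  qed
qed

end

section \<open>Functionals on path space and smooth cylindrical functions\<close>

definition ramp :: "real \<Rightarrow> real" where "ramp s = max 0 (min 1 s)"

text \<open>
  The hat function with node \<open>k / m\<close> and mesh \<open>1 / m\<close>, written as a difference of two ramps. Linear
  interpolation of \<open>x\<close> on this mesh is the sum over \<open>k\<close> of \<open>x (k / m)\<close> times \<open>hat m k\<close>.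
\<close>
definition hat :: "nat \<Rightarrow> nat \<Rightarrow> real \<Rightarrow> real" where
  "hat m k t = ramp (real m * t - real k + 1) - ramp (real m * t - real k)"

lemma hat_nonneg: "0 \<le> hat m k t"
  by (simp add: hat_def ramp_def)

lemma hat_eq_0: "1 \<le> \<bar>real m * t - real k\<bar> \<Longrightarrow> hat m k t = 0"
  by (auto simp: hat_def ramp_def)

lemma sum_hat:
  assumes "t \<in> {0..1}"
  shows "(\<Sum>k\<le>m. hat m k t) = 1"
proof -
  have "(\<Sum>k\<le>j. hat m k t) = ramp (real m * t + 1) - ramp (real m * t - real j)" for j
    by (induction j) (auto simp: hat_def algebra_simps)
  moreover have "ramp (real m * t + 1) = 1" using assms by (simp add: ramp_def)
  moreover have "real m * t \<le> real m" using assms by (simp add: mult_left_le)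
  then have "ramp (real m * t - real m) = 0" by (simp add: ramp_def)
  ultimately show ?thesis by simp
qed

lemma hat_W01: "1 \<le> k \<Longrightarrow> hat m k \<in> W01"
  unfolding W01_def hat_def [abs_def] ramp_def by (auto intro!: continuous_intros)

lemma W01_lincomb: "x \<in> W01 \<Longrightarrow> y \<in> W01 \<Longrightarrow> (\<lambda>t. a * x t + b * y t) \<in> W01"
  by (auto simp: W01_def intro!: continuous_intros)

lemma W01_sum:
  "finite A \<Longrightarrow> (\<And>k. k \<in> A \<Longrightarrow> y k \<in> W01) \<Longrightarrow> (\<lambda>t. \<Sum>k\<in>A. c k * y k t) \<in> W01"
  by (auto simp: W01_def intro!: continuous_intros)

lemma W01_dual_lincomb:
  "l \<in> W01_dual \<Longrightarrow> x \<in> W01 \<Longrightarrow> y \<in> W01 \<Longrightarrow> l (\<lambda>t. a * x t + b * y t) = a * l x + b * l y"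
  unfolding W01_dual_def by blast

lemma W01_dual_sum:
  assumes l: "l \<in> W01_dual" and A: "finite A"
  shows "(\<And>k. k \<in> A \<Longrightarrow> y k \<in> W01) \<Longrightarrow> l (\<lambda>t. \<Sum>k\<in>A. c k * y k t) = (\<Sum>k\<in>A. c k * l (y k))"
  using A
proof (induction A rule: finite_induct)
  case empty
  have 0: "(\<lambda>t. 0) \<in> W01" by (simp add: W01_def)
  show ?case using W01_dual_lincomb[OF l 0 0, of 0 0] by simp
next
  case (insert k A)
  have "(\<lambda>t. \<Sum>k\<in>A. c k * y k t) \<in> W01" using insert by (intro W01_sum) auto
  from W01_dual_lincomb[OF l _ this, of "y k" "c k" 1] insert show ?case by simp
qed

lemma W01_dual_bound:
  assumes "l \<in> W01_dual"
  obtains C where "0 \<le> C" "\<And>x e. x \<in> W01 \<Longrightarrow> (\<And>t. t \<in> {0..1} \<Longrightarrow> \<bar>x t\<bar> \<le> e) \<Longrightarrow> \<bar>l x\<bar> \<le> C * e"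
proof -
  obtain C where C: "\<And>x. x \<in> W01 \<Longrightarrow> \<bar>l x\<bar> \<le> C * (SUP t\<in>{0..1}. \<bar>x t\<bar>)"
    using assms unfolding W01_dual_def by blast
  show thesis
  proof (rule that[of "\<bar>C\<bar>"])
    fix x :: "real \<Rightarrow> real" and e assume x: "x \<in> W01" and e: "\<And>t. t \<in> {0..1} \<Longrightarrow> \<bar>x t\<bar> \<le> e"
    have up: "(SUP t\<in>{0..1}. \<bar>x t\<bar>) \<le> e" by (rule cSUP_least) (use e in auto)
    have "0 \<le> \<bar>x 0\<bar>" by simp
    also have "\<bar>x 0\<bar> \<le> (SUP t\<in>{0..1}. \<bar>x t\<bar>)"
      by (rule cSUP_upper) (use e in \<open>auto intro!: bdd_aboveI2[where M=e]\<close>)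
    finally have lo: "0 \<le> (SUP t\<in>{0..1}. \<bar>x t\<bar>)" .
    have "\<bar>l x\<bar> \<le> C * (SUP t\<in>{0..1}. \<bar>x t\<bar>)" by (rule C[OF x])
    also have "\<dots> \<le> \<bar>C\<bar> * (SUP t\<in>{0..1}. \<bar>x t\<bar>)" using lo by (intro mult_right_mono) auto
    also have "\<dots> \<le> \<bar>C\<bar> * e" using up by (intro mult_left_mono) auto
    finally show "\<bar>l x\<bar> \<le> \<bar>C\<bar> * e" .
  qed simp
qed

text \<open>
  The coefficients of a functional on the interpolating functions form a discretised signed measure:
  their total variation is the value of the functional at a sum of hat functions with signs, whose supremum norm is at most \<open>1\<close>.
\<close>
lemma W01_dual_hat_bound:
  assumes l: "l \<in> W01_dual"
  obtains C where "0 \<le> C" "\<And>m. (\<Sum>k=1..m. \<bar>l (hat m k)\<bar>) \<le> C"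
proof -
  obtain C where C: "0 \<le> C" "\<And>x e. x \<in> W01 \<Longrightarrow> (\<And>t. t \<in> {0..1} \<Longrightarrow> \<bar>x t\<bar> \<le> e) \<Longrightarrow> \<bar>l x\<bar> \<le> C * e"
    using W01_dual_bound[OF l] by metis
  show thesis
  proof (rule that[OF C(1)])
    fix m
    define y where "y t = (\<Sum>k=1..m. sgn (l (hat m k)) * hat m k t)" for t
    have y: "y \<in> W01" unfolding y_def[abs_def] by (intro W01_sum hat_W01) auto
    have "\<bar>y t\<bar> \<le> 1" if t: "t \<in> {0..1}" for t
    proof -
      have "\<bar>y t\<bar> \<le> (\<Sum>k=1..m. \<bar>sgn (l (hat m k)) * hat m k t\<bar>)"
        unfolding y_def by (rule sum_abs)
      also have "\<dots> \<le> (\<Sum>k=1..m. hat m k t)"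
        by (intro sum_mono) (auto simp: abs_mult sgn_if hat_nonneg)
      also have "\<dots> \<le> (\<Sum>k\<le>m. hat m k t)"
        by (intro sum_mono2) (auto simp: hat_nonneg)
      finally show ?thesis by (simp add: sum_hat[OF t])
    qed
    from C(2)[OF y this] have "\<bar>l y\<bar> \<le> C" by simp
    moreover have "l y = (\<Sum>k=1..m. sgn (l (hat m k)) * l (hat m k))"
      unfolding y_def[abs_def] by (rule W01_dual_sum[OF l]) (auto intro: hat_W01)
    moreover have "\<dots> = (\<Sum>k=1..m. \<bar>l (hat m k)\<bar>)"
      by (intro sum.cong) (auto simp: abs_sgn mult.commute)
    ultimately show "(\<Sum>k=1..m. \<bar>l (hat m k)\<bar>) \<le> C"
      using abs_ge_self[of "l y"] by linarith
  qed
qed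

text \<open>
  The interpolations of a path converge to it uniformly. The node \<open>k = 0\<close> may be left out of the
  sum because paths start at \<open>0\<close>.
\<close>
lemma W01_dual_interpolation:
  assumes l: "l \<in> W01_dual" and x: "x \<in> W01"
  shows "(\<lambda>i. \<Sum>k=1..Suc i. x (real k / real (Suc i)) * l (hat (Suc i) k)) \<longlonglongrightarrow> l x"
proof -
  obtain C where C: "0 \<le> C" "\<And>x e. x \<in> W01 \<Longrightarrow> (\<And>t. t \<in> {0..1} \<Longrightarrow> \<bar>x t\<bar> \<le> e) \<Longrightarrow> \<bar>l x\<bar> \<le> C * e"
    using W01_dual_bound[OF l] by metis
  have "uniformly_continuous_on {0..1} x"
    using x by (intro compact_uniformly_continuous) (auto simp: W01_def)
  show ?thesis
  proof (rule LIMSEQ_I)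
    fix e :: real assume e: "0 < e"
    define e' where "e' = e / (C + 1)"
    have e': "0 < e'" using e C by (simp add: e'_def)
    obtain d where d: "0 < d" "\<And>s t. s \<in> {0..1} \<Longrightarrow> t \<in> {0..1} \<Longrightarrow> \<bar>s - t\<bar> < d \<Longrightarrow> \<bar>x s - x t\<bar> < e'"
      using \<open>uniformly_continuous_on {0..1} x\<close> e' unfolding uniformly_continuous_on_def dist_real_def by metis
    obtain N where N: "1 / real (Suc N) < d" using d(1) nat_approx_posE by metis
    show "\<exists>no. \<forall>n\<ge>no. norm ((\<Sum>k=1..Suc n. x (real k / real (Suc n)) * l (hat (Suc n) k)) - l x) < e"
    proof (intro exI[of _ N] allI impI)
      fix n assume n: "N \<le> n"
      define m where "m = Suc n"
      have m: "0 < real m" by (simp add: m_def)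
      have "1 / real m \<le> 1 / real (Suc N)" using n by (simp add: m_def frac_le)
      then have md: "1 / real m < d" using N by linarith
      define y where "y t = (\<Sum>k=1..m. x (real k / real m) * hat m k t)" for t
      have y: "y \<in> W01" unfolding y_def[abs_def] by (intro W01_sum hat_W01) auto
      have ly: "l y = (\<Sum>k=1..m. x (real k / real m) * l (hat m k))"
        unfolding y_def[abs_def] by (rule W01_dual_sum[OF l]) (auto intro: hat_W01)
      have "\<bar>1 * y t + (-1) * x t\<bar> \<le> e'" if t: "t \<in> {0..1}" for t
      proof -
        have "(\<Sum>k\<le>m. x (real k / real m) * hat m k t) = y t"
        proof -
          have "x 0 = 0" using x by (simp add: W01_def)
          moreover have "{..m} = insert 0 {1..m}" by auto
          ultimately show ?thesis by (simp add: y_def)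
        qed
        then have "y t - x t = (\<Sum>k\<le>m. (x (real k / real m) - x t) * hat m k t)"
          using sum_hat[OF t, of m] by (simp add: left_diff_distrib sum_subtractf sum_distrib_left[symmetric])
        also have "\<bar>\<dots>\<bar> \<le> (\<Sum>k\<le>m. \<bar>(x (real k / real m) - x t) * hat m k t\<bar>)" by (rule sum_abs)
        also have "\<dots> \<le> (\<Sum>k\<le>m. e' * hat m k t)"
        proof (rule sum_mono)
          fix k assume k: "k \<in> {..m}"
          show "\<bar>(x (real k / real m) - x t) * hat m k t\<bar> \<le> e' * hat m k t"
          proof (cases "1 \<le> \<bar>real m * t - real k\<bar>")
            case True
            then show ?thesis by (simp add: hat_eq_0)
          next
            case False
            have "\<bar>real k / real m - t\<bar> = \<bar>real m * t - real k\<bar> / real m"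
              using m by (simp add: field_simps abs_if)
            also have "\<dots> < d" using False m md by (intro order_less_trans[OF _ md]) (simp add: divide_strict_right_mono)
            finally have "\<bar>x (real k / real m) - x t\<bar> < e'"
              using t k m by (intro d(2)) auto
            then show ?thesis using hat_nonneg[of m k t] by (simp add: abs_mult mult_right_mono)
          qed
        qed
        also have "\<dots> = e'" by (simp add: sum_hat[OF t] flip: sum_distrib_left)
        finally show ?thesis by simp
      qed
      from C(2)[OF W01_lincomb[OF y x] this] have "\<bar>l y - l x\<bar> \<le> C * e'"
        by (simp add: W01_dual_lincomb[OF l y x, of 1 "-1", simplified])
      also have "C * e' < e" using e C by (simp add: e'_def field_simps)
      finally show "norm ((\<Sum>k=1..Suc n. x (real k / real (Suc n)) * l (hat (Suc n) k)) - l x) < e"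
        by (simp add: ly m_def)
    qed
  qed
qed

lemma expsmooth_iter_deriv:
  assumes f: "f \<in> Cb_infty" and vs: "vs \<in> lists Basis"
  shows "expsmooth k (\<lambda>_::'i. iter_deriv vs f)"
  using vs
proof (induction k arbitrary: vs)
  case 0
  then have d: "iter_deriv vs f differentiable_on UNIV" and b: "bounded (range (iter_deriv vs f))"
    using f unfolding Cb_infty_def by blast+
  from b obtain C where "\<And>y. \<bar>iter_deriv vs f y\<bar> \<le> C" unfolding bounded_iff by auto
  then have "expbound (\<lambda>_::'i. iter_deriv vs f)"
    by (intro expboundI[of "\<bar>C\<bar>" 0]) (auto intro: order_trans[OF _ abs_ge_self])
  moreover have "iter_deriv vs f \<in> borel_measurable borel"
    using d by (intro differentiable_imp_borel) (auto simp: differentiable_on_def)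
  ultimately show ?case by simp
next
  case (Suc k)
  have d: "iter_deriv vs f differentiable_on UNIV" and b: "bounded (range (iter_deriv vs f))"
    using f Suc.prems unfolding Cb_infty_def by blast+
  from b obtain C where "\<And>y. \<bar>iter_deriv vs f y\<bar> \<le> C" unfolding bounded_iff by auto
  then have "expbound (\<lambda>_::'i. iter_deriv vs f)"
    by (intro expboundI[of "\<bar>C\<bar>" 0]) (auto intro: order_trans[OF _ abs_ge_self])
  moreover have "dir_deriv b (iter_deriv vs f) = iter_deriv (b # vs) f" for b
    by (simp add: dir_deriv_def fun_eq_iff)
  then have "expsmooth k (\<lambda>_::'i. dir_deriv b (iter_deriv vs f))" if "b \<in> Basis" for b
    using Suc.IH[of "b # vs"] Suc.prems that by simp
  ultimately show ?case using d by (auto simp: differentiable_on_def)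
qed

lemma Cb_infty_expsmooth: "f \<in> Cb_infty \<Longrightarrow> expsmooth k (\<lambda>_. f)"
  using expsmooth_iter_deriv[of f "[]"] by simp

lemma Cb_infty_bounded:
  assumes "f \<in> Cb_infty" shows "\<exists>C. \<forall>x. \<bar>f x\<bar> \<le> C"
proof -
  have "bounded (range (iter_deriv [] f))" using assms unfolding Cb_infty_def by blast
  then show ?thesis unfolding bounded_iff by auto
qed

lemma Cb_infty_continuous: "f \<in> Cb_infty \<Longrightarrow> continuous_on UNIV f"
proof -
  assume "f \<in> Cb_infty"
  then have "iter_deriv [] f differentiable_on UNIV" unfolding Cb_infty_def by blast
  then show ?thesis by (simp add: differentiable_imp_continuous_on)
qed

lemma expbound_fst: "expbound h \<Longrightarrow> expbound (\<lambda>i p. h i (fst p))"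
  and expbound_snd: "expbound h' \<Longrightarrow> expbound (\<lambda>i p. h' i (snd p))"
proof -
  assume "expbound h"
  then obtain K L where KL: "0 \<le> K" "0 \<le> L" "\<And>i y. \<bar>h i y\<bar> \<le> K * exp (L * norm y)"
    unfolding expbound_def by blast
  show "expbound (\<lambda>i p. h i (fst p))"
    by (rule expboundI[OF KL(1,2)], rule order_trans[OF KL(3)])
      (use KL norm_fst in \<open>auto intro!: mult_left_mono\<close>)
next
  assume "expbound h'"
  then obtain K L where KL: "0 \<le> K" "0 \<le> L" "\<And>i y. \<bar>h' i y\<bar> \<le> K * exp (L * norm y)"
    unfolding expbound_def by blast
  show "expbound (\<lambda>i p. h' i (snd p))"
    by (rule expboundI[OF KL(1,2)], rule order_trans[OF KL(3)])
      (use KL norm_snd in \<open>auto intro!: mult_left_mono\<close>)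
qed

lemma dir_deriv_fst:
  assumes "\<And>y. H differentiable (at y)"
  shows "(\<lambda>p. H (fst p)) differentiable (at p)" "dir_deriv b (\<lambda>p. H (fst p)) = (\<lambda>p. frechet_derivative H (at (fst p)) (fst b))"
proof -
  have *: "((\<lambda>p. H (fst p)) has_derivative (\<lambda>q. frechet_derivative H (at (fst p)) (fst q))) (at p)" for p
    by (rule has_derivative_compose[where g=H, OF has_derivative_fst[OF has_derivative_ident]])
      (use assms in \<open>simp add: frechet_derivative_works\<close>)
  show "(\<lambda>p. H (fst p)) differentiable (at p)" using * differentiableI by blast
  show "dir_deriv b (\<lambda>p. H (fst p)) = (\<lambda>p. frechet_derivative H (at (fst p)) (fst b))"
    by (rule ext) (rule dir_deriv_eqI[OF *])
qed

lemma dir_deriv_snd: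
  assumes "\<And>y. H differentiable (at y)"
  shows "(\<lambda>p. H (snd p)) differentiable (at p)" "dir_deriv b (\<lambda>p. H (snd p)) = (\<lambda>p. frechet_derivative H (at (snd p)) (snd b))"
proof -
  have *: "((\<lambda>p. H (snd p)) has_derivative (\<lambda>q. frechet_derivative H (at (snd p)) (snd q))) (at p)" for p
    by (rule has_derivative_compose[where g=H, OF has_derivative_snd[OF has_derivative_ident]])
      (use assms in \<open>simp add: frechet_derivative_works\<close>)
  show "(\<lambda>p. H (snd p)) differentiable (at p)" using * differentiableI by blast
  show "dir_deriv b (\<lambda>p. H (snd p)) = (\<lambda>p. frechet_derivative H (at (snd p)) (snd b))"
    by (rule ext) (rule dir_deriv_eqI[OF *])
qed

lemma frechet_derivative_zero: "H differentiable (at y) \<Longrightarrow> frechet_derivative H (at y) 0 = 0"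
  by (rule linear_0[OF linear_frechet_derivative])

lemma expsmooth_fst:
  fixes h :: "'i \<Rightarrow> 'x::euclidean_space \<Rightarrow> real"
  shows "expsmooth k h \<Longrightarrow> expsmooth k (\<lambda>i (p::'x \<times> 'y::euclidean_space). h i (fst p))"
proof (induction k arbitrary: h)
  case 0
  then show ?case by (auto intro!: expbound_fst measurable_compose[OF measurable_fst] simp: borel_prod[symmetric])
next
  case (Suc k)
  have diff: "h i differentiable (at y)" for i y using Suc.prems by auto
  have "expsmooth k (\<lambda>i. dir_deriv b (\<lambda>p::'x \<times> 'y. h i (fst p)))" if b: "b \<in> Basis" for b
  proof (cases "snd b = 0")
    case True
    then have "fst b \<in> Basis" using b by (auto simp: Basis_prod_def)
    then have "expsmooth k (\<lambda>i. dir_deriv (fst b) (h i))" using Suc.prems by auto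
    from Suc.IH[OF this] show ?thesis by (simp add: dir_deriv_fst[OF diff] dir_deriv_def)
  next
    case False
    then have "fst b = 0" using b by (auto simp: Basis_prod_def)
    then show ?thesis
      using expsmooth_const[of "\<lambda>_. 0" 0] by (simp add: dir_deriv_fst[OF diff] frechet_derivative_zero[OF diff])
  qed
  then show ?case using Suc.prems expbound_fst dir_deriv_fst(1)[OF diff] by auto
qed

lemma expsmooth_snd:
  fixes h :: "'i \<Rightarrow> 'y::euclidean_space \<Rightarrow> real"
  shows "expsmooth k h \<Longrightarrow> expsmooth k (\<lambda>i (p::'x::euclidean_space \<times> 'y). h i (snd p))"
proof (induction k arbitrary: h)
  case 0
  then show ?case by (auto intro!: expbound_snd measurable_compose[OF measurable_snd] simp: borel_prod[symmetric])
next
  case (Suc k)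
  have diff: "h i differentiable (at y)" for i y using Suc.prems by auto
  have "expsmooth k (\<lambda>i. dir_deriv b (\<lambda>p::'x \<times> 'y. h i (snd p)))" if b: "b \<in> Basis" for b
  proof (cases "fst b = 0")
    case True
    then have "snd b \<in> Basis" using b by (auto simp: Basis_prod_def)
    then have "expsmooth k (\<lambda>i. dir_deriv (snd b) (h i))" using Suc.prems by auto
    from Suc.IH[OF this] show ?thesis by (simp add: dir_deriv_snd[OF diff] dir_deriv_def)
  next
    case False
    then have "snd b = 0" using b by (auto simp: Basis_prod_def)
    then show ?thesis
      using expsmooth_const[of "\<lambda>_. 0" 0] by (simp add: dir_deriv_snd[OF diff] frechet_derivative_zero[OF diff])
  qed
  then show ?case using Suc.prems expbound_snd dir_deriv_snd(1)[OF diff] by auto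
qed

section \<open>Independent processes\<close>

text \<open>
  The sigma-algebra \<open>path_events M X\<close> in the form of a measurable space, so that one can speak of
  functionals of the path that are measurable with respect to it.
\<close>
definition path_algebra :: "'a measure \<Rightarrow> (real \<Rightarrow> 'a \<Rightarrow> 'v::euclidean_space) \<Rightarrow> 'a measure" where
  "path_algebra M X = vimage_algebra (space M) (\<lambda>\<omega>. \<lambda>t\<in>{0..1}. X t \<omega>) (Pi\<^sub>M {0..1} (\<lambda>_. borel))"

lemma space_path_algebra [simp]: "space (path_algebra M X) = space M"
  by (simp add: path_algebra_def)

lemma sets_path_algebra: "sets (path_algebra M X) = path_events M X"
  by (simp add: path_algebra_def path_events_def)

lemma measurable_path_algebra:
  assumes "t \<in> {0..1}"
  shows "X t \<in> borel_measurable (path_algebra M X)"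
proof -
  have "(\<lambda>\<omega>. \<lambda>t\<in>{0..1}. X t \<omega>) \<in> measurable (path_algebra M X) (Pi\<^sub>M {0..1} (\<lambda>_. borel))"
    unfolding path_algebra_def by (rule measurable_vimage_algebra1) (auto simp: space_PiM)
  from measurable_compose[OF this measurable_component_singleton[OF assms]] assms
  show ?thesis by simp
qed

text \<open>
  Independence of the processes as a statement about joint laws. In this form it applies to
  functionals with values in different types.
\<close>
lemma (in prob_space) distr_paths_pair:
  assumes ind: "independent_processes M X Y"
    and f: "f \<in> measurable (path_algebra M X) N1" and g: "g \<in> measurable (path_algebra M Y) N2"
  shows "distr M N1 f \<Otimes>\<^sub>M distr M N2 g = distr M (N1 \<Otimes>\<^sub>M N2) (\<lambda>\<omega>. (f \<omega>, g \<omega>))"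
    and "f \<in> measurable M N1" and "g \<in> measurable M N2"
proof -
  have I: "path_events M X \<subseteq> events" "path_events M Y \<subseteq> events"
    "\<And>a b. a \<in> path_events M X \<Longrightarrow> b \<in> path_events M Y \<Longrightarrow> prob (a \<inter> b) = prob a * prob b"
    using ind unfolding independent_processes_def indep_sets2_eq by auto
  show fm [measurable]: "f \<in> measurable M N1"
    using f I(1) unfolding measurable_def sets_path_algebra by auto
  show gm [measurable]: "g \<in> measurable M N2"
    using g I(2) unfolding measurable_def sets_path_algebra by auto
  interpret f: prob_space "distr M N1 f" by (rule prob_space_distr[OF fm])
  interpret g: prob_space "distr M N2 g" by (rule prob_space_distr[OF gm])
  show "distr M N1 f \<Otimes>\<^sub>M distr M N2 g = distr M (N1 \<Otimes>\<^sub>M N2) (\<lambda>\<omega>. (f \<omega>, g \<omega>))"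
  proof (rule pair_measure_eqI)
    show "sigma_finite_measure (distr M N1 f)" "sigma_finite_measure (distr M N2 g)" ..
    show "sets (distr M N1 f \<Otimes>\<^sub>M distr M N2 g) = sets (distr M (N1 \<Otimes>\<^sub>M N2) (\<lambda>\<omega>. (f \<omega>, g \<omega>)))"
      by (simp cong: sets_pair_measure_cong)
    fix A B assume "A \<in> sets (distr M N1 f)" "B \<in> sets (distr M N2 g)"
    then have A [measurable]: "A \<in> sets N1" and B [measurable]: "B \<in> sets N2" by auto
    have "(\<lambda>\<omega>. (f \<omega>, g \<omega>)) -` (A \<times> B) \<inter> space M = (f -` A \<inter> space M) \<inter> (g -` B \<inter> space M)" by auto
    moreover have "prob ((f -` A \<inter> space M) \<inter> (g -` B \<inter> space M)) = prob (f -` A \<inter> space M) * prob (g -` B \<inter> space M)"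
      using measurable_sets[OF f A] measurable_sets[OF g B] by (intro I) (auto simp: sets_path_algebra)
    ultimately show "emeasure (distr M N1 f) A * emeasure (distr M N2 g) B
      = emeasure (distr M (N1 \<Otimes>\<^sub>M N2) (\<lambda>\<omega>. (f \<omega>, g \<omega>))) (A \<times> B)"
      by (simp add: emeasure_distr emeasure_eq_measure ennreal_mult')
  qed
qed

lemma heat_kernel_Pair:
  fixes x :: "'v::euclidean_space" and y :: "'u::euclidean_space"
  shows "heat_kernel t (x, y) = heat_kernel t x * heat_kernel t y"
proof -
  have "(2 * pi * t) powr (- real DIM('v \<times> 'u) / 2)
      = (2 * pi * t) powr (- real DIM('v) / 2) * (2 * pi * t) powr (- real DIM('u) / 2)"
    by (simp add: powr_add[symmetric] add_divide_distrib diff_divide_distrib)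
  moreover have "exp (- (norm (x, y))\<^sup>2 / (2 * t)) = exp (- (norm x)\<^sup>2 / (2 * t)) * exp (- (norm y)\<^sup>2 / (2 * t))"
    by (simp add: exp_add[symmetric] norm_Pair add_divide_distrib diff_divide_distrib)
  ultimately show ?thesis by (simp add: heat_kernel_def)
qed

lemma brownianI: "brownian_motion M B \<Longrightarrow> brownian M B"
  by (intro brownian.intro brownian_axioms.intro) (auto simp: brownian_motion_def)

text \<open>
  Independent Brownian motions are the components of one Brownian motion, so that the Gaussian
  calculus above applies to the pair.
\<close>
lemma brownian_motion_Pair:
  fixes w :: "real \<Rightarrow> 'a \<Rightarrow> 'v::euclidean_space" and z :: "real \<Rightarrow> 'a \<Rightarrow> 'u::euclidean_space"
  assumes w: "brownian_motion M w" and z: "brownian_motion M z" and ind: "independent_processes M w z"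
  shows "brownian_motion M (\<lambda>t \<omega>. (w t \<omega>, z t \<omega>))"
proof -
  interpret w: brownian M w
    by (rule brownianI[OF w])
  interpret z: brownian M z
    by (rule brownianI[OF z])
  have incr_w: "(\<lambda>\<omega>. w t \<omega> - w s \<omega>) \<in> borel_measurable (path_algebra M w)" if "s \<in> {0..1}" "t \<in> {0..1}" for s t
    using that by (intro borel_measurable_diff measurable_path_algebra)
  have incr_z: "(\<lambda>\<omega>. z t \<omega> - z s \<omega>) \<in> borel_measurable (path_algebra M z)" if "s \<in> {0..1}" "t \<in> {0..1}" for s t
    using that by (intro borel_measurable_diff measurable_path_algebra)
  show ?thesis
    unfolding brownian_motion_def
  proof (intro conjI allI ballI impI)
    show "prob_space M" by (rule w.prob_space_axioms)
    show "(\<lambda>\<omega>. (w t \<omega>, z t \<omega>)) \<in> borel_measurable M" if "t \<in> {0..1}" for t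
      using w.B_measurable[OF that] z.B_measurable[OF that] by (rule borel_measurable_Pair)
    show "(w 0 \<omega>, z 0 \<omega>) = 0" if "\<omega> \<in> space M" for \<omega>
      using w.B_0[OF that] z.B_0[OF that] by (simp add: zero_prod_def)
    show "continuous_on {0..1} (\<lambda>t. (w t \<omega>, z t \<omega>))" if "\<omega> \<in> space M" for \<omega>
      using w.B_continuous[OF that] z.B_continuous[OF that] by (rule continuous_on_Pair)
  next
    fix s t :: real assume st: "0 \<le> s \<and> s < t \<and> t \<le> 1"
    have dw: "distributed M lborel (\<lambda>\<omega>. w t \<omega> - w s \<omega>) (\<lambda>x. ennreal (heat_kernel (t - s) x))"
      and dz: "distributed M lborel (\<lambda>\<omega>. z t \<omega> - z s \<omega>) (\<lambda>x. ennreal (heat_kernel (t - s) x))"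
      using w z st unfolding brownian_motion_def by auto
    have "distr M lborel (\<lambda>\<omega>. w t \<omega> - w s \<omega>) \<Otimes>\<^sub>M distr M lborel (\<lambda>\<omega>. z t \<omega> - z s \<omega>)
      = distr M (lborel \<Otimes>\<^sub>M lborel) (\<lambda>\<omega>. (w t \<omega> - w s \<omega>, z t \<omega> - z s \<omega>))"
      using st incr_w[of s t] incr_z[of s t] by (intro w.distr_paths_pair[OF ind]) auto
    then have "distributed M (lborel \<Otimes>\<^sub>M lborel) (\<lambda>\<omega>. (w t \<omega> - w s \<omega>, z t \<omega> - z s \<omega>))
      (\<lambda>(x, y). ennreal (heat_kernel (t - s) x) * ennreal (heat_kernel (t - s) y))"
      by (intro w.distributed_joint_indep' dw dz) (auto intro: sigma_finite_lborel)
    moreover have "(\<lambda>(x, y). ennreal (heat_kernel (t - s) x) * ennreal (heat_kernel (t - s) y))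
      = (\<lambda>p::'v \<times> 'u. ennreal (heat_kernel (t - s) p))"
      using st by (auto simp: heat_kernel_Pair ennreal_mult' fun_eq_iff)
    ultimately show "distributed M lborel (\<lambda>\<omega>. (w t \<omega>, z t \<omega>) - (w s \<omega>, z s \<omega>))
      (\<lambda>p. ennreal (heat_kernel (t - s) p))"
      by (simp add: lborel_prod)
  next
    fix n :: nat and \<tau> :: "nat \<Rightarrow> real"
    assume \<tau>: "0 \<le> \<tau> 0 \<and> (\<forall>i<n. \<tau> i \<le> \<tau> (Suc i)) \<and> \<tau> n \<le> 1"
    let ?D = "\<lambda>i \<omega>. (w (\<tau> (Suc i)) \<omega>, z (\<tau> (Suc i)) \<omega>) - (w (\<tau> i) \<omega>, z (\<tau> i) \<omega>)"
    show "w.indep_vars (\<lambda>_. borel) ?D {..<n}"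
    proof (cases "n = 0")
      case True
      then show ?thesis by (simp add: w.indep_vars_def w.indep_sets_def)
    next
      case False
      then have g: "grid \<tau> n" using \<tau> by (simp add: grid_def)
      have \<tau>01: "\<tau> i \<in> {0..1}" "\<tau> (Suc i) \<in> {0..1}" if "i < n" for i
        using grid_bounds[OF g, of i] grid_bounds[OF g, of "Suc i"] that by auto
      define E :: "('v \<times> 'u) set set" where "E = {a \<times> b | a b. a \<in> sets borel \<and> b \<in> sets borel}"
      have D: "?D i = (\<lambda>\<omega>. (w.incr \<tau> i \<omega>, z.incr \<tau> i \<omega>))" for i
        by (simp add: w.incr_def z.incr_def)
      have W: "w.incr \<tau> i \<in> borel_measurable (path_algebra M w)" if "i < n" for i
        unfolding w.incr_def[abs_def] by (rule incr_w) (use \<tau>01[OF that] in auto)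
      have Z: "z.incr \<tau> i \<in> borel_measurable (path_algebra M z)" if "i < n" for i
        unfolding z.incr_def[abs_def] by (rule incr_z) (use \<tau>01[OF that] in auto)
      have iff: "w.indep_vars (\<lambda>_. borel) ?D {..<n} \<longleftrightarrow>
        (\<forall>A\<in>(\<Pi> i\<in>{..<n}. E). w.prob (\<Inter>j\<in>{..<n}. ?D j -` A j \<inter> space M) = (\<Prod>j\<in>{..<n}. w.prob (?D j -` A j \<inter> space M)))"
      proof (rule w.indep_vars_finite)
        show "sets (borel :: ('v \<times> 'u) measure) = sigma_sets (space borel) E"
          unfolding E_def borel_prod[symmetric] sets_pair_measure by (simp add: space_pair_measure)
        show "?D i \<in> borel_measurable M" if "i \<in> {..<n}" for i
          unfolding D using that w.incr_measurable[OF g] z.incr_measurable[OF g] by (intro borel_measurable_Pair) auto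
        show "Int_stable E"
          unfolding E_def by (rule Int_stable_pair_measure_generator)
        show "space borel \<in> E" unfolding E_def by (auto intro!: exI[of _ UNIV] simp flip: UNIV_Times_UNIV)
      qed (use False in \<open>auto simp: E_def\<close>)
      show ?thesis
        unfolding iff
      proof (intro ballI)
        fix A assume "A \<in> (\<Pi> i\<in>{..<n}. E)"
        then have "\<forall>i\<in>{..<n}. \<exists>a b. A i = a \<times> b \<and> a \<in> sets borel \<and> b \<in> sets borel"
          unfolding E_def by (auto simp: Pi_iff)
        then obtain a b where ab: "\<And>i. i < n \<Longrightarrow> A i = a i \<times> b i" "\<And>i. i < n \<Longrightarrow> a i \<in> sets borel" "\<And>i. i < n \<Longrightarrow> b i \<in> sets borel"
          by (metis lessThan_iff)
        define Wa where "Wa i = w.incr \<tau> i -` a i \<inter> space M" for i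
        define Zb where "Zb i = z.incr \<tau> i -` b i \<inter> space M" for i
        have We: "Wa i \<in> path_events M w" if "i < n" for i
          using measurable_sets[OF W[OF that] ab(2)[OF that]] by (simp add: Wa_def sets_path_algebra)
        have Ze: "Zb i \<in> path_events M z" if "i < n" for i
          using measurable_sets[OF Z[OF that] ab(3)[OF that]] by (simp add: Zb_def sets_path_algebra)
        have I: "w.prob (e \<inter> e') = w.prob e * w.prob e'" if "e \<in> path_events M w" "e' \<in> path_events M z" for e e'
          using ind that unfolding independent_processes_def w.indep_sets2_eq by auto
        have AD: "?D i -` A i \<inter> space M = Wa i \<inter> Zb i" if "i < n" for i
          using ab(1)[OF that] by (auto simp: Wa_def Zb_def w.incr_def z.incr_def)
        have ne: "{..<n} \<noteq> {}" using False by auto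
        have "(\<Inter>j\<in>{..<n}. ?D j -` A j \<inter> space M) = (\<Inter>j\<in>{..<n}. Wa j) \<inter> (\<Inter>j\<in>{..<n}. Zb j)"
          using AD by auto
        also have "w.prob \<dots> = w.prob (\<Inter>j\<in>{..<n}. Wa j) * w.prob (\<Inter>j\<in>{..<n}. Zb j)"
          using We Ze ne unfolding sets_path_algebra[symmetric] by (intro I[unfolded sets_path_algebra[symmetric]] sets.finite_INT) auto
        also have "w.prob (\<Inter>j\<in>{..<n}. Wa j) = (\<Prod>j\<in>{..<n}. w.prob (Wa j))"
          unfolding Wa_def using w.indep_varsD[OF w.indep_incr[OF g] ne] ab by auto
        also have "w.prob (\<Inter>j\<in>{..<n}. Zb j) = (\<Prod>j\<in>{..<n}. w.prob (Zb j))"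
          unfolding Zb_def using w.indep_varsD[OF z.indep_incr[OF g] ne] ab by auto
        also have "(\<Prod>j\<in>{..<n}. w.prob (Wa j)) * (\<Prod>j\<in>{..<n}. w.prob (Zb j)) = (\<Prod>j\<in>{..<n}. w.prob (Wa j \<inter> Zb j))"
          unfolding prod.distrib[symmetric] using We Ze I by (intro prod.cong) auto
        also have "\<dots> = (\<Prod>j\<in>{..<n}. w.prob (?D j -` A j \<inter> space M))"
          using AD by (intro prod.cong) auto
        finally show "w.prob (\<Inter>j\<in>{..<n}. ?D j -` A j \<inter> space M) = (\<Prod>j\<in>{..<n}. w.prob (?D j -` A j \<inter> space M))" .
      qed
    qed
  qed
qed

text \<open>
  By interpolation, a functional of the path is a limit of functions of finitely many of its values.
\<close>
lemma W01_dual_measurable: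
  assumes l: "l \<in> W01_dual" and z: "\<And>\<omega>. \<omega> \<in> space M \<Longrightarrow> (\<lambda>t. z t \<omega>) \<in> W01"
  shows "(\<lambda>\<omega>. l (\<lambda>t. z t \<omega>)) \<in> borel_measurable (path_algebra M z)"
proof (rule borel_measurable_LIMSEQ_real)
  show "(\<lambda>i. \<Sum>k=1..Suc i. z (real k / real (Suc i)) \<omega> * l (hat (Suc i) k)) \<longlonglongrightarrow> l (\<lambda>t. z t \<omega>)"
    if "\<omega> \<in> space (path_algebra M z)" for \<omega>
    using W01_dual_interpolation[OF l z] that by simp
  show "(\<lambda>\<omega>. \<Sum>k=1..Suc i. z (real k / real (Suc i)) \<omega> * l (hat (Suc i) k)) \<in> borel_measurable (path_algebra M z)" for i
    by (intro borel_measurable_sum borel_measurable_times borel_measurable_const measurable_path_algebra) (auto simp: field_simps)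
qed

lemma FCb_infty_measurable:
  assumes F: "F \<in> FCb_infty TYPE('n::finite)" and z: "\<And>\<omega>. \<omega> \<in> space M \<Longrightarrow> (\<lambda>t. z t \<omega>) \<in> W01"
  shows "(\<lambda>\<omega>. F (\<lambda>t. z t \<omega>)) \<in> borel_measurable (path_algebra M z)"
proof -
  obtain g :: "real^'n \<Rightarrow> real" and l where g: "g \<in> Cb_infty" "\<And>i. l i \<in> W01_dual" "\<And>x. x \<in> W01 \<Longrightarrow> F x = g (\<chi> i. l i x)"
    using F unfolding FCb_infty_def by blast
  have "g \<in> borel_measurable borel"
    using Cb_infty_continuous[OF g(1)] by (rule borel_measurable_continuous_onI)
  moreover have "(\<lambda>\<omega>. \<chi> i. l i (\<lambda>t. z t \<omega>)) \<in> borel_measurable (path_algebra M z)"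
    by (subst borel_measurable_euclidean_space)
      (auto simp: Basis_vec_def inner_axis intro: W01_dual_measurable[OF g(2) z])
  ultimately have "(\<lambda>\<omega>. g (\<chi> i. l i (\<lambda>t. z t \<omega>))) \<in> borel_measurable (path_algebra M z)"
    by (rule measurable_compose[rotated])
  then show ?thesis
    by (rule measurable_cong[THEN iffD1, rotated]) (simp add: g(3) z)
qed

lemma FCb_infty_bounded:
  assumes F: "F \<in> FCb_infty TYPE('n::finite)"
  shows "\<exists>C. \<forall>x\<in>W01. \<bar>F x\<bar> \<le> C"
proof -
  obtain g :: "real^'n \<Rightarrow> real" and l where g: "g \<in> Cb_infty" "\<And>x. x \<in> W01 \<Longrightarrow> F x = g (\<chi> i. l i x)"
    using F unfolding FCb_infty_def by blast
  then show ?thesis using Cb_infty_bounded[OF g(1)] by metis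
qed

section \<open>Test functions\<close>

lemma (in brownian) second_moment:
  assumes t: "t \<in> {0..1}"
  shows "(\<lambda>\<omega>. c \<bullet> B t \<omega>) \<in> L2 M" and "(\<integral>\<omega>. (c \<bullet> B t \<omega>)\<^sup>2 \<partial>M) = t * (c \<bullet> c)"
proof -
  define \<tau> where "\<tau> i = (if i = 0 then 0 else t)" for i :: nat
  have g: "grid \<tau> 1" using t by (auto simp: grid_def \<tau>_def)
  have eq: "lincomb \<tau> 1 (\<lambda>_. c) \<omega> * lincomb \<tau> 1 (\<lambda>_. c) \<omega> = (c \<bullet> B t \<omega>)\<^sup>2" if "\<omega> \<in> space M" for \<omega>
    using B_0[OF that] by (simp add: lincomb_def incr_def \<tau>_def power2_eq_square)
  have "integrable M (\<lambda>\<omega>. (c \<bullet> B t \<omega>)\<^sup>2)"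
    using integrable_lincomb_mult[OF g, of "\<lambda>_. c" "\<lambda>_. c"]
    by (rule Bochner_Integration.integrable_cong[THEN iffD1, rotated -1]) (simp_all only: eq)
  then show "(\<lambda>\<omega>. c \<bullet> B t \<omega>) \<in> L2 M"
    using B_measurable[OF t] by (auto simp: L2_def)
  have "(\<integral>\<omega>. (c \<bullet> B t \<omega>)\<^sup>2 \<partial>M) = (\<integral>\<omega>. lincomb \<tau> 1 (\<lambda>_. c) \<omega> * lincomb \<tau> 1 (\<lambda>_. c) \<omega> \<partial>M)"
    by (rule Bochner_Integration.integral_cong) (simp_all only: eq)
  also have "\<dots> = grid_cov \<tau> 1 (\<lambda>_. c) (\<lambda>_. c)" by (rule covariance_lincomb[OF g])
  also have "\<dots> = t * (c \<bullet> c)" by (simp add: grid_cov_def \<tau>_def)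
  finally show "(\<integral>\<omega>. (c \<bullet> B t \<omega>)\<^sup>2 \<partial>M) = t * (c \<bullet> c)" .
qed

text \<open>
  Minkowski's inequality in \<open>L2\<close>, for variables in the unit ball.
\<close>
lemma (in prob_space) second_moment_sum_le:
  fixes a :: "'i \<Rightarrow> real" and X :: "'i \<Rightarrow> 'a \<Rightarrow> real"
  assumes X: "\<And>k. k \<in> A \<Longrightarrow> X k \<in> L2 M" "\<And>k. k \<in> A \<Longrightarrow> (\<integral>\<omega>. (X k \<omega>)\<^sup>2 \<partial>M) \<le> 1"
  shows "(\<integral>\<omega>. (\<Sum>k\<in>A. X k \<omega> * a k)\<^sup>2 \<partial>M) \<le> (\<Sum>k\<in>A. \<bar>a k\<bar>)\<^sup>2"
proof -
  have "(\<integral>\<omega>. (\<Sum>k\<in>A. X k \<omega> * a k)\<^sup>2 \<partial>M) = (\<integral>\<omega>. (\<Sum>j\<in>A. \<Sum>k\<in>A. (a j * a k) * (X j \<omega> * X k \<omega>)) \<partial>M)"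
    by (simp add: power2_eq_square sum_product mult_ac)
  also have "\<dots> = (\<Sum>j\<in>A. \<Sum>k\<in>A. (a j * a k) * (\<integral>\<omega>. X j \<omega> * X k \<omega> \<partial>M))"
    using X(1) by (simp add: Bochner_Integration.integral_sum L2_integrable_mult)
  also have "\<dots> \<le> (\<Sum>j\<in>A. \<Sum>k\<in>A. \<bar>a j\<bar> * \<bar>a k\<bar>)"
  proof (intro sum_mono)
    fix j k assume jk: "j \<in> A" "k \<in> A"
    have "\<bar>\<integral>\<omega>. X j \<omega> * X k \<omega> \<partial>M\<bar> \<le> sqrt (\<integral>\<omega>. (X j \<omega>)\<^sup>2 \<partial>M) * sqrt (\<integral>\<omega>. (X k \<omega>)\<^sup>2 \<partial>M)"
      by (rule L2_Cauchy_Schwarz[OF X(1)[OF jk(1)] X(1)[OF jk(2)]])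
    also have "\<dots> \<le> 1 * 1"
      using X(2)[OF jk(1)] X(2)[OF jk(2)] by (intro mult_mono) auto
    finally have "\<bar>(a j * a k) * (\<integral>\<omega>. X j \<omega> * X k \<omega> \<partial>M)\<bar> \<le> \<bar>a j\<bar> * \<bar>a k\<bar>"
      by (simp add: abs_mult mult_left_le)
    then show "(a j * a k) * (\<integral>\<omega>. X j \<omega> * X k \<omega> \<partial>M) \<le> \<bar>a j\<bar> * \<bar>a k\<bar>" by linarith
  qed
  also have "\<dots> = (\<Sum>k\<in>A. \<bar>a k\<bar>)\<^sup>2" by (simp add: power2_eq_square sum_product)
  finally show ?thesis .
qed

lemma brownian_path_W01: "brownian_motion M z \<Longrightarrow> \<omega> \<in> space M \<Longrightarrow> (\<lambda>t. z t \<omega>) \<in> W01"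
  by (auto simp: brownian_motion_def W01_def)

text \<open>
  \<open>F\<close> is the limit of \<open>F1 g\<close> evaluated at the Gaussian vectors \<open>Y i\<close> that consist of the increment of \<open>w\<close> and of
  the functionals \<open>l j\<close> at the interpolated path of \<open>z\<close>. Their variances are bounded in terms of the
  total variations of the functionals, so that \<open>chaos_decay\<close> applies in the Gaussian space of the
  pair \<open>(w, z)\<close>.
\<close>
lemma test_function_pairing:
  fixes w :: "real \<Rightarrow> 'a \<Rightarrow> real ^ 'd::finite"
  assumes w: "brownian_motion M w" and z: "brownian_motion M z" and ind: "independent_processes M w z"
    and s: "s1 \<in> {0..1}" "s2 \<in> {0..1}" and F1: "F1 \<in> Cb_infty" and F2: "F2 \<in> FCb_infty TYPE('n::finite)"
    and F: "\<And>\<omega>. F \<omega> = F1 (w s2 \<omega> - w s1 \<omega>) * F2 (\<lambda>t. z t \<omega>)"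
    and lim: "((\<lambda>\<epsilon>. \<integral>\<omega>. F \<omega> * X \<epsilon> \<omega> \<partial>M) \<longlongrightarrow> c) (at_right 0)"
    and \<eta>: "D2_limit M (brownian_generators w z) \<gamma> X \<eta>"
  shows "has_D2_pairing M \<eta> F c"
proof -
  interpret z: brownian M z by (rule brownianI[OF z])
  interpret w: brownian M w by (rule brownianI[OF w])
  interpret B: brownian M "\<lambda>t \<omega>. (w t \<omega>, z t \<omega>)"
    by (rule brownianI[OF brownian_motion_Pair[OF w z ind]])
  obtain g :: "real^'n \<Rightarrow> real" and l where g: "g \<in> Cb_infty" and l: "\<And>j. l j \<in> W01_dual"
    and F2g: "\<And>x. x \<in> W01 \<Longrightarrow> F2 x = g (\<chi> j. l j x)"
    using F2 unfolding FCb_infty_def by blast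
  have Sg: "brownian_generators w z \<subseteq> B.gaussian_space"
  proof
    fix G assume "G \<in> brownian_generators w z"
    then consider t i where "t \<in> {0..1}" "G = (\<lambda>\<omega>. w t \<omega> $ i)" | t where "t \<in> {0..1}" "G = z t"
      unfolding brownian_generators_def by auto
    then show "G \<in> B.gaussian_space"
    proof cases
      case 1
      then show ?thesis using B.gaussian_space_inner[OF 1(1), of "(axis i 1, 0)"] by (simp add: inner_axis')
    next
      case 2
      then show ?thesis using B.gaussian_space_inner[OF 2(1), of "(0, 1)"] by simp
    qed
  qed
  define Y where "Y i \<omega> = (w s2 \<omega> - w s1 \<omega>, \<chi> j. \<Sum>k=1..Suc i. z (real k / real (Suc i)) \<omega> * l j (hat (Suc i) k))"
    for i \<omega>
  have Yw: "(\<lambda>\<omega>. (w s2 \<omega> - w s1 \<omega>) \<bullet> b) \<in> B.gaussian_space" for b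
  proof -
    have "(\<lambda>\<omega>. (-1) * ((b, 0) \<bullet> (w s1 \<omega>, z s1 \<omega>)) + (b, 0) \<bullet> (w s2 \<omega>, z s2 \<omega>)) \<in> B.gaussian_space"
      by (intro B.gaussian_space_add_scale B.gaussian_space_inner s)
    then show ?thesis by (simp add: inner_diff_right inner_commute)
  qed
  have k01: "real k / real (Suc i) \<in> {0..1}" if "k \<in> {1..Suc i}" for k i
    using that by (simp add: field_simps)
  have Yz: "(\<lambda>\<omega>. \<Sum>k=1..Suc i. z (real k / real (Suc i)) \<omega> * l j (hat (Suc i) k)) \<in> B.gaussian_space" for i j
  proof -
    have "(\<lambda>\<omega>. \<Sum>k=1..Suc i. l j (hat (Suc i) k) * ((0, 1) \<bullet> (w (real k / real (Suc i)) \<omega>, z (real k / real (Suc i)) \<omega>))) \<in> B.gaussian_space"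
      by (intro B.gaussian_space_sum B.gaussian_space_inner k01) auto
    then show ?thesis by (simp add: mult.commute)
  qed
  have YB: "(\<lambda>\<omega>. Y i \<omega> \<bullet> b) \<in> B.gaussian_space" if "b \<in> Basis" for i b
    using that Yw[of "fst b"] Yz[of i] unfolding Basis_prod_def Y_def
    by (auto simp: Basis_vec_def inner_axis)
  have "\<forall>j. \<exists>C\<ge>0. \<forall>m. (\<Sum>k=1..m. \<bar>l j (hat m k)\<bar>) \<le> C"
    using W01_dual_hat_bound[OF l] by metis
  then obtain C where C: "\<And>j. 0 \<le> C j" "\<And>j m. (\<Sum>k=1..m. \<bar>l j (hat m k)\<bar>) \<le> C j"
    by metis
  define \<kappa> where "\<kappa> = (\<Sum>b\<in>Basis. \<integral>\<omega>. ((w s2 \<omega> - w s1 \<omega>) \<bullet> b)\<^sup>2 \<partial>M) + (\<Sum>j\<in>UNIV. (C j)\<^sup>2)"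
  have \<kappa>: "(\<integral>\<omega>. (Y i \<omega> \<bullet> b)\<^sup>2 \<partial>M) \<le> \<kappa>" if b: "b \<in> Basis" for i b
  proof -
    consider b1 where "b1 \<in> Basis" "b = (b1, 0)" | j where "b = (0, axis j 1)"
      using b unfolding Basis_prod_def Basis_vec_def by auto
    then show ?thesis
    proof cases
      case 1
      have "(\<integral>\<omega>. (Y i \<omega> \<bullet> b)\<^sup>2 \<partial>M) = (\<integral>\<omega>. ((w s2 \<omega> - w s1 \<omega>) \<bullet> b1)\<^sup>2 \<partial>M)"
        by (simp add: 1 Y_def)
      also have "\<dots> \<le> (\<Sum>b\<in>Basis. \<integral>\<omega>. ((w s2 \<omega> - w s1 \<omega>) \<bullet> b)\<^sup>2 \<partial>M)"
        by (rule member_le_sum) (use 1 in auto)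
      also have "\<dots> \<le> \<kappa>" by (simp add: \<kappa>_def sum_nonneg)
      finally show ?thesis .
    next
      case 2
      have "(\<integral>\<omega>. (Y i \<omega> \<bullet> b)\<^sup>2 \<partial>M) = (\<integral>\<omega>. (\<Sum>k=1..Suc i. z (real k / real (Suc i)) \<omega> * l j (hat (Suc i) k))\<^sup>2 \<partial>M)"
        by (simp add: 2 Y_def inner_axis)
      also have "\<dots> \<le> (\<Sum>k=1..Suc i. \<bar>l j (hat (Suc i) k)\<bar>)\<^sup>2"
      proof (rule z.second_moment_sum_le)
        fix k assume k: "k \<in> {1..Suc i}"
        show "z (real k / real (Suc i)) \<in> L2 M"
          using z.second_moment(1)[OF k01[OF k], of 1] by simp
        show "(\<integral>\<omega>. (z (real k / real (Suc i)) \<omega>)\<^sup>2 \<partial>M) \<le> 1"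
          using z.second_moment(2)[OF k01[OF k], of 1] k01[OF k] by simp
      qed
      also have "\<dots> \<le> (C j)\<^sup>2" by (intro power_mono C sum_nonneg) auto
      also have "\<dots> \<le> (\<Sum>j\<in>UNIV. (C j)\<^sup>2)" by (rule member_le_sum) auto
      also have "\<dots> \<le> \<kappa>" by (simp add: \<kappa>_def sum_nonneg)
      finally show ?thesis .
    qed
  qed
  define h where "h = (\<lambda>(i::nat) p. F1 (fst p) * g (snd p))"
  have hs: "expsmooth k h" for k
    unfolding h_def by (intro expsmooth_mult expsmooth_fst expsmooth_snd Cb_infty_expsmooth F1 g)
  obtain C1 where C1: "\<And>x. \<bar>F1 x\<bar> \<le> C1" using Cb_infty_bounded[OF F1] by blast
  obtain C2 where C2: "\<And>x. \<bar>g x\<bar> \<le> C2" using Cb_infty_bounded[OF g] by blast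
  have hb: "\<bar>h i y\<bar> \<le> C1 * C2" for i y
    unfolding h_def abs_mult using C1[of "fst y"] C2[of "snd y"] by (intro mult_mono) auto
  have lim_h: "(\<lambda>i. h i (Y i \<omega>)) \<longlonglongrightarrow> F \<omega>" if \<omega>: "\<omega> \<in> space M" for \<omega>
  proof -
    have "(\<lambda>i. \<chi> j. \<Sum>k=1..Suc i. z (real k / real (Suc i)) \<omega> * l j (hat (Suc i) k))
      \<longlonglongrightarrow> (\<chi> j. l j (\<lambda>t. z t \<omega>))"
      by (rule tendsto_vec_lambda) (rule W01_dual_interpolation[OF l brownian_path_W01[OF z \<omega>]])
    moreover have "isCont g y" for y
      using Cb_infty_continuous[OF g] by (simp add: continuous_on_eq_continuous_at)
    ultimately show ?thesis
      unfolding h_def Y_def F F2g[OF brownian_path_W01[OF z \<omega>]] fst_conv snd_conv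
      by (intro tendsto_mult tendsto_const isCont_tendsto_compose[where g=g]) auto
  qed
  have hm: "(\<lambda>\<omega>. h i (Y i \<omega>)) \<in> borel_measurable M" for i
  proof -
    obtain K L where "0 \<le> K" "0 \<le> L" "\<And>i y. \<bar>h i y\<bar> \<le> K * exp (L * norm y)"
      using expsmooth_imp_expbound[OF hs[of 0]] unfolding expbound_def by blast
    from B.expbound_L2(1)[OF YB this expsmooth_measurable[OF hs[of 0]]]
    show ?thesis by (simp add: L2_def)
  qed
  have Fm: "F \<in> borel_measurable M"
    by (rule borel_measurable_LIMSEQ_real[OF lim_h hm])
  have Fb: "\<bar>F \<omega>\<bar> \<le> C1 * C2" if "\<omega> \<in> space M" for \<omega>
    by (rule LIMSEQ_le_const2[OF tendsto_rabs[OF lim_h[OF that]]]) (use hb in auto)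
  have FL: "F \<in> L2 M"
  proof -
    have "norm ((F \<omega>)\<^sup>2) \<le> (C1 * C2)\<^sup>2" if "\<omega> \<in> space M" for \<omega>
      using power_mono[OF Fb[OF that], of 2] by simp
    then have "integrable M (\<lambda>\<omega>. (F \<omega>)\<^sup>2)"
      using Fm by (intro z.integrable_const_bound[where B="(C1 * C2)\<^sup>2"]) auto
    then show ?thesis using Fm by (simp add: L2_def)
  qed
  show ?thesis
    by (rule has_D2_pairing_limit[OF FL B.chaos_gens_L2[OF Sg] B.chaos_decay[OF Sg YB \<kappa> hs Fm lim_h hb] lim \<eta>])
qed

section \<open>Gaussian regression and conditional expectation\<close>

lemma heat_kernel_pos: "0 < t \<Longrightarrow> 0 < heat_kernel t x"
  by (simp add: heat_kernel_def)

lemma heat_kernel_le: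
  fixes x :: "'v::euclidean_space"
  assumes "0 < t" shows "heat_kernel t x \<le> (2 * pi * t) powr (- real DIM('v) / 2)"
  using assms by (simp add: heat_kernel_def mult_left_le)

lemma lborel_nn_integral_shift:
  fixes f :: "'v::euclidean_space \<Rightarrow> ennreal"
  assumes "f \<in> borel_measurable borel"
  shows "(\<integral>\<^sup>+x. f (x + c) \<partial>lborel) = (\<integral>\<^sup>+x. f x \<partial>lborel)"
  using nn_integral_lborel_affine[OF assms, of 1 c] by (simp add: add.commute)

text \<open>Completing the square in the exponent of the Cameron--Martin density.\<close>
lemma heat_kernel_tilt:
  fixes y b :: "'v::euclidean_space"
  assumes t: "0 < t"
  shows "heat_kernel t y * exp (b \<bullet> y - t * (b \<bullet> b) / 2) = heat_kernel t (y - t *\<^sub>R b)"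
proof -
  have "- (norm y)\<^sup>2 / (2 * t) + (b \<bullet> y - t * (b \<bullet> b) / 2) = - (norm (y - t *\<^sub>R b))\<^sup>2 / (2 * t)"
  proof -
    have n: "(norm (y - t *\<^sub>R b))\<^sup>2 = (norm y)\<^sup>2 - 2 * t * (b \<bullet> y) + t\<^sup>2 * (b \<bullet> b)"
    proof -
      have "(y - t *\<^sub>R b) \<bullet> (y - t *\<^sub>R b) = y \<bullet> y - 2 * t * (b \<bullet> y) + t * t * (b \<bullet> b)"
        by (simp add: inner_diff_left inner_diff_right inner_commute[of y b] right_diff_distrib mult.assoc)
      then show ?thesis by (simp add: power2_norm_eq_inner power2_eq_square[of t])
    qed
    show ?thesis unfolding n using t by (simp add: field_simps power2_eq_square)
  qed
  then show ?thesis by (simp add: heat_kernel_def mult.assoc exp_add[symmetric])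
qed

context brownian
begin

lemma covariance_B:
  assumes st: "s \<in> {0..1}" "t \<in> {0..1}"
  shows "(\<integral>\<omega>. (b \<bullet> B s \<omega>) * (c \<bullet> B t \<omega>) \<partial>M) = min s t * (b \<bullet> c)"
proof -
  have *: "(\<integral>\<omega>. (b \<bullet> B s \<omega>) * (c \<bullet> B t \<omega>) \<partial>M) = s * (b \<bullet> c)" if "s \<le> t" "0 \<le> s" "t \<le> 1" for s t b c
  proof -
    define \<tau> where "\<tau> i = (if i = 0 then 0 else if i = 1 then s else t)" for i :: nat
    have g: "grid \<tau> 2" using that by (auto simp: grid_def \<tau>_def less_2_cases_iff)
    have "(\<integral>\<omega>. (b \<bullet> B s \<omega>) * (c \<bullet> B t \<omega>) \<partial>M)
      = (\<integral>\<omega>. lincomb \<tau> 2 (\<lambda>k. if k = 0 then b else 0) \<omega> * lincomb \<tau> 2 (\<lambda>_. c) \<omega> \<partial>M)"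
      by (rule Bochner_Integration.integral_cong)
        (auto simp: lincomb_def incr_def \<tau>_def numeral_2_eq_2 inner_diff_right B_0)
    also have "\<dots> = s * (b \<bullet> c)"
      by (subst covariance_lincomb[OF g]) (simp add: grid_cov_def \<tau>_def numeral_2_eq_2)
    finally show ?thesis .
  qed
  show ?thesis
  proof (cases "s \<le> t")
    case True
    then show ?thesis using *[of s t b c] st by simp
  next
    case False
    then show ?thesis using *[of t s c b] st by (simp add: mult.commute inner_commute min_def)
  qed
qed

text \<open>
  Uncorrelated Gaussian vectors are independent. The Cameron--Martin shift by \<open>t b\<close> moves \<open>Y\<close> but not
  \<open>U\<close>; integrating the shifted identity over all \<open>b\<close> replaces the law of \<open>Y\<close> by Lebesgue measure.
\<close>
lemma gaussian_indep:
  fixes U Y :: "'a \<Rightarrow> 'u::euclidean_space"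
  assumes U: "\<And>b. (\<lambda>\<omega>. U \<omega> \<bullet> b) \<in> gaussian_space" and Y: "\<And>b. (\<lambda>\<omega>. Y \<omega> \<bullet> b) \<in> gaussian_space"
    and t: "0 < t" and cY: "\<And>b c. (\<integral>\<omega>. (Y \<omega> \<bullet> b) * (Y \<omega> \<bullet> c) \<partial>M) = t * (b \<bullet> c)"
    and cU: "\<And>b c. (\<integral>\<omega>. (Y \<omega> \<bullet> b) * (U \<omega> \<bullet> c) \<partial>M) = 0"
    and law: "distr M borel Y = density lborel (\<lambda>x. ennreal (heat_kernel t x))"
  shows "distr M borel U \<Otimes>\<^sub>M distr M borel Y = distr M (borel \<Otimes>\<^sub>M borel) (\<lambda>\<omega>. (U \<omega>, Y \<omega>))"
proof -
  have Um [measurable]: "U \<in> borel_measurable M"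
    by (subst borel_measurable_euclidean_space) (auto intro: gaussian_space_measurable U)
  have Ym [measurable]: "Y \<in> borel_measurable M"
    by (subst borel_measurable_euclidean_space) (auto intro: gaussian_space_measurable Y)
  have tilt: "(\<integral>\<^sup>+\<omega>. ennreal (H (U \<omega>, Y \<omega> + t *\<^sub>R b)) \<partial>M)
      = (\<integral>\<^sup>+\<omega>. ennreal (H (U \<omega>, Y \<omega>) * exp (b \<bullet> Y \<omega> - t * (b \<bullet> b) / 2)) \<partial>M)"
    if Hm: "H \<in> borel_measurable borel" and H: "\<And>p. 0 \<le> H p" "\<And>p. H p \<le> C" for H C b
  proof -
    have UY: "(\<lambda>\<omega>. (U \<omega>, Y \<omega>) \<bullet> p) \<in> gaussian_space" if "p \<in> Basis" for p
      using that U[of "fst p"] Y[of "snd p"] by (auto simp: Basis_prod_def)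
    obtain \<tau> n a \<beta> where g: "grid \<tau> n" and a: "\<And>\<omega>. \<omega> \<in> space M \<Longrightarrow> Y \<omega> \<bullet> b = lincomb \<tau> n a \<omega>"
      and \<beta>: "\<And>\<omega>. \<omega> \<in> space M \<Longrightarrow> (U \<omega>, Y \<omega>) = grid_vec \<tau> n \<beta> \<omega>"
      by (rule gaussian_space_grid[OF Y[of b] UY]) (assumption, rule that, assumption, blast+)
    have aa: "grid_cov \<tau> n a a = t * (b \<bullet> b)"
      unfolding covariance_lincomb[OF g, symmetric] cY[symmetric]
      by (rule Bochner_Integration.integral_cong) (simp_all add: a)
    have ab: "grid_cov \<tau> n a (\<beta> p) = (if fst p = 0 then t * (b \<bullet> snd p) else 0)" if p: "p \<in> Basis" for p
    proof -
      have "grid_cov \<tau> n a (\<beta> p) = (\<integral>\<omega>. (Y \<omega> \<bullet> b) * ((U \<omega>, Y \<omega>) \<bullet> p) \<partial>M)"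
        unfolding covariance_lincomb[OF g, symmetric]
        by (rule Bochner_Integration.integral_cong) (simp_all add: a \<beta> grid_vec_inner[OF p])
      also have "\<dots> = (if fst p = 0 then t * (b \<bullet> snd p) else 0)"
        using p cY cU by (auto simp: Basis_prod_def)
      finally show ?thesis .
    qed
    have c: "(\<Sum>p\<in>Basis. grid_cov \<tau> n a (\<beta> p) *\<^sub>R p) = (0, t *\<^sub>R b)"
    proof -
      have "(\<Sum>p\<in>Basis. grid_cov \<tau> n a (\<beta> p) *\<^sub>R p) = (\<Sum>p\<in>(Basis::('u \<times> 'u) set). ((0, t *\<^sub>R b) \<bullet> p) *\<^sub>R p)"
      proof (rule sum.cong[OF refl])
        fix p :: "'u \<times> 'u" assume p: "p \<in> Basis"
        then have "fst p = 0 \<or> snd p = 0" by (auto simp: Basis_prod_def)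
        then have "(0, t *\<^sub>R b) \<bullet> p = (if fst p = 0 then t * (b \<bullet> snd p) else 0)"
          by (cases p) auto
        then show "grid_cov \<tau> n a (\<beta> p) *\<^sub>R p = ((0, t *\<^sub>R b) \<bullet> p) *\<^sub>R p"
          by (simp only: ab[OF p])
      qed
      then show ?thesis by (simp add: euclidean_representation)
    qed
    have eq: "(\<integral>\<omega>. H (U \<omega>, Y \<omega> + t *\<^sub>R b) \<partial>M) = (\<integral>\<omega>. H (U \<omega>, Y \<omega>) * exp (b \<bullet> Y \<omega> - t * (b \<bullet> b) / 2) \<partial>M)"
    proof -
      have "(\<integral>\<omega>. H (U \<omega>, Y \<omega> + t *\<^sub>R b) \<partial>M) = (\<integral>\<omega>. H (grid_vec \<tau> n \<beta> \<omega> + (0, t *\<^sub>R b)) \<partial>M)"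
        by (rule Bochner_Integration.integral_cong) (simp_all add: \<beta>[symmetric])
      also have "\<dots> = (\<integral>\<omega>. H (grid_vec \<tau> n \<beta> \<omega>) * exp (lincomb \<tau> n a \<omega> - grid_cov \<tau> n a a / 2) \<partial>M)"
        using cameron_martin[OF g Hm, of \<beta> a] by (simp add: c)
      also have "\<dots> = (\<integral>\<omega>. H (U \<omega>, Y \<omega>) * exp (b \<bullet> Y \<omega> - t * (b \<bullet> b) / 2) \<partial>M)"
        by (rule Bochner_Integration.integral_cong) (simp_all add: \<beta>[symmetric] a[symmetric] aa inner_commute)
      finally show ?thesis .
    qed
    have Hm' [measurable]: "H \<in> borel_measurable (borel \<Otimes>\<^sub>M borel)"
      using Hm by (simp add: borel_prod)
    have i1: "integrable M (\<lambda>\<omega>. H (U \<omega>, Y \<omega> + t *\<^sub>R b))"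
      by (rule integrable_const_bound[where B=C]) (use H in auto)
    have i2: "integrable M (\<lambda>\<omega>. H (U \<omega>, Y \<omega>) * exp (b \<bullet> Y \<omega> - t * (b \<bullet> b) / 2))"
    proof (rule Bochner_Integration.integrable_bound)
      have "integrable M (\<lambda>\<omega>. C * exp (- t * (b \<bullet> b) / 2) * exp (lincomb \<tau> n a \<omega>))"
        by (intro integrable_mult_right exp_lincomb g)
      then show "integrable M (\<lambda>\<omega>. C * exp (- t * (b \<bullet> b) / 2) * exp (b \<bullet> Y \<omega>))"
        by (rule Bochner_Integration.integrable_cong[THEN iffD1, rotated -1]) (simp_all add: a[symmetric] inner_commute)
      have "norm (H (U \<omega>, Y \<omega>) * exp (b \<bullet> Y \<omega> - t * (b \<bullet> b) / 2)) \<le> norm (C * exp (- t * (b \<bullet> b) / 2) * exp (b \<bullet> Y \<omega>))" for \<omega>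
      proof -
        have "0 \<le> C" using H(1)[of undefined] H(2)[of undefined] by linarith
        moreover have e: "C * exp (- t * (b \<bullet> b) / 2) * exp (b \<bullet> Y \<omega>) = C * exp (b \<bullet> Y \<omega> - t * (b \<bullet> b) / 2)"
          by (simp add: mult.assoc mult_exp_exp)
        ultimately show ?thesis
          unfolding e using H[of "(U \<omega>, Y \<omega>)"] by (simp add: abs_mult mult_right_mono)
      qed
      then show "AE \<omega> in M. norm (H (U \<omega>, Y \<omega>) * exp (b \<bullet> Y \<omega> - t * (b \<bullet> b) / 2)) \<le> norm (C * exp (- t * (b \<bullet> b) / 2) * exp (b \<bullet> Y \<omega>))"
        by simp
    qed measurable
    show ?thesis
      using i1 i2 H(1) by (simp add: nn_integral_eq_integral eq)
  qed
  interpret U: prob_space "distr M borel U" by (rule prob_space_distr) simp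
  interpret Y: prob_space "distr M borel Y" by (rule prob_space_distr) simp
  interpret MB: pair_sigma_finite M "lborel :: 'u measure" ..
  define J where "J = ennreal (\<bar>t\<bar> ^ DIM('u))"
  show ?thesis
  proof (rule pair_measure_eqI)
    show "sigma_finite_measure (distr M borel U)" "sigma_finite_measure (distr M borel Y)" ..
    show "sets (distr M borel U \<Otimes>\<^sub>M distr M borel Y) = sets (distr M (borel \<Otimes>\<^sub>M borel) (\<lambda>\<omega>. (U \<omega>, Y \<omega>)))"
      by (simp cong: sets_pair_measure_cong)
    fix A D assume "A \<in> sets (distr M borel U)" "D \<in> sets (distr M borel Y)"
    then have [measurable]: "A \<in> sets borel" "D \<in> sets borel" by auto
    \<comment> \<open>With the density as a factor, the integral of \<open>\<kappa>\<close> over all shifts is a multiple of the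
      probability that \<open>Y\<close> lies in \<open>D\<close>.\<close>
    define \<kappa> where "\<kappa> y = indicator D y * heat_kernel t y" for y :: 'u
    have [measurable]: "\<kappa> \<in> borel_measurable borel" unfolding \<kappa>_def[abs_def] by measurable
    have \<kappa>: "0 \<le> \<kappa> y" "\<kappa> y \<le> (2 * pi * t) powr (- real DIM('u) / 2)" for y
      using heat_kernel_le[OF t, of y] by (auto simp: \<kappa>_def indicator_def)
    have "(\<integral>\<^sup>+b. \<integral>\<^sup>+\<omega>. ennreal (indicator A (U \<omega>) * \<kappa> (Y \<omega> + t *\<^sub>R b)) \<partial>M \<partial>lborel)
        = (\<integral>\<^sup>+b. \<integral>\<^sup>+\<omega>. ennreal (indicator A (U \<omega>) * \<kappa> (Y \<omega>) * exp (b \<bullet> Y \<omega> - t * (b \<bullet> b) / 2)) \<partial>M \<partial>lborel)"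
    proof (rule nn_integral_cong)
      fix b
      show "(\<integral>\<^sup>+\<omega>. ennreal (indicator A (U \<omega>) * \<kappa> (Y \<omega> + t *\<^sub>R b)) \<partial>M)
        = (\<integral>\<^sup>+\<omega>. ennreal (indicator A (U \<omega>) * \<kappa> (Y \<omega>) * exp (b \<bullet> Y \<omega> - t * (b \<bullet> b) / 2)) \<partial>M)"
        using tilt[of "\<lambda>p. indicator A (fst p) * \<kappa> (snd p)" "(2 * pi * t) powr (- real DIM('u) / 2)" b] \<kappa>
        by (auto simp: borel_prod[symmetric] indicator_def)
    qed
    also have "(\<integral>\<^sup>+b. \<integral>\<^sup>+\<omega>. ennreal (indicator A (U \<omega>) * \<kappa> (Y \<omega> + t *\<^sub>R b)) \<partial>M \<partial>lborel)
      = (\<integral>\<^sup>+\<omega>. \<integral>\<^sup>+b. ennreal (indicator A (U \<omega>) * \<kappa> (Y \<omega> + t *\<^sub>R b)) \<partial>lborel \<partial>M)"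
      by (rule MB.Fubini') simp
    also have "(\<integral>\<^sup>+b. \<integral>\<^sup>+\<omega>. ennreal (indicator A (U \<omega>) * \<kappa> (Y \<omega>) * exp (b \<bullet> Y \<omega> - t * (b \<bullet> b) / 2)) \<partial>M \<partial>lborel)
      = (\<integral>\<^sup>+\<omega>. \<integral>\<^sup>+b. ennreal (indicator A (U \<omega>) * \<kappa> (Y \<omega>) * exp (b \<bullet> Y \<omega> - t * (b \<bullet> b) / 2)) \<partial>lborel \<partial>M)"
      by (rule MB.Fubini') simp
    finally have main: "(\<integral>\<^sup>+\<omega>. J * (\<integral>\<^sup>+b. ennreal (indicator A (U \<omega>) * \<kappa> (Y \<omega> + t *\<^sub>R b)) \<partial>lborel) \<partial>M)
      = (\<integral>\<^sup>+\<omega>. J * (\<integral>\<^sup>+b. ennreal (indicator A (U \<omega>) * \<kappa> (Y \<omega>) * exp (b \<bullet> Y \<omega> - t * (b \<bullet> b) / 2)) \<partial>lborel) \<partial>M)"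
      by (simp add: nn_integral_cmult)
    have left: "J * (\<integral>\<^sup>+b. ennreal (indicator A (U \<omega>) * \<kappa> (Y \<omega> + t *\<^sub>R b)) \<partial>lborel)
      = indicator A (U \<omega>) * (\<integral>\<^sup>+y. ennreal (\<kappa> y) \<partial>lborel)" for \<omega>
    proof -
      have "(\<integral>\<^sup>+y. ennreal (\<kappa> y) \<partial>lborel) = J * (\<integral>\<^sup>+b. ennreal (\<kappa> (Y \<omega> + t *\<^sub>R b)) \<partial>lborel)"
        unfolding J_def using t by (intro nn_integral_lborel_affine) auto
      then show ?thesis by (cases "U \<omega> \<in> A") auto
    qed
    have right: "J * (\<integral>\<^sup>+b. ennreal (indicator A (U \<omega>) * \<kappa> (Y \<omega>) * exp (b \<bullet> Y \<omega> - t * (b \<bullet> b) / 2)) \<partial>lborel)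
      = indicator A (U \<omega>) * indicator D (Y \<omega>)" for \<omega>
    proof -
      have e: "\<kappa> (Y \<omega>) * exp (b \<bullet> Y \<omega> - t * (b \<bullet> b) / 2) = indicator D (Y \<omega>) * heat_kernel t (Y \<omega> + (- t) *\<^sub>R b)" for b
        using heat_kernel_tilt[OF t, of "Y \<omega>" b] by (simp add: \<kappa>_def mult.assoc)
      have "1 = (\<integral>\<^sup>+y. ennreal (heat_kernel t (y::'u)) \<partial>lborel)" by (simp add: nn_integral_heat_kernel t)
      also have "\<dots> = J * (\<integral>\<^sup>+b. ennreal (heat_kernel t (Y \<omega> + (- t) *\<^sub>R b)) \<partial>lborel)"
        unfolding J_def abs_minus_cancel[of t, symmetric] using t by (intro nn_integral_lborel_affine) auto
      finally show ?thesis
        unfolding mult.assoc e by (cases "U \<omega> \<in> A"; cases "Y \<omega> \<in> D") auto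
    qed
    have "emeasure (distr M borel U) A * emeasure (distr M borel Y) D
      = (\<integral>\<^sup>+\<omega>. indicator A (U \<omega>) \<partial>M) * (\<integral>\<^sup>+y. ennreal (\<kappa> y) \<partial>lborel)"
    proof -
      have "emeasure (distr M borel U) A = (\<integral>\<^sup>+u. indicator A u \<partial>distr M borel U)" by simp
      also have "\<dots> = (\<integral>\<^sup>+\<omega>. indicator A (U \<omega>) \<partial>M)" by (rule nn_integral_distr) auto
      finally have "emeasure (distr M borel U) A = (\<integral>\<^sup>+\<omega>. indicator A (U \<omega>) \<partial>M)" .
      moreover have "emeasure (distr M borel Y) D = (\<integral>\<^sup>+y. ennreal (\<kappa> y) \<partial>lborel)"
        unfolding law by (subst emeasure_density) (auto simp: \<kappa>_def indicator_def intro!: nn_integral_cong)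
      ultimately show ?thesis by simp
    qed
    also have "\<dots> = (\<integral>\<^sup>+\<omega>. indicator A (U \<omega>) * indicator D (Y \<omega>) \<partial>M)"
      using main unfolding left right by (simp add: nn_integral_multc)
    also have "\<dots> = (\<integral>\<^sup>+p. indicator (A \<times> D) p \<partial>distr M (borel \<Otimes>\<^sub>M borel) (\<lambda>\<omega>. (U \<omega>, Y \<omega>)))"
      by (subst nn_integral_distr) (auto simp: indicator_times)
    also have "\<dots> = emeasure (distr M (borel \<Otimes>\<^sub>M borel) (\<lambda>\<omega>. (U \<omega>, Y \<omega>))) (A \<times> D)" by simp
    finally show "emeasure (distr M borel U) A * emeasure (distr M borel Y) D = \<dots>" .
  qed
qed

lemma distr_increment:
  assumes "0 \<le> t1" "t1 < t2" "t2 \<le> 1"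
  shows "distr M borel (\<lambda>\<omega>. B t2 \<omega> - B t1 \<omega>) = density lborel (\<lambda>x. ennreal (heat_kernel (t2 - t1) x))"
  using distr_incr[of t1 t2] gauss_eq_density[of "t2 - t1"] assms by simp

text \<open>
  Gaussian regression: the coefficient \<open>a\<close> makes the residual uncorrelated with the second increment.
\<close>
lemma increment_regression:
  assumes s: "s1 \<in> {0..1}" "s2 \<in> {0..1}" and t: "0 \<le> t1" "t1 < t2" "t2 \<le> 1"
  obtains a where "distr M borel (\<lambda>\<omega>. (B s2 \<omega> - B s1 \<omega>) - a *\<^sub>R (B t2 \<omega> - B t1 \<omega>)) \<Otimes>\<^sub>M distr M borel (\<lambda>\<omega>. B t2 \<omega> - B t1 \<omega>)
    = distr M (borel \<Otimes>\<^sub>M borel) (\<lambda>\<omega>. ((B s2 \<omega> - B s1 \<omega>) - a *\<^sub>R (B t2 \<omega> - B t1 \<omega>), B t2 \<omega> - B t1 \<omega>))"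
proof -
  define X where "X \<omega> = B s2 \<omega> - B s1 \<omega>" for \<omega>
  define Y where "Y \<omega> = B t2 \<omega> - B t1 \<omega>" for \<omega>
  have t': "t1 \<in> {0..1}" "t2 \<in> {0..1}" using t by auto
  have L: "(\<lambda>\<omega>. c \<bullet> B s \<omega>) \<in> L2 M" if "s \<in> {0..1}" for s c by (rule second_moment[OF that])
  have cov: "(\<integral>\<omega>. ((B v2 \<omega> - B v1 \<omega>) \<bullet> b) * ((B r2 \<omega> - B r1 \<omega>) \<bullet> c) \<partial>M)
      = (min v2 r2 - min v2 r1 - min v1 r2 + min v1 r1) * (b \<bullet> c)"
    if v: "v1 \<in> {0..1}" "v2 \<in> {0..1}" "r1 \<in> {0..1}" "r2 \<in> {0..1}" for v1 v2 r1 r2 b c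
  proof -
    have i: "integrable M (\<lambda>\<omega>. (b \<bullet> B p \<omega>) * (c \<bullet> B q \<omega>))" if "p \<in> {0..1}" "q \<in> {0..1}" for p q
      by (rule L2_integrable_mult[OF L L]) (use that in auto)
    have "(\<integral>\<omega>. ((B v2 \<omega> - B v1 \<omega>) \<bullet> b) * ((B r2 \<omega> - B r1 \<omega>) \<bullet> c) \<partial>M)
      = (\<integral>\<omega>. (b \<bullet> B v2 \<omega>) * (c \<bullet> B r2 \<omega>) - (b \<bullet> B v2 \<omega>) * (c \<bullet> B r1 \<omega>)
          - (b \<bullet> B v1 \<omega>) * (c \<bullet> B r2 \<omega>) + (b \<bullet> B v1 \<omega>) * (c \<bullet> B r1 \<omega>) \<partial>M)"
      by (rule Bochner_Integration.integral_cong) (auto simp: inner_commute inner_diff_right algebra_simps)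
    also have "\<dots> = (min v2 r2 - min v2 r1 - min v1 r2 + min v1 r1) * (b \<bullet> c)"
      using i v by (simp add: covariance_B algebra_simps)
    finally show ?thesis .
  qed
  define a where "a = (min t2 s2 - min t2 s1 - min t1 s2 + min t1 s1) / (t2 - t1)"
  have cYY: "(\<integral>\<omega>. (Y \<omega> \<bullet> b) * (Y \<omega> \<bullet> c) \<partial>M) = (t2 - t1) * (b \<bullet> c)" for b c
    unfolding Y_def cov[OF t' t'] using t by (simp add: min_def)
  have cYX: "(\<integral>\<omega>. (Y \<omega> \<bullet> b) * (X \<omega> \<bullet> c) \<partial>M) = a * (t2 - t1) * (b \<bullet> c)" for b c
    unfolding X_def Y_def cov[OF t' s] a_def using t by simp
  have YL: "(\<lambda>\<omega>. Y \<omega> \<bullet> b) \<in> L2 M" for b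
    using L2_diff[OF L[OF t'(2), of b] L[OF t'(1), of b]] by (simp add: Y_def inner_diff_right inner_commute)
  have XL: "(\<lambda>\<omega>. X \<omega> \<bullet> b) \<in> L2 M" for b
    using L2_diff[OF L[OF s(2), of b] L[OF s(1), of b]] by (simp add: X_def inner_diff_right inner_commute)
  have Yg: "(\<lambda>\<omega>. Y \<omega> \<bullet> b) \<in> gaussian_space" for b
    using gaussian_space_add_scale[OF gaussian_space_inner[OF t'(1), of b] gaussian_space_inner[OF t'(2), of b], of "-1"]
    by (simp add: Y_def inner_diff_right inner_commute)
  have Xg: "(\<lambda>\<omega>. X \<omega> \<bullet> b) \<in> gaussian_space" for b
    using gaussian_space_add_scale[OF gaussian_space_inner[OF s(1), of b] gaussian_space_inner[OF s(2), of b], of "-1"]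
    by (simp add: X_def inner_diff_right inner_commute)
  have "distr M borel (\<lambda>\<omega>. X \<omega> - a *\<^sub>R Y \<omega>) \<Otimes>\<^sub>M distr M borel Y
    = distr M (borel \<Otimes>\<^sub>M borel) (\<lambda>\<omega>. (X \<omega> - a *\<^sub>R Y \<omega>, Y \<omega>))"
  proof (rule gaussian_indep[where t="t2 - t1"])
    show "(\<lambda>\<omega>. (X \<omega> - a *\<^sub>R Y \<omega>) \<bullet> b) \<in> gaussian_space" for b
      using gaussian_space_add_scale[OF Yg[of b] Xg[of b], of "-a"] by (simp add: inner_diff_left)
    show "(\<integral>\<omega>. (Y \<omega> \<bullet> b) * ((X \<omega> - a *\<^sub>R Y \<omega>) \<bullet> c) \<partial>M) = 0" for b c
    proof -
      have "(\<integral>\<omega>. (Y \<omega> \<bullet> b) * ((X \<omega> - a *\<^sub>R Y \<omega>) \<bullet> c) \<partial>M)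
        = (\<integral>\<omega>. (Y \<omega> \<bullet> b) * (X \<omega> \<bullet> c) - a * ((Y \<omega> \<bullet> b) * (Y \<omega> \<bullet> c)) \<partial>M)"
        by (rule Bochner_Integration.integral_cong) (auto simp: inner_diff_left algebra_simps)
      also have "\<dots> = 0"
        using L2_integrable_mult[OF YL XL, of b c] L2_integrable_mult[OF YL YL, of b c]
        by (simp add: cYX cYY)
      finally show ?thesis .
    qed
    show "distr M borel Y = density lborel (\<lambda>x. ennreal (heat_kernel (t2 - t1) x))"
      unfolding Y_def[abs_def] by (rule distr_increment[OF t])
  qed (use t Yg cYY in auto)
  then show thesis by (intro that[of a]) (simp add: X_def[abs_def] Y_def[abs_def])
qed

end

text \<open>
  Open sets of Lebesgue measure zero are empty.
\<close>
lemma continuous_AE_eq: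
  fixes \<phi> \<psi> :: "'v::euclidean_space \<Rightarrow> real"
  assumes c: "continuous_on UNIV \<phi>" "continuous_on UNIV \<psi>" and ae: "AE x in lborel. \<phi> x = \<psi> x"
  shows "\<phi> = \<psi>"
proof -
  have "open {x. \<phi> x \<noteq> \<psi> x}"
    using c by (intro open_Collect_neq)
  moreover have "{x. \<phi> x \<noteq> \<psi> x} \<in> null_sets lborel"
    using ae \<open>open {x. \<phi> x \<noteq> \<psi> x}\<close> by (subst AE_iff_null_sets) (auto intro: borel_open)
  then have "negligible {x. \<phi> x \<noteq> \<psi> x}"
    by (simp add: negligible_iff_null_sets null_sets_completionI)
  ultimately have "{x. \<phi> x \<noteq> \<psi> x} = {}" using open_not_negligible by blast
  then show ?thesis by auto
qed

text \<open>
  Fubini for the product law of \<open>P\<close> and \<open>Y\<close> shows that \<open>y \<mapsto> E[h(P, y)]\<close> is a version of the conditional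
  expectation given \<open>Y\<close>. It is the only continuous one, because the law of \<open>Y\<close> has a positive density.
\<close>
lemma (in prob_space) cond_exp_at_indep:
  fixes Y :: "'a \<Rightarrow> 'v::euclidean_space"
  assumes P [measurable]: "P \<in> measurable M N" and Y [measurable]: "Y \<in> borel_measurable M"
    and ind: "distr M N P \<Otimes>\<^sub>M distr M borel Y = distr M (N \<Otimes>\<^sub>M borel) (\<lambda>\<omega>. (P \<omega>, Y \<omega>))"
    and law: "distr M borel Y = density lborel (\<lambda>x. ennreal (p x))" "\<And>x. 0 < p x" "p \<in> borel_measurable borel"
    and h [measurable]: "(\<lambda>(x, y). h x y) \<in> borel_measurable (N \<Otimes>\<^sub>M borel)"
    and int: "integrable M (\<lambda>\<omega>. h (P \<omega>) (Y \<omega>))"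
    and cont: "continuous_on UNIV (\<lambda>y. \<integral>\<omega>. h (P \<omega>) y \<partial>M)"
  shows "cond_exp_at M (\<lambda>\<omega>. h (P \<omega>) (Y \<omega>)) Y y = (\<integral>\<omega>. h (P \<omega>) y \<partial>M)"
    and "\<And>k. k \<in> borel_measurable borel \<Longrightarrow> integrable M (\<lambda>\<omega>. k (Y \<omega>) * h (P \<omega>) (Y \<omega>)) \<Longrightarrow>
      (\<integral>\<omega>. k (Y \<omega>) * h (P \<omega>) (Y \<omega>) \<partial>M) = (\<integral>y. p y * (k y * (\<integral>\<omega>. h (P \<omega>) y \<partial>M)) \<partial>lborel)"
proof -
  define \<phi> where "\<phi> y = (\<integral>\<omega>. h (P \<omega>) y \<partial>M)" for y
  interpret P: prob_space "distr M N P" by (rule prob_space_distr[OF P])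
  interpret Y: prob_space "distr M borel Y" by (rule prob_space_distr[OF Y])
  interpret PY: pair_sigma_finite "distr M N P" "distr M borel Y" ..
  have \<phi>m [measurable]: "\<phi> \<in> borel_measurable borel"
    unfolding \<phi>_def[abs_def] by (rule borel_measurable_continuous_onI[OF cont])
  have sub: "subalgebra M (vimage_algebra (space M) Y borel)"
    unfolding subalgebra_def using measurable_sets[OF Y] by (auto simp: sets_vimage_algebra2)
  interpret S: finite_measure_subalgebra M "vimage_algebra (space M) Y borel"
    by unfold_locales (rule sub)
  have \<phi>P: "\<phi> y = (\<integral>x. h x y \<partial>distr M N P)" for y
  proof -
    have "(\<lambda>x. h x y) \<in> borel_measurable N"
      using measurable_compose[OF measurable_Pair2'[of y borel N] h] by simp
    then show ?thesis unfolding \<phi>_def by (intro integral_distr[symmetric] P)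
  qed
  have *: "(\<integral>\<omega>. k (Y \<omega>) * h (P \<omega>) (Y \<omega>) \<partial>M) = (\<integral>\<omega>. k (Y \<omega>) * \<phi> (Y \<omega>) \<partial>M)"
    and **: "integrable M (\<lambda>\<omega>. k (Y \<omega>) * \<phi> (Y \<omega>))"
    if k [measurable]: "k \<in> borel_measurable borel" and i: "integrable M (\<lambda>\<omega>. k (Y \<omega>) * h (P \<omega>) (Y \<omega>))" for k
  proof -
    have i': "integrable (distr M N P \<Otimes>\<^sub>M distr M borel Y) (\<lambda>(x, y). k y * h x y)"
      unfolding ind using i by (subst integrable_distr_eq) (auto simp: split_beta')
    have "(\<integral>\<omega>. k (Y \<omega>) * h (P \<omega>) (Y \<omega>) \<partial>M) = (\<integral>q. (\<lambda>(x, y). k y * h x y) q \<partial>distr M (N \<Otimes>\<^sub>M borel) (\<lambda>\<omega>. (P \<omega>, Y \<omega>)))"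
      by (subst integral_distr) (auto simp: split_beta')
    also have "\<dots> = (\<integral>y. \<integral>x. k y * h x y \<partial>distr M N P \<partial>distr M borel Y)"
      unfolding ind[symmetric] using PY.integral_snd[OF i'] by simp
    also have "\<dots> = (\<integral>y. k y * \<phi> y \<partial>distr M borel Y)"
      by (simp add: \<phi>P)
    also have "\<dots> = (\<integral>\<omega>. k (Y \<omega>) * \<phi> (Y \<omega>) \<partial>M)"
      by (rule integral_distr) auto
    finally show "(\<integral>\<omega>. k (Y \<omega>) * h (P \<omega>) (Y \<omega>) \<partial>M) = (\<integral>\<omega>. k (Y \<omega>) * \<phi> (Y \<omega>) \<partial>M)" .
    have "integrable (distr M borel Y) (\<lambda>y. k y * \<phi> y)"
      using PY.integrable_snd[OF i'] by (simp add: \<phi>P)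
    then show "integrable M (\<lambda>\<omega>. k (Y \<omega>) * \<phi> (Y \<omega>))"
      by (subst (asm) integrable_distr_eq) auto
  qed
  have ae: "AE \<omega> in M. real_cond_exp M (vimage_algebra (space M) Y borel) (\<lambda>\<omega>. h (P \<omega>) (Y \<omega>)) \<omega> = \<phi> (Y \<omega>)"
  proof (rule S.real_cond_exp_charact)
    fix A assume "A \<in> sets (vimage_algebra (space M) Y borel)"
    then obtain D where D [measurable]: "D \<in> sets borel" and A: "A = Y -` D \<inter> space M"
      by (auto simp: sets_vimage_algebra2)
    have e: "(\<integral>\<omega>\<in>A. g \<omega> \<partial>M) = (\<integral>\<omega>. indicator D (Y \<omega>) * g \<omega> \<partial>M)" for g :: "'a \<Rightarrow> real"
      unfolding set_lebesgue_integral_def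
      by (rule Bochner_Integration.integral_cong) (auto simp: A indicator_def)
    have "integrable M (\<lambda>\<omega>. indicator D (Y \<omega>) * h (P \<omega>) (Y \<omega>))"
      by (rule Bochner_Integration.integrable_bound[OF int]) (auto simp: indicator_def)
    then show "(\<integral>\<omega>\<in>A. h (P \<omega>) (Y \<omega>) \<partial>M) = (\<integral>\<omega>\<in>A. \<phi> (Y \<omega>) \<partial>M)"
      unfolding e by (intro *) auto
  next
    show "integrable M (\<lambda>\<omega>. h (P \<omega>) (Y \<omega>))" by fact
    show "integrable M (\<lambda>\<omega>. \<phi> (Y \<omega>))" using **[of "\<lambda>_. 1"] int by simp
    show "(\<lambda>\<omega>. \<phi> (Y \<omega>)) \<in> borel_measurable (vimage_algebra (space M) Y borel)"
      by (rule measurable_compose[OF measurable_vimage_algebra1 \<phi>m]) auto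
  qed
  have "(THE \<psi>. continuous_on UNIV \<psi> \<and>
        (AE \<omega> in M. real_cond_exp M (vimage_algebra (space M) Y borel) (\<lambda>\<omega>. h (P \<omega>) (Y \<omega>)) \<omega> = \<psi> (Y \<omega>))) = \<phi>"
  proof (rule the_equality)
    show "continuous_on UNIV \<phi> \<and> (AE \<omega> in M. real_cond_exp M (vimage_algebra (space M) Y borel) (\<lambda>\<omega>. h (P \<omega>) (Y \<omega>)) \<omega> = \<phi> (Y \<omega>))"
      using ae cont by (simp add: \<phi>_def[abs_def])
    fix \<psi> assume \<psi>: "continuous_on UNIV \<psi> \<and>
        (AE \<omega> in M. real_cond_exp M (vimage_algebra (space M) Y borel) (\<lambda>\<omega>. h (P \<omega>) (Y \<omega>)) \<omega> = \<psi> (Y \<omega>))"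
    then have [measurable]: "\<psi> \<in> borel_measurable borel" by (intro borel_measurable_continuous_onI) simp
    have "AE \<omega> in M. \<psi> (Y \<omega>) = \<phi> (Y \<omega>)"
      using conjunct2[OF \<psi>] ae by eventually_elim simp
    then have "AE y in distr M borel Y. \<psi> y = \<phi> y"
      by (subst AE_distr_iff) auto
    then have "AE y in lborel. \<psi> y = \<phi> y"
      unfolding law(1) using law(2,3) by (subst (asm) AE_density) auto
    then show "\<psi> = \<phi>"
      using \<psi> cont by (intro continuous_AE_eq) (auto simp: \<phi>_def[abs_def])
  qed
  then show "cond_exp_at M (\<lambda>\<omega>. h (P \<omega>) (Y \<omega>)) Y y = (\<integral>\<omega>. h (P \<omega>) y \<partial>M)"
    by (simp add: cond_exp_at_def \<phi>_def)
  fix k :: "'v \<Rightarrow> real" assume k [measurable]: "k \<in> borel_measurable borel" and i: "integrable M (\<lambda>\<omega>. k (Y \<omega>) * h (P \<omega>) (Y \<omega>))"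
  have "(\<integral>\<omega>. k (Y \<omega>) * h (P \<omega>) (Y \<omega>) \<partial>M) = (\<integral>\<omega>. k (Y \<omega>) * \<phi> (Y \<omega>) \<partial>M)" by (rule *[OF k i])
  also have "\<dots> = (\<integral>y. k y * \<phi> y \<partial>distr M borel Y)" by (rule integral_distr[symmetric]) auto
  also have "\<dots> = (\<integral>y. p y * (k y * \<phi> y) \<partial>lborel)"
    unfolding law(1) using law(2,3) by (subst integral_density) (auto intro: less_imp_le)
  finally show "(\<integral>\<omega>. k (Y \<omega>) * h (P \<omega>) (Y \<omega>) \<partial>M) = (\<integral>y. p y * (k y * (\<integral>\<omega>. h (P \<omega>) y \<partial>M)) \<partial>lborel)"
    by (simp add: \<phi>_def)
qed

section \<open>Gaussian averages and heat kernel estimates\<close>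

lemma heat_kernel_real: "heat_kernel t (x::real) = (2 * pi * t) powr (- 1 / 2) * exp (- x\<^sup>2 / (2 * t))"
  by (simp add: heat_kernel_def)

text \<open>
  This is where the exponential weight in the hypothesis is used: the Cauchy--Schwarz inequality with
  the weight \<open>exp (- v\<^sup>2 / 4)\<close>, in the form \<open>2 a b \<le> a\<^sup>2 + b\<^sup>2\<close> with a free parameter \<open>\<mu>\<close>. The constant
  \<open>\<mu> = 1\<close> gives a bound on the average, a large \<open>\<mu>\<close> shows that it is small
  when the weighted norm of \<open>g\<close> is small.
\<close>
lemma gaussian_average:
  fixes g :: "real \<Rightarrow> real"
  assumes g [measurable]: "g \<in> borel_measurable borel"
    and G: "integrable lborel (\<lambda>x. (g x)\<^sup>2 * exp (- x\<^sup>2 / 2))"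
    and rc: "r\<^sup>2 + c\<^sup>2 = 1" "0 < c" and \<tau>: "0 < \<tau>" "\<tau> \<le> 1" and \<mu>: "0 < \<mu>"
  shows "integrable lborel (\<lambda>x. heat_kernel \<tau> x * \<bar>g (r * y + c * x)\<bar>)"
    and "(\<integral>x. heat_kernel \<tau> x * \<bar>g (r * y + c * x)\<bar> \<partial>lborel)
      \<le> exp (y\<^sup>2 / 4) / 2 * (\<mu> * (\<integral>x. (g x)\<^sup>2 * exp (- x\<^sup>2 / 2) \<partial>lborel) / c + (2 * pi * \<tau>) powr (- 1 / 2) / \<mu>)"
proof -
  define D where "D = (2 * pi * \<tau>) powr (- 1 / 2)"
  define W where "W x = (g x)\<^sup>2 * exp (- x\<^sup>2 / 2)" for x
  define p :: "real \<Rightarrow> real" where "p = heat_kernel \<tau>"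
  have D: "0 < D" using \<tau> by (simp add: D_def)
  have iW: "integrable lborel (\<lambda>x. W (r * y + c * x))"
  proof -
    have "integrable lborel W" using G by (simp add: W_def[abs_def])
    from lborel_integrable_real_affine[OF this, of c "r * y"] show ?thesis using rc by simp
  qed
  have WI: "(\<integral>x. W (r * y + c * x) \<partial>lborel) = (\<integral>x. W x \<partial>lborel) / c"
    using lborel_integral_real_affine[of c W "r * y"] rc by (simp add: field_simps)
  have ip: "integrable lborel p" unfolding p_def by (rule integrable_heat_kernel[OF \<tau>(1)])
  have pI: "(\<integral>x. p x \<partial>lborel) = 1" unfolding p_def by (rule integral_heat_kernel[OF \<tau>(1)])
  define b where "b x = exp (y\<^sup>2 / 4) / 2 * (\<mu> * W (r * y + c * x) + D / \<mu> * p x)" for x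
  have ib: "integrable lborel b"
    unfolding b_def[abs_def] by (intro integrable_mult_right Bochner_Integration.integrable_add iW ip)
  have bI: "(\<integral>x. b x \<partial>lborel) = exp (y\<^sup>2 / 4) / 2 * (\<mu> * (\<integral>x. W x \<partial>lborel) / c + D / \<mu>)"
    unfolding b_def[abs_def] using iW ip by (simp add: WI pI)
  have le: "p x * \<bar>g (r * y + c * x)\<bar> \<le> b x" for x
  proof -
    define v where "v = r * y + c * x"
    define L where "L = \<mu> * exp (y\<^sup>2 / 4)"
    have L: "0 < L" using \<mu> by (simp add: L_def)
    have p0: "0 \<le> p x" by (simp add: p_def)
    have v2: "v\<^sup>2 \<le> y\<^sup>2 + x\<^sup>2"
    proof -
      have "v\<^sup>2 + (r * x - c * y)\<^sup>2 = (r\<^sup>2 + c\<^sup>2) * (y\<^sup>2 + x\<^sup>2)"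
        by (simp add: v_def power2_eq_square algebra_simps)
      then have "v\<^sup>2 + (r * x - c * y)\<^sup>2 = y\<^sup>2 + x\<^sup>2" using rc(1) by simp
      then show ?thesis using zero_le_power2[of "r * x - c * y"] by linarith
    qed
    have ep: "exp (x\<^sup>2 / 2) * p x \<le> D"
    proof -
      have "x\<^sup>2 / 2 \<le> x\<^sup>2 / (2 * \<tau>)" using \<tau> by (simp add: field_simps mult_left_le_one_le)
      then have "exp (x\<^sup>2 / 2 - x\<^sup>2 / (2 * \<tau>)) \<le> 1" by simp
      then have "D * exp (x\<^sup>2 / 2 - x\<^sup>2 / (2 * \<tau>)) \<le> D" using D by (simp add: mult_left_le)
      moreover have "exp (x\<^sup>2 / 2) * p x = D * exp (x\<^sup>2 / 2 - x\<^sup>2 / (2 * \<tau>))"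
        by (simp add: p_def heat_kernel_real D_def diff_conv_add_uminus exp_add mult_ac del: add_uminus_conv_diff)
      ultimately show ?thesis by simp
    qed
    define a1 where "a1 = sqrt L * (\<bar>g v\<bar> * exp (- v\<^sup>2 / 4))"
    define a2 where "a2 = p x * exp (v\<^sup>2 / 4) / sqrt L"
    have "2 * a1 * a2 \<le> a1\<^sup>2 + a2\<^sup>2" by (rule sum_squares_bound)
    moreover have "a1 * a2 = p x * \<bar>g v\<bar>"
      using L by (simp add: a1_def a2_def exp_minus field_simps)
    moreover have "a1\<^sup>2 = L * W v"
    proof -
      have "(exp (- v\<^sup>2 / 4))\<^sup>2 = exp (- v\<^sup>2 / 2)" by (simp add: exp_double[symmetric])
      then show ?thesis using L by (simp add: a1_def W_def power_mult_distrib)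
    qed
    moreover have "a2\<^sup>2 \<le> exp (y\<^sup>2 / 4) / \<mu> * D * p x"
    proof -
      have "(exp (v\<^sup>2 / 4))\<^sup>2 = exp (v\<^sup>2 / 2)" by (simp add: exp_double[symmetric])
      then have "a2\<^sup>2 = p x * p x * exp (v\<^sup>2 / 2) / L"
        using L by (simp add: a2_def power_mult_distrib power_divide power2_eq_square)
      also have "\<dots> \<le> p x * p x * exp ((y\<^sup>2 + x\<^sup>2) / 2) / L"
        using v2 L p0 by (intro divide_right_mono mult_left_mono) auto
      also have "\<dots> = (p x * (exp (x\<^sup>2 / 2) * p x)) * (exp (y\<^sup>2 / 2) / L)"
        by (simp add: exp_add add_divide_distrib)
      also have "\<dots> \<le> (p x * D) * (exp (y\<^sup>2 / 2) / L)"
        using ep p0 L by (intro mult_right_mono mult_left_mono) auto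
      also have "exp (y\<^sup>2 / 2) / L = exp (y\<^sup>2 / 4) / \<mu>"
      proof -
        have "exp (y\<^sup>2 / 2) = exp (y\<^sup>2 / 4) * exp (y\<^sup>2 / 4)" by (simp add: mult_exp_exp)
        then show ?thesis using \<mu> by (simp add: L_def field_simps)
      qed
      finally show ?thesis by (simp add: mult_ac)
    qed
    ultimately have "2 * (p x * \<bar>g v\<bar>) \<le> L * W v + exp (y\<^sup>2 / 4) / \<mu> * D * p x" by simp
    then show ?thesis by (simp add: b_def v_def L_def field_simps)
  qed
  have b0: "0 \<le> p x * \<bar>g (r * y + c * x)\<bar>" for x by (simp add: p_def)
  have pm [measurable]: "p \<in> borel_measurable borel" by (simp add: p_def)
  show 1: "integrable lborel (\<lambda>x. heat_kernel \<tau> x * \<bar>g (r * y + c * x)\<bar>)"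
  proof (rule Bochner_Integration.integrable_bound[OF ib])
    show "AE x in lborel. norm (heat_kernel \<tau> x * \<bar>g (r * y + c * x)\<bar>) \<le> norm (b x)"
      using le b0 by (intro AE_I2) (auto simp: p_def intro: order_trans[OF _ abs_ge_self])
  qed measurable
  have "(\<integral>x. heat_kernel \<tau> x * \<bar>g (r * y + c * x)\<bar> \<partial>lborel) \<le> (\<integral>x. b x \<partial>lborel)"
    using le by (intro integral_mono 1 ib) (simp add: p_def)
  then show "(\<integral>x. heat_kernel \<tau> x * \<bar>g (r * y + c * x)\<bar> \<partial>lborel)
      \<le> exp (y\<^sup>2 / 4) / 2 * (\<mu> * (\<integral>x. (g x)\<^sup>2 * exp (- x\<^sup>2 / 2) \<partial>lborel) / c + (2 * pi * \<tau>) powr (- 1 / 2) / \<mu>)"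
    by (simp add: bI W_def D_def)
qed

lemma integrable_gaussian_weight: "integrable lborel (\<lambda>x::real. exp (- x\<^sup>2 / 2))"
proof -
  have "integrable lborel (\<lambda>x. (2 * pi) powr (1 / 2) * heat_kernel 1 (x::real))"
    by (intro integrable_mult_right integrable_heat_kernel) simp
  then show ?thesis by (simp add: heat_kernel_real powr_minus field_simps)
qed

text \<open>
  Truncate \<open>f\<close> and then an approximation of \<open>f\<close> by continuous functions that converges almost everywhere;
  both truncations converge in the weighted \<open>L2\<close> space by dominated convergence.
\<close>
lemma gaussian_L2_approx:
  fixes f :: "real \<Rightarrow> real"
  assumes f [measurable]: "f \<in> borel_measurable borel"
    and F: "integrable lborel (\<lambda>x. (f x)\<^sup>2 * exp (- x\<^sup>2 / 2))" and \<delta>: "0 < \<delta>"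
  shows "\<exists>h C. continuous_on UNIV h \<and> (\<forall>x. \<bar>h x\<bar> \<le> C) \<and>
    integrable lborel (\<lambda>x. (f x - h x)\<^sup>2 * exp (- x\<^sup>2 / 2)) \<and>
    (\<integral>x. (f x - h x)\<^sup>2 * exp (- x\<^sup>2 / 2) \<partial>lborel) < \<delta>"
proof -
  define W where "W x = exp (- x\<^sup>2 / 2)" for x :: real
  have W0: "0 \<le> W x" for x by (simp add: W_def)
  have [measurable]: "W \<in> borel_measurable borel" unfolding W_def[abs_def] by measurable
  have iW: "integrable lborel W" unfolding W_def[abs_def] by (rule integrable_gaussian_weight)
  define cl where "cl R x = max (- R) (min R x)" for R x :: real
  have [measurable]: "cl R \<in> borel_measurable borel" for R unfolding cl_def[abs_def] by measurable
  have F': "integrable lborel (\<lambda>x. (f x)\<^sup>2 * W x)" using F by (simp add: W_def)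
  have d1: "(f x - cl (real n) (f x))\<^sup>2 * W x \<le> (f x)\<^sup>2 * W x" for n x
    using W0 by (intro mult_right_mono) (auto simp: cl_def abs_le_square_iff[symmetric] max_def min_def)
  have "(\<lambda>n. \<integral>x. (f x - cl (real n) (f x))\<^sup>2 * W x \<partial>lborel) \<longlonglongrightarrow> (\<integral>x. 0 \<partial>(lborel::real measure))"
  proof (rule integral_dominated_convergence[OF _ _ F'])
    show "AE x in lborel. (\<lambda>n. (f x - cl (real n) (f x))\<^sup>2 * W x) \<longlonglongrightarrow> 0"
    proof (rule AE_I2)
      fix x
      have z: "(f x - cl (real n) (f x))\<^sup>2 * W x = 0" if "nat \<lceil>\<bar>f x\<bar>\<rceil> \<le> n" for n
      proof -
        have "\<bar>f x\<bar> \<le> real n" using that by linarith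
        then show ?thesis by (auto simp: cl_def max_def min_def)
      qed
      then show "(\<lambda>n. (f x - cl (real n) (f x))\<^sup>2 * W x) \<longlonglongrightarrow> 0"
        by (intro tendsto_eventually eventually_sequentiallyI[of "nat \<lceil>\<bar>f x\<bar>\<rceil>"] z)
    qed
    show "AE x in lborel. norm ((f x - cl (real n) (f x))\<^sup>2 * W x) \<le> (f x)\<^sup>2 * W x" for n
      using d1 W0 by auto
  qed measurable
  then have "\<forall>\<^sub>F n in sequentially. (\<integral>x. (f x - cl (real n) (f x))\<^sup>2 * W x \<partial>lborel) < \<delta> / 4"
    using \<delta> by (intro order_tendstoD(2)[where a="\<delta> / 4"]) auto
  then obtain R where R: "(\<integral>x. (f x - cl (real R) (f x))\<^sup>2 * W x \<partial>lborel) < \<delta> / 4"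
    by (auto simp: eventually_sequentially)
  have "f \<in> borel_measurable lebesgue" by (rule measurable_completion) simp
  then have "f measurable_on UNIV" by (rule lebesgue_measurable_imp_measurable_on_real) simp
  then obtain N k where N: "negligible N" and k: "\<And>n. continuous_on UNIV (k n)"
    and lim: "\<And>x. x \<notin> N \<Longrightarrow> (\<lambda>n. k n x) \<longlonglongrightarrow> f x"
    unfolding measurable_on_def by auto
  have [measurable]: "k n \<in> borel_measurable borel" for n
    using k by (intro borel_measurable_continuous_onI)
  have AEN: "AE x in lborel. x \<notin> N"
  proof -
    have "AE x in lebesgue. x \<notin> N"
      using N by (intro AE_not_in) (simp add: negligible_iff_null_sets)
    then show ?thesis by (simp add: AE_completion_iff)
  qed
  have clb: "\<bar>cl (real R) x\<bar> \<le> real R" for x by (auto simp: cl_def)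
  have d2: "(cl (real R) (f x) - cl (real R) (k n x))\<^sup>2 * W x \<le> (2 * real R)\<^sup>2 * W x" for n x
  proof (intro mult_right_mono W0)
    have "\<bar>cl (real R) (f x) - cl (real R) (k n x)\<bar> \<le> \<bar>2 * real R\<bar>"
      using clb[of "f x"] clb[of "k n x"] by linarith
    then show "(cl (real R) (f x) - cl (real R) (k n x))\<^sup>2 \<le> (2 * real R)\<^sup>2"
      by (simp only: abs_le_square_iff)
  qed
  have i3: "integrable lborel (\<lambda>x. (2 * real R)\<^sup>2 * W x)" by (intro integrable_mult_right iW)
  have "(\<lambda>n. \<integral>x. (cl (real R) (f x) - cl (real R) (k n x))\<^sup>2 * W x \<partial>lborel) \<longlonglongrightarrow> (\<integral>x. 0 \<partial>(lborel::real measure))"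
  proof (rule integral_dominated_convergence[OF _ _ i3])
    show "AE x in lborel. (\<lambda>n. (cl (real R) (f x) - cl (real R) (k n x))\<^sup>2 * W x) \<longlonglongrightarrow> 0"
      using AEN
    proof eventually_elim
      case (elim x)
      have "(\<lambda>n. (cl (real R) (f x) - cl (real R) (k n x))\<^sup>2 * W x) \<longlonglongrightarrow>
        (cl (real R) (f x) - cl (real R) (f x))\<^sup>2 * W x"
        unfolding cl_def by (intro tendsto_intros lim elim)
      then show ?case by simp
    qed
    show "AE x in lborel. norm ((cl (real R) (f x) - cl (real R) (k n x))\<^sup>2 * W x) \<le> (2 * real R)\<^sup>2 * W x" for n
      using d2 W0 by auto
  qed measurable
  then have "\<forall>\<^sub>F n in sequentially. (\<integral>x. (cl (real R) (f x) - cl (real R) (k n x))\<^sup>2 * W x \<partial>lborel) < \<delta> / 4"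
    using \<delta> by (intro order_tendstoD(2)[where a="\<delta> / 4"]) auto
  then obtain n where n: "(\<integral>x. (cl (real R) (f x) - cl (real R) (k n x))\<^sup>2 * W x \<partial>lborel) < \<delta> / 4"
    by (auto simp: eventually_sequentially)
  define h where "h x = cl (real R) (k n x)" for x
  have [measurable]: "h \<in> borel_measurable borel" unfolding h_def[abs_def] by measurable
  have i1: "integrable lborel (\<lambda>x. (f x - cl (real R) (f x))\<^sup>2 * W x)"
    by (rule Bochner_Integration.integrable_bound[OF F']) (use d1[of _ R] W0 in \<open>auto\<close>)
  have i2: "integrable lborel (\<lambda>x. (cl (real R) (f x) - h x)\<^sup>2 * W x)"
    by (rule Bochner_Integration.integrable_bound[OF i3]) (use d2[of _ n] W0 in \<open>auto simp: h_def\<close>)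
  have i12: "integrable lborel (\<lambda>x. 2 * ((f x - cl (real R) (f x))\<^sup>2 * W x) + 2 * ((cl (real R) (f x) - h x)\<^sup>2 * W x))"
    by (intro Bochner_Integration.integrable_add integrable_mult_right i1 i2)
  have le: "(f x - h x)\<^sup>2 * W x \<le> 2 * ((f x - cl (real R) (f x))\<^sup>2 * W x) + 2 * ((cl (real R) (f x) - h x)\<^sup>2 * W x)" for x
  proof -
    have "(f x - h x)\<^sup>2 \<le> 2 * (f x - cl (real R) (f x))\<^sup>2 + 2 * (cl (real R) (f x) - h x)\<^sup>2"
      using square_diff_le[of "f x - cl (real R) (f x)" "h x - cl (real R) (f x)"]
      by (simp add: power2_commute)
    then have "(f x - h x)\<^sup>2 * W x \<le> (2 * (f x - cl (real R) (f x))\<^sup>2 + 2 * (cl (real R) (f x) - h x)\<^sup>2) * W x"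
      using W0 by (rule mult_right_mono)
    then show ?thesis by (simp add: algebra_simps)
  qed
  have i: "integrable lborel (\<lambda>x. (f x - h x)\<^sup>2 * W x)"
    by (rule Bochner_Integration.integrable_bound[OF i12])
      (use le W0 in \<open>auto intro!: AE_I2 intro: order_trans[OF _ abs_ge_self]\<close>)
  have "(\<integral>x. (f x - h x)\<^sup>2 * W x \<partial>lborel)
    \<le> (\<integral>x. 2 * ((f x - cl (real R) (f x))\<^sup>2 * W x) + 2 * ((cl (real R) (f x) - h x)\<^sup>2 * W x) \<partial>lborel)"
    by (intro integral_mono i i12 le)
  also have "\<dots> = 2 * (\<integral>x. (f x - cl (real R) (f x))\<^sup>2 * W x \<partial>lborel) + 2 * (\<integral>x. (cl (real R) (f x) - h x)\<^sup>2 * W x \<partial>lborel)"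
    using i1 i2 by simp
  also have "\<dots> < \<delta>" using R n by (simp add: h_def)
  finally have "(\<integral>x. (f x - h x)\<^sup>2 * W x \<partial>lborel) < \<delta>" .
  moreover have "continuous_on UNIV h"
    unfolding h_def[abs_def] cl_def by (intro continuous_intros k)
  ultimately show ?thesis
    using i clb by (intro exI[of _ h] exI[of _ "real R"]) (auto simp: h_def W_def)
qed

text \<open>
  The estimate of \<open>gaussian_average\<close> in probabilistic form. The bounded factor \<open>V\<close> may depend on \<open>Z\<close>.
\<close>
lemma (in prob_space) gaussian_expectation:
  fixes f :: "real \<Rightarrow> real" and Z :: "'a \<Rightarrow> real"
  assumes f [measurable]: "f \<in> borel_measurable borel"
    and F: "integrable lborel (\<lambda>x. (f x)\<^sup>2 * exp (- x\<^sup>2 / 2))"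
    and rc: "r\<^sup>2 + c\<^sup>2 = 1" "0 < c" and \<tau>: "0 < \<tau>" "\<tau> \<le> 1"
    and Z [measurable]: "Z \<in> borel_measurable M" and law: "distr M borel Z = density lborel (\<lambda>x. ennreal (heat_kernel \<tau> x))"
    and V [measurable]: "V \<in> borel_measurable M" and Vb: "\<And>\<omega>. \<omega> \<in> space M \<Longrightarrow> \<bar>V \<omega>\<bar> \<le> C"
  shows "integrable M (\<lambda>\<omega>. V \<omega> * f (r * y + c * Z \<omega>))"
    and "0 < \<mu> \<Longrightarrow> \<bar>\<integral>\<omega>. V \<omega> * f (r * y + c * Z \<omega>) \<partial>M\<bar> \<le> C * (exp (y\<^sup>2 / 4) / 2 *
      (\<mu> * (\<integral>x. (f x)\<^sup>2 * exp (- x\<^sup>2 / 2) \<partial>lborel) / c + (2 * pi * \<tau>) powr (- 1 / 2) / \<mu>))"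
proof -
  have C: "0 \<le> C"
  proof -
    obtain \<omega> where "\<omega> \<in> space M" using not_empty by auto
    then show ?thesis using Vb[of \<omega>] by linarith
  qed
  have i: "integrable M (\<lambda>\<omega>. \<bar>f (r * y + c * Z \<omega>)\<bar>)"
  proof -
    have "integrable (distr M borel Z) (\<lambda>x. \<bar>f (r * y + c * x)\<bar>)"
      unfolding law using gaussian_average(1)[OF f F rc \<tau>, of 1]
      by (subst integrable_density) auto
    then show ?thesis by (subst (asm) integrable_distr_eq) auto
  qed
  have e: "(\<integral>\<omega>. \<bar>f (r * y + c * Z \<omega>)\<bar> \<partial>M) = (\<integral>x. heat_kernel \<tau> x * \<bar>f (r * y + c * x)\<bar> \<partial>lborel)"
  proof -
    have "(\<integral>\<omega>. \<bar>f (r * y + c * Z \<omega>)\<bar> \<partial>M) = (\<integral>x. \<bar>f (r * y + c * x)\<bar> \<partial>distr M borel Z)"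
      by (rule integral_distr[symmetric]) auto
    also have "\<dots> = (\<integral>x. heat_kernel \<tau> x * \<bar>f (r * y + c * x)\<bar> \<partial>lborel)"
      unfolding law by (subst integral_density) auto
    finally show ?thesis .
  qed
  have le: "\<bar>V \<omega> * f (r * y + c * Z \<omega>)\<bar> \<le> C * \<bar>f (r * y + c * Z \<omega>)\<bar>" if "\<omega> \<in> space M" for \<omega>
    unfolding abs_mult using Vb[OF that] by (rule mult_right_mono) simp
  show 1: "integrable M (\<lambda>\<omega>. V \<omega> * f (r * y + c * Z \<omega>))"
    by (rule Bochner_Integration.integrable_bound[OF integrable_mult_right[OF i, of C]])
      (use le C in \<open>auto intro!: AE_I2 intro: order_trans[OF _ abs_ge_self]\<close>)
  assume \<mu>: "0 < \<mu>"
  have "\<bar>\<integral>\<omega>. V \<omega> * f (r * y + c * Z \<omega>) \<partial>M\<bar> \<le> (\<integral>\<omega>. \<bar>V \<omega> * f (r * y + c * Z \<omega>)\<bar> \<partial>M)"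
    by (rule integral_abs_bound)
  also have "\<dots> \<le> (\<integral>\<omega>. C * \<bar>f (r * y + c * Z \<omega>)\<bar> \<partial>M)"
    using le by (intro integral_mono integrable_abs 1 integrable_mult_right i) auto
  also have "\<dots> = C * (\<integral>x. heat_kernel \<tau> x * \<bar>f (r * y + c * x)\<bar> \<partial>lborel)"
    by (simp add: e)
  also have "\<dots> \<le> C * (exp (y\<^sup>2 / 4) / 2 *
      (\<mu> * (\<integral>x. (f x)\<^sup>2 * exp (- x\<^sup>2 / 2) \<partial>lborel) / c + (2 * pi * \<tau>) powr (- 1 / 2) / \<mu>))"
    using gaussian_average(2)[OF f F rc \<tau> \<mu>] C by (rule mult_left_mono)
  finally show "\<bar>\<integral>\<omega>. V \<omega> * f (r * y + c * Z \<omega>) \<partial>M\<bar> \<le> C * (exp (y\<^sup>2 / 4) / 2 *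
      (\<mu> * (\<integral>x. (f x)\<^sup>2 * exp (- x\<^sup>2 / 2) \<partial>lborel) / c + (2 * pi * \<tau>) powr (- 1 / 2) / \<mu>))" .
qed

text \<open>
  For a bounded continuous \<open>f\<close> this is dominated convergence. In general approximate \<open>f\<close> in the weighted
  \<open>L2\<close> space with squared error \<open>1 / (n + 1)\<^sup>2\<close>; the estimate with \<open>\<mu> = n + 1\<close> makes the convergence locally uniform in \<open>y\<close>.
\<close>
lemma (in prob_space) continuous_gaussian_expectation:
  fixes f :: "real \<Rightarrow> real" and Z :: "'a \<Rightarrow> real"
  assumes f [measurable]: "f \<in> borel_measurable borel"
    and F: "integrable lborel (\<lambda>x. (f x)\<^sup>2 * exp (- x\<^sup>2 / 2))"
    and rc: "r\<^sup>2 + c\<^sup>2 = 1" "0 < c" and \<tau>: "0 < \<tau>" "\<tau> \<le> 1"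
    and Z [measurable]: "Z \<in> borel_measurable M" and law: "distr M borel Z = density lborel (\<lambda>x. ennreal (heat_kernel \<tau> x))"
    and V [measurable]: "V \<in> borel_measurable M" and Vb: "\<And>\<omega>. \<omega> \<in> space M \<Longrightarrow> \<bar>V \<omega>\<bar> \<le> C"
  shows "continuous_on UNIV (\<lambda>y. \<integral>\<omega>. V \<omega> * f (r * y + c * Z \<omega>) \<partial>M)"
proof -
  define q where "q g y = (\<integral>\<omega>. V \<omega> * g (r * y + c * Z \<omega>) \<partial>M)" for g :: "real \<Rightarrow> real" and y :: real
  have C: "0 \<le> C"
  proof -
    obtain \<omega> where "\<omega> \<in> space M" using not_empty by auto
    then show ?thesis using Vb[of \<omega>] by linarith
  qed
  have "\<forall>n::nat. \<exists>h D. continuous_on UNIV h \<and> (\<forall>x. \<bar>h x\<bar> \<le> D) \<and>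
    integrable lborel (\<lambda>x. (f x - h x)\<^sup>2 * exp (- x\<^sup>2 / 2)) \<and>
    (\<integral>x. (f x - h x)\<^sup>2 * exp (- x\<^sup>2 / 2) \<partial>lborel) < 1 / (real n + 1)\<^sup>2"
    by (intro allI gaussian_L2_approx[OF f F]) simp
  from choice[OF this] obtain h where "\<forall>n. \<exists>D. continuous_on UNIV (h n) \<and> (\<forall>x. \<bar>h n x\<bar> \<le> D) \<and>
    integrable lborel (\<lambda>x. (f x - h n x)\<^sup>2 * exp (- x\<^sup>2 / 2)) \<and>
    (\<integral>x. (f x - h n x)\<^sup>2 * exp (- x\<^sup>2 / 2) \<partial>lborel) < 1 / (real n + 1)\<^sup>2" ..
  from choice[OF this] obtain D where hD: "\<forall>n. continuous_on UNIV (h n) \<and> (\<forall>x. \<bar>h n x\<bar> \<le> D n) \<and>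
    integrable lborel (\<lambda>x. (f x - h n x)\<^sup>2 * exp (- x\<^sup>2 / 2)) \<and>
    (\<integral>x. (f x - h n x)\<^sup>2 * exp (- x\<^sup>2 / 2) \<partial>lborel) < 1 / (real n + 1)\<^sup>2" ..
  have h: "continuous_on UNIV (h n)" and D: "\<bar>h n x\<bar> \<le> D n"
    and hi: "integrable lborel (\<lambda>x. (f x - h n x)\<^sup>2 * exp (- x\<^sup>2 / 2))"
    and hd: "(\<integral>x. (f x - h n x)\<^sup>2 * exp (- x\<^sup>2 / 2) \<partial>lborel) < 1 / (real n + 1)\<^sup>2" for n x
    using hD by auto
  have hm [measurable]: "h n \<in> borel_measurable borel" for n
    using h by (rule borel_measurable_continuous_onI)
  have ih: "integrable M (\<lambda>\<omega>. V \<omega> * h n (r * y + c * Z \<omega>))" for n y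
  proof (rule integrable_const_bound[where B="C * D n"])
    show "AE \<omega> in M. norm (V \<omega> * h n (r * y + c * Z \<omega>)) \<le> C * D n"
      using Vb D C by (intro AE_I2) (auto simp: abs_mult intro!: mult_mono)
  qed measurable
  have qh: "continuous_on UNIV (q (h n))" for n
    unfolding continuous_on_sequentially comp_def
  proof (intro allI ballI impI, elim conjE)
    fix ys y assume ys: "ys \<longlonglongrightarrow> (y::real)"
    show "(\<lambda>i. q (h n) (ys i)) \<longlonglongrightarrow> q (h n) y"
      unfolding q_def
    proof (rule integral_dominated_convergence[where w="\<lambda>_. C * D n"])
      have "isCont (h n) x" for x using h[of n] by (simp add: continuous_on_eq_continuous_at)
      then show "AE \<omega> in M. (\<lambda>i. V \<omega> * h n (r * ys i + c * Z \<omega>)) \<longlonglongrightarrow> V \<omega> * h n (r * y + c * Z \<omega>)"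
        by (intro AE_I2 tendsto_mult tendsto_const isCont_tendsto_compose[where g="h n"] tendsto_add ys)
      show "AE \<omega> in M. norm (V \<omega> * h n (r * ys i + c * Z \<omega>)) \<le> C * D n" for i
        using Vb D C by (intro AE_I2) (auto simp: abs_mult intro!: mult_mono)
    qed measurable
  qed
  define E where "E \<rho> = C * (exp (\<rho>\<^sup>2 / 4) / 2 * (1 / c + (2 * pi * \<tau>) powr (- 1 / 2)))" for \<rho> :: real
  have close: "\<bar>q (h n) y - q f y\<bar> \<le> E \<rho> / (real n + 1)" if y: "\<bar>y\<bar> \<le> \<rho>" for n y \<rho>
  proof -
    have fh: "(\<lambda>x. f x - h n x) \<in> borel_measurable borel" by measurable
    have "q f y - q (h n) y = (\<integral>\<omega>. V \<omega> * f (r * y + c * Z \<omega>) - V \<omega> * h n (r * y + c * Z \<omega>) \<partial>M)"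
      unfolding q_def using gaussian_expectation(1)[OF f F rc \<tau> Z law V Vb] ih by simp
    also have "\<dots> = (\<integral>\<omega>. V \<omega> * (f (r * y + c * Z \<omega>) - h n (r * y + c * Z \<omega>)) \<partial>M)"
      by (simp add: right_diff_distrib)
    finally have "\<bar>q f y - q (h n) y\<bar> \<le> C * (exp (y\<^sup>2 / 4) / 2 *
      ((real n + 1) * (\<integral>x. (f x - h n x)\<^sup>2 * exp (- x\<^sup>2 / 2) \<partial>lborel) / c + (2 * pi * \<tau>) powr (- 1 / 2) / (real n + 1)))"
      using gaussian_expectation(2)[OF fh hi[of n] rc \<tau> Z law V Vb, of "real n + 1" y] by simp
    also have "\<dots> \<le> C * (exp (\<rho>\<^sup>2 / 4) / 2 * (1 / (real n + 1) / c + (2 * pi * \<tau>) powr (- 1 / 2) / (real n + 1)))"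
    proof (intro mult_left_mono C mult_mono add_mono divide_right_mono)
      have "y\<^sup>2 \<le> \<rho>\<^sup>2" using y by (simp add: abs_le_square_iff[symmetric])
      then show "exp (y\<^sup>2 / 4) \<le> exp (\<rho>\<^sup>2 / 4)" by simp
      have "(real n + 1) * (\<integral>x. (f x - h n x)\<^sup>2 * exp (- x\<^sup>2 / 2) \<partial>lborel) \<le> (real n + 1) * (1 / (real n + 1)\<^sup>2)"
        using hd[of n] by (intro mult_left_mono) auto
      also have "\<dots> = 1 / (real n + 1)" by (simp add: power2_eq_square)
      finally show "(real n + 1) * (\<integral>x. (f x - h n x)\<^sup>2 * exp (- x\<^sup>2 / 2) \<partial>lborel) \<le> 1 / (real n + 1)" .
    qed (use rc in auto)
    also have "\<dots> = E \<rho> / (real n + 1)"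
    proof -
      have "1 / (real n + 1) / c + P / (real n + 1) = (1 / c + P) / (real n + 1)" for P
        by (simp add: add_divide_distrib)
      then show ?thesis by (simp add: E_def)
    qed
    finally show ?thesis by (simp add: abs_minus_commute)
  qed
  have "isCont (q f) y0" for y0
  proof -
    define \<rho> where "\<rho> = \<bar>y0\<bar> + 1"
    have "uniform_limit {- \<rho>..\<rho>} (\<lambda>n. q (h n)) (q f) sequentially"
    proof (rule uniform_limitI)
      fix e :: real assume e: "0 < e"
      have "(\<lambda>n. E \<rho> / (real n + 1)) \<longlonglongrightarrow> 0"
        using tendsto_mult[OF tendsto_const LIMSEQ_inverse_real_of_nat, of "E \<rho>"]
        by (simp add: divide_inverse add.commute)
      then have "\<forall>\<^sub>F n in sequentially. E \<rho> / (real n + 1) < e" using e by (rule order_tendstoD)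
      then show "\<forall>\<^sub>F n in sequentially. \<forall>y\<in>{- \<rho>..\<rho>}. dist (q (h n) y) (q f y) < e"
      proof eventually_elim
        case (elim n)
        show ?case
        proof
          fix y assume "y \<in> {- \<rho>..\<rho>}"
          then have "\<bar>y\<bar> \<le> \<rho>" by auto
          from order_le_less_trans[OF close[OF this, of n] elim] show "dist (q (h n) y) (q f y) < e"
            by (simp add: dist_real_def)
        qed
      qed
    qed
    then have "continuous_on {- \<rho>..\<rho>} (q f)"
      by (rule uniform_limit_theorem[rotated]) (auto intro!: always_eventually continuous_on_subset[OF qh])
    moreover have "y0 \<in> interior {- \<rho>..\<rho>}" by (auto simp: \<rho>_def interior_atLeastAtMost_real)
    ultimately show ?thesis by (rule continuous_on_interior)
  qed
  then have "continuous_on UNIV (q f)" by (simp add: continuous_on_eq_continuous_at)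
  then show ?thesis by (simp add: q_def)
qed

text \<open>
  With \<open>q = \<rho>\<^sup>2 / (2 t)\<close> the claim is that \<open>q powr (d / 2) * exp (- q)\<close> is bounded.
\<close>
lemma heat_kernel_away:
  fixes \<rho> :: real
  assumes \<rho>: "0 < \<rho>"
  shows "\<exists>K\<ge>0. \<forall>(t::real) (x::'v::euclidean_space). 0 < t \<longrightarrow> \<rho> \<le> norm x \<longrightarrow> heat_kernel t x \<le> K"
proof (intro exI conjI allI impI)
  let ?d = "DIM('v)"
  show "0 \<le> (pi * \<rho>\<^sup>2) powr (- real ?d / 2) * (1 + real ?d ^ ?d)" by simp
  fix t :: real and x :: 'v assume t: "0 < t" and x: "\<rho> \<le> norm x"
  define q where "q = \<rho>\<^sup>2 / (2 * t)"
  have q: "0 < q" using t \<rho> by (simp add: q_def)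
  have e: "2 * pi * t = pi * \<rho>\<^sup>2 / q" using t \<rho> by (simp add: q_def)
  have 1: "(2 * pi * t) powr (- real ?d / 2) = (pi * \<rho>\<^sup>2) powr (- real ?d / 2) * q powr (real ?d / 2)"
  proof -
    have "(pi * \<rho>\<^sup>2 / q) powr a = (pi * \<rho>\<^sup>2) powr a / q powr a" for a
      by (rule powr_divide)
    moreover have "inverse (q powr (- real ?d / 2)) = q powr (real ?d / 2)"
      by (simp add: powr_minus[symmetric])
    ultimately show ?thesis unfolding e by (simp only: divide_inverse)
  qed
  have "q powr (real ?d / 2) \<le> (1 + real ?d ^ ?d) * exp q"
  proof (cases "q \<le> 1")
    case True
    then have "q powr (real ?d / 2) \<le> 1" using q by (intro powr_le1) auto
    also have "1 \<le> (1 + real ?d ^ ?d) * exp q"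
      using q mult_mono[of 1 "1 + real ?d ^ ?d" 1 "exp q"] by simp
    finally show ?thesis .
  next
    case False
    then have "q powr (real ?d / 2) \<le> q powr (real ?d)" by (intro powr_mono) auto
    also have "\<dots> = real ?d ^ ?d * (q / real ?d) ^ ?d"
      using q by (simp add: powr_realpow power_divide)
    also have "\<dots> \<le> real ?d ^ ?d * (1 + q / real ?d) ^ ?d"
      using q by (intro mult_left_mono power_mono) auto
    also have "\<dots> \<le> real ?d ^ ?d * exp q"
      using q by (intro mult_left_mono exp_ge_one_plus_x_over_n_power_n) auto
    also have "\<dots> \<le> (1 + real ?d ^ ?d) * exp q" by (intro mult_right_mono) auto
    finally show ?thesis .
  qed
  then have 2: "q powr (real ?d / 2) * exp (- q) \<le> 1 + real ?d ^ ?d"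
    by (simp add: exp_minus field_simps)
  have "exp (- (norm x)\<^sup>2 / (2 * t)) \<le> exp (- q)"
    using x \<rho> t by (simp add: q_def divide_right_mono power_mono)
  then have "heat_kernel t x \<le> (2 * pi * t) powr (- real ?d / 2) * exp (- q)"
    unfolding heat_kernel_def by (rule mult_left_mono) simp
  also have "\<dots> \<le> (pi * \<rho>\<^sup>2) powr (- real ?d / 2) * (1 + real ?d ^ ?d)"
    unfolding 1 using 2 by (simp add: mult.assoc mult_left_mono)
  finally show "heat_kernel t x \<le> (pi * \<rho>\<^sup>2) powr (- real ?d / 2) * (1 + real ?d ^ ?d)" .
qed

lemma heat_kernel_shift_integral:
  fixes u :: "'v::euclidean_space"
  assumes "0 < t"
  shows "integrable lborel (\<lambda>y. heat_kernel t (y - u))" "(\<integral>y. heat_kernel t (y - u) \<partial>lborel) = 1"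
proof -
  have n: "(\<integral>\<^sup>+y. ennreal (heat_kernel t (y - u)) \<partial>lborel) = 1"
    using lborel_nn_integral_shift[of "\<lambda>y. ennreal (heat_kernel t y)" "- u"] nn_integral_heat_kernel[OF assms]
    by simp
  show "integrable lborel (\<lambda>y. heat_kernel t (y - u))"
    by (rule integrableI_nonneg) (auto simp: n)
  show "(\<integral>y. heat_kernel t (y - u) \<partial>lborel) = 1"
    by (subst integral_eq_nn_integral) (auto simp: n)
qed

text \<open>
  At every point at least one of the two factors is evaluated away from its centre. This is where
  \<open>u \<noteq> 0\<close> enters.
\<close>
lemma heat_kernel_product_bound:
  fixes u :: "'v::euclidean_space"
  assumes u: "u \<noteq> 0"
  shows "\<exists>K\<ge>0. \<forall>s t. 0 < s \<longrightarrow> 0 < t \<longrightarrow> integrable lborel (\<lambda>y. heat_kernel s (y - u) * heat_kernel t y) \<and>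
    (\<integral>y. heat_kernel s (y - u) * heat_kernel t y \<partial>lborel) \<le> K"
proof -
  obtain K where K: "0 \<le> K" "\<And>t x::'v. 0 < t \<Longrightarrow> norm u / 2 \<le> norm x \<Longrightarrow> heat_kernel t x \<le> K"
    using heat_kernel_away[of "norm u / 2", where 'v='v] u by auto
  show ?thesis
  proof (intro exI[of _ "2 * K"] conjI allI impI)
    show "0 \<le> 2 * K" using K by simp
    fix s t :: real assume st: "0 < s" "0 < t"
    have le: "heat_kernel s (y - u) * heat_kernel t y \<le> K * heat_kernel s (y - u) + K * heat_kernel t y" for y
    proof (cases "norm u / 2 \<le> norm y")
      case True
      then have "heat_kernel s (y - u) * heat_kernel t y \<le> heat_kernel s (y - u) * K"
        using K(2)[OF st(2)] by (intro mult_left_mono) auto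
      then show ?thesis using mult_nonneg_nonneg[OF K(1) heat_kernel_nonneg[of t y]]
        unfolding mult.commute[of _ K] by linarith
    next
      case False
      then have "norm u / 2 \<le> norm (y - u)" using norm_triangle_sub[of u y] by (simp add: norm_minus_commute)
      then have "heat_kernel s (y - u) * heat_kernel t y \<le> K * heat_kernel t y"
        using K(2)[OF st(1)] by (intro mult_right_mono) auto
      then show ?thesis using mult_nonneg_nonneg[OF K(1) heat_kernel_nonneg[of s "y - u"]] by linarith
    qed
    have i: "integrable lborel (\<lambda>y. K * heat_kernel s (y - u) + K * heat_kernel t y)"
      by (intro Bochner_Integration.integrable_add integrable_mult_right heat_kernel_shift_integral integrable_heat_kernel st)
    show i1: "integrable lborel (\<lambda>y. heat_kernel s (y - u) * heat_kernel t y)"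
      by (rule Bochner_Integration.integrable_bound[OF i])
        (use le in \<open>auto intro!: AE_I2 intro: order_trans[OF _ abs_ge_self]\<close>)
    have "(\<integral>y. heat_kernel s (y - u) * heat_kernel t y \<partial>lborel)
      \<le> (\<integral>y. K * heat_kernel s (y - u) + K * heat_kernel t y \<partial>lborel)"
      by (intro integral_mono i1 i le)
    also have "\<dots> = 2 * K"
      using heat_kernel_shift_integral[OF st(1), of u] integrable_heat_kernel[OF st(2), where 'v='v]
        integral_heat_kernel[OF st(2), where 'v='v] by simp
    finally show "(\<integral>y. heat_kernel s (y - u) * heat_kernel t y \<partial>lborel) \<le> 2 * K" .
  qed
qed

text \<open>
  Doubling the time absorbs the exponential: for \<open>t \<le> 1\<close> half of the exponent of \<open>heat_kernel t\<close>
  dominates \<open>(norm y)\<^sup>2 / 4\<close>.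
\<close>
lemma heat_kernel_exp_bound:
  fixes y :: "'v::euclidean_space"
  assumes t: "0 < t" "t \<le> 1"
  shows "heat_kernel t y * exp ((norm y)\<^sup>2 / 4) \<le> 2 powr (real DIM('v) / 2) * heat_kernel (2 * t) y"
proof -
  have "(2 * pi * (2 * t)) powr (- real DIM('v) / 2) = 2 powr (- real DIM('v) / 2) * (2 * pi * t) powr (- real DIM('v) / 2)"
    using t powr_mult[of 2 "2 * pi * t" "- real DIM('v) / 2"] by (simp add: mult_ac)
  moreover have "2 powr (real DIM('v) / 2) * 2 powr (- real DIM('v) / 2) = (1::real)"
    by (simp add: powr_add[symmetric])
  ultimately have "(2 * pi * t) powr (- real DIM('v) / 2)
      = 2 powr (real DIM('v) / 2) * (2 * pi * (2 * t)) powr (- real DIM('v) / 2)"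
    by (simp only: mult.assoc[symmetric] mult_1)
  moreover have "exp (- (norm y)\<^sup>2 / (2 * t)) * exp ((norm y)\<^sup>2 / 4) \<le> exp (- (norm y)\<^sup>2 / (2 * (2 * t)))"
  proof -
    have "(norm y)\<^sup>2 / 4 \<le> (norm y)\<^sup>2 / (4 * t)" using t by (simp add: field_simps mult_left_le_one_le)
    moreover have "(norm y)\<^sup>2 / (2 * t) = 2 * ((norm y)\<^sup>2 / (4 * t))" by simp
    ultimately have "- (norm y)\<^sup>2 / (2 * t) + (norm y)\<^sup>2 / 4 \<le> - (norm y)\<^sup>2 / (2 * (2 * t))" by simp
    then show ?thesis unfolding mult_exp_exp by simp
  qed
  ultimately show ?thesis
    unfolding heat_kernel_def by (simp add: mult.assoc mult_left_mono)
qed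

text \<open>
  After the substitution \<open>y = u + sqrt t x\<close> the kernel no longer depends on \<open>t\<close> and dominated convergence applies.
\<close>
lemma heat_kernel_approx_identity:
  fixes h :: "'v::euclidean_space \<Rightarrow> real"
  assumes h: "continuous_on UNIV h" and C: "\<And>y. \<bar>h y\<bar> \<le> C" and e: "\<And>n::nat. 0 < e n" "e \<longlonglongrightarrow> 0"
  shows "(\<lambda>n. \<integral>y. heat_kernel (e n) (y - u) * h y \<partial>lborel) \<longlonglongrightarrow> h u"
proof -
  have [measurable]: "h \<in> borel_measurable borel" using h by (rule borel_measurable_continuous_onI)
  have eq: "(\<integral>y. heat_kernel t (y - u) * h y \<partial>lborel) = (\<integral>x. heat_kernel 1 x * h (u + sqrt t *\<^sub>R x) \<partial>lborel)"
    if t: "0 < t" for t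
  proof -
    have "(\<integral>y. heat_kernel t (y - u) * h y \<partial>lborel) = (\<integral>y. heat_kernel t (y - u) * h y \<partial>distr lborel borel ((+) u))"
      by (simp add: lborel_distr_plus)
    also have "\<dots> = (\<integral>y. heat_kernel t y * h (u + y) \<partial>lborel)"
      by (subst integral_distr) auto
    also have "\<dots> = (\<integral>y. h (u + y) \<partial>gauss t)"
      unfolding gauss_eq_density[OF t] by (subst integral_density) auto
    also have "\<dots> = (\<integral>x. h (u + sqrt t *\<^sub>R x) \<partial>density lborel (\<lambda>x. ennreal (heat_kernel 1 x)))"
      unfolding gauss_def by (subst integral_distr) auto
    also have "\<dots> = (\<integral>x. heat_kernel 1 x * h (u + sqrt t *\<^sub>R x) \<partial>lborel)"
      by (subst integral_density) auto
    finally show ?thesis .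
  qed
  have "(\<lambda>n. \<integral>x. heat_kernel 1 x * h (u + sqrt (e n) *\<^sub>R x) \<partial>lborel) \<longlonglongrightarrow> (\<integral>x. heat_kernel 1 (x::'v) * h u \<partial>lborel)"
  proof (rule integral_dominated_convergence[where w="\<lambda>x. heat_kernel 1 x * C"])
    show "integrable lborel (\<lambda>x::'v. heat_kernel 1 x * C)"
      by (intro integrable_mult_left integrable_heat_kernel) simp
    show "AE x in lborel. (\<lambda>n. heat_kernel 1 x * h (u + sqrt (e n) *\<^sub>R x)) \<longlonglongrightarrow> heat_kernel 1 x * h u"
    proof (rule AE_I2)
      fix x :: 'v
      have "(\<lambda>n. u + sqrt (e n) *\<^sub>R x) \<longlonglongrightarrow> u + sqrt 0 *\<^sub>R x"
        by (intro tendsto_intros e(2))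
      moreover have "isCont h u" using h by (simp add: continuous_on_eq_continuous_at)
      ultimately show "(\<lambda>n. heat_kernel 1 x * h (u + sqrt (e n) *\<^sub>R x)) \<longlonglongrightarrow> heat_kernel 1 x * h u"
        by (intro tendsto_mult tendsto_const isCont_tendsto_compose[where g=h]) auto
    qed
    show "AE x in lborel. norm (heat_kernel 1 x * h (u + sqrt (e n) *\<^sub>R x)) \<le> heat_kernel 1 x * C" for n
      using C by (intro AE_I2) (auto simp: abs_mult intro!: mult_left_mono)
  qed measurable
  then show ?thesis
    using e(1) by (simp add: eq integral_heat_kernel)
qed

section \<open>Expectations at fixed times\<close>

text \<open>
  A process with continuous paths is the pointwise limit of processes that are constant on time
  intervals of length \<open>1 / (n + 1)\<close>, and these are jointly measurable.
\<close>
lemma continuous_process_measurable: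
  fixes X :: "real \<Rightarrow> 'a \<Rightarrow> 'v::euclidean_space"
  assumes X: "\<And>t. X t \<in> borel_measurable M"
    and c: "\<And>\<omega>. \<omega> \<in> space M \<Longrightarrow> continuous_on UNIV (\<lambda>t. X t \<omega>)"
  shows "(\<lambda>p. X (fst p) (snd p)) \<in> borel_measurable (borel \<Otimes>\<^sub>M M)"
proof (rule borel_measurable_LIMSEQ_metric)
  fix n :: nat
  show "(\<lambda>p. X (real_of_int \<lfloor>real (Suc n) * fst p\<rfloor> / real (Suc n)) (snd p)) \<in> borel_measurable (borel \<Otimes>\<^sub>M M)"
  proof (rule measurable_compose_countable[where g="\<lambda>p. \<lfloor>real (Suc n) * fst p\<rfloor>"])
    show "(\<lambda>p. X (real_of_int i / real (Suc n)) (snd p)) \<in> borel_measurable (borel \<Otimes>\<^sub>M M)" for i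
      by (rule measurable_compose[OF measurable_snd X])
    show "(\<lambda>p. \<lfloor>real (Suc n) * fst p\<rfloor>) \<in> measurable (borel \<Otimes>\<^sub>M M) (count_space UNIV)"
      by measurable
  qed
next
  fix p assume "p \<in> space ((borel :: real measure) \<Otimes>\<^sub>M M)"
  then have "snd p \<in> space M" by (auto simp: space_pair_measure)
  then have "isCont (\<lambda>t. X t (snd p)) (fst p)" using c by (simp add: continuous_on_eq_continuous_at)
  moreover have "(\<lambda>n. real_of_int \<lfloor>real (Suc n) * fst p\<rfloor> / real (Suc n)) \<longlonglongrightarrow> fst p"
  proof (rule LIMSEQ_I)
    fix e :: real assume "0 < e"
    then obtain N where N: "1 / real (Suc N) < e" using nat_approx_posE by metis
    have "norm (real_of_int \<lfloor>real (Suc n) * fst p\<rfloor> / real (Suc n) - fst p) < e" if "N \<le> n" for n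
    proof -
      have "\<bar>real_of_int \<lfloor>real (Suc n) * fst p\<rfloor> - real (Suc n) * fst p\<bar> \<le> 1" by linarith
      then have "\<bar>real_of_int \<lfloor>real (Suc n) * fst p\<rfloor> - real (Suc n) * fst p\<bar> / real (Suc n) \<le> 1 / real (Suc n)"
        by (rule divide_right_mono) simp
      also have "\<dots> \<le> 1 / real (Suc N)" using that by (simp add: frac_le)
      finally have "\<bar>(real_of_int \<lfloor>real (Suc n) * fst p\<rfloor> - real (Suc n) * fst p) / real (Suc n)\<bar> < e"
        using N by (simp add: abs_divide)
      moreover have "(real_of_int \<lfloor>real (Suc n) * fst p\<rfloor> - real (Suc n) * fst p) / real (Suc n)
        = real_of_int \<lfloor>real (Suc n) * fst p\<rfloor> / real (Suc n) - fst p"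
        by (simp add: diff_divide_distrib)
      ultimately show ?thesis by (simp only: real_norm_def)
    qed
    then show "\<exists>no. \<forall>n\<ge>no. norm (real_of_int \<lfloor>real (Suc n) * fst p\<rfloor> / real (Suc n) - fst p) < e" by blast
  qed
  ultimately show "(\<lambda>n. X (real_of_int \<lfloor>real (Suc n) * fst p\<rfloor> / real (Suc n)) (snd p)) \<longlonglongrightarrow> X (fst p) (snd p)"
    by (rule isCont_tendsto_compose[where g="\<lambda>t. X t (snd p)"])
qed

lemma Delta2_measurable [measurable]: "Delta2 \<in> sets borel"
proof -
  have "{p \<in> space (borel \<Otimes>\<^sub>M borel). 0 \<le> fst p \<and> fst p < snd p \<and> snd p \<le> (1::real)} \<in> sets (borel \<Otimes>\<^sub>M borel)"
    by measurable
  moreover have "{p \<in> space (borel \<Otimes>\<^sub>M borel). 0 \<le> fst p \<and> fst p < snd p \<and> snd p \<le> (1::real)} = Delta2"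
    by (auto simp: Delta2_def space_pair_measure)
  ultimately have "Delta2 \<in> sets (borel \<Otimes>\<^sub>M borel)" by (simp only:)
  then show ?thesis unfolding borel_prod .
qed

text \<open>
  The majorant for the integration over the times.
\<close>
lemma integrable_Delta2_powr:
  "integrable lborel (\<lambda>t. indicator Delta2 t * (snd t - fst t) powr (- 1 / 2) :: real)"
proof (rule integrableI_nonneg)
  define g :: "real \<Rightarrow> real" where "g x = (if x \<in> {0..1} then x powr (- 1 / 2) else 0)" for x
  have gm [measurable]: "g \<in> borel_measurable borel" unfolding g_def[abs_def] by measurable
  have gI: "(\<integral>\<^sup>+x. ennreal (g x) \<partial>lborel) = ennreal 2"
  proof (rule nn_integral_has_integral_lborel)
    have "((\<lambda>x::real. x powr (- 1 / 2)) has_integral (1 powr (- 1 / 2 + 1) / (- 1 / 2 + 1))) {0..1}"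
      by (rule has_integral_powr_from_0) auto
    then show "(g has_integral 2) UNIV"
      unfolding g_def[abs_def] has_integral_restrict_UNIV by simp
  qed (auto simp: g_def)
  have m: "(\<lambda>t. indicator Delta2 t * (snd t - fst t) powr (- 1 / 2) :: real) \<in> borel_measurable (borel \<Otimes>\<^sub>M borel)"
    using Delta2_measurable by (intro borel_measurable_times borel_measurable_indicator) (auto simp: borel_prod[symmetric])
  then show "(\<lambda>t. indicator Delta2 t * (snd t - fst t) powr (- 1 / 2) :: real) \<in> borel_measurable lborel"
    by (simp add: borel_prod)
  have "(\<integral>\<^sup>+t. ennreal (indicator Delta2 t * (snd t - fst t) powr (- 1 / 2)) \<partial>lborel)
    = (\<integral>\<^sup>+t1. \<integral>\<^sup>+t2. ennreal (indicator Delta2 (t1, t2) * (t2 - t1) powr (- 1 / 2)) \<partial>lborel \<partial>lborel)"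
    unfolding lborel_prod[symmetric]
    by (subst lborel.nn_integral_fst[symmetric]) (use m in auto)
  also have "\<dots> \<le> (\<integral>\<^sup>+t1. indicator {0..1} t1 * (\<integral>\<^sup>+t2. ennreal (g (t2 + (- t1))) \<partial>lborel) \<partial>lborel)"
  proof (rule nn_integral_mono)
    fix t1 :: real
    show "(\<integral>\<^sup>+t2. ennreal (indicator Delta2 (t1, t2) * (t2 - t1) powr (- 1 / 2)) \<partial>lborel)
      \<le> indicator {0..1} t1 * (\<integral>\<^sup>+t2. ennreal (g (t2 + (- t1))) \<partial>lborel)"
    proof (cases "t1 \<in> {0..1}")
      case True
      then show ?thesis
        by (auto simp: Delta2_def g_def indicator_def intro!: nn_integral_mono)
    next
      case False
      then have "indicator Delta2 (t1, t2) = (0::real)" for t2 by (auto simp: Delta2_def indicator_def)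
      then show ?thesis by simp
    qed
  qed
  also have "\<dots> = (\<integral>\<^sup>+t1. indicator {0..1} t1 * ennreal 2 \<partial>(lborel :: real measure))"
  proof -
    have "(\<integral>\<^sup>+t2. ennreal (g (t2 + (- t1))) \<partial>lborel) = ennreal 2" for t1
      using lborel_nn_integral_shift[of "\<lambda>x. ennreal (g x)" "- t1"] gI by simp
    then show ?thesis by (simp only:)
  qed
  also have "\<dots> = ennreal 2" by (subst nn_integral_multc) auto
  also have "\<dots> < \<infinity>" by simp
  finally show "(\<integral>\<^sup>+t. ennreal (indicator Delta2 t * (snd t - fst t) powr (- 1 / 2)) \<partial>lborel) < \<infinity>" .
qed simp

lemma independent_processes_sym:
  assumes M: "prob_space M" and ind: "independent_processes M w z"
  shows "independent_processes M z w"
proof -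
  interpret prob_space M by fact
  show ?thesis
    using ind unfolding independent_processes_def indep_sets2_eq by (metis Int_commute mult.commute)
qed

text \<open>
  Fubini for the product law of the independent random elements \<open>G\<close> and \<open>P\<close>. The majorant \<open>B\<close> supplies
  the integrability over the product.
\<close>
lemma (in prob_space) freezing:
  fixes H :: "'g \<Rightarrow> 'p \<Rightarrow> real"
  assumes G [measurable]: "G \<in> measurable M N" and P [measurable]: "P \<in> measurable M N'"
    and ind: "distr M N G \<Otimes>\<^sub>M distr M N' P = distr M (N \<Otimes>\<^sub>M N') (\<lambda>\<omega>. (G \<omega>, P \<omega>))"
    and H [measurable]: "(\<lambda>(g, p). H g p) \<in> borel_measurable (N \<Otimes>\<^sub>M N')"
    and int: "\<And>g. g \<in> space N \<Longrightarrow> integrable M (\<lambda>\<omega>. H g (P \<omega>))"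
    and B: "\<And>g. g \<in> space N \<Longrightarrow> (\<integral>\<omega>. \<bar>H g (P \<omega>)\<bar> \<partial>M) \<le> B g"
    and Bm [measurable]: "B \<in> borel_measurable N" and Bi: "integrable M (\<lambda>\<omega>. B (G \<omega>))"
  shows "integrable M (\<lambda>\<omega>. H (G \<omega>) (P \<omega>))"
    and "(\<integral>\<omega>. H (G \<omega>) (P \<omega>) \<partial>M) = (\<integral>\<omega>. (\<integral>\<omega>'. H (G \<omega>) (P \<omega>') \<partial>M) \<partial>M)"
proof -
  interpret G: prob_space "distr M N G" by (rule prob_space_distr[OF G])
  interpret P: prob_space "distr M N' P" by (rule prob_space_distr[OF P])
  interpret GP: pair_sigma_finite "distr M N G" "distr M N' P" ..
  have Hg: "(\<lambda>p. H g p) \<in> borel_measurable N'" if "g \<in> space N" for g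
    using measurable_compose[OF measurable_Pair1'[OF that] H] by simp
  have e: "(\<integral>p. H g p \<partial>distr M N' P) = (\<integral>\<omega>. H g (P \<omega>) \<partial>M)"
    and ea: "(\<integral>p. \<bar>H g p\<bar> \<partial>distr M N' P) = (\<integral>\<omega>. \<bar>H g (P \<omega>)\<bar> \<partial>M)"
    and i: "integrable (distr M N' P) (\<lambda>p. H g p)" if "g \<in> space N" for g
    using Hg[OF that] int[OF that] by (auto simp: integral_distr integrable_distr_eq)
  have main: "integrable (distr M N G \<Otimes>\<^sub>M distr M N' P) (\<lambda>(g, p). H g p)"
  proof (rule GP.Fubini_integrable)
    show "integrable (distr M N G) (\<lambda>g. \<integral>p. norm ((\<lambda>(g, p). H g p) (g, p)) \<partial>distr M N' P)"
    proof (rule Bochner_Integration.integrable_bound)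
      show "integrable (distr M N G) B" using Bi by (subst integrable_distr_eq) auto
      show "AE g in distr M N G. norm (\<integral>p. norm ((\<lambda>(g, p). H g p) (g, p)) \<partial>distr M N' P) \<le> norm (B g)"
        using B by (intro AE_I2) (auto simp: ea intro: order_trans[OF _ abs_ge_self])
    qed measurable
    show "AE g in distr M N G. integrable (distr M N' P) (\<lambda>p. (\<lambda>(g, p). H g p) (g, p))"
      using i by (intro AE_I2) auto
  qed measurable
  then show "integrable M (\<lambda>\<omega>. H (G \<omega>) (P \<omega>))"
    unfolding ind by (subst (asm) integrable_distr_eq) auto
  have "(\<integral>\<omega>. H (G \<omega>) (P \<omega>) \<partial>M) = (\<integral>q. (\<lambda>(g, p). H g p) q \<partial>distr M (N \<Otimes>\<^sub>M N') (\<lambda>\<omega>. (G \<omega>, P \<omega>)))"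
    by (subst integral_distr) auto
  also have "\<dots> = (\<integral>g. \<integral>p. H g p \<partial>distr M N' P \<partial>distr M N G)"
    unfolding ind[symmetric] using GP.integral_fst[OF main] by simp
  also have "\<dots> = (\<integral>g. (\<integral>\<omega>'. H g (P \<omega>') \<partial>M) \<partial>distr M N G)"
    by (rule Bochner_Integration.integral_cong) (auto simp: e)
  also have "\<dots> = (\<integral>\<omega>. (\<integral>\<omega>'. H (G \<omega>) (P \<omega>') \<partial>M) \<partial>M)"
  proof (rule integral_distr[OF G])
    have "(\<lambda>g. \<integral>p. H g p \<partial>distr M N' P) \<in> borel_measurable N" by measurable
    then show "(\<lambda>g. \<integral>\<omega>'. H g (P \<omega>') \<partial>M) \<in> borel_measurable N"
      by (rule measurable_cong[THEN iffD1, rotated]) (simp add: e)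
  qed
  finally show "(\<integral>\<omega>. H (G \<omega>) (P \<omega>) \<partial>M) = (\<integral>\<omega>. (\<integral>\<omega>'. H (G \<omega>) (P \<omega>') \<partial>M) \<partial>M)" .
qed

text \<open>
  Freezing the two increments of \<open>w\<close> integrates \<open>z\<close> out and leaves \<open>Q(Y)\<close>; the regression of \<open>X\<close> on \<open>Y\<close>
  then leaves \<open>\<phi>(Y)\<close>. Both functions are continuous and \<open>Y\<close> has full support, so they are the two
  conditional expectations.
\<close>
lemma fixed_time_factorisation:
  fixes w :: "real \<Rightarrow> 'a \<Rightarrow> real ^ 'd::finite" and z :: "real \<Rightarrow> 'a \<Rightarrow> real" and V :: "'a \<Rightarrow> real" and f :: "real \<Rightarrow> real" and i1 :: 'd
  assumes w: "brownian_motion M w" and z: "brownian_motion M z" and ind: "independent_processes M w z"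
    and rc: "r\<^sup>2 + c\<^sup>2 = 1" "0 < c"
    and f [measurable]: "f \<in> borel_measurable borel" and fi: "integrable lborel (\<lambda>x. (f x)\<^sup>2 * exp (- x\<^sup>2 / 2))"
    and s: "s1 \<in> {0..1}" "s2 \<in> {0..1}" and t: "0 \<le> t1" "t1 < t2" "t2 \<le> 1"
    and F1: "continuous_on UNIV F1" "\<And>x. \<bar>F1 x\<bar> \<le> C1"
    and V: "V \<in> borel_measurable (path_algebra M z)" "\<And>\<omega>. \<omega> \<in> space M \<Longrightarrow> \<bar>V \<omega>\<bar> \<le> C2"
  defines "A \<equiv> (\<integral>x. (f x)\<^sup>2 * exp (- x\<^sup>2 / 2) \<partial>lborel)"
    and "X \<equiv> \<lambda>\<omega>. w s2 \<omega> - w s1 \<omega>" and "Y \<equiv> \<lambda>\<omega>. w t2 \<omega> - w t1 \<omega>" and "Z \<equiv> \<lambda>\<omega>. z t2 \<omega> - z t1 \<omega>"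
  obtains \<phi> Q where "continuous_on UNIV \<phi>" "\<And>y. \<bar>\<phi> y\<bar> \<le> C1" "continuous_on UNIV Q"
    "\<And>y. \<bar>Q y\<bar> \<le> C2 * (A / c + 1) * (t2 - t1) powr (- 1 / 2) * exp ((norm y)\<^sup>2 / 4)"
    "\<And>y. cond_exp_at M (\<lambda>\<omega>. F1 (X \<omega>)) Y y = \<phi> y"
    "\<And>y. cond_exp_at M (\<lambda>\<omega>. V \<omega> * f (r * Y \<omega> $ i1 + c * Z \<omega>)) Y y = Q y"
    "\<And>k D. k \<in> borel_measurable borel \<Longrightarrow> (\<And>y. \<bar>k y\<bar> \<le> D) \<Longrightarrow>
      integrable M (\<lambda>\<omega>. F1 (X \<omega>) * V \<omega> * (k (Y \<omega>) * f (r * Y \<omega> $ i1 + c * Z \<omega>))) \<and>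
      (\<integral>\<omega>. F1 (X \<omega>) * V \<omega> * (k (Y \<omega>) * f (r * Y \<omega> $ i1 + c * Z \<omega>)) \<partial>M)
        = (\<integral>y. heat_kernel (t2 - t1) y * (k y * (\<phi> y * Q y)) \<partial>lborel)"
proof -
  interpret w: brownian M w by (rule brownianI[OF w])
  interpret z: brownian M z by (rule brownianI[OF z])
  define \<tau> where "\<tau> = t2 - t1"
  have \<tau>: "0 < \<tau>" "\<tau> \<le> 1" using t by (auto simp: \<tau>_def)
  have t': "t1 \<in> {0..1}" "t2 \<in> {0..1}" using t by auto
  have C1: "0 \<le> C1" using F1(2)[of 0] by linarith
  have C2: "0 \<le> C2"
  proof -
    obtain \<omega> where "\<omega> \<in> space M" using w.not_empty by auto
    then show ?thesis using V(2)[of \<omega>] by linarith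
  qed
  have A0: "0 \<le> A" unfolding A_def by simp
  have F1m [measurable]: "F1 \<in> borel_measurable borel" using F1(1) by (rule borel_measurable_continuous_onI)
  define P where "P = (\<lambda>\<omega>. (V \<omega>, Z \<omega>))"
  have Pz: "P \<in> measurable (path_algebra M z) (borel \<Otimes>\<^sub>M borel)"
    unfolding P_def Z_def using V(1) measurable_path_algebra[OF t'(1), of z M] measurable_path_algebra[OF t'(2), of z M]
    by (intro measurable_Pair borel_measurable_diff)
  have Xw: "X \<in> borel_measurable (path_algebra M w)" and Yw: "Y \<in> borel_measurable (path_algebra M w)"
    unfolding X_def Y_def by (intro borel_measurable_diff measurable_path_algebra s t')+
  have XYw: "(\<lambda>\<omega>. (X \<omega>, Y \<omega>)) \<in> measurable (path_algebra M w) (borel \<Otimes>\<^sub>M borel)"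
    by (intro measurable_Pair Xw Yw)
  note law_XY_P = w.distr_paths_pair[OF ind XYw Pz]
  note law_P_Y = w.distr_paths_pair[OF independent_processes_sym[OF w.prob_space_axioms ind] Pz Yw]
  note law_Y_P = w.distr_paths_pair[OF ind Yw Pz]
  have [measurable]: "P \<in> measurable M (borel \<Otimes>\<^sub>M borel)" "Y \<in> borel_measurable M" "X \<in> borel_measurable M"
    using law_XY_P(3) law_Y_P(2) w.distr_paths_pair(2)[OF ind Xw Pz] by auto
  have Vm [measurable]: "V \<in> borel_measurable M" and Zm [measurable]: "Z \<in> borel_measurable M"
    using measurable_compose[OF law_XY_P(3) measurable_fst] measurable_compose[OF law_XY_P(3) measurable_snd]
    by (simp_all add: P_def)
  have lawY: "distr M borel Y = density lborel (\<lambda>x. ennreal (heat_kernel \<tau> x))"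
    unfolding Y_def \<tau>_def by (rule w.distr_increment[OF t])
  have lawZ: "distr M borel Z = density lborel (\<lambda>x. ennreal (heat_kernel \<tau> x))"
    unfolding Z_def \<tau>_def by (rule z.distr_increment[OF t])
  define q where "q y = (\<integral>\<omega>. V \<omega> * f (r * y + c * Z \<omega>) \<partial>M)" for y
  define Q where "Q y = q (y $ i1)" for y
  define CQ where "CQ = C2 * (A / c + 1) * \<tau> powr (- 1 / 2)"
  have CQ: "0 \<le> CQ" using C2 A0 rc by (simp add: CQ_def)
  have const_le: "C2 * (exp (y\<^sup>2 / 4) / 2 * (1 * A / c + (2 * pi * \<tau>) powr (- 1 / 2) / 1)) \<le> CQ * exp (y\<^sup>2 / 4)" for y
  proof -
    have 1: "1 \<le> \<tau> powr (- 1 / 2)" using \<tau> powr_mono2'[of "- 1 / 2" \<tau> 1] by simp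
    have 2: "(2 * pi * \<tau>) powr (- 1 / 2) \<le> \<tau> powr (- 1 / 2)"
    proof -
      have "\<tau> \<le> 2 * pi * \<tau>" using \<tau> pi_gt3 by simp
      then show ?thesis using \<tau> by (intro powr_mono2') auto
    qed
    have "A / c * 1 \<le> A / c * \<tau> powr (- 1 / 2)" using 1 A0 rc by (intro mult_left_mono) auto
    then have "1 * A / c + (2 * pi * \<tau>) powr (- 1 / 2) / 1 \<le> (A / c + 1) * \<tau> powr (- 1 / 2)"
      using 2 by (simp add: algebra_simps)
    then have "C2 * (exp (y\<^sup>2 / 4) / 2 * (1 * A / c + (2 * pi * \<tau>) powr (- 1 / 2) / 1))
        \<le> C2 * (exp (y\<^sup>2 / 4) * ((A / c + 1) * \<tau> powr (- 1 / 2)))"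
      using C2 A0 rc by (intro mult_left_mono mult_mono) auto
    then show ?thesis by (simp add: CQ_def mult_ac)
  qed
  have exp_le: "exp ((y $ i1)\<^sup>2 / 4) \<le> exp ((norm y)\<^sup>2 / 4)" for y :: "real ^ 'd"
    using component_le_norm_cart[of y i1] by (simp add: abs_le_square_iff[symmetric])
  have qi: "integrable M (\<lambda>\<omega>. V \<omega> * f (r * y + c * Z \<omega>))" for y
    by (rule w.gaussian_expectation(1)[OF f fi rc \<tau> Zm lawZ Vm V(2)])
  have qabs: "(\<integral>\<omega>. \<bar>V \<omega> * f (r * y + c * Z \<omega>)\<bar> \<partial>M) \<le> CQ * exp (y\<^sup>2 / 4)" for y
  proof -
    have fa: "(\<lambda>x. \<bar>f x\<bar>) \<in> borel_measurable borel" and Va: "(\<lambda>\<omega>. \<bar>V \<omega>\<bar>) \<in> borel_measurable M" by auto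
    have "integrable lborel (\<lambda>x. \<bar>f x\<bar>\<^sup>2 * exp (- x\<^sup>2 / 2))" using fi by simp
    from w.gaussian_expectation(2)[OF fa this rc \<tau> Zm lawZ Va, of C2 1 y] V(2)
    show ?thesis by (intro order_trans[OF _ const_le]) (simp add: abs_mult A_def)
  qed
  have qle: "\<bar>q y\<bar> \<le> CQ * exp (y\<^sup>2 / 4)" for y
    unfolding q_def by (rule order_trans[OF integral_abs_bound qabs])
  have Qle: "\<bar>Q y\<bar> \<le> CQ * exp ((norm y)\<^sup>2 / 4)" for y
    unfolding Q_def by (rule order_trans[OF qle mult_left_mono[OF exp_le CQ]])
  have qc: "continuous_on UNIV q"
    unfolding q_def by (rule w.continuous_gaussian_expectation[OF f fi rc \<tau> Zm lawZ Vm V(2)])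
  have Qc: "continuous_on UNIV Q"
    unfolding Q_def by (rule continuous_on_compose2[OF qc]) (auto intro!: continuous_intros)
  have Qm [measurable]: "Q \<in> borel_measurable borel" using Qc by (rule borel_measurable_continuous_onI)
  have ie: "integrable M (\<lambda>\<omega>. exp ((norm (Y \<omega>))\<^sup>2 / 4))"
  proof -
    have "integrable lborel (\<lambda>y::real^'d. heat_kernel \<tau> y * exp ((norm y)\<^sup>2 / 4))"
    proof (rule Bochner_Integration.integrable_bound)
      show "integrable lborel (\<lambda>y::real^'d. 2 powr (real DIM(real^'d) / 2) * heat_kernel (2 * \<tau>) y)"
        using \<tau> by (intro integrable_mult_right integrable_heat_kernel) auto
      show "AE y in lborel. norm (heat_kernel \<tau> (y::real^'d) * exp ((norm y)\<^sup>2 / 4))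
          \<le> norm (2 powr (real DIM(real^'d) / 2) * heat_kernel (2 * \<tau>) y)"
        using heat_kernel_exp_bound[OF \<tau>, where 'v="real^'d"] by (intro AE_I2) (auto intro: order_trans[OF _ abs_ge_self])
    qed measurable
    then have "integrable (distr M borel Y) (\<lambda>y. exp ((norm y)\<^sup>2 / 4))"
      unfolding lawY by (subst integrable_density) auto
    then show ?thesis by (subst (asm) integrable_distr_eq) auto
  qed
  define h where "h p y = fst p * f (r * y $ i1 + c * snd p)" for p :: "real \<times> real" and y :: "real ^ 'd"
  have hm [measurable]: "(\<lambda>(p, y). h p y) \<in> borel_measurable ((borel \<Otimes>\<^sub>M borel) \<Otimes>\<^sub>M borel)"
  proof -
    have 1: "(\<lambda>x :: (real \<times> real) \<times> (real ^ 'd). r * snd x $ i1 + c * snd (fst x)) \<in> borel_measurable borel"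
      by (intro borel_measurable_continuous_onI continuous_intros)
    have 2: "(\<lambda>x :: (real \<times> real) \<times> (real ^ 'd). fst (fst x)) \<in> borel_measurable borel"
      by (intro borel_measurable_continuous_onI continuous_intros)
    show ?thesis
      using borel_measurable_times[OF 2 measurable_compose[OF 1 f]] by (simp add: h_def split_beta borel_prod)
  qed
  have hm2 [measurable]: "(\<lambda>(y, p). h p y) \<in> borel_measurable (borel \<Otimes>\<^sub>M (borel \<Otimes>\<^sub>M borel))"
    using measurable_compose[OF measurable_pair_swap' hm] by (simp add: split_beta)
  have hP: "h (P \<omega>) y = V \<omega> * f (r * y $ i1 + c * Z \<omega>)" for \<omega> y by (simp add: h_def P_def)
  have hi: "integrable M (\<lambda>\<omega>. h (P \<omega>) (Y \<omega>))"
  proof (rule w.freezing(1)[OF law_Y_P(2,3,1) hm2])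
    show "integrable M (\<lambda>\<omega>. h (P \<omega>) y)" for y unfolding hP by (rule qi)
    show "(\<integral>\<omega>. \<bar>h (P \<omega>) y\<bar> \<partial>M) \<le> CQ * exp ((norm y)\<^sup>2 / 4)" for y
      unfolding hP by (rule order_trans[OF qabs mult_left_mono[OF exp_le CQ]])
    show "integrable M (\<lambda>\<omega>. CQ * exp ((norm (Y \<omega>))\<^sup>2 / 4))" by (intro integrable_mult_right ie)
  qed measurable
  have ce2: "cond_exp_at M (\<lambda>\<omega>. V \<omega> * f (r * Y \<omega> $ i1 + c * Z \<omega>)) Y y = Q y" for y
  proof -
    have "continuous_on UNIV (\<lambda>y. \<integral>\<omega>. h (P \<omega>) y \<partial>M)" using Qc by (simp add: hP Q_def q_def[abs_def])
    from w.cond_exp_at_indep(1)[OF law_P_Y(2,3,1) lawY heat_kernel_pos[OF \<tau>(1)] borel_measurable_heat_kernel hm hi this]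
    show ?thesis by (simp add: hP Q_def q_def)
  qed
  obtain a where a: "distr M borel (\<lambda>\<omega>. X \<omega> - a *\<^sub>R Y \<omega>) \<Otimes>\<^sub>M distr M borel Y
    = distr M (borel \<Otimes>\<^sub>M borel) (\<lambda>\<omega>. (X \<omega> - a *\<^sub>R Y \<omega>, Y \<omega>))"
    unfolding X_def Y_def by (rule w.increment_regression[OF s t])
  define R where "R \<omega> = X \<omega> - a *\<^sub>R Y \<omega>" for \<omega>
  have Rm [measurable]: "R \<in> borel_measurable M" unfolding R_def[abs_def] by measurable
  define g where "g x y = F1 (x + a *\<^sub>R y)" for x y
  have gR: "g (R \<omega>) (Y \<omega>) = F1 (X \<omega>)" for \<omega> by (simp add: g_def R_def)
  have gm: "(\<lambda>(x, y). g x y) \<in> borel_measurable (borel \<Otimes>\<^sub>M borel)"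
    unfolding g_def[abs_def] by measurable
  define \<phi> where "\<phi> y = (\<integral>\<omega>. g (R \<omega>) y \<partial>M)" for y
  have gi: "integrable M (\<lambda>\<omega>. g (R \<omega>) (Y \<omega>))"
    unfolding gR by (rule w.integrable_const_bound[where B=C1]) (use F1(2) in auto)
  have \<phi>c: "continuous_on UNIV \<phi>"
    unfolding continuous_on_sequentially comp_def
  proof (intro allI ballI impI, elim conjE)
    fix ys and y :: "real ^ 'd" assume ys: "ys \<longlonglongrightarrow> y"
    show "(\<lambda>i. \<phi> (ys i)) \<longlonglongrightarrow> \<phi> y"
      unfolding \<phi>_def g_def
    proof (rule integral_dominated_convergence[where w="\<lambda>_. C1"])
      have "isCont F1 x" for x using F1(1) by (simp add: continuous_on_eq_continuous_at)
      then show "AE \<omega> in M. (\<lambda>i. F1 (R \<omega> + a *\<^sub>R ys i)) \<longlonglongrightarrow> F1 (R \<omega> + a *\<^sub>R y)"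
        by (intro AE_I2 isCont_tendsto_compose[where g=F1] tendsto_intros ys)
      show "AE \<omega> in M. norm (F1 (R \<omega> + a *\<^sub>R ys i)) \<le> C1" for i using F1(2) by auto
    qed (auto intro: measurable_compose[OF _ F1m])
  qed
  have \<phi>b: "\<bar>\<phi> y\<bar> \<le> C1" for y
  proof -
    have "\<bar>\<phi> y\<bar> \<le> (\<integral>\<omega>. \<bar>g (R \<omega>) y\<bar> \<partial>M)" unfolding \<phi>_def by (rule integral_abs_bound)
    also have "\<dots> \<le> (\<integral>\<omega>. C1 \<partial>M)"
      using F1(2) C1 by (intro integral_mono w.integrable_const_bound[where B=C1]) (auto simp: g_def)
    finally show ?thesis by (simp add: w.prob_space)
  qed
  note regr = w.cond_exp_at_indep[OF Rm \<open>Y \<in> borel_measurable M\<close> a[folded R_def] lawY heat_kernel_pos[OF \<tau>(1)]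
      borel_measurable_heat_kernel gm gi, folded \<phi>_def, OF \<phi>c]
  have ce1: "cond_exp_at M (\<lambda>\<omega>. F1 (X \<omega>)) Y y = \<phi> y" for y
    using regr(1) by (simp add: gR)
  have joint: "integrable M (\<lambda>\<omega>. F1 (X \<omega>) * V \<omega> * (k (Y \<omega>) * f (r * Y \<omega> $ i1 + c * Z \<omega>))) \<and>
      (\<integral>\<omega>. F1 (X \<omega>) * V \<omega> * (k (Y \<omega>) * f (r * Y \<omega> $ i1 + c * Z \<omega>)) \<partial>M)
        = (\<integral>y. heat_kernel \<tau> y * (k y * (\<phi> y * Q y)) \<partial>lborel)"
    if k [measurable]: "k \<in> borel_measurable borel" and D: "\<And>y. \<bar>k y\<bar> \<le> D" for k D
  proof -
    have D0: "0 \<le> D" using D[of 0] by linarith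
    define H where "H = (\<lambda>(x, y) p. (F1 x * k y) * h p y)"
    have Hm: "(\<lambda>(g, p). H g p) \<in> borel_measurable ((borel \<Otimes>\<^sub>M borel) \<Otimes>\<^sub>M (borel \<Otimes>\<^sub>M borel))"
    proof -
      have 1: "(\<lambda>q. h (snd q) (snd (fst q))) \<in> borel_measurable ((borel \<Otimes>\<^sub>M borel) \<Otimes>\<^sub>M (borel \<Otimes>\<^sub>M borel))"
        using measurable_compose[OF measurable_Pair[OF measurable_snd measurable_compose[OF measurable_fst measurable_snd]] hm]
        by simp
      have 2: "(\<lambda>q. F1 (fst (fst q)) * k (snd (fst q))) \<in> borel_measurable ((borel \<Otimes>\<^sub>M borel) \<Otimes>\<^sub>M (borel \<Otimes>\<^sub>M borel))"
        by (intro borel_measurable_times measurable_compose[OF _ k] measurable_compose[OF _ F1m]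
            measurable_compose[OF measurable_fst measurable_fst] measurable_compose[OF measurable_fst measurable_snd])
      show ?thesis using borel_measurable_times[OF 2 1] by (simp add: H_def split_beta)
    qed
    have HP: "H (x, y) (P \<omega>) = (F1 x * k y) * (V \<omega> * f (r * y $ i1 + c * Z \<omega>))" for x y \<omega>
      by (simp add: H_def hP)
    have kb: "\<bar>F1 x * k y\<bar> \<le> C1 * D" for x y
      unfolding abs_mult using F1(2) D C1 by (intro mult_mono) auto
    have 1: "integrable M (\<lambda>\<omega>. H (X \<omega>, Y \<omega>) (P \<omega>))"
      and 2: "(\<integral>\<omega>. H (X \<omega>, Y \<omega>) (P \<omega>) \<partial>M) = (\<integral>\<omega>. (\<integral>\<omega>'. H (X \<omega>, Y \<omega>) (P \<omega>') \<partial>M) \<partial>M)"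
    proof -
      have int: "integrable M (\<lambda>\<omega>. H g (P \<omega>))" for g
        by (cases g) (simp add: HP qi)
      have bd: "(\<integral>\<omega>. \<bar>H g (P \<omega>)\<bar> \<partial>M) \<le> C1 * D * (CQ * exp ((norm (snd g))\<^sup>2 / 4))" for g
      proof (cases g)
        case (Pair x y)
        have "(\<integral>\<omega>. \<bar>H g (P \<omega>)\<bar> \<partial>M) = \<bar>F1 x * k y\<bar> * (\<integral>\<omega>. \<bar>V \<omega> * f (r * y $ i1 + c * Z \<omega>)\<bar> \<partial>M)"
          by (simp add: Pair HP abs_mult[of "F1 x * k y"])
        also have "\<dots> \<le> (C1 * D) * (CQ * exp ((norm y)\<^sup>2 / 4))"
          using C1 D0 by (intro mult_mono kb order_trans[OF qabs mult_left_mono[OF exp_le CQ]]) auto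
        finally show ?thesis by (simp add: Pair)
      qed
      have Bi: "integrable M (\<lambda>\<omega>. C1 * D * (CQ * exp ((norm (snd (X \<omega>, Y \<omega>)))\<^sup>2 / 4)))"
        using ie by (simp only: snd_conv) (intro integrable_mult_right)
      have Bm: "(\<lambda>g. C1 * D * (CQ * exp ((norm (snd g))\<^sup>2 / 4))) \<in> borel_measurable (borel \<Otimes>\<^sub>M (borel :: (real^'d) measure))"
        by measurable
      show "integrable M (\<lambda>\<omega>. H (X \<omega>, Y \<omega>) (P \<omega>))"
        by (rule w.freezing(1)[OF law_XY_P(2,3,1) Hm int bd Bm Bi])
      show "(\<integral>\<omega>. H (X \<omega>, Y \<omega>) (P \<omega>) \<partial>M) = (\<integral>\<omega>. (\<integral>\<omega>'. H (X \<omega>, Y \<omega>) (P \<omega>') \<partial>M) \<partial>M)"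
        by (rule w.freezing(2)[OF law_XY_P(2,3,1) Hm int bd Bm Bi])
    qed
    have HV: "H (X \<omega>, Y \<omega>) (P \<omega>) = F1 (X \<omega>) * V \<omega> * (k (Y \<omega>) * f (r * Y \<omega> $ i1 + c * Z \<omega>))" for \<omega>
      by (simp add: HP mult_ac)
    have inner: "(\<integral>\<omega>'. H (X \<omega>, Y \<omega>) (P \<omega>') \<partial>M) = (k (Y \<omega>) * Q (Y \<omega>)) * g (R \<omega>) (Y \<omega>)" for \<omega>
    proof -
      have "(\<integral>\<omega>'. H (X \<omega>, Y \<omega>) (P \<omega>') \<partial>M) = (F1 (X \<omega>) * k (Y \<omega>)) * Q (Y \<omega>)"
        unfolding HP Q_def q_def by (rule integral_mult_right_zero)
      then show ?thesis unfolding gR by (simp only: mult_ac)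
    qed
    have "integrable M (\<lambda>\<omega>. (k (Y \<omega>) * Q (Y \<omega>)) * g (R \<omega>) (Y \<omega>))"
    proof (rule Bochner_Integration.integrable_bound)
      show "integrable M (\<lambda>\<omega>. D * C1 * CQ * exp ((norm (Y \<omega>))\<^sup>2 / 4))" by (intro integrable_mult_right ie)
      show "AE \<omega> in M. norm ((k (Y \<omega>) * Q (Y \<omega>)) * g (R \<omega>) (Y \<omega>)) \<le> norm (D * C1 * CQ * exp ((norm (Y \<omega>))\<^sup>2 / 4))"
      proof (rule AE_I2)
        fix \<omega>
        have "\<bar>k (Y \<omega>)\<bar> * \<bar>Q (Y \<omega>)\<bar> * \<bar>F1 (X \<omega>)\<bar> \<le> D * (CQ * exp ((norm (Y \<omega>))\<^sup>2 / 4)) * C1"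
          using D Qle F1(2) D0 CQ by (intro mult_mono) auto
        then show "norm ((k (Y \<omega>) * Q (Y \<omega>)) * g (R \<omega>) (Y \<omega>)) \<le> norm (D * C1 * CQ * exp ((norm (Y \<omega>))\<^sup>2 / 4))"
          using D0 C1 CQ by (simp add: gR abs_mult mult_ac)
      qed
      show "(\<lambda>\<omega>. (k (Y \<omega>) * Q (Y \<omega>)) * g (R \<omega>) (Y \<omega>)) \<in> borel_measurable M" unfolding gR by measurable
    qed
    from regr(2)[OF _ this]
    have "(\<integral>\<omega>. (k (Y \<omega>) * Q (Y \<omega>)) * g (R \<omega>) (Y \<omega>) \<partial>M) = (\<integral>y. heat_kernel \<tau> y * ((k y * Q y) * \<phi> y) \<partial>lborel)"
      by simp
    then show ?thesis
      using 1 2 by (simp only: HV inner) (simp add: mult_ac)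
  qed
  show thesis
    by (rule that[OF \<phi>c \<phi>b Qc Qle[unfolded CQ_def \<tau>_def] ce1 ce2 joint[unfolded \<tau>_def]])
qed

text \<open>
  Applied with \<open>k = heat_kernel \<epsilon> (\<cdot> - u)\<close>, the factorisation turns the expectation into the convolution of an
  approximate identity with the bounded continuous function \<open>p\<^sub>\<tau> \<phi> Q\<close>. The same function is at most a
  constant times \<open>\<tau> powr (- 1 / 2)\<close> times \<open>p\<^sub>2\<^sub>\<tau>\<close>, which bounds the expectation uniformly in \<open>\<epsilon>\<close>.
\<close>
lemma fixed_time_limit:
  fixes w :: "real \<Rightarrow> 'a \<Rightarrow> real ^ 'd::finite" and z :: "real \<Rightarrow> 'a \<Rightarrow> real" and f :: "real \<Rightarrow> real"
    and i1 :: 'd and u :: "real ^ 'd"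
  assumes w: "brownian_motion M w" and z: "brownian_motion M z" and ind: "independent_processes M w z"
    and rc: "r\<^sup>2 + c\<^sup>2 = 1" "0 < c"
    and f: "f \<in> borel_measurable borel" and fi: "integrable lborel (\<lambda>x. (f x)\<^sup>2 * exp (- x\<^sup>2 / 2))"
    and s: "s1 \<in> {0..1}" "s2 \<in> {0..1}" and t: "0 \<le> t1" "t1 < t2" "t2 \<le> 1"
    and F1: "continuous_on UNIV F1" "\<And>x. \<bar>F1 x\<bar> \<le> C1"
    and V: "V \<in> borel_measurable (path_algebra M z)" "\<And>\<omega>. \<omega> \<in> space M \<Longrightarrow> \<bar>V \<omega>\<bar> \<le> C2"
    and K: "\<And>s t. 0 < s \<Longrightarrow> 0 < t \<Longrightarrow> integrable lborel (\<lambda>y. heat_kernel s (y - u) * heat_kernel t y)"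
      "\<And>s t. 0 < s \<Longrightarrow> 0 < t \<Longrightarrow> (\<integral>y. heat_kernel s (y - u) * heat_kernel t y \<partial>lborel) \<le> K"
  defines "A \<equiv> (\<integral>x. (f x)\<^sup>2 * exp (- x\<^sup>2 / 2) \<partial>lborel)"
    and "X \<equiv> \<lambda>\<omega>. w s2 \<omega> - w s1 \<omega>" and "Y \<equiv> \<lambda>\<omega>. w t2 \<omega> - w t1 \<omega>" and "Z \<equiv> \<lambda>\<omega>. z t2 \<omega> - z t1 \<omega>"
  defines "G \<equiv> \<lambda>\<epsilon> \<omega>. F1 (X \<omega>) * V \<omega> * (heat_kernel \<epsilon> (Y \<omega> - u) * f (r * Y \<omega> $ i1 + c * Z \<omega>))"
  shows "\<And>\<epsilon>. 0 < \<epsilon> \<Longrightarrow> integrable M (G \<epsilon>)"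
    and "\<And>\<epsilon>. 0 < \<epsilon> \<Longrightarrow> \<bar>\<integral>\<omega>. G \<epsilon> \<omega> \<partial>M\<bar>
      \<le> C1 * C2 * (A / c + 1) * 2 powr (real CARD('d) / 2) * K * (t2 - t1) powr (- 1 / 2)"
    and "\<And>e :: nat \<Rightarrow> real. (\<And>n. 0 < e n) \<Longrightarrow> e \<longlonglongrightarrow> 0 \<Longrightarrow>
      (\<lambda>n. \<integral>\<omega>. G (e n) \<omega> \<partial>M) \<longlonglongrightarrow> heat_kernel (t2 - t1) u * cond_exp_at M (\<lambda>\<omega>. F1 (X \<omega>)) Y u
        * cond_exp_at M (\<lambda>\<omega>. V \<omega> * f (r * Y \<omega> $ i1 + c * Z \<omega>)) Y u"
proof -
  obtain \<phi> Q where \<phi>: "continuous_on UNIV \<phi>" "\<And>y. \<bar>\<phi> y\<bar> \<le> C1" and Q: "continuous_on UNIV Q"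
    "\<And>y. \<bar>Q y\<bar> \<le> C2 * (A / c + 1) * (t2 - t1) powr (- 1 / 2) * exp ((norm y)\<^sup>2 / 4)"
    and ce1: "\<And>y. cond_exp_at M (\<lambda>\<omega>. F1 (X \<omega>)) Y y = \<phi> y"
    and ce2: "\<And>y. cond_exp_at M (\<lambda>\<omega>. V \<omega> * f (r * Y \<omega> $ i1 + c * Z \<omega>)) Y y = Q y"
    and joint: "\<And>k D. k \<in> borel_measurable borel \<Longrightarrow> (\<And>y. \<bar>k y\<bar> \<le> D) \<Longrightarrow>
      integrable M (\<lambda>\<omega>. F1 (X \<omega>) * V \<omega> * (k (Y \<omega>) * f (r * Y \<omega> $ i1 + c * Z \<omega>))) \<and>
      (\<integral>\<omega>. F1 (X \<omega>) * V \<omega> * (k (Y \<omega>) * f (r * Y \<omega> $ i1 + c * Z \<omega>)) \<partial>M)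
        = (\<integral>y. heat_kernel (t2 - t1) y * (k y * (\<phi> y * Q y)) \<partial>lborel)"
  proof -
    show ?thesis
    proof (rule fixed_time_factorisation[OF w z ind rc f fi s t F1 V, of i1], goal_cases)
      case (2 \<phi> Q)
      then show ?thesis by (rule that[unfolded A_def X_def Y_def Z_def])
    qed simp
  qed
  define \<tau> where "\<tau> = t2 - t1"
  have \<tau>: "0 < \<tau>" "\<tau> \<le> 1" using t by (auto simp: \<tau>_def)
  define L where "L = C1 * (C2 * (A / c + 1) * \<tau> powr (- 1 / 2)) * 2 powr (real CARD('d) / 2)"
  have C1: "0 \<le> C1" using \<phi>(2)[of 0] by linarith
  have CQ: "0 \<le> C2 * (A / c + 1) * \<tau> powr (- 1 / 2)"
    using Q(2)[of 0] abs_ge_zero[of "Q 0"] unfolding \<tau>_def by simp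
  have L0: "0 \<le> L" using C1 CQ by (simp add: L_def)
  have [measurable]: "\<phi> \<in> borel_measurable borel" "Q \<in> borel_measurable borel"
    using \<phi>(1) Q(1) by (auto intro: borel_measurable_continuous_onI)
  define h where "h y = heat_kernel \<tau> y * (\<phi> y * Q y)" for y
  have hm [measurable]: "h \<in> borel_measurable borel" unfolding h_def[abs_def] by measurable
  have hle: "\<bar>h y\<bar> \<le> L * heat_kernel (2 * \<tau>) y" for y
  proof -
    have "\<bar>\<phi> y\<bar> * \<bar>Q y\<bar> \<le> C1 * (C2 * (A / c + 1) * \<tau> powr (- 1 / 2) * exp ((norm y)\<^sup>2 / 4))"
      using \<phi>(2) Q(2) C1 unfolding \<tau>_def by (intro mult_mono) auto
    then have "heat_kernel \<tau> y * (\<bar>\<phi> y\<bar> * \<bar>Q y\<bar>)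
        \<le> heat_kernel \<tau> y * (C1 * (C2 * (A / c + 1) * \<tau> powr (- 1 / 2) * exp ((norm y)\<^sup>2 / 4)))"
      by (rule mult_left_mono) (rule heat_kernel_nonneg)
    also have "\<dots> = C1 * (C2 * (A / c + 1) * \<tau> powr (- 1 / 2)) * (heat_kernel \<tau> y * exp ((norm y)\<^sup>2 / 4))"
      by (simp only: mult_ac)
    also have "\<dots> \<le> C1 * (C2 * (A / c + 1) * \<tau> powr (- 1 / 2)) * (2 powr (real DIM(real^'d) / 2) * heat_kernel (2 * \<tau>) y)"
      by (intro mult_left_mono heat_kernel_exp_bound \<tau> mult_nonneg_nonneg C1 CQ)
    finally show ?thesis by (simp add: h_def abs_mult L_def mult_ac)
  qed
  have kb: "\<bar>heat_kernel \<epsilon> (y - u)\<bar> \<le> (2 * pi * \<epsilon>) powr (- real DIM(real^'d) / 2)" if "0 < \<epsilon>" for \<epsilon> and y :: "real^'d"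
    using heat_kernel_le[OF that, of "y - u"] by simp
  have km: "(\<lambda>y. heat_kernel \<epsilon> (y - u)) \<in> borel_measurable borel" for \<epsilon> by measurable
  have G: "integrable M (G \<epsilon>)" "(\<integral>\<omega>. G \<epsilon> \<omega> \<partial>M) = (\<integral>y. heat_kernel \<epsilon> (y - u) * h y \<partial>lborel)" if e: "0 < \<epsilon>" for \<epsilon>
    using joint[OF km kb[OF e]] unfolding G_def h_def \<tau>_def by (simp_all only: mult.left_commute)
  show "integrable M (G \<epsilon>)" if "0 < \<epsilon>" for \<epsilon> by (rule G(1)[OF that])
  show "\<bar>\<integral>\<omega>. G \<epsilon> \<omega> \<partial>M\<bar> \<le> C1 * C2 * (A / c + 1) * 2 powr (real CARD('d) / 2) * K * (t2 - t1) powr (- 1 / 2)"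
    if e: "0 < \<epsilon>" for \<epsilon>
  proof -
    have le: "\<bar>heat_kernel \<epsilon> (y - u) * h y\<bar> \<le> L * (heat_kernel \<epsilon> (y - u) * heat_kernel (2 * \<tau>) y)" for y
      using mult_left_mono[OF hle[of y] heat_kernel_nonneg[of \<epsilon> "y - u"]] by (simp add: abs_mult mult_ac)
    have i: "integrable lborel (\<lambda>y. L * (heat_kernel \<epsilon> (y - u) * heat_kernel (2 * \<tau>) y))"
      using K(1)[of \<epsilon> "2 * \<tau>"] e \<tau> by (intro integrable_mult_right) auto
    have j: "integrable lborel (\<lambda>y. \<bar>heat_kernel \<epsilon> (y - u) * h y\<bar>)"
      using le L0 by (intro Bochner_Integration.integrable_bound[OF i]) (auto intro!: order_trans[OF le] simp: abs_mult)
    have "\<bar>\<integral>\<omega>. G \<epsilon> \<omega> \<partial>M\<bar> \<le> (\<integral>y. \<bar>heat_kernel \<epsilon> (y - u) * h y\<bar> \<partial>lborel)"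
      unfolding G(2)[OF e] by (rule integral_abs_bound)
    also have "\<dots> \<le> (\<integral>y. L * (heat_kernel \<epsilon> (y - u) * heat_kernel (2 * \<tau>) y) \<partial>lborel)"
      by (intro integral_mono i j le)
    also have "\<dots> = L * (\<integral>y. heat_kernel \<epsilon> (y - u) * heat_kernel (2 * \<tau>) y \<partial>lborel)"
      by (rule integral_mult_right_zero)
    also have "\<dots> \<le> L * K" using K(2)[of \<epsilon> "2 * \<tau>"] e \<tau> by (intro mult_left_mono L0) auto
    finally show ?thesis by (simp add: L_def \<tau>_def mult_ac)
  qed
  show "(\<lambda>n. \<integral>\<omega>. G (e n) \<omega> \<partial>M) \<longlonglongrightarrow> heat_kernel (t2 - t1) u * cond_exp_at M (\<lambda>\<omega>. F1 (X \<omega>)) Y u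
        * cond_exp_at M (\<lambda>\<omega>. V \<omega> * f (r * Y \<omega> $ i1 + c * Z \<omega>)) Y u"
    if e: "\<And>n. 0 < e n" "e \<longlonglongrightarrow> 0" for e :: "nat \<Rightarrow> real"
  proof -
    have "continuous_on UNIV h"
      unfolding h_def[abs_def] heat_kernel_def using \<tau>
      by (intro continuous_intros \<phi>(1) Q(1)) auto
    moreover have "\<bar>h y\<bar> \<le> L * (2 * pi * (2 * \<tau>)) powr (- real DIM(real^'d) / 2)" for y
      using \<tau> by (intro order_trans[OF hle] mult_left_mono L0 heat_kernel_le) auto
    ultimately have "(\<lambda>n. \<integral>y. heat_kernel (e n) (y - u) * h y \<partial>lborel) \<longlonglongrightarrow> h u"
      by (rule heat_kernel_approx_identity) (use e in auto)
    then show ?thesis unfolding G(2)[OF e(1)] ce1 ce2 by (simp only: h_def \<tau>_def mult.assoc)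
  qed
qed

section \<open>Integration over the times\<close>

text \<open>
  Fubini and dominated convergence over the times. The majorant of the absolute values, needed for
  Fubini, comes from the same estimate applied to the absolute values of \<open>F1\<close>, \<open>V\<close> and \<open>f\<close>.
\<close>
lemma expectation_limit:
  fixes w :: "real \<Rightarrow> 'a \<Rightarrow> real ^ 'd::finite" and z :: "real \<Rightarrow> 'a \<Rightarrow> real" and f :: "real \<Rightarrow> real"
    and i1 :: 'd and u :: "real ^ 'd"
  assumes w: "brownian_motion M w" and z: "brownian_motion M z" and ind: "independent_processes M w z"
    and rc: "r\<^sup>2 + c\<^sup>2 = 1" "0 < c" and u: "u \<noteq> 0"
    and \<beta>: "\<And>t \<omega>. \<beta> t \<omega> = r * w t \<omega> $ i1 + c * z t \<omega>"
    and f [measurable]: "f \<in> borel_measurable borel" and fi: "integrable lborel (\<lambda>x. (f x)\<^sup>2 * exp (- x\<^sup>2 / 2))"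
    and s: "s1 \<in> {0..1}" "s2 \<in> {0..1}"
    and F1: "continuous_on UNIV F1" "\<And>x. \<bar>F1 x\<bar> \<le> C1"
    and V: "V \<in> borel_measurable (path_algebra M z)" "\<And>\<omega>. \<omega> \<in> space M \<Longrightarrow> \<bar>V \<omega>\<bar> \<le> C2"
  defines "J \<equiv> \<lambda>t. heat_kernel (snd t - fst t) u
      * cond_exp_at M (\<lambda>\<omega>. F1 (w s2 \<omega> - w s1 \<omega>)) (\<lambda>\<omega>. w (snd t) \<omega> - w (fst t) \<omega>) u
      * cond_exp_at M (\<lambda>\<omega>. V \<omega> * f (\<beta> (snd t) \<omega> - \<beta> (fst t) \<omega>)) (\<lambda>\<omega>. w (snd t) \<omega> - w (fst t) \<omega>) u"
  shows "set_integrable lborel Delta2 J"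
    and "((\<lambda>\<epsilon>. \<integral>\<omega>. F1 (w s2 \<omega> - w s1 \<omega>) * V \<omega> * eta_approx w \<beta> u f \<epsilon> \<omega> \<partial>M)
      \<longlongrightarrow> (LINT t:Delta2|lborel. J t)) (at_right 0)"
proof -
  interpret w: brownian M w by (rule brownianI[OF w])
  interpret z: brownian M z by (rule brownianI[OF z])
  interpret pair_sigma_finite "lborel :: (real \<times> real) measure" M ..
  obtain K where K: "\<And>s t. 0 < s \<Longrightarrow> 0 < t \<Longrightarrow> integrable lborel (\<lambda>y. heat_kernel s (y - u) * heat_kernel t y)"
      "\<And>s t. 0 < s \<Longrightarrow> 0 < t \<Longrightarrow> (\<integral>y. heat_kernel s (y - u) * heat_kernel t y \<partial>lborel) \<le> K"
    using heat_kernel_product_bound[OF u] by blast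
  define A where "A = (\<integral>x. (f x)\<^sup>2 * exp (- x\<^sup>2 / 2) \<partial>lborel)"
  define B where "B = C1 * C2 * (A / c + 1) * 2 powr (real CARD('d) / 2) * K"
  define dom where "dom t = B * (indicator Delta2 t * (snd t - fst t) powr (- 1 / 2))" for t :: "real \<times> real"
  have domi: "integrable lborel dom"
    unfolding dom_def[abs_def] by (intro integrable_mult_right integrable_Delta2_powr)
  define G where "G \<epsilon> t \<omega> = F1 (w s2 \<omega> - w s1 \<omega>) * V \<omega> * (heat_kernel \<epsilon> (w (snd t) \<omega> - w (fst t) \<omega> - u)
    * f (r * (w (snd t) \<omega> - w (fst t) \<omega>) $ i1 + c * (z (snd t) \<omega> - z (fst t) \<omega>)))" for \<epsilon> t \<omega>
  have \<beta>d: "\<beta> t2 \<omega> - \<beta> t1 \<omega> = r * (w t2 \<omega> - w t1 \<omega>) $ i1 + c * (z t2 \<omega> - z t1 \<omega>)" for t1 t2 \<omega>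
    by (simp add: \<beta> algebra_simps)
  have D: "0 \<le> fst t" "fst t < snd t" "snd t \<le> 1" if "t \<in> Delta2" for t
    using that by (auto simp: Delta2_def)
  have F1a: "continuous_on UNIV (\<lambda>x. \<bar>F1 x\<bar>)" "\<And>x. \<bar>\<bar>F1 x\<bar>\<bar> \<le> C1" using F1 by (auto intro: continuous_intros)
  have Va: "(\<lambda>\<omega>. \<bar>V \<omega>\<bar>) \<in> borel_measurable (path_algebra M z)" "\<And>\<omega>. \<omega> \<in> space M \<Longrightarrow> \<bar>\<bar>V \<omega>\<bar>\<bar> \<le> C2"
    using V by auto
  have fa: "(\<lambda>x. \<bar>f x\<bar>) \<in> borel_measurable borel" by measurable
  have fia: "integrable lborel (\<lambda>x. \<bar>f x\<bar>\<^sup>2 * exp (- x\<^sup>2 / 2))" using fi by simp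
  have Gi: "integrable M (G \<epsilon> t)" and Ga: "(\<integral>\<omega>. \<bar>G \<epsilon> t \<omega>\<bar> \<partial>M) \<le> dom t" if t: "t \<in> Delta2" and e: "0 < \<epsilon>" for \<epsilon> t
  proof -
    show "integrable M (G \<epsilon> t)"
      unfolding G_def by (rule fixed_time_limit(1)[OF w z ind rc f fi s D[OF t] F1 V K e])
    have "\<bar>\<integral>\<omega>. \<bar>G \<epsilon> t \<omega>\<bar> \<partial>M\<bar> \<le> B * (snd t - fst t) powr (- 1 / 2)"
      using fixed_time_limit(2)[OF w z ind rc fa fia s D[OF t] F1a Va K e, of i1]
      unfolding G_def B_def A_def by (simp add: abs_mult)
    then show "(\<integral>\<omega>. \<bar>G \<epsilon> t \<omega>\<bar> \<partial>M) \<le> dom t" using t by (simp add: dom_def)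
  qed
  \<comment> \<open>The paths are continuous on \<open>{0..1}\<close> only; stopping them outside makes them continuous on the
    whole line, hence jointly measurable.\<close>
  define cl :: "real \<Rightarrow> real" where "cl t = max 0 (min 1 t)" for t
  have cl: "cl t \<in> {0..1}" for t by (simp add: cl_def)
  have clc: "continuous_on UNIV cl" unfolding cl_def[abs_def] by (intro continuous_intros)
  have Vm [measurable]: "V \<in> borel_measurable M"
    by (rule w.distr_paths_pair(3)[OF ind measurable_path_algebra[OF s(1)] V(1)])
  have F1m [measurable]: "F1 \<in> borel_measurable borel" using F1(1) by (rule borel_measurable_continuous_onI)
  have [measurable]: "w s1 \<in> borel_measurable M" "w s2 \<in> borel_measurable M"
    using w s by (auto simp: brownian_motion_def)
  have wcl: "(\<lambda>p. w (cl (fst p)) (snd p)) \<in> borel_measurable (borel \<Otimes>\<^sub>M M)"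
    and zcl: "(\<lambda>p. z (cl (fst p)) (snd p)) \<in> borel_measurable (borel \<Otimes>\<^sub>M M)"
    using w z cl by (auto intro!: continuous_process_measurable continuous_on_compose2[OF _ clc] simp: brownian_motion_def)
  have m1: "(\<lambda>p. (fst (fst p), snd p)) \<in> measurable ((lborel :: (real \<times> real) measure) \<Otimes>\<^sub>M M) (borel \<Otimes>\<^sub>M M)"
    and m2: "(\<lambda>p. (snd (fst p), snd p)) \<in> measurable ((lborel :: (real \<times> real) measure) \<Otimes>\<^sub>M M) (borel \<Otimes>\<^sub>M M)"
    by (intro measurable_Pair measurable_snd measurable_compose[OF measurable_fst];
        simp add: borel_prod[symmetric])+
  note wz [measurable] = measurable_compose[OF m1 wcl, simplified] measurable_compose[OF m2 wcl, simplified]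
    measurable_compose[OF m1 zcl, simplified] measurable_compose[OF m2 zcl, simplified]
  have nth: "(\<lambda>x :: real ^ 'd. x $ i1) \<in> borel_measurable borel"
    by (intro borel_measurable_continuous_onI continuous_intros)
  have fm [measurable]: "(\<lambda>p. f (r * (w (cl (snd (fst p))) (snd p) - w (cl (fst (fst p))) (snd p)) $ i1
      + c * (z (cl (snd (fst p))) (snd p) - z (cl (fst (fst p))) (snd p)))) \<in> borel_measurable (lborel \<Otimes>\<^sub>M M)"
    by (intro measurable_compose[OF _ f] borel_measurable_add borel_measurable_times borel_measurable_diff
        measurable_compose[OF _ nth] wz borel_measurable_const)
  define \<Psi> where "\<Psi> \<epsilon> t \<omega> = indicator Delta2 t * G \<epsilon> (cl (fst t), cl (snd t)) \<omega>" for \<epsilon> t \<omega>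
  have \<Psi>: "\<Psi> \<epsilon> t \<omega> = indicator Delta2 t * G \<epsilon> t \<omega>" for \<epsilon> t \<omega>
    by (cases "t \<in> Delta2") (use D[of t] in \<open>auto simp: \<Psi>_def cl_def\<close>)
  have \<Psi>m [measurable]: "(\<lambda>(t, \<omega>). \<Psi> \<epsilon> t \<omega>) \<in> borel_measurable (lborel \<Otimes>\<^sub>M M)" for \<epsilon>
    unfolding \<Psi>_def G_def split_beta fst_conv snd_conv by measurable
  have \<Psi>t: "integrable M (\<Psi> \<epsilon> t)" "(\<integral>\<omega>. \<bar>\<Psi> \<epsilon> t \<omega>\<bar> \<partial>M) \<le> dom t" if "0 < \<epsilon>" for \<epsilon> t
    unfolding \<Psi> using Gi[of t \<epsilon>] Ga[of t \<epsilon>] that by (cases "t \<in> Delta2"; simp add: dom_def)+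
  have \<Psi>i: "integrable (lborel \<Otimes>\<^sub>M M) (\<lambda>(t, \<omega>). \<Psi> \<epsilon> t \<omega>)" if e: "0 < \<epsilon>" for \<epsilon>
  proof (rule Fubini_integrable)
    show "integrable lborel (\<lambda>t. \<integral>\<omega>. norm ((\<lambda>(t, \<omega>). \<Psi> \<epsilon> t \<omega>) (t, \<omega>)) \<partial>M)"
    proof (rule Bochner_Integration.integrable_bound[OF domi])
      show "AE t in lborel. norm (\<integral>\<omega>. norm ((\<lambda>(t, \<omega>). \<Psi> \<epsilon> t \<omega>) (t, \<omega>)) \<partial>M) \<le> norm (dom t)"
        using \<Psi>t(2)[OF e] by (intro AE_I2) (auto intro: order_trans[OF _ abs_ge_self])
    qed measurable
    show "AE t in lborel. integrable M (\<lambda>\<omega>. (\<lambda>(t, \<omega>). \<Psi> \<epsilon> t \<omega>) (t, \<omega>))"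
      using \<Psi>t(1)[OF e] by (intro AE_I2) simp
  qed measurable
  have eta: "F1 (w s2 \<omega> - w s1 \<omega>) * V \<omega> * eta_approx w \<beta> u f \<epsilon> \<omega> = (\<integral>t. \<Psi> \<epsilon> t \<omega> \<partial>lborel)" for \<epsilon> \<omega>
    unfolding eta_approx_def set_lebesgue_integral_def integral_mult_right_zero[symmetric]
    by (rule Bochner_Integration.integral_cong) (auto simp: \<Psi> G_def \<beta>d split_beta mult_ac)
  define g where "g \<epsilon> t = (\<integral>\<omega>. \<Psi> \<epsilon> t \<omega> \<partial>M)" for \<epsilon> t
  have gm: "g \<epsilon> \<in> borel_measurable lborel" for \<epsilon> unfolding g_def[abs_def] by measurable
  have fub: "(\<integral>\<omega>. F1 (w s2 \<omega> - w s1 \<omega>) * V \<omega> * eta_approx w \<beta> u f \<epsilon> \<omega> \<partial>M) = (\<integral>t. g \<epsilon> t \<partial>lborel)" if "0 < \<epsilon>" for \<epsilon>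
    unfolding eta g_def by (rule Fubini_integral[OF \<Psi>i[OF that]])
  have gle: "norm (g \<epsilon> t) \<le> dom t" if "0 < \<epsilon>" for \<epsilon> t
    unfolding g_def real_norm_def by (rule order_trans[OF integral_abs_bound \<Psi>t(2)[OF that]])
  have glim: "(\<lambda>n. g (e n) t) \<longlonglongrightarrow> indicator Delta2 t * J t" if e: "\<And>n. 0 < e n" "e \<longlonglongrightarrow> 0" for e :: "nat \<Rightarrow> real" and t
  proof (cases "t \<in> Delta2")
    case True
    have "(\<lambda>n. \<integral>\<omega>. G (e n) t \<omega> \<partial>M) \<longlonglongrightarrow> J t"
      unfolding G_def J_def \<beta>d
      by (rule fixed_time_limit(3)[OF w z ind rc f fi s D[OF True] F1 V K e])
    then show ?thesis using True by (simp add: g_def \<Psi>)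
  qed (simp add: g_def \<Psi>)
  have seq: "0 < inverse (real (Suc n))" for n by simp
  have Jm: "(\<lambda>t. indicator Delta2 t * J t) \<in> borel_measurable lborel"
    by (rule borel_measurable_LIMSEQ_real[OF glim[OF seq LIMSEQ_inverse_real_of_nat] gm])
  have DC: "integrable lborel (\<lambda>t. indicator Delta2 t * J t)"
      "(\<lambda>n. \<integral>t. g (e n) t \<partial>lborel) \<longlonglongrightarrow> (\<integral>t. indicator Delta2 t * J t \<partial>lborel)"
    if e: "\<And>n. 0 < e n" "e \<longlonglongrightarrow> 0" for e :: "nat \<Rightarrow> real"
    using integrable_dominated_convergence[OF Jm gm domi AE_I2[OF glim[OF e]] AE_I2[OF gle[OF e(1)]]]
      integral_dominated_convergence[OF Jm gm domi AE_I2[OF glim[OF e]] AE_I2[OF gle[OF e(1)]]]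
    by auto
  show "set_integrable lborel Delta2 J"
    unfolding set_integrable_def real_scaleR_def
    by (rule DC(1)[OF seq LIMSEQ_inverse_real_of_nat])
  show "((\<lambda>\<epsilon>. \<integral>\<omega>. F1 (w s2 \<omega> - w s1 \<omega>) * V \<omega> * eta_approx w \<beta> u f \<epsilon> \<omega> \<partial>M)
      \<longlongrightarrow> (LINT t:Delta2|lborel. J t)) (at_right 0)"
    unfolding set_lebesgue_integral_def real_scaleR_def
  proof (rule tendsto_at_right_sequentially[of 0 1])
    fix e :: "nat \<Rightarrow> real" assume e: "\<And>n. 0 < e n" "e \<longlonglongrightarrow> 0"
    show "(\<lambda>n. \<integral>\<omega>. F1 (w s2 \<omega> - w s1 \<omega>) * V \<omega> * eta_approx w \<beta> u f (e n) \<omega> \<partial>M)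
      \<longlonglongrightarrow> (\<integral>t. indicator Delta2 t * J t \<partial>lborel)"
      using DC(2)[OF e] by (simp add: fub e(1))
  qed simp
qed

theorem proposition2p14:
  fixes M :: "'a measure"
    and w :: "real \<Rightarrow> 'a \<Rightarrow> real ^ 'd::finite" and z :: "real \<Rightarrow> 'a \<Rightarrow> real"
    and i1 :: 'd and r :: real and \<beta> :: "real \<Rightarrow> 'a \<Rightarrow> real"
    and u :: "real ^ 'd" and f :: "real \<Rightarrow> real" and s1 s2 :: real
    and F1 :: "real ^ 'd \<Rightarrow> real" and F2 :: "(real \<Rightarrow> real) \<Rightarrow> real" and F :: "'a \<Rightarrow> real"
  assumes "brownian_motion M w"
    and "brownian_motion M z"
    and "independent_processes M w z"
    and "0 < r" and "r < 1"
    and "\<And>t \<omega>. \<beta> t \<omega> = r * w t \<omega> $ i1 + sqrt (1 - r\<^sup>2) * z t \<omega>"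
    and "u \<noteq> 0"
    and "f \<in> borel_measurable borel" and "\<And>x. f x \<ge> 0"
    and "integrable lborel (\<lambda>x. (f x)\<^sup>2 * exp (- x\<^sup>2 / 2))"
    and "(s1, s2) \<in> Delta2"
    and "F1 \<in> Cb_infty"
    and "F2 \<in> FCb_infty TYPE('n::finite)"
    and "\<And>\<omega>. F \<omega> = F1 (w s2 \<omega> - w s1 \<omega>) * F2 (\<lambda>t. z t \<omega>)"
  shows "let J = (\<lambda>(t1, t2). heat_kernel (t2 - t1) u
                    * cond_exp_at M (\<lambda>\<omega>. F1 (w s2 \<omega> - w s1 \<omega>)) (\<lambda>\<omega>. w t2 \<omega> - w t1 \<omega>) u
                    * cond_exp_at M (\<lambda>\<omega>. F2 (\<lambda>t. z t \<omega>) * f (\<beta> t2 \<omega> - \<beta> t1 \<omega>))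
                        (\<lambda>\<omega>. w t2 \<omega> - w t1 \<omega>) u)
         in set_integrable lborel Delta2 J
          \<and> ((\<lambda>\<epsilon>. \<integral>\<omega>. F \<omega> * eta_approx w \<beta> u f \<epsilon> \<omega> \<partial>M) \<longlongrightarrow> (LINT t:Delta2|lborel. J t)) (at_right 0)
          \<and> (\<forall>\<gamma><0. \<forall>\<eta>. D2_limit M (brownian_generators w z) \<gamma> (eta_approx w \<beta> u f) \<eta>
               \<longrightarrow> has_D2_pairing M \<eta> F (LINT t:Delta2|lborel. J t))"
proof -
  note w = assms(1) and z = assms(2) and ind = assms(3) and F = assms(14)
  have "r\<^sup>2 < 1" using assms(4,5) by (simp add: power_less_one_iff)
  then have rc: "r\<^sup>2 + (sqrt (1 - r\<^sup>2))\<^sup>2 = 1" "0 < sqrt (1 - r\<^sup>2)" by auto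
  have s: "s1 \<in> {0..1}" "s2 \<in> {0..1}" using assms(11) by (auto simp: Delta2_def)
  obtain C1 where C1: "\<And>x. \<bar>F1 x\<bar> \<le> C1" using Cb_infty_bounded[OF assms(12)] by blast
  obtain C2 where "\<And>x. x \<in> W01 \<Longrightarrow> \<bar>F2 x\<bar> \<le> C2" using FCb_infty_bounded[OF assms(13)] by blast
  then have C2: "\<bar>F2 (\<lambda>t. z t \<omega>)\<bar> \<le> C2" if "\<omega> \<in> space M" for \<omega> using brownian_path_W01[OF z that] by blast
  note L = expectation_limit[OF w z ind rc assms(7,6,8,10) s Cb_infty_continuous[OF assms(12)] C1
      FCb_infty_measurable[OF assms(13) brownian_path_W01[OF z]] C2, folded F]
  show ?thesis
    unfolding Let_def split_beta
    using L test_function_pairing[OF w z ind s assms(12,13) F L(2)] by blast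
qed

end
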